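(* Let $n\ge3$ and $0<T\le\infty$. Assume that $u$ and $v$ are two mild solutions of the Navier-Stokes system on $(0,T)\times\mathbb{R}^n$, both belonging to $\mathscr{C}([0,T);\dot H^{\frac n2-1}(\mathbb{R}^n;\mathbb{R}^n))$, with the same initial condition $u_0\in\dot H^{\frac n2-1}(\mathbb{R}^n;\mathbb{R}^n)$. Then $u=v$ on $[0,T)$.
   Context: The Fourier transform is $\hat f(\xi)=\mathscr{F}(f)(\xi)=(2\pi)^{-n/2}\int_{\mathbb{R}^n}f(x)e^{-i\xi\cdot x}\,dx$, extended to tempered distributions $\mathscr{S}'(\mathbb{R}^n)$. For $s\in\mathbb{R}$, $\dot H^s(\mathbb{R}^n)$ is the set of $f\in\mathscr{S}'(\mathbb{R}^n)$ with $\hat f\in L^1_{\rm loc}(\mathbb{R}^n)$ and $\xi\mapsto|\xi|^s\hat f(\xi)\in L^2(\mathbb{R}^n)$, normed by $\|f\|_{\dot H^s}=\||\xi|^s\hat f\|_{L^2}$; for vector fields it is taken componentwise. The heat semigroup is $e^{t\Delta}g=\mathscr{F}^{-1}(\xi\mapsto e^{-t|\xi|^2}\hat g(\xi))$, $t\ge0$. The Leray projection $\mathbb{P}$ is the Fourier multiplier acting on vector fields with matrix symbol $\bigl(\delta_{jk}-\frac{\xi_j\xi_k}{|\xi|^2}\bigr)_{1\le j,k\le n}$. For vector fields $u,v$, $\nabla\cdot(u\otimes v):=\sum_{j=1}^n\partial_j(u_jv)$. The Navier-Stokes system is $\partial_tu-\Delta u+\nabla\pi+(u\cdot\nabla)u=0$,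 $\operatorname{div}u=0$ in $(0,T)\times\mathbb{R}^n$. A mild solution on $(0,T)\times\mathbb{R}^n$ with initial condition $u_0$ satisfying $\operatorname{div}u_0=0$ is a vector field $u:[0,T)\times\mathbb{R}^n\to\mathbb{R}^n$ satisfying $$u(t)=e^{t\Delta}u_0-\int_0^te^{(t-s)\Delta}\,\mathbb{P}\bigl(\nabla\cdot(u\otimes u)(s)\bigr)\,ds,\qquad 0\le t<T,$$ where the time integral is understood on the Fourier side in the space variable (i.e. the Fourier transform of the integral at $\xi$ is $\int_0^te^{-(t-s)|\xi|^2}\mathscr{F}\bigl(\mathbb{P}(\nabla\cdot(u\otimes u)(s))\bigr)(\xi)\,ds$). *)

theory Defs
  imports "HOL-Analysis.Analysis"
begin

section \<open>Schwartz functions and tempered distributions\<close>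

definition partial :: "'n::finite \<Rightarrow> (real^'n \<Rightarrow> complex) \<Rightarrow> real^'n \<Rightarrow> complex" where
  "partial j f = (\<lambda>x. frechet_derivative f (at x) (axis j 1))"

text \<open>A multi-index is encoded by a list of coordinate directions, its order being the length
  of the list.\<close>

definition partials :: "'n::finite list \<Rightarrow> (real^'n \<Rightarrow> complex) \<Rightarrow> real^'n \<Rightarrow> complex" where
  "partials js f = foldr partial js f"

definition schwartz :: "(real^'n::finite \<Rightarrow> complex) set" where
  "schwartz = {f. \<forall>js. partials js f differentiable_on UNIV \<and>
     (\<forall>k. bounded (range (\<lambda>x. (1 + norm x) ^ k * norm (partials js f x))))}"

definition test_functions :: "(real^'n::finite \<Rightarrow> complex) set" where
  "test_functions = {f \<in> schwartz. compact (closure {x. f x \<noteq> 0})}"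

definition schwartz_norm :: "nat \<Rightarrow> (real^'n::finite \<Rightarrow> complex) \<Rightarrow> real" where
  "schwartz_norm N f =
     (\<Sum>js\<in>{js. length js \<le> N}. SUP x. (1 + norm x) ^ N * norm (partials js f x))"

text \<open>Distributions are functionals of which only the values on \<^const>\<open>schwartz\<close> are
  meaningful; accordingly equality of tempered distributions is equality on \<^const>\<open>schwartz\<close>.\<close>

type_synonym 'n dist = "(real^'n \<Rightarrow> complex) \<Rightarrow> complex"

definition tempered_dist :: "'n::finite dist \<Rightarrow> bool" where
  "tempered_dist S \<longleftrightarrow>
     (\<forall>f\<in>schwartz. \<forall>g\<in>schwartz. \<forall>a b. S (\<lambda>x. a * f x + b * g x) = a * S f + b * S g) \<and>
     (\<exists>C N. \<forall>f\<in>schwartz. norm (S f) \<le> C * schwartz_norm N f)"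

definition dist_eq :: "'n::finite dist \<Rightarrow> 'n dist \<Rightarrow> bool" where
  "dist_eq S R \<longleftrightarrow> (\<forall>f\<in>schwartz. S f = R f)"

definition dist_partial :: "'n::finite \<Rightarrow> 'n dist \<Rightarrow> 'n dist" where
  "dist_partial j S = (\<lambda>f. - S (partial j f))"

definition regular_dist :: "(real^'n::finite \<Rightarrow> complex) \<Rightarrow> 'n dist" where
  "regular_dist g = (\<lambda>f. \<integral>x. g x * f x \<partial>lebesgue)"

definition tempered_fun :: "(real^'n::finite \<Rightarrow> complex) \<Rightarrow> bool" where
  "tempered_fun g \<longleftrightarrow>
     (\<forall>f\<in>schwartz. integrable lebesgue (\<lambda>x. g x * f x)) \<and> tempered_dist (regular_dist g)"

definition L1_loc :: "(real^'n::finite \<Rightarrow> complex) set" where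
  "L1_loc = {g. \<forall>K. compact K \<longrightarrow> g absolutely_integrable_on K}"

text \<open>\<open>S\<close> is the locally integrable function \<open>g\<close>. Only compactly supported test functions are
  used, since \<open>g * f\<close> need not be integrable for general \<open>f \<in> schwartz\<close>; by density they
  determine a tempered distribution.\<close>

definition represents :: "(real^'n::finite \<Rightarrow> complex) \<Rightarrow> 'n dist \<Rightarrow> bool" where
  "represents g S \<longleftrightarrow> g \<in> L1_loc \<and> (\<forall>f\<in>test_functions. S f = regular_dist g f)"


section \<open>Fourier transform\<close>

definition fourier :: "(real^'n::finite \<Rightarrow> complex) \<Rightarrow> real^'n \<Rightarrow> complex" where
  "fourier f \<xi> = of_real ((2 * pi) powr (- real CARD('n) / 2)) *
     (\<integral>x. f x * exp (- \<i> * of_real (\<xi> \<bullet> x)) \<partial>lebesgue)"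

definition inv_fourier :: "(real^'n::finite \<Rightarrow> complex) \<Rightarrow> real^'n \<Rightarrow> complex" where
  "inv_fourier f x = of_real ((2 * pi) powr (- real CARD('n) / 2)) *
     (\<integral>\<xi>. f \<xi> * exp (\<i> * of_real (x \<bullet> \<xi>)) \<partial>lebesgue)"

definition fourier_dist :: "'n::finite dist \<Rightarrow> 'n dist" where
  "fourier_dist S = (\<lambda>f. S (fourier f))"

definition inv_fourier_dist :: "'n::finite dist \<Rightarrow> 'n dist" where
  "inv_fourier_dist S = (\<lambda>f. S (inv_fourier f))"


section \<open>Homogeneous Sobolev spaces\<close>

text \<open>A locally integrable function representing the Fourier transform, if there is one; it is
  determined up to a null set.\<close>

definition fourier_fun :: "'n::finite dist \<Rightarrow> real^'n \<Rightarrow> complex" where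
  "fourier_fun S = (SOME g. represents g (fourier_dist S))"

definition hdot :: "real \<Rightarrow> 'n::finite dist set" where
  "hdot s = {S. tempered_dist S \<and> (\<exists>g. represents g (fourier_dist S)) \<and>
     integrable lebesgue (\<lambda>\<xi>. (norm \<xi> powr s * norm (fourier_fun S \<xi>))\<^sup>2)}"

definition hdot_norm :: "real \<Rightarrow> 'n::finite dist \<Rightarrow> real" where
  "hdot_norm s S = sqrt (\<integral>\<xi>. (norm \<xi> powr s * norm (fourier_fun S \<xi>))\<^sup>2 \<partial>lebesgue)"

definition component :: "(real^'n::finite \<Rightarrow> real^'n) \<Rightarrow> 'n \<Rightarrow> real^'n \<Rightarrow> complex" where
  "component w j = (\<lambda>x. complex_of_real (w x $ j))"

definition component_dist :: "(real^'n::finite \<Rightarrow> real^'n) \<Rightarrow> 'n \<Rightarrow> 'n dist" where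
  "component_dist w j = regular_dist (component w j)"

definition tempered_field :: "(real^'n::finite \<Rightarrow> real^'n) \<Rightarrow> bool" where
  "tempered_field w \<longleftrightarrow> (\<forall>j. tempered_fun (component w j))"

definition hdot_field :: "real \<Rightarrow> (real^'n::finite \<Rightarrow> real^'n) set" where
  "hdot_field s = {w. tempered_field w \<and> (\<forall>j. component_dist w j \<in> hdot s)}"

definition hdot_field_norm :: "real \<Rightarrow> (real^'n::finite \<Rightarrow> real^'n) \<Rightarrow> real" where
  "hdot_field_norm s w = sqrt (\<Sum>j\<in>UNIV. (hdot_norm s (component_dist w j))\<^sup>2)"

definition time_interval :: "ereal \<Rightarrow> real set" where
  "time_interval T = {t. 0 \<le> t \<and> ereal t < T}"

definition continuous_hdot ::
    "ereal \<Rightarrow> real \<Rightarrow> (real \<Rightarrow> real^'n::finite \<Rightarrow> real^'n) \<Rightarrow> bool" where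
  "continuous_hdot T s u \<longleftrightarrow>
     (\<forall>t\<in>time_interval T. u t \<in> hdot_field s \<and>
        ((\<lambda>r. hdot_field_norm s (\<lambda>x. u r x - u t x)) \<longlongrightarrow> 0) (at t within time_interval T))"


section \<open>Mild solutions of the Navier-Stokes system\<close>

definition heat :: "real \<Rightarrow> 'n::finite dist \<Rightarrow> 'n dist" where
  "heat t S =
     inv_fourier_dist (\<lambda>f. fourier_dist S (\<lambda>\<xi>. of_real (exp (- t * (norm \<xi>)\<^sup>2)) * f \<xi>))"

definition leray_symbol :: "'n::finite \<Rightarrow> 'n \<Rightarrow> real^'n \<Rightarrow> real" where
  "leray_symbol j k \<xi> = (if j = k then 1 else 0) - \<xi> $ j * \<xi> $ k / (norm \<xi>)\<^sup>2"

text \<open>\<open>R\<close> is the Leray projection of the vector-valued distribution \<open>S\<close>. The symbol is not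
  smooth at the origin, so the projection is only defined for those \<open>S\<close> for which the
  multiplication makes sense; \<open>R\<close> is then unique as a tempered distribution.\<close>

definition leray_projection :: "('n::finite \<Rightarrow> 'n dist) \<Rightarrow> ('n \<Rightarrow> 'n dist) \<Rightarrow> bool" where
  "leray_projection S R \<longleftrightarrow>
     (\<forall>j. tempered_dist (S j) \<and> tempered_dist (R j)) \<and>
     (\<exists>g. (\<forall>k. represents (g k) (fourier_dist (S k))) \<and>
        (\<forall>j. represents (\<lambda>\<xi>. \<Sum>k\<in>UNIV. of_real (leray_symbol j k \<xi>) * g k \<xi>)
                        (fourier_dist (R j))))"

definition div_field :: "(real^'n::finite \<Rightarrow> real^'n) \<Rightarrow> 'n dist" where
  "div_field w = (\<lambda>f. \<Sum>j\<in>UNIV. dist_partial j (component_dist w j) f)"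

definition tensor_entry ::
    "(real^'n::finite \<Rightarrow> real^'n) \<Rightarrow> (real^'n \<Rightarrow> real^'n) \<Rightarrow> 'n \<Rightarrow> 'n \<Rightarrow> real^'n \<Rightarrow> complex" where
  "tensor_entry v w j k = (\<lambda>x. complex_of_real (v x $ j * w x $ k))"

definition div_tensor ::
    "(real^'n::finite \<Rightarrow> real^'n) \<Rightarrow> (real^'n \<Rightarrow> real^'n) \<Rightarrow> 'n \<Rightarrow> 'n dist" where
  "div_tensor v w k = (\<lambda>f. \<Sum>j\<in>UNIV. dist_partial j (regular_dist (tensor_entry v w j k)) f)"

text \<open>\<open>I t\<close> is the time integral \<open>\<integral>\<^sub>0\<^sup>t e\<^bsup>(t-s)\<Delta>\<^esup> R(s) ds\<close>, \<open>t \<in> [0,T)\<close>, understood on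
  the Fourier side. The Fourier transform of each \<open>R(s)\<close> is a function only up to a null set
  depending on \<open>s\<close>, so to integrate in \<open>s\<close> at fixed \<open>\<xi>\<close> one takes representatives
  \<open>G j s\<close> that are jointly measurable in \<open>(s,\<xi>)\<close>. By Fubini the result does not depend on
  which jointly measurable \<open>G\<close> is taken.\<close>

definition duhamel_integral ::
    "ereal \<Rightarrow> (real \<Rightarrow> 'n::finite \<Rightarrow> 'n dist) \<Rightarrow> (real \<Rightarrow> 'n \<Rightarrow> 'n dist) \<Rightarrow> bool" where
  "duhamel_integral T R I \<longleftrightarrow>
     (\<exists>G. (\<forall>j. (\<lambda>(s,\<xi>). G j s \<xi>) \<in> borel_measurable (lebesgue_on (time_interval T \<times> UNIV))) \<and>
        (\<forall>j. \<forall>s\<in>time_interval T. represents (G j s) (fourier_dist (R s j))) \<and>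
        (\<forall>j. \<forall>t\<in>time_interval T.
           (AE \<xi> in lebesgue. set_integrable lebesgue {0..t}
              (\<lambda>s. of_real (exp (- (t - s) * (norm \<xi>)\<^sup>2)) * G j s \<xi>)) \<and>
           tempered_dist (I t j) \<and>
           represents (\<lambda>\<xi>. set_lebesgue_integral lebesgue {0..t}
              (\<lambda>s. of_real (exp (- (t - s) * (norm \<xi>)\<^sup>2)) * G j s \<xi>)) (fourier_dist (I t j))))"

text \<open>For each \<open>s\<close>, \<open>P s\<close> is the Leray projection of the divergence of the tensor square of
  \<open>u s\<close>, and \<open>I t\<close> is the Duhamel term.\<close>

definition mild_solution ::
    "ereal \<Rightarrow> (real^'n::finite \<Rightarrow> real^'n) \<Rightarrow> (real \<Rightarrow> real^'n \<Rightarrow> real^'n) \<Rightarrow> bool" where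
  "mild_solution T u\<^sub>0 u \<longleftrightarrow>
     tempered_field u\<^sub>0 \<and> dist_eq (div_field u\<^sub>0) (\<lambda>f. 0) \<and>
     (\<forall>t\<in>time_interval T. tempered_field (u t) \<and> (\<forall>j k. tempered_fun (tensor_entry (u t) (u t) j k))) \<and>
     (\<exists>P I. (\<forall>s\<in>time_interval T. leray_projection (div_tensor (u s) (u s)) (P s)) \<and>
        duhamel_integral T P I \<and>
        (\<forall>t\<in>time_interval T. \<forall>j. dist_eq (component_dist (u t) j)
                             (\<lambda>f. heat t (component_dist u\<^sub>0 j) f - I t j f)))"

end

theory Submission
  imports Defs "HOL-Probability.Probability" "HOL-Real_Asymp.Real_Asymp"
begin

text \<open>We argue on the Fourier side, in \<open>L\<^sup>2\<close> with weight \<open>|\<xi>|\<^bsup>n-2\<^esup>\<close>, which is the homogeneous Sobolev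
  space of order \<open>n/2 - 1\<close>. In the difference \<open>w = u - v\<close> the heat flow of the initial value cancels,
  so \<open>w\<close> is the Duhamel integral of the projected divergence of \<open>u \<otimes> w + w \<otimes> v\<close>. Two estimates give
  uniqueness: maximal \<open>L\<^sup>2\<close> regularity in time, which at a fixed frequency is Young's inequality for
  the kernel \<open>exp (- t |\<xi>|\<^sup>2)\<close> of mass at most \<open>min (|\<xi>|\<^bsup>-2\<^esup>) \<tau>\<close> on an interval of length \<open>\<tau>\<close>; and
  the product estimate from order \<open>n/2 - 1\<close> (twice) to order \<open>n/2 - 2\<close>, a weighted Schur test for the
  convolution of the transforms. Smallness, without small data, comes from splitting frequencies at a
  large \<open>R\<close>: near a given time, continuity makes the high frequencies of \<open>u\<close> and \<open>v\<close> uniformly small,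
  so the product is small at output frequencies above \<open>R\<close>, while below \<open>R\<close> the kernel has mass at
  most \<open>\<tau>\<close>. Hence \<open>w\<close> vanishes on a short interval after any time up to which it vanishes.

  The transform of a product of two functions known only as tempered distributions is the convolution
  of the transforms because one factor is an almost everywhere limit, dominated by a constant plus an
  \<open>L\<^sup>2\<close> function, of inverse transforms of its frequency truncations.\<close>

section \<open>Smooth functions\<close>

text \<open>The Fourier representatives \<open>a t j\<close> and \<open>b t j\<close> are chosen
  separately at each time, so nothing is known about the measurability of
  \<open>hat_energy (w t)\<close> in \<open>t\<close>. Integrals over time are therefore taken only
  of \<open>duhamel_bound h a t\<close>, where \<open>h\<close> comes from the jointly measurable
  representatives in \<open>duhamel_integral\<close>; the energy of the difference enters through
  inequalities at single times. In the critical space the count of derivatives is exact: the heat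
  kernel gains two, the divergence loses one and the product loses one, from order n/2 - 1 to order
  n/2 - 2. At high frequencies no power of the length \<tau> is left over, which is why smallness
  there has to come from the solutions themselves. The dimension enters through the squared weight
  |\<xi>|^(n-4) of order n/2 - 2, which is locally integrable exactly for n > 2. Since the fields
  are known only as tempered functions, the product formula is reached by testing against transforms
  of test functions, which can be made nonzero on prescribed balls and then divided out.\<close>

definition smooth :: "(real^'n::finite \<Rightarrow> complex) \<Rightarrow> bool" where
  "smooth f \<longleftrightarrow> (\<forall>js. partials js f differentiable_on UNIV)"

lemma partials_Nil [simp]: "partials [] f = f"
  by (simp add: partials_def)

lemma partials_Cons [simp]: "partials (j # js) f = partial j (partials js f)"
  by (simp add: partials_def)

lemma partials_snoc: "partials (js @ [j]) f = partials js (partial j f)"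
  by (simp add: partials_def)

lemma smooth_differentiable: "smooth f \<Longrightarrow> f differentiable (at x)"
  unfolding smooth_def
  by (metis UNIV_I differentiable_on_def partials_Nil)

lemma smooth_partial: "smooth f \<Longrightarrow> smooth (partial j f)"
  unfolding smooth_def by (metis partials_snoc)

lemma smooth_iff:
  "smooth f \<longleftrightarrow> (\<forall>x. f differentiable (at x)) \<and> (\<forall>j. smooth (partial j f))"
proof (intro iffI conjI allI)
  assume *: "(\<forall>x. f differentiable (at x)) \<and> (\<forall>j. smooth (partial j f))"
  show "smooth f" unfolding smooth_def
  proof
    fix js show "partials js f differentiable_on UNIV"
    proof (cases js rule: rev_cases)
      case Nil then show ?thesis using * by (simp add: differentiable_on_def)
    next
      case (snoc ks j) then show ?thesis using * by (simp add: partials_snoc smooth_def)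
    qed
  qed
qed (auto simp: smooth_differentiable smooth_partial)

text \<open>Induction on the multi-index keeps every iterated partial derivative inside the family
  \<open>S\<close>, so a proof of smoothness only has to name a family that is closed under
  differentiation; no formula for higher derivatives appears.\<close>

lemma smooth_coinduct:
  assumes "f \<in> S"
    and "\<And>g x. g \<in> S \<Longrightarrow> g differentiable (at x)"
    and "\<And>g j. g \<in> S \<Longrightarrow> partial j g \<in> S"
  shows "smooth f"
proof -
  have "\<forall>g\<in>S. partials js g \<in> S" for js
    by (induction js) (auto intro: assms)
  then show ?thesis using assms unfolding smooth_def differentiable_on_def by (simp add: assms(2))
qed

lemma partial_eqI: "(f has_derivative D) (at x) \<Longrightarrow> partial j f x = D (axis j 1)"
  unfolding partial_def using frechet_derivative_at by metis

lemma has_derivative_frechet: "f differentiable (at x) \<Longrightarrow> (f has_derivative frechet_derivative f (at x)) (at x)"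
  by (simp add: frechet_derivative_works)

lemma partial_add:
  assumes "\<And>x. f differentiable (at x)" "\<And>x. g differentiable (at x)"
  shows "partial j (\<lambda>x. f x + g x) = (\<lambda>x. partial j f x + partial j g x)"
proof
  fix x
  have "((\<lambda>x. f x + g x) has_derivative
     (\<lambda>h. frechet_derivative f (at x) h + frechet_derivative g (at x) h)) (at x)"
    by (intro has_derivative_add has_derivative_frechet assms)
  from partial_eqI[OF this] show "partial j (\<lambda>x. f x + g x) x = partial j f x + partial j g x"
    by (simp add: partial_def)
qed

lemma partial_mult:
  assumes "\<And>x. f differentiable (at x)" "\<And>x. g differentiable (at x)"
  shows "partial j (\<lambda>x. f x * g x) = (\<lambda>x. f x * partial j g x + partial j f x * g x)"
proof
  fix x
  have "((\<lambda>x. f x * g x) has_derivative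
     (\<lambda>h. f x * frechet_derivative g (at x) h + frechet_derivative f (at x) h * g x)) (at x)"
    by (intro has_derivative_mult has_derivative_frechet assms)
  from partial_eqI[OF this] show "partial j (\<lambda>x. f x * g x) x = f x * partial j g x + partial j f x * g x"
    by (simp add: partial_def)
qed

lemma partial_const: "partial j (\<lambda>x. c) = (\<lambda>x. 0)"
  by (rule ext, subst partial_eqI[where D="\<lambda>h. 0"]) auto

lemma smooth_const: "smooth (\<lambda>x. c)"
  by (rule smooth_coinduct[of _ "range (\<lambda>c x. c)"]) (auto simp: partial_const)

lemma smooth_mult:
  fixes f g :: "real^'n::finite \<Rightarrow> complex"
  assumes "smooth f" "smooth g" shows "smooth (\<lambda>x. f x * g x)"
proof -
  \<comment> \<open>Products alone are not stable under the Leibniz rule; finite sums of products of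
    smooth functions are.\<close>
  define S where "S = {h. \<exists>I f g. finite (I::nat set) \<and> (\<forall>i. smooth (f i) \<and> smooth (g i)) \<and>
     h = (\<lambda>x::real^'n. \<Sum>i\<in>I. f i x * (g i x :: complex))}"
  have diff: "(\<lambda>x. f x * g x) differentiable (at x)" if "smooth f" "smooth g" for f g x
    using that by (intro differentiable_mult smooth_differentiable)
  show ?thesis
  proof (rule smooth_coinduct[of _ S])
    show "(\<lambda>x. f x * g x) \<in> S"
      unfolding S_def mem_Collect_eq using assms
      by (rule_tac exI[of _ "{0::nat}"], rule_tac exI[of _ "\<lambda>_. f"], rule_tac exI[of _ "\<lambda>_. g"]) auto
  next
    fix h x assume "h \<in> S"
    then show "h differentiable (at x)"
      unfolding S_def by (auto intro!: differentiable_sum diff)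
  next
    fix h j assume "h \<in> S"
    then have "\<exists>I f g. finite (I::nat set) \<and> (\<forall>i. smooth (f i) \<and> smooth (g i)) \<and>
      h = (\<lambda>x. \<Sum>i\<in>I. f i x * g i x)" unfolding S_def mem_Collect_eq .
    then obtain I :: "nat set" and f g where "finite I \<and> (\<forall>i. smooth (f i) \<and> smooth (g i)) \<and>
      h = (\<lambda>x. \<Sum>i\<in>I. f i x * g i x)" by (elim exE)
    then have *: "finite I" "\<And>i. smooth (f i)" "\<And>i. smooth (g i)"
      "h = (\<lambda>x. \<Sum>i\<in>I. f i x * g i x)" by auto
    have "partial j (\<lambda>x. \<Sum>i\<in>I. f i x * g i x)
        = (\<lambda>x. \<Sum>i\<in>I. f i x * partial j (g i) x + partial j (f i) x * g i x)"
      using \<open>finite I\<close>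
    proof (induction I)
      case empty then show ?case by (simp add: partial_const)
    next
      case (insert k I)
      then show ?case using *
        by (simp add: partial_add partial_mult differentiable_sum diff smooth_differentiable)
    qed
    \<comment> \<open>The index set is doubled to hold both Leibniz terms: even indices carry the
      derivative on \<open>g\<close>, odd ones on \<open>f\<close>, and \<open>i div 2\<close>
      recovers the old index.\<close>
    also have "\<dots> = (\<lambda>x. \<Sum>i\<in>(\<lambda>i. 2*i) ` I \<union> (\<lambda>i. 2*i+1) ` I.
        (if even i then f (i div 2) else partial j (f (i div 2))) x *
        (if even i then partial j (g (i div 2)) else g (i div 2)) x)"
      using \<open>finite I\<close>
      by (intro ext, subst sum.union_disjoint)
         (auto simp: sum.reindex inj_on_def sum.distrib dest: arg_cong[of _ _ even])
    finally have "h' \<in> S" if "h' = partial j h" for h'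
      unfolding S_def mem_Collect_eq using * that
      by (intro exI[of _ "(\<lambda>i. 2*i) ` I \<union> (\<lambda>i. 2*i+1) ` I"]
         exI[of _ "\<lambda>i. if even i then f (i div 2) else partial j (f (i div 2))"]
         exI[of _ "\<lambda>i. if even i then partial j (g (i div 2)) else g (i div 2)"])
         (auto simp: smooth_partial)
    then show "partial j h \<in> S" by simp
  qed
qed

lemma smooth_prod:
  assumes "\<And>i. i \<in> I \<Longrightarrow> smooth (f i)" shows "smooth (\<lambda>x. \<Prod>i\<in>I. f i x)"
  using assms by (induction I rule: infinite_finite_induct) (auto simp: smooth_const smooth_mult)

lemma has_derivative_nth: "((\<lambda>x::real^'n. complex_of_real (x $ i)) has_derivative (\<lambda>h. of_real (h $ i))) (at x)"
  by (intro has_derivative_of_real bounded_linear_imp_has_derivative bounded_linear_vec_nth)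

lemma partial_coord: "partial j (\<lambda>x::real^'n. complex_of_real (x $ i)) = (\<lambda>x. if i = j then 1 else 0)"
  by (rule ext, subst partial_eqI[OF has_derivative_nth]) (auto simp: axis_def)

lemma smooth_coord: "smooth (\<lambda>x::real^'n::finite. complex_of_real (x $ i))"
proof -
  have "\<And>x::real^'n. (\<lambda>x. complex_of_real (x $ i)) differentiable (at x)"
    using has_derivative_nth differentiableI by blast
  then show ?thesis by (subst smooth_iff) (auto simp: partial_coord smooth_const)
qed

text \<open>Derivatives of \<open>exp (- 1 / t)\<close> are polynomials in \<open>1 / t\<close> times \<open>exp (- 1 / t)\<close>.\<close>

definition flat_fun :: "real poly \<Rightarrow> real \<Rightarrow> real" where
  "flat_fun p t = (if t \<le> 0 then 0 else poly p (1 / t) * exp (- (1 / t)))"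

text \<open>In the variable x = 1 / t the right-hand limit is that of a polynomial against exp (- x)
  at infinity; on the left the function is zero.\<close>

lemma flat_fun_tendsto_0: "((\<lambda>t. flat_fun p t) \<longlongrightarrow> 0) (at 0)"
proof -
  have "((\<lambda>x. poly p x * exp (- x)) \<longlongrightarrow> 0) at_top"
  proof -
    have "((\<lambda>x. \<Sum>i\<le>degree p. coeff p i * (x ^ i * exp (- x))) \<longlongrightarrow> (\<Sum>i\<le>degree p. coeff p i * 0)) at_top"
      by (intro tendsto_sum tendsto_mult_left)
         (use tendsto_power_div_exp_0 in \<open>simp add: exp_minus field_simps\<close>)
    then show ?thesis by (simp add: poly_altdef sum_distrib_left sum_distrib_right mult_ac)
  qed
  from filterlim_compose[OF this filterlim_inverse_at_top_right]
  have "((\<lambda>t. flat_fun p t) \<longlongrightarrow> 0) (at_right 0)"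
    by (rule Lim_transform_eventually)
       (auto simp: eventually_at_filter flat_fun_def inverse_eq_divide intro!: always_eventually)
  moreover have "((\<lambda>t. flat_fun p t) \<longlongrightarrow> 0) (at_left 0)"
    by (rule Lim_transform_eventually[of "\<lambda>_. 0"])
       (auto simp: eventually_at_filter flat_fun_def)
  ultimately show ?thesis by (simp add: filterlim_split_at)
qed

text \<open>With x = 1 / t the chain rule reads d/dt = - x^2 d/dx, and applied to p(x) exp (- x) it
  gives x^2 (p - p')(x) exp (- x); \<open>[:0,0,1:]\<close> is the polynomial x^2.\<close>

lemma flat_fun_deriv:
  "(flat_fun p has_real_derivative flat_fun ([:0,0,1:] * (p - pderiv p)) t) (at t)"
proof -
  consider "t < 0" | "t > 0" | "t = 0" by linarith
  then show ?thesis
  proof cases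
    case 1
    have "((\<lambda>t. 0) has_real_derivative flat_fun ([:0,0,1:] * (p - pderiv p)) t) (at t)"
      using 1 by (auto simp: flat_fun_def intro!: derivative_eq_intros)
    then show ?thesis
      by (rule has_field_derivative_transform_within_open[of _ _ _ "{..<0}"])
         (use 1 in \<open>auto simp: flat_fun_def\<close>)
  next
    case 2
    have "((\<lambda>t. poly p (1 / t) * exp (- (1 / t))) has_real_derivative
        flat_fun ([:0,0,1:] * (p - pderiv p)) t) (at t)"
      using 2 by (auto simp: flat_fun_def field_simps power2_eq_square
          intro!: derivative_eq_intros DERIV_chain'[of _ _ _ _ "poly p", OF _ poly_DERIV])
    then show ?thesis
      by (rule has_field_derivative_transform_within_open[of _ _ _ "{0<..}"])
         (use 2 in \<open>auto simp: flat_fun_def\<close>)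
  next
    case 3
    \<comment> \<open>Dividing by \<open>h\<close> multiplies the polynomial by x = 1 / h, so the
      difference quotient at 0 is again a flat function.\<close>
    have "((\<lambda>h. flat_fun ([:0,1:] * p) h) \<longlongrightarrow> 0) (at 0)" by (rule flat_fun_tendsto_0)
    then have "((\<lambda>h. (flat_fun p (0 + h) - flat_fun p 0) / h) \<longlongrightarrow> 0) (at 0)"
      by (rule Lim_transform_eventually) (auto simp: flat_fun_def)
    then show ?thesis using 3 by (simp add: DERIV_def flat_fun_def)
  qed
qed

text \<open>The factor \<open>a\<close> collects the inner derivatives \<open>c\<close>, and becomes
  0 for directions other than \<open>i\<close>; with it the functions form a family closed under all
  partial derivatives, as \<open>smooth_coinduct\<close> wants.\<close>

lemma partial_flat:
  "partial j (\<lambda>x::real^'n. complex_of_real (a * flat_fun p (c * x $ i + d)))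
   = (\<lambda>x. complex_of_real ((if i = j then a * c else 0) * flat_fun ([:0,0,1:] * (p - pderiv p)) (c * x $ i + d)))"
  and differentiable_flat:
  "(\<lambda>x::real^'n. complex_of_real (a * flat_fun p (c * x $ i + d))) differentiable (at y)"
proof -
  have *: "((\<lambda>x::real^'n. complex_of_real (a * flat_fun p (c * x $ i + d))) has_derivative
    (\<lambda>h. of_real (a * ((c * h $ i) * flat_fun ([:0,0,1:] * (p - pderiv p)) (c * x $ i + d))))) (at x)" for x
    by (intro has_derivative_of_real has_derivative_mult_right
        has_derivative_compose[OF _ flat_fun_deriv[unfolded has_field_derivative_def], THEN has_derivative_eq_rhs])
       (auto intro!: derivative_eq_intros bounded_linear_imp_has_derivative bounded_linear_vec_nth simp: mult_ac)
  show "partial j (\<lambda>x::real^'n. complex_of_real (a * flat_fun p (c * x $ i + d)))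
   = (\<lambda>x. complex_of_real ((if i = j then a * c else 0) * flat_fun ([:0,0,1:] * (p - pderiv p)) (c * x $ i + d)))"
    by (rule ext, subst partial_eqI[OF *]) (auto simp: axis_def)
  show "(\<lambda>x::real^'n. complex_of_real (a * flat_fun p (c * x $ i + d))) differentiable (at y)"
    using * differentiableI by blast
qed

lemma smooth_flat: "smooth (\<lambda>x::real^'n. complex_of_real (flat_fun p (c * x $ i + d)))"
proof (rule smooth_coinduct[of _ "{\<lambda>x. complex_of_real (a * flat_fun p (c * x $ i + d)) | a p. True}"])
  show "(\<lambda>x::real^'n. complex_of_real (flat_fun p (c * x $ i + d))) \<in>
     {\<lambda>x. complex_of_real (a * flat_fun p (c * x $ i + d)) | a p. True}"
    by (auto intro!: exI[of _ "1::real"] exI[of _ p])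
qed (use differentiable_flat partial_flat in \<open>blast+\<close>)

section \<open>Test functions\<close>

lemma partial_eq_0:
  assumes "open U" "x \<in> U" "\<And>y. y \<in> U \<Longrightarrow> f y = 0"
  shows "partial j f x = 0"
proof (rule partial_eqI[where D="\<lambda>h. 0", simplified])
  show "(f has_derivative (\<lambda>h. 0)) (at x)"
    by (rule has_derivative_transform_within_open[where f="\<lambda>_. 0", OF _ assms(1,2)])
       (auto simp: assms)
qed

lemma partials_eq_0:
  assumes "open U" "x \<in> U" "\<And>y. y \<in> U \<Longrightarrow> f y = 0"
  shows "partials js f x = 0"
  using assms(2) by (induction js arbitrary: x) (auto intro: partial_eq_0[OF assms(1)] assms)

lemma smooth_continuous: "smooth f \<Longrightarrow> continuous_on A f"
  unfolding smooth_def
  by (metis continuous_on_subset differentiable_imp_continuous_on partials_Nil subset_UNIV)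

lemma smooth_partials: "smooth f \<Longrightarrow> smooth (partials js f)"
  by (induction js) (auto intro: smooth_partial)

text \<open>Compact support makes the decay conditions of \<open>schwartz\<close> automatic: a
  weighted derivative is continuous, bounded on the support and zero off it.\<close>

lemma test_functions_iff: "f \<in> test_functions \<longleftrightarrow> smooth f \<and> compact (closure {x. f x \<noteq> 0})"
proof -
  have "bounded (range (\<lambda>x. (1 + norm x) ^ k * norm (partials js f x)))"
    if "smooth f" and K: "compact (closure {x. f x \<noteq> 0})" for js k
  proof -
    let ?K = "closure {x. f x \<noteq> 0}" and ?h = "\<lambda>x. (1 + norm x) ^ k * norm (partials js f x)"
    have 0: "partials js f x = 0" if "x \<notin> ?K" for x
      by (rule partials_eq_0[of "- ?K"]) (use that closure_subset[of "{x. f x \<noteq> 0}"] in auto)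
    have "continuous_on ?K ?h"
      by (intro continuous_intros smooth_continuous smooth_partials \<open>smooth f\<close>)
    then have "bounded (insert 0 (?h ` ?K))"
      using K by (simp add: compact_continuous_image compact_imp_bounded)
    then show ?thesis
    proof (rule bounded_subset)
      show "range ?h \<subseteq> insert 0 (?h ` ?K)"
      proof
        fix y assume "y \<in> range ?h"
        then obtain x where "y = ?h x" by blast
        then show "y \<in> insert 0 (?h ` ?K)" using 0[of x] by (cases "x \<in> ?K") auto
      qed
    qed
  qed
  then show ?thesis unfolding test_functions_def schwartz_def smooth_def by blast
qed

lemma test_functionI:
  assumes "smooth f" "\<And>x. f x \<noteq> 0 \<Longrightarrow> x \<in> K" "compact K"
  shows "f \<in> test_functions"
proof -
  have "closure {x. f x \<noteq> 0} \<subseteq> K"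
    using assms by (intro closure_minimal) (auto simp: compact_imp_closed)
  then have "compact (closure {x. f x \<noteq> 0})"
    using \<open>compact K\<close> by (metis closed_closure compact_Int_closed inf.absorb_iff2)
  then show ?thesis using assms(1) by (simp add: test_functions_iff)
qed

lemma test_function_support:
  assumes "f \<in> test_functions"
  obtains K where "compact K" "\<And>x. x \<notin> K \<Longrightarrow> f x = 0"
proof (rule that)
  show "compact (closure {x. f x \<noteq> 0})" using assms by (simp add: test_functions_iff)
  show "f x = 0" if "x \<notin> closure {x. f x \<noteq> 0}" for x
    using that closure_subset[of "{x. f x \<noteq> 0}"] by blast
qed

lemma test_function_partial:
  assumes "f \<in> test_functions" shows "partial j f \<in> test_functions"
proof -
  let ?K = "closure {x. f x \<noteq> 0}"
  have "partial j f x = 0" if "x \<notin> ?K" for x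
    by (rule partial_eq_0[of "- ?K"]) (use that closure_subset[of "{x. f x \<noteq> 0}"] in auto)
  then show ?thesis using assms
    by (intro test_functionI[of _ ?K]) (auto simp: test_functions_iff smooth_partial)
qed

lemma test_function_mult:
  assumes "f \<in> test_functions" "smooth g" shows "(\<lambda>x. g x * f x) \<in> test_functions"
proof -
  obtain K where "compact K" "\<And>x. x \<notin> K \<Longrightarrow> f x = 0" using test_function_support assms(1) by blast
  then show ?thesis using assms
    by (intro test_functionI[of _ K]) (auto simp: test_functions_iff smooth_mult)
qed

lemma partial_translate:
  assumes "\<And>x. f differentiable (at x)"
  shows "partial j (\<lambda>x. f (x + a)) = (\<lambda>x. partial j f (x + a))"
    and "(\<lambda>x. f (x + a)) differentiable (at x)"
proof -
  have *: "((\<lambda>x. f (x + a)) has_derivative frechet_derivative f (at (x + a))) (at x)" for x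
    by (rule has_derivative_compose[OF _ has_derivative_frechet[OF assms], where f="\<lambda>x. x + a", THEN has_derivative_eq_rhs])
       (auto intro!: derivative_eq_intros)
  show "partial j (\<lambda>x. f (x + a)) = (\<lambda>x. partial j f (x + a))"
    by (rule ext, subst partial_eqI[OF *]) (simp add: partial_def)
  show "(\<lambda>x. f (x + a)) differentiable (at x)" using * differentiableI by blast
qed

lemma smooth_translate: "smooth f \<Longrightarrow> smooth (\<lambda>x. f (x + a))"
  by (rule smooth_coinduct[of _ "{\<lambda>x. f (x + a) | f. smooth f}"])
     (auto simp: partial_translate smooth_differentiable intro: smooth_partial)

lemma test_function_translate:
  assumes "f \<in> test_functions" shows "(\<lambda>x. f (x + a)) \<in> test_functions"
proof -
  obtain K where K: "compact K" "\<And>x. x \<notin> K \<Longrightarrow> f x = 0" using test_function_support assms(1) by blast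
  show ?thesis
  proof (rule test_functionI)
    show "smooth (\<lambda>x. f (x + a))" using assms by (simp add: smooth_translate test_functions_iff)
    show "compact ((\<lambda>x. x - a) ` K)" by (intro compact_continuous_image continuous_intros K)
    show "x \<in> (\<lambda>x. x - a) ` K" if "f (x + a) \<noteq> 0" for x
      using that K(2)[of "x + a"] by (intro image_eqI[of _ _ "x + a"]) auto
  qed
qed

text \<open>As k tends to infinity these functions increase to the indicator of the open box: inside
  it each factor is exp (- 1 / (k t)), with t the distance to a face. The arguments are spelled in
  the affine form that \<open>smooth_flat\<close> accepts.\<close>

definition bump :: "real \<Rightarrow> real^'n::finite \<Rightarrow> real^'n \<Rightarrow> real^'n \<Rightarrow> complex" where
  "bump k a b x = (\<Prod>i\<in>UNIV. of_real (flat_fun 1 (k * x $ i + - k * a $ i)) *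
     of_real (flat_fun 1 (- k * x $ i + k * b $ i)))"

lemma flat_fun_1: "flat_fun 1 t = (if t \<le> 0 then 0 else exp (- (1 / t)))"
  by (simp add: flat_fun_def)

lemma bump_of_real: "bump k a b x = of_real (\<Prod>i\<in>UNIV. flat_fun 1 (k * (x $ i - a $ i)) *
     flat_fun 1 (k * (b $ i - x $ i)))"
  by (simp add: bump_def algebra_simps)

lemma bump_outside: "k > 0 \<Longrightarrow> x \<notin> box a b \<Longrightarrow> bump k a b x = 0"
proof -
  assume "k > 0" "x \<notin> box a b"
  then obtain i where "x $ i \<le> a $ i \<or> b $ i \<le> x $ i" by (auto simp: mem_box_cart not_less)
  then have "k * (x $ i - a $ i) \<le> 0 \<or> k * (b $ i - x $ i) \<le> 0"
    using \<open>k > 0\<close> by (auto simp: mult_le_0_iff)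
  then have "flat_fun 1 (k * (x $ i - a $ i)) * flat_fun 1 (k * (b $ i - x $ i)) = 0"
    by (auto simp: flat_fun_1)
  then show ?thesis unfolding bump_of_real by (auto intro!: prod_zero)
qed

lemma test_function_bump: "k > 0 \<Longrightarrow> bump k a b \<in> test_functions"
proof (rule test_functionI)
  show "smooth (bump k a b)" unfolding bump_def[abs_def]
    by (intro smooth_prod smooth_mult smooth_flat)
  show "x \<in> cbox a b" if "k > 0" "bump k a b x \<noteq> 0" for x
    using that bump_outside[of k x a b] box_subset_cbox[of a b] by blast
qed simp_all

lemma norm_bump_le_1: "norm (bump k a b x) \<le> 1"
  unfolding bump_of_real norm_of_real abs_prod
  by (intro prod_le_1) (auto simp: flat_fun_1 abs_mult mult_le_one)

lemma bump_tendsto: "(\<lambda>m. bump (real m) a b x) \<longlonglongrightarrow> indicator (box a b) x"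
proof (cases "x \<in> box a b")
  case True
  have 1: "(\<lambda>m. flat_fun 1 (real m * t)) \<longlonglongrightarrow> 1" if "t > 0" for t
  proof -
    have "(\<lambda>m. exp (- (1 / (real m * t)))) \<longlonglongrightarrow> 1" using that by real_asymp
    then show ?thesis
      by (rule Lim_transform_eventually)
         (use that in \<open>auto simp: flat_fun_1 mult_le_0_iff intro!: eventually_sequentiallyI[of 1]\<close>)
  qed
  have "(\<lambda>m. bump (real m) a b x) \<longlonglongrightarrow> of_real (\<Prod>i\<in>(UNIV::'a set). 1 * 1)"
    unfolding bump_of_real
    by (intro tendsto_intros 1) (use True in \<open>auto simp: mem_box_cart\<close>)
  then show ?thesis using True by simp
next
  case False
  then have "\<forall>\<^sub>F m in sequentially. 0 = bump (real m) a b x"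
    by (intro eventually_sequentiallyI[of 1]) (simp add: bump_outside)
  then show ?thesis using False by (auto intro: Lim_transform_eventually)
qed

section \<open>Locally integrable functions are determined by test functions\<close>

text \<open>Representatives of transforms are only Lebesgue measurable, whereas translations,
  product measures and integrals with parameters are handled for Borel functions. Passing to real
  and imaginary parts gives the Borel version.\<close>

lemma completion_ex_borel_measurable_complex:
  fixes g :: "'a \<Rightarrow> complex"
  assumes "g \<in> borel_measurable (completion M)"
  obtains g' where "g' \<in> borel_measurable M" "AE x in M. g x = g' x"
proof -
  have "(\<lambda>x. Re (g x)) \<in> borel_measurable (completion M)" "(\<lambda>x. Im (g x)) \<in> borel_measurable (completion M)"
    using assms by measurable
  then obtain r i where ri: "r \<in> borel_measurable M" "AE x in M. Re (g x) = r x"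
      "i \<in> borel_measurable M" "AE x in M. Im (g x) = i x"
    using completion_ex_borel_measurable_real by metis
  show thesis
  proof (rule that)
    show "(\<lambda>x. of_real (r x) + \<i> * of_real (i x)) \<in> borel_measurable M" using ri by measurable
    show "AE x in M. g x = of_real (r x) + \<i> * of_real (i x)"
      using ri(2,4) by eventually_elim (auto simp: complex_eq_iff)
  qed
qed

text \<open>Local integrability makes the truncations to balls measurable, and at each point they
  are eventually equal to \<open>g\<close>.\<close>

lemma L1_loc_measurable:
  assumes "g \<in> L1_loc" shows "g \<in> borel_measurable lebesgue"
proof (rule borel_measurable_LIMSEQ_metric)
  fix m
  have "g absolutely_integrable_on (cball 0 (real m))" using assms unfolding L1_loc_def by simp
  then show "(\<lambda>x. indicator (cball 0 (real m)) x *\<^sub>R g x) \<in> borel_measurable lebesgue"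
    unfolding set_integrable_def by (rule borel_measurable_integrable)
next
  fix x :: "real^'a"
  obtain M where M: "norm x \<le> real M" using real_arch_simple by blast
  show "(\<lambda>m. indicator (cball 0 (real m)) x *\<^sub>R g x) \<longlonglongrightarrow> g x"
    by (rule tendsto_eventually, rule eventually_sequentiallyI[of M]) (use M in auto)
qed

lemma test_function_bounded:
  assumes "f \<in> test_functions" obtains B where "B \<ge> 0" "\<And>x. norm (f x) \<le> B"
proof -
  have "bounded (range (\<lambda>x. (1 + norm x) ^ 0 * norm (partials [] f x)))"
    using assms unfolding test_functions_def schwartz_def by blast
  then obtain B where "\<And>x. norm (f x) \<le> B" by (auto simp: bounded_iff)
  then show thesis using that norm_ge_zero order_trans by blast
qed

lemma test_function_continuous: "f \<in> test_functions \<Longrightarrow> continuous_on A f"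
  by (simp add: test_functions_iff smooth_continuous)

lemma test_function_measurable: "f \<in> test_functions \<Longrightarrow> f \<in> borel_measurable borel"
  by (simp add: test_function_continuous borel_measurable_continuous_onI)

lemma L1_loc_mult_test:
  assumes "g \<in> L1_loc" "f \<in> test_functions"
  shows "integrable lebesgue (\<lambda>x. g x * f x)"
proof -
  obtain K where K: "compact K" "\<And>x. x \<notin> K \<Longrightarrow> f x = 0" using test_function_support assms(2) by blast
  obtain B where B: "B \<ge> 0" "\<And>x. norm (f x) \<le> B" using test_function_bounded assms(2) by blast
  have "integrable lebesgue (\<lambda>x. B *\<^sub>R (indicator K x *\<^sub>R g x))"
    using assms(1) K(1) unfolding L1_loc_def set_integrable_def
    by (intro Bochner_Integration.integrable_scaleR_right) blast
  moreover have "(\<lambda>x. g x * f x) \<in> borel_measurable lebesgue"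
    using L1_loc_measurable[OF assms(1)] measurable_completion[of f lborel borel] test_function_measurable[OF assms(2)]
    by (intro borel_measurable_times) auto
  moreover have "norm (g x * f x) \<le> norm (B *\<^sub>R (indicator K x *\<^sub>R g x))" for x
  proof (cases "x \<in> K")
    case True
    then show ?thesis using B by (simp add: norm_mult mult.commute[of B] mult_left_mono)
  qed (use K(2) in simp)
  ultimately show ?thesis by (rule Bochner_Integration.integrable_bound[OF _ _ AE_I2])
qed

lemma L1_loc_diff: "f \<in> L1_loc \<Longrightarrow> g \<in> L1_loc \<Longrightarrow> (\<lambda>x. f x - g x) \<in> L1_loc"
  unfolding L1_loc_def by auto

text \<open>Boxes form a generator of the Borel sets that is stable under intersection, and the sets
  over which \<open>f\<close> integrates to 0 form a Dynkin system. Stability under complements uses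
  that the total integral is 0, a limit of integrals over growing boxes.\<close>

lemma AE_zero_of_box_integrals:
  fixes f :: "'a::euclidean_space \<Rightarrow> 'b::{banach, second_countable_topology}"
  assumes f: "integrable lborel f"
    and box: "\<And>a b. set_lebesgue_integral lborel (box a b) f = 0"
  shows "AE x in lborel. f x = 0"
proof -
  have int: "set_integrable lborel A f" if "A \<in> sets lborel" for A
    using f that by (simp add: set_integrable_def integrable_mult_indicator)
  have "(\<lambda>m::nat. set_lebesgue_integral lborel (box (- real m *\<^sub>R One) (real m *\<^sub>R One)) f)
      \<longlonglongrightarrow> (\<integral>x. f x \<partial>lborel)"
    unfolding set_lebesgue_integral_def
  proof (rule integral_dominated_convergence[where w="\<lambda>x. norm (f x)"])
    show "AE x in lborel. (\<lambda>m::nat. indicator (box (- real m *\<^sub>R One) (real m *\<^sub>R One)) x *\<^sub>R f x) \<longlonglongrightarrow> f x"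
    proof (rule AE_I2, rule tendsto_eventually)
      fix x :: 'a
      obtain M where M: "norm x < real M" using reals_Archimedean2 by blast
      have "x \<in> box (- real m *\<^sub>R One) (real m *\<^sub>R One)" if "m \<ge> M" for m
        using M that Basis_le_norm[of _ x] by (force simp: mem_box abs_le_iff)
      then show "\<forall>\<^sub>F m in sequentially. indicator (box (- real m *\<^sub>R One) (real m *\<^sub>R One)) x *\<^sub>R f x = f x"
        by (intro eventually_sequentiallyI[of M]) auto
    qed
  qed (use f in \<open>auto simp: indicator_def intro!: AE_I2\<close>)
  then have total: "(\<integral>x. f x \<partial>lborel) = 0" unfolding box using LIMSEQ_unique by blast
  show ?thesis
  proof (rule sigma_finite_measure.density_zero[OF sigma_finite_lborel f])
    fix A :: "'a set" assume "A \<in> sets lborel"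
    have sig: "B \<in> sets lborel" if "B \<in> sigma_sets UNIV (range (\<lambda>(a, b). box a b))" for B :: "'a set"
      using that by (simp add: borel_eq_box)
    have "Int_stable (range (\<lambda>(a, b). box a b :: 'a set))"
      by (auto simp: Int_stable_def box_Int_box)
    moreover have "range (\<lambda>(a, b). box a b :: 'a set) \<subseteq> Pow UNIV" by simp
    moreover have "A \<in> sigma_sets UNIV (range (\<lambda>(a, b). box a b))"
      using \<open>A \<in> sets lborel\<close> by (simp add: borel_eq_box)
    ultimately show "set_lebesgue_integral lborel A f = 0"
    proof (induction A rule: sigma_sets_induct_disjoint)
      case (compl A)
      have "set_lebesgue_integral lborel (A \<union> (UNIV - A)) f
          = set_lebesgue_integral lborel A f + set_lebesgue_integral lborel (UNIV - A) f"
        using sig compl by (intro set_integral_Un int) auto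
      then show ?case using compl total by (simp add: set_lebesgue_integral_def)
    next
      case (union A)
      then have A: "\<And>i. A i \<in> sets lborel" using sig by blast
      then have "set_lebesgue_integral lborel (\<Union>i. A i) f = (\<Sum>i. set_lebesgue_integral lborel (A i) f)"
        using union by (intro lebesgue_integral_countable_add int) (auto simp: disjoint_family_on_def)
      then show ?case using union by simp
    next
      case (basic A)
      then obtain a b where "A = box a b" by auto
      then show ?case by (simp only: box)
    qed (simp add: set_lebesgue_integral_def)
  qed
qed

text \<open>Bumps approximating a box from inside turn the hypothesis into vanishing integrals over
  boxes. Since \<open>g\<close> is only locally integrable, it is cut down to a large box;
  integrating the cut function over a box is integrating \<open>g\<close> over an intersection of
  boxes, again a box.\<close>

lemma L1_loc_eq_0:
  fixes g :: "real^'n::finite \<Rightarrow> complex"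
  assumes g: "g \<in> L1_loc" and 0: "\<And>f. f \<in> test_functions \<Longrightarrow> (\<integral>x. g x * f x \<partial>lebesgue) = 0"
  shows "AE x in lebesgue. g x = 0"
proof -
  have boxint: "set_integrable lebesgue (box a b) g" for a b
    by (rule set_integrable_subset[of _ "cbox a b"])
       (use g box_subset_cbox in \<open>auto simp: L1_loc_def\<close>)
  have box0: "set_lebesgue_integral lebesgue (box a b) g = 0" for a b :: "real^'n"
  proof -
    \<comment> \<open>\<open>Suc m\<close> keeps the steepness of the bump positive, as
      \<open>test_function_bump\<close> requires.\<close>
    have "(\<lambda>m. \<integral>x. g x * bump (real (Suc m)) a b x \<partial>lebesgue) \<longlonglongrightarrow> (\<integral>x. g x * indicator (box a b) x \<partial>lebesgue)"
    proof (rule integral_dominated_convergence[where w="\<lambda>x. norm (indicator (box a b) x *\<^sub>R g x)"])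
      show "AE x in lebesgue. (\<lambda>m. g x * bump (real (Suc m)) a b x) \<longlonglongrightarrow> g x * indicator (box a b) x"
        by (intro AE_I2 tendsto_intros LIMSEQ_Suc[OF bump_tendsto])
      show "AE x in lebesgue. norm (g x * bump (real (Suc m)) a b x) \<le> norm (indicator (box a b) x *\<^sub>R g x)" for m
      proof (rule AE_I2)
        fix x
        show "norm (g x * bump (real (Suc m)) a b x) \<le> norm (indicator (box a b) x *\<^sub>R g x)"
        proof (cases "x \<in> box a b")
          case True
          then show ?thesis by (simp add: norm_mult mult_left_le norm_bump_le_1 del: of_nat_Suc)
        next
          case False
          then show ?thesis using bump_outside[of "real (Suc m)" x a b] by simp
        qed
      qed
      have "integrable lebesgue (\<lambda>x. indicator (box a b) x *\<^sub>R g x)"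
        using boxint unfolding set_integrable_def .
      then show "integrable lebesgue (\<lambda>x. norm (indicator (box a b) x *\<^sub>R g x))"
        by (rule integrable_norm)
      from \<open>integrable lebesgue (\<lambda>x. indicator (box a b) x *\<^sub>R g x)\<close>
      show "(\<lambda>x. g x * indicator (box a b) x) \<in> borel_measurable lebesgue"
        by (intro borel_measurable_times borel_measurable_indicator L1_loc_measurable g) auto
      show "(\<lambda>x. g x * bump (real (Suc m)) a b x) \<in> borel_measurable lebesgue" for m
        by (rule borel_measurable_integrable, rule L1_loc_mult_test[OF g]) (simp add: test_function_bump)
    qed
    moreover have "(\<integral>x. g x * bump (real (Suc m)) a b x \<partial>lebesgue) = 0" for m
      by (rule 0) (simp add: test_function_bump)
    ultimately have "(\<integral>x. g x * indicator (box a b) x \<partial>lebesgue) = 0"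
      by (simp add: LIMSEQ_const_iff)
    moreover have "(\<lambda>x. g x * indicator (box a b) x) = (\<lambda>x. indicator (box a b) x *\<^sub>R g x)"
      by (auto simp: indicator_def)
    ultimately show ?thesis unfolding set_lebesgue_integral_def by simp
  qed
  have "AE x in lebesgue. indicator (box (- real m *\<^sub>R One) (real m *\<^sub>R One)) x *\<^sub>R g x = 0" for m :: nat
  proof -
    let ?B = "box (- real m *\<^sub>R One) (real m *\<^sub>R One) :: (real^'n) set"
    let ?h = "\<lambda>x. indicator ?B x *\<^sub>R g x"
    have h: "integrable lebesgue ?h" using boxint unfolding set_integrable_def .
    then obtain h' where h': "h' \<in> borel_measurable lborel" "AE x in lborel. ?h x = h' x"
      using completion_ex_borel_measurable_complex[OF borel_measurable_integrable] by blast
    have AE: "AE x in lebesgue. ?h x = h' x" using h'(2) by (rule AE_completion)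
    have h'm: "h' \<in> borel_measurable lebesgue" using h'(1) by (rule measurable_completion)
    have "integrable lebesgue h'"
      using integrable_cong_AE_imp[OF h h'm] AE by (auto simp: eq_commute)
    then have "integrable lborel h'" using h'(1) integrable_completion by blast
    moreover have "set_lebesgue_integral lborel (box a b) h' = 0" for a b
    proof -
      have "set_lebesgue_integral lborel (box a b) h' = set_lebesgue_integral lebesgue (box a b) h'"
        unfolding set_lebesgue_integral_def by (rule integral_completion[symmetric]) (use h'(1) in measurable)
      also have "\<dots> = set_lebesgue_integral lebesgue (box a b) ?h"
        unfolding set_lebesgue_integral_def
      proof (rule integral_cong_AE)
        show "(\<lambda>x. indicator (box a b) x *\<^sub>R h' x) \<in> borel_measurable lebesgue"
          by (intro borel_measurable_scaleR borel_measurable_indicator h'm) simp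
        show "(\<lambda>x. indicator (box a b) x *\<^sub>R ?h x) \<in> borel_measurable lebesgue"
          by (intro borel_measurable_scaleR[OF _ borel_measurable_integrable[OF h]] borel_measurable_indicator) simp
        show "AE x in lebesgue. indicator (box a b) x *\<^sub>R h' x = indicator (box a b) x *\<^sub>R ?h x"
          using AE by eventually_elim simp
      qed
      also have "\<dots> = set_lebesgue_integral lebesgue (box a b \<inter> ?B) g"
        unfolding set_lebesgue_integral_def by (intro Bochner_Integration.integral_cong) (auto simp: indicator_def)
      also have "\<dots> = 0" unfolding box_Int_box by (rule box0)
      finally show ?thesis .
    qed
    ultimately have "AE x in lborel. h' x = 0" by (rule AE_zero_of_box_integrals)
    then have "AE x in lebesgue. h' x = 0" by (rule AE_completion)
    with AE show ?thesis by eventually_elim simp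
  qed
  then have "AE x in lebesgue. \<forall>m::nat. indicator (box (- real m *\<^sub>R One) (real m *\<^sub>R One)) x *\<^sub>R g x = 0"
    unfolding AE_all_countable by blast
  then show ?thesis
  proof eventually_elim
    case (elim x)
    obtain M :: nat where M: "norm x < real M" using reals_Archimedean2 by blast
    then have "x \<in> box (- real M *\<^sub>R One) (real M *\<^sub>R One)"
      using Basis_le_norm[of _ x] by (force simp: mem_box abs_le_iff)
    then show ?case using elim[rule_format, of M] by simp
  qed
qed

lemma L1_loc_unique:
  fixes g h :: "real^'n::finite \<Rightarrow> complex"
  assumes g: "g \<in> L1_loc" and h: "h \<in> L1_loc"
    and eq: "\<And>f. f \<in> test_functions \<Longrightarrow> (\<integral>x. g x * f x \<partial>lebesgue) = (\<integral>x. h x * f x \<partial>lebesgue)"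
  shows "AE x in lebesgue. g x = h x"
proof -
  have "AE x in lebesgue. g x - h x = 0"
  proof (rule L1_loc_eq_0[OF L1_loc_diff[OF g h]])
    fix f :: "real^'n \<Rightarrow> complex" assume "f \<in> test_functions"
    then show "(\<integral>x. (g x - h x) * f x \<partial>lebesgue) = 0"
      using eq L1_loc_mult_test[OF g] L1_loc_mult_test[OF h]
      by (simp add: left_diff_distrib)
  qed
  then show ?thesis by simp
qed

lemma represents_unique: "represents g S \<Longrightarrow> represents h S \<Longrightarrow> AE x in lebesgue. g x = h x"
  unfolding represents_def regular_dist_def by (auto intro!: L1_loc_unique)

section \<open>Lebesgue measure on Euclidean space\<close>

lemma lborel_distr_minus:
  fixes a :: "'a::euclidean_space"
  shows "distr lborel borel (\<lambda>x. a - x) = lborel"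
  by (subst (2) lborel_affine[of "-1" a]) (auto simp: density_1)

lemma nn_integral_translate:
  fixes f :: "'a::euclidean_space \<Rightarrow> ennreal"
  assumes "f \<in> borel_measurable borel"
  shows "(\<integral>\<^sup>+x. f (x + a) \<partial>lborel) = (\<integral>\<^sup>+x. f x \<partial>lborel)"
proof -
  have "(\<integral>\<^sup>+x. f x \<partial>lborel) = (\<integral>\<^sup>+x. f x \<partial>(distr lborel borel ((+) a)))"
    by (simp add: lborel_distr_plus)
  also have "\<dots> = (\<integral>\<^sup>+x. f (a + x) \<partial>lborel)"
    using assms by (subst nn_integral_distr) auto
  finally show ?thesis by (simp add: add.commute)
qed

lemma nn_integral_reflect:
  fixes f :: "'a::euclidean_space \<Rightarrow> ennreal"
  assumes "f \<in> borel_measurable borel"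
  shows "(\<integral>\<^sup>+x. f (a - x) \<partial>lborel) = (\<integral>\<^sup>+x. f x \<partial>lborel)"
proof -
  have "(\<integral>\<^sup>+x. f x \<partial>lborel) = (\<integral>\<^sup>+x. f x \<partial>(distr lborel borel (\<lambda>x. a - x)))"
    by (simp add: lborel_distr_minus)
  also have "\<dots> = (\<integral>\<^sup>+x. f (a - x) \<partial>lborel)"
    using assms by (subst nn_integral_distr) auto
  finally show ?thesis by simp
qed

lemma integral_translate:
  fixes f :: "'a::euclidean_space \<Rightarrow> 'b::{banach, second_countable_topology}"
  assumes "f \<in> borel_measurable borel"
  shows "(\<integral>x. f (x + a) \<partial>lborel) = (\<integral>x. f x \<partial>lborel)"
proof -
  have "(\<integral>x. f x \<partial>lborel) = (\<integral>x. f x \<partial>(distr lborel borel ((+) a)))"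
    by (simp add: lborel_distr_plus)
  also have "\<dots> = (\<integral>x. f (a + x) \<partial>lborel)"
    using assms by (subst integral_distr) auto
  finally show ?thesis by (simp add: add.commute)
qed

lemma integrable_translate:
  fixes f :: "'a::euclidean_space \<Rightarrow> 'b::{banach, second_countable_topology}"
  assumes "integrable lborel f"
  shows "integrable lborel (\<lambda>x. f (x + a))"
proof -
  have "integrable (distr lborel borel ((+) a)) f" using assms by (simp add: lborel_distr_plus)
  then show ?thesis by (subst (asm) integrable_distr_eq) (use assms in \<open>auto simp: add.commute\<close>)
qed

section \<open>Lebesgue measure as a product over coordinates\<close>

lemma measurable_vec_lambda_PiM:
  "(\<lambda>f. \<chi> i. f i) \<in> (\<Pi>\<^sub>M i\<in>(UNIV::'n::finite set). (lborel::real measure)) \<rightarrow>\<^sub>M borel"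
proof (rule borel_measurable_euclidean_space[THEN iffD2], rule ballI)
  fix b :: "real^'n" assume "b \<in> Basis"
  then obtain i where "b = axis i 1" by (auto simp: Basis_vec_def)
  then show "(\<lambda>f. (\<chi> i. f i) \<bullet> b) \<in> borel_measurable (\<Pi>\<^sub>M i\<in>(UNIV::'n set). (lborel::real measure))"
    by (simp add: inner_axis)
qed

text \<open>Lebesgue measure is determined by the volumes of boxes, and those of the product measure
  are products of side lengths. This opens the way to integrating products of functions of one
  coordinate factor by factor.\<close>

lemma lborel_eq_cart:
  "(lborel :: (real^'n::finite) measure) = distr (\<Pi>\<^sub>M i\<in>(UNIV::'n set). (lborel::real measure)) borel (\<lambda>f. \<chi> i. f i)"
proof (rule lborel_eqI)
  note [measurable] = measurable_vec_lambda_PiM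
  interpret product_sigma_finite "\<lambda>i::'n. lborel :: real measure" ..
  fix l u :: "real^'n"
  assume le: "\<And>b. b \<in> Basis \<Longrightarrow> l \<bullet> b \<le> u \<bullet> b"
  then have le': "l $ i \<le> u $ i" for i
    using le[of "axis i 1"] by (simp add: inner_axis axis_in_Basis_iff)
  have "emeasure (distr (\<Pi>\<^sub>M i\<in>(UNIV::'n set). lborel) borel (\<lambda>f. \<chi> i. f i)) (box l u)
      = emeasure (\<Pi>\<^sub>M i\<in>(UNIV::'n set). lborel) (PiE UNIV (\<lambda>i. {l $ i <..< u $ i}))"
    by (subst emeasure_distr)
       (auto simp: mem_box_cart space_PiM PiE_def extensional_def Pi_def intro!: arg_cong2[where f=emeasure])
  also have "\<dots> = (\<Prod>i\<in>UNIV. ennreal (u $ i - l $ i))"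
    using le' by (subst emeasure_PiM) auto
  also have "\<dots> = ennreal (\<Prod>i\<in>UNIV. u $ i - l $ i)" using le' by (simp add: prod_ennreal)
  also have "(\<Prod>i\<in>UNIV. u $ i - l $ i) = (\<Prod>b\<in>Basis. (u - l) \<bullet> b)"
    by (simp add: Basis_vec_def UNION_singleton_eq_range prod.reindex inj_on_def axis_eq_axis inner_axis)
  finally show "emeasure (distr (\<Pi>\<^sub>M i\<in>(UNIV::'n set). lborel) borel (\<lambda>f. \<chi> i. f i)) (box l u)
      = ennreal (\<Prod>b\<in>Basis. (u - l) \<bullet> b)" .
qed simp

lemma nn_integral_prod_cart:
  fixes f :: "'n::finite \<Rightarrow> real \<Rightarrow> ennreal"
  assumes [measurable]: "\<And>i. f i \<in> borel_measurable borel"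
  shows "(\<integral>\<^sup>+x. (\<Prod>i\<in>UNIV. f i (x $ i)) \<partial>(lborel::(real^'n) measure)) = (\<Prod>i\<in>UNIV. \<integral>\<^sup>+t. f i t \<partial>lborel)"
proof -
  interpret product_sigma_finite "\<lambda>i::'n. lborel :: real measure" ..
  note [measurable] = measurable_vec_lambda_PiM
  show ?thesis
    by (subst lborel_eq_cart, subst nn_integral_distr) (auto simp: product_nn_integral_prod)
qed

lemma integrable_prod_cart:
  fixes f :: "'n::finite \<Rightarrow> real \<Rightarrow> complex"
  assumes "\<And>i. integrable lborel (f i)"
  shows "integrable (lborel::(real^'n) measure) (\<lambda>x. \<Prod>i\<in>UNIV. f i (x $ i))"
    and "(\<integral>x. (\<Prod>i\<in>UNIV. f i (x $ i)) \<partial>(lborel::(real^'n) measure)) = (\<Prod>i\<in>UNIV. \<integral>t. f i t \<partial>lborel)"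
proof -
  interpret product_sigma_finite "\<lambda>i::'n. lborel :: real measure" ..
  note [measurable] = measurable_vec_lambda_PiM
  have [measurable]: "f i \<in> borel_measurable borel" for i using assms[of i] by auto
  show "integrable (lborel::(real^'n) measure) (\<lambda>x. \<Prod>i\<in>UNIV. f i (x $ i))"
    by (subst lborel_eq_cart, subst integrable_distr_eq) (auto intro!: product_integrable_prod assms)
  show "(\<integral>x. (\<Prod>i\<in>UNIV. f i (x $ i)) \<partial>(lborel::(real^'n) measure)) = (\<Prod>i\<in>UNIV. \<integral>t. f i t \<partial>lborel)"
    by (subst lborel_eq_cart, subst integral_distr) (auto intro!: product_integral_prod assms)
qed

text \<open>The exponent 2n arises because (1 + |x|)^2 dominates 1 + x_i^2 for each of the n
  coordinates; the product of the functions 1 / (1 + x_i^2) is an integrable majorant.\<close>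

lemma integrable_rational_decay:
  "integrable lborel (\<lambda>x::real^'n::finite. 1 / (1 + norm x) ^ (2 * CARD('n)))"
proof (rule Bochner_Integration.integrable_bound)
  have "integrable lborel (\<lambda>t::real. inverse (1 + t\<^sup>2))"
    using integrable_inverse_1_plus_square by (simp add: set_integrable_def)
  then have "integrable lborel (\<lambda>t::real. complex_of_real (inverse (1 + t\<^sup>2)))"
    by (rule integrable_of_real)
  then show "integrable lborel (\<lambda>x::real^'n. \<Prod>i\<in>UNIV. complex_of_real (inverse (1 + (x $ i)\<^sup>2)))"
    by (rule integrable_prod_cart)
  show "AE x in lborel. norm (1 / (1 + norm x) ^ (2 * CARD('n)))
      \<le> norm (\<Prod>i\<in>UNIV. complex_of_real (inverse (1 + ((x::real^'n) $ i)\<^sup>2)))"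
  proof (rule AE_I2)
    fix x :: "real^'n"
    have "(\<Prod>i\<in>UNIV. 1 + (x $ i)\<^sup>2) \<le> (\<Prod>i\<in>(UNIV::'n set). (1 + norm x)\<^sup>2)"
    proof (rule prod_mono, intro conjI)
      fix i
      have "(x $ i)\<^sup>2 \<le> (norm x)\<^sup>2" using component_le_norm_cart[of x i] by (rule abs_le_square_iff[THEN iffD1, of _ "norm x", simplified])
      then show "1 + (x $ i)\<^sup>2 \<le> (1 + norm x)\<^sup>2" by (simp add: power2_sum add_increasing2)
    qed simp
    also have "\<dots> = (1 + norm x) ^ (2 * CARD('n))" by (simp add: power_mult)
    finally have "1 / (1 + norm x) ^ (2 * CARD('n)) \<le> 1 / (\<Prod>i\<in>UNIV. 1 + (x $ i)\<^sup>2)"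
      by (intro divide_left_mono mult_pos_pos prod_pos zero_less_power)
         (auto simp: add_pos_nonneg intro!: add_pos_nonneg)
    also have "\<dots> = (\<Prod>i\<in>UNIV. inverse (1 + (x $ i)\<^sup>2))" by (simp add: prod_inversef[symmetric] inverse_eq_divide prod_dividef)
    also have "\<dots> = norm (\<Prod>i\<in>UNIV. complex_of_real (inverse (1 + (x $ i)\<^sup>2)))"
      unfolding of_real_prod[symmetric] norm_of_real by (subst abs_of_nonneg) (auto intro!: prod_nonneg)
    finally show "norm (1 / (1 + norm x) ^ (2 * CARD('n)))
      \<le> norm (\<Prod>i\<in>UNIV. complex_of_real (inverse (1 + (x $ i)\<^sup>2)))" by simp
  qed
qed auto

lemma test_function_mult_integrable:
  fixes f :: "real^'n::finite \<Rightarrow> complex" and g :: "real^'n \<Rightarrow> complex"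
  assumes f: "f \<in> test_functions" and g: "continuous_on UNIV g"
  shows "integrable lborel (\<lambda>x. f x * g x)"
proof -
  obtain K where K: "compact K" "\<And>x. x \<notin> K \<Longrightarrow> f x = 0" using test_function_support f by blast
  have "integrable lborel (\<lambda>x. indicator K x *\<^sub>R (f x * g x))"
    by (intro borel_integrable_compact K continuous_intros test_function_continuous f continuous_on_subset[OF g]) auto
  moreover have "(\<lambda>x. indicator K x *\<^sub>R (f x * g x)) = (\<lambda>x. f x * g x)"
    using K(2) by (auto simp: indicator_def)
  ultimately show ?thesis by simp
qed

lemma test_function_integrable: "f \<in> test_functions \<Longrightarrow> integrable lborel f"
  using test_function_mult_integrable[of f "\<lambda>_. 1"] by simp

abbreviation fourier_const :: "'n::finite itself \<Rightarrow> complex" where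
  "fourier_const t \<equiv> complex_of_real ((2 * pi) powr (- real CARD('n) / 2))"

lemma fourier_lborel:
  fixes f :: "real^'n::finite \<Rightarrow> complex"
  assumes "f \<in> borel_measurable borel"
  shows "fourier f \<xi> = fourier_const TYPE('n) * (\<integral>x. f x * exp (- \<i> * of_real (\<xi> \<bullet> x)) \<partial>lborel)"
  unfolding fourier_def by (subst integral_completion) (use assms in auto)

lemma inv_fourier_lborel:
  fixes f :: "real^'n::finite \<Rightarrow> complex"
  assumes "f \<in> borel_measurable borel"
  shows "inv_fourier f x = fourier_const TYPE('n) * (\<integral>\<xi>. f \<xi> * exp (\<i> * of_real (x \<bullet> \<xi>)) \<partial>lborel)"
  unfolding inv_fourier_def by (subst integral_completion) (use assms in auto)

section \<open>Fourier transforms of test functions\<close>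

lemma smooth_exp_inner: "smooth (\<lambda>x::real^'n::finite. exp (- \<i> * of_real (\<xi> \<bullet> x)))"
proof (rule smooth_coinduct[of _ "range (\<lambda>c x. c * exp (- \<i> * of_real (\<xi> \<bullet> x)))"])
  have *: "((\<lambda>x::real^'n. c * exp (- \<i> * of_real (\<xi> \<bullet> x))) has_derivative
     (\<lambda>h. c * (exp (- \<i> * of_real (\<xi> \<bullet> x)) * (- \<i> * of_real (\<xi> \<bullet> h))))) (at x)" for c x
    by (intro has_derivative_mult_right has_derivative_compose[OF _ DERIV_exp[unfolded has_field_derivative_def], THEN has_derivative_eq_rhs])
       (auto intro!: derivative_eq_intros)
  fix g :: "real^'n \<Rightarrow> complex" and x :: "real^'n" and j
  assume "g \<in> range (\<lambda>c x. c * exp (- \<i> * of_real (\<xi> \<bullet> x)))"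
  then obtain c where g: "g = (\<lambda>x. c * exp (- \<i> * of_real (\<xi> \<bullet> x)))" by blast
  show "g differentiable (at x)" unfolding g using * differentiableI by blast
  have "partial j g = (\<lambda>x. (c * (- \<i> * of_real (\<xi> $ j))) * exp (- \<i> * of_real (\<xi> \<bullet> x)))"
    unfolding g by (rule ext, subst partial_eqI[OF *]) (simp add: inner_axis mult_ac)
  then show "partial j g \<in> range (\<lambda>c x. c * exp (- \<i> * of_real (\<xi> \<bullet> x)))" by blast
qed (rule range_eqI[of _ _ 1], simp)

lemma partial_exp_inner:
  "partial j (\<lambda>x::real^'n::finite. exp (- \<i> * of_real (\<xi> \<bullet> x)))
    = (\<lambda>x. - \<i> * of_real (\<xi> $ j) * exp (- \<i> * of_real (\<xi> \<bullet> x)))"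
proof
  fix x :: "real^'n"
  have "((\<lambda>x::real^'n. exp (- \<i> * of_real (\<xi> \<bullet> x))) has_derivative
     (\<lambda>h. exp (- \<i> * of_real (\<xi> \<bullet> x)) * (- \<i> * of_real (\<xi> \<bullet> h)))) (at x)"
    by (intro has_derivative_compose[OF _ DERIV_exp[unfolded has_field_derivative_def], THEN has_derivative_eq_rhs])
       (auto intro!: derivative_eq_intros)
  from partial_eqI[OF this] show "partial j (\<lambda>x::real^'n. exp (- \<i> * of_real (\<xi> \<bullet> x))) x
    = - \<i> * of_real (\<xi> $ j) * exp (- \<i> * of_real (\<xi> \<bullet> x))"
    by (simp add: inner_axis mult_ac)
qed

lemma has_vector_derivative_line:
  assumes "f differentiable (at (x + t *\<^sub>R axis j 1))"
  shows "((\<lambda>t. f (x + t *\<^sub>R axis j 1)) has_vector_derivative partial j f (x + t *\<^sub>R axis j 1)) (at t within S)"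
proof -
  have "((\<lambda>t. f (x + t *\<^sub>R axis j 1)) has_derivative
     (\<lambda>s. frechet_derivative f (at (x + t *\<^sub>R axis j 1)) (s *\<^sub>R axis j 1))) (at t within S)"
    by (rule has_derivative_compose[where f="\<lambda>t. x + t *\<^sub>R axis j 1" and g=f, OF _ has_derivative_frechet[OF assms]])
       (auto intro!: derivative_eq_intros)
  moreover have "frechet_derivative f (at (x + t *\<^sub>R axis j 1)) (s *\<^sub>R axis j 1)
     = s *\<^sub>R partial j f (x + t *\<^sub>R axis j 1)" for s
    using has_derivative_frechet[OF assms]
    by (simp add: partial_def linear_cmul has_derivative_linear)
  ultimately show ?thesis by (simp add: has_vector_derivative_def)
qed

text \<open>The integral of a difference quotient vanishes by translation invariance.\<close>

lemma integral_partial_test: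
  assumes f: "f \<in> test_functions"
  shows "(\<integral>x. partial j f x \<partial>lborel) = 0"
proof -
  define e :: "real^'a" where "e = axis j 1"
  have diff: "f differentiable (at x)" for x using f by (simp add: test_functions_iff smooth_differentiable)
  obtain B where B: "B \<ge> 0" "\<And>x. norm (partial j f x) \<le> B"
    using test_function_bounded test_function_partial[OF f] by blast
  obtain K where K: "compact K" "\<And>x. x \<notin> K \<Longrightarrow> f x = 0" using test_function_support f by blast
  then obtain R where R: "\<And>x. x \<in> K \<Longrightarrow> norm x \<le> R" using compact_imp_bounded bounded_iff by metis
  have [measurable]: "f \<in> borel_measurable borel" by (rule test_function_measurable[OF f])
  \<comment> \<open>Difference quotients with step 1 / (m + 1). The step is at most 1, so all of
    them vanish outside the ball of radius \<open>R + 1\<close>; on it the mean value inequality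
    bounds them by the bound \<open>B\<close> of the derivative.\<close>
  let ?q = "\<lambda>m x. real (Suc m) *\<^sub>R (f (x + (1 / real (Suc m)) *\<^sub>R e) - f x)"
  have "(\<lambda>m. \<integral>x. ?q m x \<partial>lborel) \<longlonglongrightarrow> (\<integral>x. partial j f x \<partial>lborel)"
  proof (rule integral_dominated_convergence[where w="\<lambda>x. B * indicator (cball 0 (R + 1)) x"])
    show "partial j f \<in> borel_measurable lborel"
      using test_function_measurable[OF test_function_partial[OF f]] by simp
    show "(\<lambda>x. ?q m x) \<in> borel_measurable lborel" for m by measurable
    show "integrable lborel (\<lambda>x. B * indicator (cball 0 (R + 1)) x :: real)"
      using emeasure_bounded_finite[OF bounded_cball, of 0 "R + 1"]
      by (intro integrable_mult_right integrable_real_indicator) auto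
    show "AE x in lborel. norm (?q m x) \<le> B * indicator (cball 0 (R + 1)) x" for m
    proof (rule AE_I2)
      fix x
      let ?t = "1 / real (Suc m)"
      have ne: "norm e = 1" by (simp add: e_def norm_axis_1)
      show "norm (?q m x) \<le> B * indicator (cball 0 (R + 1)) x"
      proof (cases "x \<in> cball 0 (R + 1)")
        case True
        have "norm (f (x + ?t *\<^sub>R e) - f (x + 0 *\<^sub>R e)) \<le> B * norm (?t - 0)"
        proof (rule differentiable_bound[where S=UNIV and f="\<lambda>t. f (x + t *\<^sub>R e)"])
          show "((\<lambda>t. f (x + t *\<^sub>R e)) has_derivative (\<lambda>s. s *\<^sub>R partial j f (x + t *\<^sub>R e))) (at t within UNIV)" for t
            using has_vector_derivative_line[OF diff] unfolding e_def has_vector_derivative_def by blast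
          show "onorm (\<lambda>s. s *\<^sub>R partial j f (x + t *\<^sub>R e)) \<le> B" for t
            by (rule onorm_le) (use B(2) in \<open>auto simp: mult.commute[of B] intro!: mult_left_mono\<close>)
        qed auto
        then have "real (Suc m) * norm (f (x + ?t *\<^sub>R e) - f x) \<le> real (Suc m) * (B * ?t)"
          by (intro mult_left_mono) auto
        then show ?thesis using True by simp
      next
        case False
        have "norm x \<le> norm (x + ?t *\<^sub>R e) + ?t"
          using norm_triangle_ineq4[of "x + ?t *\<^sub>R e" "?t *\<^sub>R e"] ne by simp
        moreover have "?t \<le> 1" by simp
        moreover have "norm x > R + 1" using False by simp
        ultimately have "norm (x + ?t *\<^sub>R e) > R" "norm x > R" by linarith+
        then have "f (x + ?t *\<^sub>R e) = 0" "f x = 0" using K R by (meson not_le)+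
        then show ?thesis using B by simp
      qed
    qed
    show "AE x in lborel. (\<lambda>m. ?q m x) \<longlonglongrightarrow> partial j f x"
    proof (rule AE_I2)
      fix x
      have "((\<lambda>t. f (x + t *\<^sub>R e)) has_vector_derivative partial j f (x + 0 *\<^sub>R e)) (at 0)"
        unfolding e_def by (rule has_vector_derivative_line[OF diff])
      then have "((\<lambda>h. norm (f (x + h *\<^sub>R e) - f x - h *\<^sub>R partial j f x) / norm h) \<longlongrightarrow> 0) (at 0)"
        by (simp add: has_vector_derivative_def has_derivative_at)
      then have "((\<lambda>h. norm ((1 / h) *\<^sub>R (f (x + h *\<^sub>R e) - f x) - partial j f x)) \<longlongrightarrow> 0) (at 0)"
      proof (rule Lim_transform_eventually)
        have "norm (f (x + h *\<^sub>R e) - f x - h *\<^sub>R partial j f x) / norm h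
            = norm ((1 / h) *\<^sub>R (f (x + h *\<^sub>R e) - f x) - partial j f x)" if "h \<noteq> 0" for h
        proof -
          have "(1 / h) *\<^sub>R (f (x + h *\<^sub>R e) - f x) - partial j f x
              = (1 / h) *\<^sub>R (f (x + h *\<^sub>R e) - f x - h *\<^sub>R partial j f x)"
            using that by (simp add: scaleR_right_diff_distrib)
          then show ?thesis by (simp only: norm_scaleR) simp
        qed
        then show "\<forall>\<^sub>F h in at 0. norm (f (x + h *\<^sub>R e) - f x - h *\<^sub>R partial j f x) / norm h
            = norm ((1 / h) *\<^sub>R (f (x + h *\<^sub>R e) - f x) - partial j f x)"
          by (auto simp: eventually_at_filter)
      qed
      then have "((\<lambda>h. (1 / h) *\<^sub>R (f (x + h *\<^sub>R e) - f x)) \<longlongrightarrow> partial j f x) (at 0)"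
        by (rule LIM_zero_cancel[OF tendsto_norm_zero_cancel])
      moreover have "filterlim (\<lambda>m. 1 / real (Suc m)) (at 0) sequentially"
      proof (rule filterlim_atI)
        show "(\<lambda>m. 1 / real (Suc m)) \<longlonglongrightarrow> 0"
          using LIMSEQ_inverse_real_of_nat by (simp only: inverse_eq_divide)
      qed (auto intro!: always_eventually)
      ultimately have "(\<lambda>m. (1 / (1 / real (Suc m))) *\<^sub>R (f (x + (1 / real (Suc m)) *\<^sub>R e) - f x)) \<longlonglongrightarrow> partial j f x"
        by (rule filterlim_compose)
      then show "(\<lambda>m. ?q m x) \<longlonglongrightarrow> partial j f x"
        by (simp only: div_by_1 divide_divide_eq_right mult_1)
    qed
  qed
  moreover have "(\<integral>x. ?q m x \<partial>lborel) = 0" for m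
    using integral_translate[of f "(1 / real (Suc m)) *\<^sub>R e"] test_function_integrable[OF f]
    by (simp add: integrable_translate)
  ultimately show ?thesis by (simp add: LIMSEQ_const_iff)
qed

text \<open>Integration by parts: the exponential times \<open>f\<close> is again a test function,
  so its derivative has integral 0, and the product rule splits that integral into the two
  sides.\<close>

lemma fourier_partial:
  fixes f :: "real^'n::finite \<Rightarrow> complex"
  assumes f: "f \<in> test_functions"
  shows "fourier (partial j f) \<xi> = \<i> * of_real (\<xi> $ j) * fourier f \<xi>"
proof -
  let ?e = "\<lambda>x::real^'n. exp (- \<i> * of_real (\<xi> \<bullet> x))"
  have ce: "continuous_on UNIV ?e" using smooth_exp_inner by (rule smooth_continuous)
  have sf: "smooth f" using f by (simp add: test_functions_iff)
  have int: "integrable lborel (\<lambda>x. f x * ?e x)" "integrable lborel (\<lambda>x. partial j f x * ?e x)"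
    by (intro test_function_mult_integrable test_function_partial f ce)+
  have "(\<lambda>x. ?e x * f x) \<in> test_functions" by (intro test_function_mult f smooth_exp_inner)
  note int0 = integral_partial_test[OF this, of j]
  have "partial j (\<lambda>x. ?e x * f x) = (\<lambda>x. ?e x * partial j f x + partial j ?e x * f x)"
    by (rule partial_mult) (intro smooth_differentiable smooth_exp_inner sf)+
  with int0 have "0 = (\<integral>x. ?e x * partial j f x + partial j ?e x * f x \<partial>lborel)" by simp
  also have "\<dots> = (\<integral>x. partial j f x * ?e x - \<i> * of_real (\<xi> $ j) * (f x * ?e x) \<partial>lborel)"
    unfolding partial_exp_inner by (simp add: mult_ac)
  also have "\<dots> = (\<integral>x. partial j f x * ?e x \<partial>lborel) - \<i> * of_real (\<xi> $ j) * (\<integral>x. f x * ?e x \<partial>lborel)"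
    using int by (subst Bochner_Integration.integral_diff) (auto intro: integrable_mult_right)
  finally show ?thesis
    using test_function_measurable[OF f] test_function_measurable[OF test_function_partial[OF f]]
    by (simp add: fourier_lborel mult_ac)
qed

lemma test_function_coord: "f \<in> test_functions \<Longrightarrow> (\<lambda>x. of_real (x $ j) * f x) \<in> test_functions"
  by (rule test_function_mult[OF _ smooth_coord])

lemma test_function_cmult: "f \<in> test_functions \<Longrightarrow> (\<lambda>x. c * f x) \<in> test_functions"
  by (rule test_function_mult[OF _ smooth_const])

lemma test_function_coord': "f \<in> test_functions \<Longrightarrow> (\<lambda>x. c * of_real (x $ j) * f x) \<in> test_functions"
  using test_function_cmult[OF test_function_coord, of f c j] by (simp add: mult.assoc)

text \<open>Differentiation under the integral, with a rate: the Taylor remainder of the exponential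
  is at most (h.x)^2, so the linearisation error is at most \<open>C\<close> times |h|^2, where
  \<open>C\<close> is essentially a second moment of \<open>f\<close>, finite by compact
  support.\<close>

lemma fourier_has_derivative:
  fixes f :: "real^'n::finite \<Rightarrow> complex"
  assumes f: "f \<in> test_functions"
  shows "(fourier f has_derivative
    (\<lambda>h. \<Sum>j\<in>UNIV. of_real (h $ j) * fourier (\<lambda>x. - \<i> * of_real (x $ j) * f x) \<xi>)) (at \<xi>)"
proof -
  let ?D = "\<lambda>h::real^'n. \<Sum>j\<in>UNIV. of_real (h $ j) * fourier (\<lambda>x. - \<i> * of_real (x $ j) * f x) \<xi>"
  let ?e = "\<lambda>\<xi> x::real^'n. exp (- \<i> * of_real (\<xi> \<bullet> x))"
  have ce: "continuous_on UNIV (?e \<xi>)" for \<xi> using smooth_exp_inner by (rule smooth_continuous)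
  have mf[measurable]: "f \<in> borel_measurable borel" by (rule test_function_measurable[OF f])
  note tf = test_function_coord'[OF f]
  have int: "integrable lborel (\<lambda>x. f x * ?e \<xi> x)" for \<xi>
    by (intro test_function_mult_integrable f ce)
  have int2: "integrable lborel (\<lambda>x. - \<i> * of_real (x $ j) * f x * ?e \<xi> x)" for j \<xi>
    by (intro test_function_mult_integrable tf ce)
  have int3: "integrable lborel (\<lambda>x. norm (f x) * (norm x)\<^sup>2)"
  proof -
    have "integrable lborel (\<lambda>x. norm (f x * of_real ((norm x)\<^sup>2)))"
      by (intro integrable_norm test_function_mult_integrable f continuous_intros)
    then show ?thesis by (simp add: norm_mult norm_power)
  qed
  define C where "C = norm (fourier_const TYPE('n)) * (\<integral>x. norm (f x) * (norm x)\<^sup>2 \<partial>lborel)"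
  have main: "norm (fourier f (\<xi> + h) - fourier f \<xi> - ?D h) \<le> C * (norm h)\<^sup>2" for h
  proof -
    have D: "?D h = fourier_const TYPE('n) * (\<integral>x. f x * (?e \<xi> x * (- \<i> * of_real (h \<bullet> x))) \<partial>lborel)"
    proof -
      have "?D h = fourier_const TYPE('n) * (\<Sum>j\<in>UNIV. \<integral>x. of_real (h $ j) * (- \<i> * of_real (x $ j) * f x * ?e \<xi> x) \<partial>lborel)"
        unfolding sum_distrib_left
      proof (rule sum.cong[OF refl])
        fix j
        have "fourier (\<lambda>x. - \<i> * of_real (x $ j) * f x) \<xi>
          = fourier_const TYPE('n) * (\<integral>x. - \<i> * of_real (x $ j) * f x * ?e \<xi> x \<partial>lborel)"
          by (rule fourier_lborel) (use test_function_measurable[OF tf] in blast)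
        then show "of_real (h $ j) * fourier (\<lambda>x. - \<i> * of_real (x $ j) * f x) \<xi>
          = fourier_const TYPE('n) * (\<integral>x. of_real (h $ j) * (- \<i> * of_real (x $ j) * f x * ?e \<xi> x) \<partial>lborel)"
          by (simp only: integral_mult_right_zero mult.left_commute)
      qed
      also have "\<dots> = fourier_const TYPE('n) * (\<integral>x. (\<Sum>j\<in>UNIV. of_real (h $ j) * (- \<i> * of_real (x $ j) * f x * ?e \<xi> x)) \<partial>lborel)"
        by (subst Bochner_Integration.integral_sum) (rule integrable_mult_right int2 refl)+
      also have "(\<lambda>x. \<Sum>j\<in>UNIV. of_real (h $ j) * (- \<i> * of_real (x $ j) * f x * ?e \<xi> x))
          = (\<lambda>x. f x * (?e \<xi> x * (- \<i> * of_real (h \<bullet> x))))"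
        by (simp add: inner_vec_def sum_distrib_left sum_distrib_right sum_negf mult_ac)
      finally show ?thesis .
    qed
    have i1: "integrable lborel (\<lambda>x. f x * (?e \<xi> x * (- \<i> * of_real (h \<bullet> x))))"
      by (intro test_function_mult_integrable f continuous_intros)
    have "fourier f (\<xi> + h) - fourier f \<xi> - ?D h = fourier_const TYPE('n) *
        ((\<integral>x. f x * ?e (\<xi> + h) x \<partial>lborel) - (\<integral>x. f x * ?e \<xi> x \<partial>lborel) - (\<integral>x. f x * (?e \<xi> x * (- \<i> * of_real (h \<bullet> x))) \<partial>lborel))"
      unfolding D fourier_lborel[OF mf] by (simp add: algebra_simps)
    also have "\<dots> = fourier_const TYPE('n) *
        (\<integral>x. f x * ?e (\<xi> + h) x - f x * ?e \<xi> x - f x * (?e \<xi> x * (- \<i> * of_real (h \<bullet> x))) \<partial>lborel)"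
      using int i1 by simp
    finally have "norm (fourier f (\<xi> + h) - fourier f \<xi> - ?D h) = norm (fourier_const TYPE('n)) *
        norm (\<integral>x. f x * ?e (\<xi> + h) x - f x * ?e \<xi> x - f x * (?e \<xi> x * (- \<i> * of_real (h \<bullet> x))) \<partial>lborel)"
      by (simp add: norm_mult)
    also have "\<dots> \<le> norm (fourier_const TYPE('n)) * (\<integral>x. norm (f x) * (norm x)\<^sup>2 * (norm h)\<^sup>2 \<partial>lborel)"
    proof (rule mult_left_mono[OF Bochner_Integration.integral_norm_bound_integral])
      fix x :: "real^'n"
      have "f x * ?e (\<xi> + h) x - f x * ?e \<xi> x - f x * (?e \<xi> x * (- \<i> * of_real (h \<bullet> x)))
          = f x * ?e \<xi> x * (exp (\<i> * of_real (- (h \<bullet> x))) - (1 + \<i> * of_real (- (h \<bullet> x))))"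
        by (simp add: inner_add_left exp_add[symmetric] ring_distribs exp_diff exp_minus field_simps)
      also have "norm \<dots> = norm (f x) * norm (exp (\<i> * of_real (- (h \<bullet> x))) - (1 + \<i> * of_real (- (h \<bullet> x))))"
        by (simp add: norm_mult)
      also have "\<dots> \<le> norm (f x) * ((h \<bullet> x)\<^sup>2)"
      proof (rule mult_left_mono)
        have "norm (exp (\<i> * of_real (- (h \<bullet> x))) - (1 + \<i> * of_real (- (h \<bullet> x)))) \<le> (h \<bullet> x)\<^sup>2 / 2"
          using iexp_approx1[of "- (h \<bullet> x)" 1] by (simp add: numeral_2_eq_2)
        also have "\<dots> \<le> (h \<bullet> x)\<^sup>2" by simp
        finally show "norm (exp (\<i> * of_real (- (h \<bullet> x))) - (1 + \<i> * of_real (- (h \<bullet> x)))) \<le> (h \<bullet> x)\<^sup>2" .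
      qed simp
      also have "\<dots> \<le> norm (f x) * ((norm x)\<^sup>2 * (norm h)\<^sup>2)"
      proof (rule mult_left_mono)
        have "\<bar>h \<bullet> x\<bar>\<^sup>2 \<le> (norm h * norm x)\<^sup>2" by (rule power_mono[OF Cauchy_Schwarz_ineq2]) simp
        then show "(h \<bullet> x)\<^sup>2 \<le> (norm x)\<^sup>2 * (norm h)\<^sup>2" by (simp add: power_mult_distrib mult.commute)
      qed simp
      finally show "norm (f x * ?e (\<xi> + h) x - f x * ?e \<xi> x - f x * (?e \<xi> x * (- \<i> * of_real (h \<bullet> x))))
          \<le> norm (f x) * (norm x)\<^sup>2 * (norm h)\<^sup>2" by (simp add: mult.assoc)
    qed (use int i1 int3 in auto)
    also have "\<dots> = C * (norm h)\<^sup>2" by (simp add: C_def)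
    finally show ?thesis .
  qed
  show ?thesis
  proof (rule has_derivativeI_sandwich[of 1 _ _ _ _ "\<lambda>y. C * norm (y - \<xi>)"])
    show "bounded_linear ?D"
      by (intro bounded_linear_sum bounded_linear_mult_left[THEN bounded_linear_compose]
          bounded_linear_of_real[THEN bounded_linear_compose] bounded_linear_vec_nth)
    show "norm (fourier f y - fourier f \<xi> - ?D (y - \<xi>)) / norm (y - \<xi>) \<le> C * norm (y - \<xi>)"
      if "y \<noteq> \<xi>" for y
      using main[of "y - \<xi>"] that by (simp add: divide_le_eq power2_eq_square mult.assoc)
    have "((\<lambda>y. C * norm (y - \<xi>)) \<longlongrightarrow> C * norm (\<xi> - \<xi>)) (at \<xi>)"
      by (intro tendsto_intros)
    then show "((\<lambda>y. C * norm (y - \<xi>)) \<longlongrightarrow> 0) (at \<xi>)" by simp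
  qed simp
qed

lemma partial_fourier:
  assumes f: "f \<in> test_functions"
  shows "partial j (fourier f) = fourier (\<lambda>x. - \<i> * of_real (x $ j) * f x)"
proof
  fix \<xi>
  have "partial j (fourier f) \<xi> = (\<Sum>i\<in>UNIV. of_real (axis j 1 $ i) * fourier (\<lambda>x. - \<i> * of_real (x $ i) * f x) \<xi>)"
    by (rule partial_eqI[OF fourier_has_derivative[OF f]])
  also have "\<dots> = (\<Sum>i\<in>UNIV. if i = j then fourier (\<lambda>x. - \<i> * of_real (x $ i) * f x) \<xi> else 0)"
    by (rule sum.cong) (auto simp: axis_def)
  finally show "partial j (fourier f) \<xi> = fourier (\<lambda>x. - \<i> * of_real (x $ j) * f x) \<xi>" by simp
qed

text \<open>Differentiating a transform multiplies the test function by a coordinate, which leaves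
  it a test function; so the transforms of test functions form a family closed under
  differentiation.\<close>

lemma smooth_fourier: "f \<in> test_functions \<Longrightarrow> smooth (fourier f)"
proof (rule smooth_coinduct[of _ "fourier ` test_functions"])
  fix g :: "real^'a \<Rightarrow> complex" and x assume "g \<in> fourier ` test_functions"
  then show "g differentiable (at x)" using fourier_has_derivative differentiableI by blast
next
  fix g :: "real^'a \<Rightarrow> complex" and j assume "g \<in> fourier ` test_functions"
  then show "partial j g \<in> fourier ` test_functions"
    by (auto simp: partial_fourier intro!: imageI test_function_coord'[of _ "- \<i>", simplified])
qed simp

lemma fourier_bounded:
  fixes f :: "real^'n::finite \<Rightarrow> complex"
  assumes f: "f \<in> test_functions" obtains B where "B \<ge> 0" "\<And>\<xi>. norm (fourier f \<xi>) \<le> B"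
proof (rule that)
  let ?B = "norm (fourier_const TYPE('n)) * (\<integral>x. norm (f x) \<partial>lborel)"
  show "0 \<le> ?B" by simp
  show "norm (fourier f \<xi>) \<le> ?B" for \<xi>
  proof -
    have "norm (\<integral>x. f x * exp (- \<i> * of_real (\<xi> \<bullet> x)) \<partial>lborel) \<le> (\<integral>x. norm (f x * exp (- \<i> * of_real (\<xi> \<bullet> x))) \<partial>lborel)"
      by (rule integral_norm_bound)
    also have "\<dots> = (\<integral>x. norm (f x) \<partial>lborel)" by (simp add: norm_mult)
    finally show ?thesis
      by (subst fourier_lborel[OF test_function_measurable[OF f]]) (simp add: norm_mult mult_left_mono)
  qed
qed

lemma fourier_coord_power:
  assumes f: "f \<in> test_functions"
  obtains g where "g \<in> test_functions" "\<And>\<xi>. norm (fourier g \<xi>) = \<bar>\<xi> $ j\<bar> ^ k * norm (fourier f \<xi>)"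
proof -
  have "(partial j ^^ k) f \<in> test_functions \<and> (\<forall>\<xi>. norm (fourier ((partial j ^^ k) f) \<xi>) = \<bar>\<xi> $ j\<bar> ^ k * norm (fourier f \<xi>))"
    by (induction k) (auto simp: f test_function_partial fourier_partial norm_mult)
  then show thesis using that by blast
qed

text \<open>Pure derivatives in one direction suffice: the largest coordinate of \<xi> controls
  |\<xi>| up to the factor n, and the k-th derivative in that direction yields the factor
  |\<xi>_j|^k. Summing the bounds over all directions removes the dependence on j.\<close>

lemma fourier_decay:
  fixes f :: "real^'n::finite \<Rightarrow> complex"
  assumes f: "f \<in> test_functions"
  obtains C where "C \<ge> 0" "\<And>\<xi>. (1 + norm \<xi>) ^ k * norm (fourier f \<xi>) \<le> C"
proof -
  obtain B where B: "B \<ge> 0" "\<And>\<xi>. norm (fourier f \<xi>) \<le> B" using fourier_bounded f by blast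
  have "\<exists>Bj\<ge>0. \<forall>\<xi>. \<bar>\<xi> $ j\<bar> ^ k * norm (fourier f \<xi>) \<le> Bj" for j
    using fourier_coord_power[OF f, of j k] fourier_bounded by metis
  then obtain C where C: "\<And>j. C j \<ge> 0" "\<And>j \<xi>. \<bar>\<xi> $ j\<bar> ^ k * norm (fourier f \<xi>) \<le> C j" by metis
  show thesis
  proof (rule that)
    show "0 \<le> (1 + real CARD('n)) ^ k * (B + (\<Sum>j\<in>UNIV. C j))" using B C by (simp add: sum_nonneg)
    fix \<xi> :: "real^'n"
    obtain j where j: "\<And>i. \<bar>\<xi> $ i\<bar> \<le> \<bar>\<xi> $ j\<bar>"
    proof -
      let ?M = "Max (range (\<lambda>i. \<bar>\<xi> $ i\<bar>))"
      have "?M \<in> range (\<lambda>i. \<bar>\<xi> $ i\<bar>)" by (intro Max_in) auto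
      then obtain j where "?M = \<bar>\<xi> $ j\<bar>" by blast
      moreover have "\<bar>\<xi> $ i\<bar> \<le> ?M" for i by (intro Max_ge) auto
      ultimately have "\<bar>\<xi> $ i\<bar> \<le> \<bar>\<xi> $ j\<bar>" for i by simp
      then show thesis by (rule that)
    qed
    have "norm \<xi> \<le> (\<Sum>i\<in>UNIV. \<bar>\<xi> $ i\<bar>)" by (rule norm_le_l1_cart)
    also have "\<dots> \<le> real CARD('n) * \<bar>\<xi> $ j\<bar>" using sum_bounded_above[of UNIV "\<lambda>i. \<bar>\<xi> $ i\<bar>"] j by simp
    finally have n: "norm \<xi> \<le> real CARD('n) * \<bar>\<xi> $ j\<bar>" .
    have "1 + norm \<xi> \<le> (1 + real CARD('n)) * max 1 \<bar>\<xi> $ j\<bar>"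
    proof -
      have "real CARD('n) * \<bar>\<xi> $ j\<bar> \<le> real CARD('n) * max 1 \<bar>\<xi> $ j\<bar>" by (intro mult_left_mono) auto
      moreover have "1 \<le> max 1 \<bar>\<xi> $ j\<bar>" by simp
      ultimately show ?thesis using n unfolding distrib_right by linarith
    qed
    then have "(1 + norm \<xi>) ^ k \<le> ((1 + real CARD('n)) * max 1 \<bar>\<xi> $ j\<bar>) ^ k" by (rule power_mono) simp
    also have "\<dots> \<le> (1 + real CARD('n)) ^ k * (1 + \<bar>\<xi> $ j\<bar> ^ k)"
      unfolding power_mult_distrib by (intro mult_left_mono) (auto simp: max_def)
    finally have "(1 + norm \<xi>) ^ k * norm (fourier f \<xi>) \<le> (1 + real CARD('n)) ^ k * (1 + \<bar>\<xi> $ j\<bar> ^ k) * norm (fourier f \<xi>)"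
      by (rule mult_right_mono) simp
    also have "\<dots> = (1 + real CARD('n)) ^ k * (norm (fourier f \<xi>) + \<bar>\<xi> $ j\<bar> ^ k * norm (fourier f \<xi>))"
      by (simp add: algebra_simps)
    also have "\<dots> \<le> (1 + real CARD('n)) ^ k * (B + (\<Sum>j\<in>UNIV. C j))"
    proof (intro mult_left_mono add_mono B)
      have "C j \<le> (\<Sum>j\<in>UNIV. C j)" by (rule member_le_sum) (auto simp: C)
      then show "\<bar>\<xi> $ j\<bar> ^ k * norm (fourier f \<xi>) \<le> (\<Sum>j\<in>UNIV. C j)" using C(2)[of \<xi> j] by linarith
    qed simp
    finally show "(1 + norm \<xi>) ^ k * norm (fourier f \<xi>) \<le> (1 + real CARD('n)) ^ k * (B + (\<Sum>j\<in>UNIV. C j))" .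
  qed
qed

lemma partials_fourier: "f \<in> test_functions \<Longrightarrow> \<exists>g\<in>test_functions. partials js (fourier f) = fourier g"
proof (induction js)
  case (Cons j js)
  then obtain g where "g \<in> test_functions" "partials js (fourier f) = fourier g" by blast
  then show ?case using test_function_coord' partial_fourier by (metis partials_Cons)
qed auto

text \<open>The distributions of the definitions are meaningful on \<open>schwartz\<close> only.
  Their transforms are evaluated on test functions, and this lemma places the transformed test
  function where the distribution may be used.\<close>

lemma fourier_in_schwartz: "f \<in> test_functions \<Longrightarrow> fourier f \<in> schwartz"
proof -
  assume f: "f \<in> test_functions"
  have "bounded (range (\<lambda>x. (1 + norm x) ^ k * norm (partials js (fourier f) x)))" for js k
  proof -
    obtain g where g: "g \<in> test_functions" "partials js (fourier f) = fourier g"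
      using partials_fourier[OF f] by blast
    obtain C where "C \<ge> 0" "\<And>\<xi>. (1 + norm \<xi>) ^ k * norm (fourier g \<xi>) \<le> C" using fourier_decay[OF g(1)] by blast
    then show ?thesis unfolding g(2) by (intro boundedI[of _ C]) auto
  qed
  then show ?thesis using smooth_fourier[OF f] unfolding schwartz_def smooth_def by blast
qed

lemma fourier_measurable [measurable]: "f \<in> test_functions \<Longrightarrow> fourier f \<in> borel_measurable borel"
  by (intro borel_measurable_continuous_onI smooth_continuous smooth_fourier)

lemma fourier_integrable:
  fixes f :: "real^'n::finite \<Rightarrow> complex"
  assumes f: "f \<in> test_functions" shows "integrable lborel (fourier f)"
proof -
  obtain C where C: "C \<ge> 0" "\<And>\<xi>. (1 + norm \<xi>) ^ (2 * CARD('n)) * norm (fourier f \<xi>) \<le> C"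
    using fourier_decay[OF f] by blast
  show ?thesis
  proof (rule Bochner_Integration.integrable_bound)
    show "integrable lborel (\<lambda>x::real^'n. C * (1 / (1 + norm x) ^ (2 * CARD('n))))"
      by (intro integrable_mult_right integrable_rational_decay)
    show "AE x in lborel. norm (fourier f x) \<le> norm (C * (1 / (1 + norm x) ^ (2 * CARD('n))))"
    proof (rule AE_I2)
      fix x :: "real^'n"
      have "norm (fourier f x) \<le> C / (1 + norm x) ^ (2 * CARD('n))"
        using C(2)[of x] by (subst pos_le_divide_eq) (auto simp: mult.commute intro!: zero_less_power add_pos_nonneg)
      then show "norm (fourier f x) \<le> norm (C * (1 / (1 + norm x) ^ (2 * CARD('n))))"
        using C(1) by simp
    qed
  qed (use fourier_measurable[OF f] in simp)
qed

lemma fourier_translate: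
  assumes f: "f \<in> test_functions"
  shows "fourier (\<lambda>y. f (y + a)) x = exp (\<i> * of_real (x \<bullet> a)) * fourier f x"
proof -
  have [measurable]: "f \<in> borel_measurable borel" by (rule test_function_measurable[OF f])
  have "(\<integral>y. f (y + a) * exp (- \<i> * of_real (x \<bullet> y)) \<partial>lborel)
      = (\<integral>y. (\<lambda>z. exp (\<i> * of_real (x \<bullet> a)) * (f z * exp (- \<i> * of_real (x \<bullet> z)))) (y + a) \<partial>lborel)"
  proof (rule Bochner_Integration.integral_cong[OF refl])
    fix y
    have "exp (\<i> * of_real (x \<bullet> a)) * exp (- \<i> * of_real (x \<bullet> (y + a))) = exp (- \<i> * of_real (x \<bullet> y))"
      unfolding exp_add[symmetric] by (simp add: inner_add_right algebra_simps)
    then show "f (y + a) * exp (- \<i> * of_real (x \<bullet> y))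
      = exp (\<i> * of_real (x \<bullet> a)) * (f (y + a) * exp (- \<i> * of_real (x \<bullet> (y + a))))"
      by (simp only: mult.left_commute)
  qed
  also have "\<dots> = (\<integral>z. exp (\<i> * of_real (x \<bullet> a)) * (f z * exp (- \<i> * of_real (x \<bullet> z))) \<partial>lborel)"
    by (rule integral_translate) measurable
  finally show ?thesis by (simp add: fourier_lborel)
qed

section \<open>Gaussian smoothing, inversion and Plancherel\<close>

definition gauss_weight :: "real \<Rightarrow> real^'n::finite \<Rightarrow> real" where
  "gauss_weight \<delta> \<xi> = exp (- (\<delta> * norm \<xi>)\<^sup>2 / 2)"

text \<open>A probability density of width \<delta>. Up to powers of 2 pi it is the Fourier
  transform of \<open>gauss_weight \<delta>\<close>, and it tends to a point mass as \<delta> tends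
  to 0.\<close>

definition gauss_kernel :: "real \<Rightarrow> real^'n::finite \<Rightarrow> real" where
  "gauss_kernel \<delta> z = (\<Prod>i\<in>UNIV. normal_density 0 \<delta> (z $ i))"

lemma gauss_weight_measurable [measurable]: "gauss_weight \<delta> \<in> borel_measurable borel"
  unfolding gauss_weight_def by measurable

lemma gauss_kernel_measurable [measurable]: "gauss_kernel \<delta> \<in> borel_measurable borel"
  unfolding gauss_kernel_def by measurable

lemma gauss_kernel_nonneg: "gauss_kernel \<delta> z \<ge> 0"
  unfolding gauss_kernel_def by (intro prod_nonneg) simp

lemma gauss_weight_le_1: "gauss_weight \<delta> z \<le> 1"
  by (simp add: gauss_weight_def)

lemma gauss_weight_nonneg: "gauss_weight \<delta> z \<ge> 0"
  by (simp add: gauss_weight_def)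

lemma gauss_weight_integrable_1:
  assumes "\<delta> > 0" shows "integrable lborel (\<lambda>t::real. complex_of_real (exp (- (\<delta> * t)\<^sup>2 / 2)))"
proof -
  have "integrable lborel (\<lambda>s. sqrt (2 * pi) * std_normal_density s)"
    by (intro integrable_mult_right) simp
  from lborel_integrable_real_affine[OF this, of \<delta> 0]
  have "integrable lborel (\<lambda>t. sqrt (2 * pi) * std_normal_density (\<delta> * t))" using assms by simp
  then show ?thesis by (intro integrable_of_real) (simp add: std_normal_density_def)
qed

text \<open>The characteristic function of the standard normal distribution is known; the
  substitution s = \<delta> t carries it to width \<delta>.\<close>

lemma gauss_fourier_1:
  assumes \<delta>: "\<delta> > 0"
  shows "(\<integral>t. exp (\<i> * of_real (t * x)) * of_real (exp (- (\<delta> * t)\<^sup>2 / 2)) \<partial>lborel)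
    = complex_of_real (2 * pi * normal_density 0 \<delta> x)"
proof -
  have "complex_of_real (exp (- (x / \<delta>)\<^sup>2 / 2)) = (\<integral>s. std_normal_density s *\<^sub>R iexp (x / \<delta> * s) \<partial>lborel)"
    using fun_cong[OF char_std_normal_distribution, of "x / \<delta>"]
    unfolding char_def by (subst (asm) integral_density) auto
  also have "\<dots> = \<bar>\<delta>\<bar> *\<^sub>R (\<integral>t. std_normal_density (\<delta> * t) *\<^sub>R iexp (x / \<delta> * (\<delta> * t)) \<partial>lborel)"
    using \<delta> by (subst lborel_integral_real_affine[of \<delta> _ 0]) auto
  also have "\<dots> = (\<delta> / sqrt (2 * pi)) *\<^sub>R (\<integral>t. exp (\<i> * of_real (t * x)) * of_real (exp (- (\<delta> * t)\<^sup>2 / 2)) \<partial>lborel)"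
  proof -
    have "(\<lambda>t. std_normal_density (\<delta> * t) *\<^sub>R iexp (x / \<delta> * (\<delta> * t)))
      = (\<lambda>t. (1 / sqrt (2 * pi)) *\<^sub>R (exp (\<i> * of_real (t * x)) * of_real (exp (- (\<delta> * t)\<^sup>2 / 2))))"
      using \<delta> by (simp add: std_normal_density_def scaleR_conv_of_real mult_ac)
    then show ?thesis using \<delta> by simp
  qed
  finally have "(\<integral>t. exp (\<i> * of_real (t * x)) * of_real (exp (- (\<delta> * t)\<^sup>2 / 2)) \<partial>lborel)
      = (sqrt (2 * pi) / \<delta>) *\<^sub>R complex_of_real (exp (- (x / \<delta>)\<^sup>2 / 2))"
    using \<delta> by simp
  also have "\<dots> = complex_of_real (sqrt (2 * pi) / \<delta> * exp (- (x / \<delta>)\<^sup>2 / 2))"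
    by (simp add: scaleR_conv_of_real)
  also have "sqrt (2 * pi) / \<delta> * exp (- (x / \<delta>)\<^sup>2 / 2) = 2 * pi * normal_density 0 \<delta> x"
  proof -
    define s where "s = sqrt (2 * pi)"
    have s: "s > 0" "2 * pi = s * s" by (simp_all add: s_def)
    have "sqrt (2 * pi * \<delta>\<^sup>2) = s * \<delta>"
      using real_sqrt_mult[of "2 * pi" "\<delta>\<^sup>2"] \<delta> by (simp add: s_def)
    then have "2 * pi * normal_density 0 \<delta> x = s / \<delta> * exp (- (x - 0)\<^sup>2 / (2 * \<delta>\<^sup>2))"
      unfolding normal_density_def using s \<delta> by simp
    then show ?thesis by (simp add: s_def power_divide)
  qed
  finally show ?thesis .
qed

lemma gauss_weight_prod: "gauss_weight \<delta> \<xi> = (\<Prod>i\<in>UNIV. exp (- (\<delta> * \<xi> $ i)\<^sup>2 / 2))"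
proof -
  have "(norm \<xi>)\<^sup>2 = (\<Sum>i\<in>UNIV. (\<xi> $ i)\<^sup>2)"
    by (simp add: norm_vec_def L2_set_def sum_nonneg)
  then show ?thesis
    by (simp add: gauss_weight_def exp_sum[symmetric] power_mult_distrib sum_distrib_left sum_divide_distrib sum_negf)
qed

lemma gauss_weight_integrable:
  assumes "\<delta> > 0" shows "integrable lborel (\<lambda>\<xi>::real^'n::finite. complex_of_real (gauss_weight \<delta> \<xi>))"
  unfolding gauss_weight_prod of_real_prod
  by (intro integrable_prod_cart gauss_weight_integrable_1 assms)

text \<open>Both the exponential and the Gaussian factorise over the coordinates, so the integral is
  a product of n copies of the one-dimensional one.\<close>

lemma gauss_fourier:
  assumes \<delta>: "\<delta> > 0"
  shows "(\<integral>\<xi>. exp (\<i> * of_real (\<xi> \<bullet> z)) * of_real (gauss_weight \<delta> \<xi>) \<partial>(lborel :: (real^'n::finite) measure))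
    = complex_of_real ((2 * pi) ^ CARD('n) * gauss_kernel \<delta> z)"
proof -
  have "(\<integral>\<xi>. exp (\<i> * of_real (\<xi> \<bullet> z)) * of_real (gauss_weight \<delta> \<xi>) \<partial>(lborel :: (real^'n) measure))
    = (\<integral>\<xi>. (\<Prod>i\<in>UNIV. exp (\<i> * of_real (\<xi> $ i * z $ i)) * of_real (exp (- (\<delta> * \<xi> $ i)\<^sup>2 / 2))) \<partial>(lborel :: (real^'n) measure))"
  proof -
    have "exp (\<i> * of_real (\<xi> \<bullet> z)) = (\<Prod>i\<in>UNIV. exp (\<i> * of_real (\<xi> $ i * z $ i)))" for \<xi>
      by (simp add: inner_vec_def sum_distrib_left exp_sum)
    then show ?thesis by (simp only: gauss_weight_prod of_real_prod prod.distrib)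
  qed
  also have "\<dots> = (\<Prod>i\<in>UNIV. \<integral>t. exp (\<i> * of_real (t * z $ i)) * of_real (exp (- (\<delta> * t)\<^sup>2 / 2)) \<partial>lborel)"
  proof (rule integrable_prod_cart(2))
    fix i
    show "integrable lborel (\<lambda>t. exp (\<i> * of_real (t * z $ i)) * of_real (exp (- (\<delta> * t)\<^sup>2 / 2)))"
      by (rule Bochner_Integration.integrable_bound[OF gauss_weight_integrable_1[OF \<delta>]])
         (auto simp: norm_mult)
  qed
  finally show ?thesis
    unfolding gauss_fourier_1[OF \<delta>] gauss_kernel_def by (simp add: prod.distrib power_mult_distrib)
qed

lemma nn_integral_gauss_kernel:
  assumes "\<delta> > 0" shows "(\<integral>\<^sup>+z. ennreal (gauss_kernel \<delta> z) \<partial>(lborel :: (real^'n::finite) measure)) = 1"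
proof -
  have "(\<integral>\<^sup>+t. ennreal (normal_density 0 \<delta> t) \<partial>lborel) = 1"
    using assms by (subst nn_integral_eq_integral) auto
  then show ?thesis
    unfolding gauss_kernel_def
    using nn_integral_prod_cart[of "\<lambda>_::'n. \<lambda>t. ennreal (normal_density 0 \<delta> t)"]
    by (subst prod_ennreal[symmetric]) auto
qed

lemma gauss_kernel_integrable: "\<delta> > 0 \<Longrightarrow> integrable lborel (\<lambda>z::real^'n::finite. gauss_kernel \<delta> z)"
  by (rule integrableI_bounded) (auto simp: gauss_kernel_nonneg nn_integral_gauss_kernel)

lemma integral_gauss_kernel: "\<delta> > 0 \<Longrightarrow> (\<integral>z. gauss_kernel \<delta> z \<partial>(lborel :: (real^'n::finite) measure)) = 1"
  using nn_integral_gauss_kernel[of \<delta>, where 'n='n]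
  by (subst integral_eq_nn_integral) (auto simp: gauss_kernel_nonneg)

lemma fourier_const_square: "fourier_const TYPE('n) * (fourier_const TYPE('n::finite) * of_real ((2 * pi) ^ CARD('n))) = 1"
proof -
  have "(2 * pi) powr (- real CARD('n) / 2) * ((2 * pi) powr (- real CARD('n) / 2) * (2 * pi) ^ CARD('n))
    = (2 * pi) powr (- real CARD('n) / 2 + (- real CARD('n) / 2 + real CARD('n)))"
    unfolding powr_add by (simp add: powr_realpow)
  also have "\<dots> = 1" by simp
  finally show ?thesis unfolding of_real_mult[symmetric] by simp
qed

text \<open>The bounded factor \<open>u\<close> stands for a Fourier exponential; integrability over
  the product then follows from that of the two other factors, which licenses exchanges of Fourier
  integrals below.\<close>

lemma integrable_pair_bounded:
  fixes f :: "'a::euclidean_space \<Rightarrow> complex" and g :: "'b::euclidean_space \<Rightarrow> complex"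
  assumes f: "integrable lborel f" and g: "integrable lborel g"
    and u: "(\<lambda>(x, y). u x y) \<in> borel_measurable (borel \<Otimes>\<^sub>M borel)" "\<And>x y. norm (u x y) \<le> (1::real)"
  shows "integrable (lborel \<Otimes>\<^sub>M lborel) (\<lambda>(x, y). f x * g y * u x y)"
proof (rule integrableI_bounded)
  have [measurable]: "f \<in> borel_measurable borel" "g \<in> borel_measurable borel" using f g by auto
  note [measurable] = u(1)
  show "(\<lambda>(x, y). f x * g y * u x y) \<in> borel_measurable (lborel \<Otimes>\<^sub>M lborel)" by measurable
  have "(\<integral>\<^sup>+p. ennreal (norm (case p of (x, y) \<Rightarrow> f x * g y * u x y)) \<partial>(lborel \<Otimes>\<^sub>M lborel))
      \<le> (\<integral>\<^sup>+p. (case p of (x, y) \<Rightarrow> ennreal (norm (f x)) * ennreal (norm (g y))) \<partial>(lborel \<Otimes>\<^sub>M lborel))"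
    using u(2) by (intro nn_integral_mono) (auto simp: norm_mult ennreal_mult[symmetric] mult_left_le)
  also have "\<dots> = (\<integral>\<^sup>+x. \<integral>\<^sup>+y. ennreal (norm (f x)) * ennreal (norm (g y)) \<partial>lborel \<partial>lborel)"
    by (subst lborel.nn_integral_fst[symmetric]) auto
  also have "\<dots> = (\<integral>\<^sup>+x. ennreal (norm (f x)) \<partial>lborel) * (\<integral>\<^sup>+y. ennreal (norm (g y)) \<partial>lborel)"
    by (simp add: nn_integral_cmult nn_integral_multc)
  also have "\<dots> < \<infinity>"
    using f g unfolding integrable_iff_bounded by (simp add: ennreal_mult_less_top)
  finally show "(\<integral>\<^sup>+p. ennreal (norm (case p of (x, y) \<Rightarrow> f x * g y * u x y)) \<partial>(lborel \<Otimes>\<^sub>M lborel)) < \<infinity>" .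
qed

lemma Fubini_bounded:
  fixes f :: "'a::euclidean_space \<Rightarrow> complex" and g :: "'b::euclidean_space \<Rightarrow> complex"
  assumes "integrable lborel f" "integrable lborel g"
    and "(\<lambda>(x, y). u x y) \<in> borel_measurable (borel \<Otimes>\<^sub>M borel)" "\<And>x y. norm (u x y) \<le> (1::real)"
  shows "(\<integral>x. \<integral>y. f x * g y * u x y \<partial>lborel \<partial>lborel) = (\<integral>y. \<integral>x. f x * g y * u x y \<partial>lborel \<partial>lborel)"
  using lborel_pair.Fubini_integral[OF integrable_pair_bounded[OF assms]] by simp

text \<open>Holds also where the function is not integrable, because the Bochner integral then has
  the default value 0. Convolutions that diverge at exceptional points are thereby covered.\<close>

lemma norm_integral_le_nn_integral:
  fixes f :: "'a \<Rightarrow> 'b::{banach, second_countable_topology}"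
  shows "ennreal (norm (\<integral>x. f x \<partial>M)) \<le> (\<integral>\<^sup>+x. ennreal (norm (f x)) \<partial>M)"
  by (cases "integrable M f") (auto simp: integral_norm_bound_ennreal not_integrable_integral_eq)

lemma norm_exp_i [simp]: "norm (exp (- \<i> * complex_of_real t)) = 1" "norm (exp (- (\<i> * complex_of_real t))) = 1"
  by (simp_all add: norm_exp_eq_Re)

lemma fourier_norm_le:
  fixes f :: "real^'n::finite \<Rightarrow> complex"
  assumes f: "integrable lborel f"
  shows "norm (fourier f \<xi>) \<le> norm (fourier_const TYPE('n)) * (\<integral>x. norm (f x) \<partial>lborel)"
proof -
  have [measurable]: "f \<in> borel_measurable borel" using f by auto
  have "norm (\<integral>x. f x * exp (- \<i> * of_real (\<xi> \<bullet> x)) \<partial>lborel) \<le> (\<integral>x. norm (f x * exp (- \<i> * of_real (\<xi> \<bullet> x))) \<partial>lborel)"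
    by (rule integral_norm_bound)
  also have "\<dots> = (\<integral>x. norm (f x) \<partial>lborel)" by (simp add: norm_mult)
  finally show ?thesis by (subst fourier_lborel) (simp_all add: norm_mult mult_left_mono)
qed

lemma fourier_measurable_L1:
  fixes f :: "real^'n::finite \<Rightarrow> complex"
  assumes f[measurable]: "f \<in> borel_measurable borel"
  shows "fourier f \<in> borel_measurable borel"
proof -
  have "(\<lambda>\<xi>. \<integral>x. f x * exp (- \<i> * of_real (\<xi> \<bullet> x)) \<partial>lborel) \<in> borel_measurable borel"
    by (rule lborel.borel_measurable_lebesgue_integral) measurable
  then show ?thesis unfolding fourier_lborel[OF f, abs_def] by measurable
qed

text \<open>The Gaussian makes the double integral absolutely convergent for every integrable
  \<open>h\<close>, although the transform of \<open>h\<close> itself may fail to be integrable.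
  After Fubini the integral over \<xi> is \<open>gauss_fourier\<close>.\<close>

lemma gauss_smoothing:
  fixes h :: "real^'n::finite \<Rightarrow> complex"
  assumes \<delta>: "\<delta> > 0" and h: "integrable lborel h"
  shows "fourier_const TYPE('n) * (\<integral>\<xi>. gauss_weight \<delta> \<xi> * fourier h \<xi> * exp (\<i> * of_real (\<xi> \<bullet> y)) \<partial>lborel)
    = (\<integral>x. h x * gauss_kernel \<delta> (y - x) \<partial>lborel)"
proof -
  have [measurable]: "h \<in> borel_measurable borel" using h by auto
  have "(\<integral>\<xi>. gauss_weight \<delta> \<xi> * fourier h \<xi> * exp (\<i> * of_real (\<xi> \<bullet> y)) \<partial>lborel)
     = fourier_const TYPE('n) * (\<integral>\<xi>. \<integral>x. gauss_weight \<delta> \<xi> * h x * exp (\<i> * of_real (\<xi> \<bullet> (y - x))) \<partial>lborel \<partial>lborel)"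
  proof -
    have "gauss_weight \<delta> \<xi> * fourier h \<xi> * exp (\<i> * of_real (\<xi> \<bullet> y))
      = fourier_const TYPE('n) * (\<integral>x. gauss_weight \<delta> \<xi> * h x * exp (\<i> * of_real (\<xi> \<bullet> (y - x))) \<partial>lborel)" for \<xi>
    proof -
      have "(\<integral>x. gauss_weight \<delta> \<xi> * h x * exp (\<i> * of_real (\<xi> \<bullet> (y - x))) \<partial>lborel)
          = (\<integral>x. (gauss_weight \<delta> \<xi> * exp (\<i> * of_real (\<xi> \<bullet> y))) * (h x * exp (- \<i> * of_real (\<xi> \<bullet> x))) \<partial>lborel)"
        by (rule Bochner_Integration.integral_cong) (auto simp: inner_diff_right right_diff_distrib exp_diff exp_minus field_simps)
      also have "\<dots> = (gauss_weight \<delta> \<xi> * exp (\<i> * of_real (\<xi> \<bullet> y))) * (\<integral>x. h x * exp (- \<i> * of_real (\<xi> \<bullet> x)) \<partial>lborel)"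
        by simp
      finally show ?thesis by (subst fourier_lborel) (simp_all add: mult_ac)
    qed
    then show ?thesis by simp
  qed
  also have "(\<integral>\<xi>. \<integral>x. gauss_weight \<delta> \<xi> * h x * exp (\<i> * of_real (\<xi> \<bullet> (y - x))) \<partial>lborel \<partial>lborel)
      = (\<integral>x. \<integral>\<xi>. gauss_weight \<delta> \<xi> * h x * exp (\<i> * of_real (\<xi> \<bullet> (y - x))) \<partial>lborel \<partial>lborel)"
    by (rule Fubini_bounded[OF gauss_weight_integrable[OF \<delta>] h])
       (unfold borel_prod case_prod_beta', intro borel_measurable_continuous_onI continuous_intros, simp)
  also have "\<dots> = (\<integral>x. of_real ((2 * pi) ^ CARD('n)) * (h x * gauss_kernel \<delta> (y - x)) \<partial>lborel)"
  proof (rule Bochner_Integration.integral_cong[OF refl])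
    fix x
    have "(\<integral>\<xi>. gauss_weight \<delta> \<xi> * h x * exp (\<i> * of_real (\<xi> \<bullet> (y - x))) \<partial>lborel)
      = h x * (\<integral>\<xi>. exp (\<i> * of_real (\<xi> \<bullet> (y - x))) * gauss_weight \<delta> \<xi> \<partial>lborel)"
      by (subst integral_mult_right_zero[symmetric]) (simp only: mult_ac)
    then show "(\<integral>\<xi>. gauss_weight \<delta> \<xi> * h x * exp (\<i> * of_real (\<xi> \<bullet> (y - x))) \<partial>lborel)
      = of_real ((2 * pi) ^ CARD('n)) * (h x * gauss_kernel \<delta> (y - x))"
      by (simp add: gauss_fourier[OF \<delta>])
  qed
  also have "\<dots> = of_real ((2 * pi) ^ CARD('n)) * (\<integral>x. h x * gauss_kernel \<delta> (y - x) \<partial>lborel)" by simp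
  finally show ?thesis
    using fourier_const_square[where 'n='n] by (simp only: mult.assoc[symmetric]) simp
qed

lemma gauss_weight_tendsto: "(\<lambda>m. gauss_weight (1 / real (Suc m)) \<xi>) \<longlonglongrightarrow> 1"
proof -
  have "(\<lambda>m. exp (- (1 / real (Suc m) * norm \<xi>)\<^sup>2 / 2)) \<longlonglongrightarrow> exp (- (0 * norm \<xi>)\<^sup>2 / 2)"
    using LIMSEQ_inverse_real_of_nat
    by (intro tendsto_intros) (simp_all only: inverse_eq_divide)
  then show ?thesis by (simp add: gauss_weight_def)
qed

lemma gauss_kernel_scale:
  assumes "\<delta> > 0" shows "gauss_kernel \<delta> (\<delta> *\<^sub>R z) * \<delta> ^ CARD('n) = gauss_kernel 1 (z :: real^'n::finite)"
proof -
  have "normal_density 0 \<delta> (\<delta> * t) * \<delta> = normal_density 0 1 t" for t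
    using assms by (simp add: normal_density_def real_sqrt_mult power_mult_distrib)
  then show ?thesis unfolding gauss_kernel_def by (simp add: prod.distrib[symmetric] flip: prod_constant)
qed

text \<open>The substitution x = y - \<delta> z moves the scale from the kernel into the argument of
  \<open>f\<close>; the fixed Gaussian times the bound of \<open>f\<close> then dominates.\<close>

lemma gauss_approx:
  fixes f :: "real^'n::finite \<Rightarrow> complex"
  assumes f: "f \<in> test_functions"
  shows "(\<lambda>m. \<integral>x. f x * gauss_kernel (1 / real (Suc m)) (y - x) \<partial>lborel) \<longlonglongrightarrow> f y"
proof -
  have [measurable]: "f \<in> borel_measurable borel" by (rule test_function_measurable[OF f])
  obtain B where B: "B \<ge> 0" "\<And>x. norm (f x) \<le> B" using test_function_bounded f by blast
  have eq: "(\<integral>x. f x * gauss_kernel \<delta> (y - x) \<partial>lborel) = (\<integral>z. f (y - \<delta> *\<^sub>R z) * gauss_kernel 1 z \<partial>lborel)"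
    if \<delta>: "\<delta> > 0" for \<delta>
  proof -
    have "(\<integral>x. f x * gauss_kernel \<delta> (y - x) \<partial>lborel)
      = (\<integral>x. f x * gauss_kernel \<delta> (y - x) \<partial>(density (distr lborel borel (\<lambda>x. y + (- \<delta>) *\<^sub>R x)) (\<lambda>_. ennreal (\<bar>- \<delta>\<bar> ^ DIM(real^'n)))))"
      using \<delta> by (subst lborel_affine[of "- \<delta>" y]) simp_all
    also have "\<dots> = (\<integral>z. (\<bar>- \<delta>\<bar> ^ DIM(real^'n)) *\<^sub>R (f (y + (- \<delta>) *\<^sub>R z) * gauss_kernel \<delta> (y - (y + (- \<delta>) *\<^sub>R z))) \<partial>lborel)"
      by (subst integral_density) (auto simp: integral_distr)
    also have "\<dots> = (\<integral>z. f (y - \<delta> *\<^sub>R z) * gauss_kernel 1 z \<partial>lborel)"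
      unfolding gauss_kernel_scale[OF \<delta>, symmetric]
      using \<delta> by (simp add: scaleR_conv_of_real mult_ac)
    finally show ?thesis .
  qed
  have "(\<lambda>m. \<integral>z. f (y - (1 / real (Suc m)) *\<^sub>R z) * gauss_kernel 1 z \<partial>lborel) \<longlonglongrightarrow> (\<integral>z. f y * gauss_kernel 1 z \<partial>(lborel :: (real^'n) measure))"
  proof (rule integral_dominated_convergence[where w="\<lambda>z::real^'n. B * gauss_kernel 1 z"])
    show "AE z in lborel. (\<lambda>m. f (y - (1 / real (Suc m)) *\<^sub>R z) * gauss_kernel 1 z) \<longlonglongrightarrow> f y * gauss_kernel 1 z"
    proof (rule AE_I2, intro tendsto_mult tendsto_const)
      fix z
      have "isCont f y" using test_function_continuous[OF f, of UNIV] by (simp add: continuous_on_eq_continuous_at)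
      moreover have "(\<lambda>m. y - (1 / real (Suc m)) *\<^sub>R z) \<longlonglongrightarrow> y - 0 *\<^sub>R z"
        using LIMSEQ_inverse_real_of_nat by (intro tendsto_intros) (simp only: inverse_eq_divide)
      ultimately show "(\<lambda>m. f (y - (1 / real (Suc m)) *\<^sub>R z)) \<longlonglongrightarrow> f y"
        by (intro isCont_tendsto_compose[of _ f]) auto
    qed
    show "AE z in lborel. norm (f (y - (1 / real (Suc m)) *\<^sub>R z) * gauss_kernel 1 z) \<le> B * gauss_kernel 1 z" for m
      by (intro AE_I2) (simp add: norm_mult gauss_kernel_nonneg B mult_right_mono)
  qed (auto intro!: gauss_kernel_integrable integrable_mult_right)
  moreover have "(\<integral>z. f y * gauss_kernel 1 z \<partial>(lborel :: (real^'n) measure)) = f y"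
    using integral_gauss_kernel[of 1, where 'n='n] by (simp add: integral_complex_of_real)
  moreover have "1 / real (Suc m) > 0" for m by simp
  ultimately show ?thesis by (simp only: eq)
qed

text \<open>Both sides of \<open>gauss_smoothing\<close> converge as \<delta> tends to 0: the left
  because the transform is integrable and the weights increase to 1, the right by
  \<open>gauss_approx\<close>.\<close>

lemma fourier_inversion_test:
  fixes f :: "real^'n::finite \<Rightarrow> complex"
  assumes f: "f \<in> test_functions"
  shows "fourier_const TYPE('n) * (\<integral>\<xi>. fourier f \<xi> * exp (\<i> * of_real (\<xi> \<bullet> y)) \<partial>lborel) = f y"
proof (rule LIMSEQ_unique)
  have [measurable]: "fourier f \<in> borel_measurable borel" by (rule fourier_measurable[OF f])
  have int: "integrable lborel (\<lambda>\<xi>. norm (fourier f \<xi>))" using fourier_integrable[OF f] by (rule integrable_norm)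
  have pos: "1 / real (Suc m) > 0" for m by simp
  have "(\<lambda>m. fourier_const TYPE('n) * (\<integral>\<xi>. gauss_weight (1 / real (Suc m)) \<xi> * fourier f \<xi> * exp (\<i> * of_real (\<xi> \<bullet> y)) \<partial>lborel)) \<longlonglongrightarrow> f y"
    unfolding gauss_smoothing[OF pos test_function_integrable[OF f]] by (rule gauss_approx[OF f])
  then show "(\<lambda>m. fourier_const TYPE('n) * (\<integral>\<xi>. gauss_weight (1 / real (Suc m)) \<xi> * fourier f \<xi> * exp (\<i> * of_real (\<xi> \<bullet> y)) \<partial>lborel)) \<longlonglongrightarrow> f y" .
  show "(\<lambda>m. fourier_const TYPE('n) * (\<integral>\<xi>. gauss_weight (1 / real (Suc m)) \<xi> * fourier f \<xi> * exp (\<i> * of_real (\<xi> \<bullet> y)) \<partial>lborel))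
    \<longlonglongrightarrow> fourier_const TYPE('n) * (\<integral>\<xi>. fourier f \<xi> * exp (\<i> * of_real (\<xi> \<bullet> y)) \<partial>lborel)"
  proof (rule tendsto_mult_left, rule integral_dominated_convergence[OF _ _ int])
    show "AE \<xi> in lborel. (\<lambda>m. gauss_weight (1 / real (Suc m)) \<xi> * fourier f \<xi> * exp (\<i> * of_real (\<xi> \<bullet> y)))
      \<longlonglongrightarrow> fourier f \<xi> * exp (\<i> * of_real (\<xi> \<bullet> y))"
    proof (rule AE_I2)
      fix \<xi> :: "real^'n"
      have "(\<lambda>m. of_real (gauss_weight (1 / real (Suc m)) \<xi>) * fourier f \<xi> * exp (\<i> * of_real (\<xi> \<bullet> y)))
        \<longlonglongrightarrow> of_real 1 * fourier f \<xi> * exp (\<i> * of_real (\<xi> \<bullet> y))"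
        by (intro tendsto_intros gauss_weight_tendsto)
      then show "(\<lambda>m. gauss_weight (1 / real (Suc m)) \<xi> * fourier f \<xi> * exp (\<i> * of_real (\<xi> \<bullet> y)))
        \<longlonglongrightarrow> fourier f \<xi> * exp (\<i> * of_real (\<xi> \<bullet> y))" by simp
    qed
    show "AE \<xi> in lborel. norm (gauss_weight (1 / real (Suc m)) \<xi> * fourier f \<xi> * exp (\<i> * of_real (\<xi> \<bullet> y))) \<le> norm (fourier f \<xi>)" for m
      by (intro AE_I2) (simp add: norm_mult gauss_weight_nonneg gauss_weight_le_1 mult_left_le_one_le)
  qed auto
qed

lemma integrable_L1_loc:
  assumes "integrable lborel h" shows "h \<in> L1_loc"
  unfolding L1_loc_def set_integrable_def
  using assms by (auto intro!: integrable_mult_indicator integrable_completion[THEN iffD2] simp: compact_imp_closed)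

text \<open>Writing a test function by the inversion formula and exchanging integrals expresses its
  pairing with \<open>h\<close> through the vanishing integrals.\<close>

lemma fourier_injective_L1:
  fixes h :: "real^'n::finite \<Rightarrow> complex"
  assumes h: "integrable lborel h" and 0: "\<And>\<xi>. (\<integral>x. h x * exp (\<i> * of_real (\<xi> \<bullet> x)) \<partial>lborel) = 0"
  shows "AE x in lborel. h x = 0"
proof -
  have [measurable]: "h \<in> borel_measurable borel" using h by auto
  have "AE x in lebesgue. h x = 0"
  proof (rule L1_loc_eq_0[OF integrable_L1_loc[OF h]])
    fix f :: "real^'n \<Rightarrow> complex" assume f: "f \<in> test_functions"
    have [measurable]: "f \<in> borel_measurable borel" by (rule test_function_measurable[OF f])
    have "(\<integral>x. h x * f x \<partial>lebesgue) = (\<integral>x. h x * f x \<partial>lborel)" by (rule integral_completion) measurable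
    also have "\<dots> = (\<integral>x. fourier_const TYPE('n) * (\<integral>\<xi>. h x * fourier f \<xi> * exp (\<i> * of_real (\<xi> \<bullet> x)) \<partial>lborel) \<partial>lborel)"
      by (subst fourier_inversion_test[OF f, symmetric]) (simp add: mult_ac)
    also have "\<dots> = fourier_const TYPE('n) * (\<integral>x. \<integral>\<xi>. h x * fourier f \<xi> * exp (\<i> * of_real (\<xi> \<bullet> x)) \<partial>lborel \<partial>lborel)"
      by simp
    also have "\<dots> = fourier_const TYPE('n) * (\<integral>\<xi>. \<integral>x. h x * fourier f \<xi> * exp (\<i> * of_real (\<xi> \<bullet> x)) \<partial>lborel \<partial>lborel)"
      by (subst Fubini_bounded[OF h fourier_integrable[OF f]])
         (unfold borel_prod case_prod_beta', intro borel_measurable_continuous_onI continuous_intros, simp, simp)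
    also have "(\<lambda>\<xi>. \<integral>x. h x * fourier f \<xi> * exp (\<i> * of_real (\<xi> \<bullet> x)) \<partial>lborel)
       = (\<lambda>\<xi>. fourier f \<xi> * (\<integral>x. h x * exp (\<i> * of_real (\<xi> \<bullet> x)) \<partial>lborel))"
      by (subst integral_mult_right_zero[symmetric]) (simp only: mult_ac)
    finally show "(\<integral>x. h x * f x \<partial>lebesgue) = 0" by (simp add: 0)
  qed
  then show ?thesis by (simp only: AE_completion_iff)
qed

text \<open>The Gaussian smoothing identity and Fatou's lemma give this half of Plancherel's theorem
  without any density argument.\<close>

lemma plancherel_le:
  fixes h :: "real^'n::finite \<Rightarrow> complex"
  assumes h: "integrable lborel h"
  shows "(\<integral>\<^sup>+\<xi>. (ennreal (norm (fourier h \<xi>)))\<^sup>2 \<partial>lborel) \<le> (\<integral>\<^sup>+x. (ennreal (norm (h x)))\<^sup>2 \<partial>lborel)"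
proof -
  have hm[measurable]: "h \<in> borel_measurable borel" using h by auto
  have [measurable]: "fourier h \<in> borel_measurable borel" by (rule fourier_measurable_L1) simp
  define C where "C = norm (fourier_const TYPE('n)) * (\<integral>x. norm (h x) \<partial>lborel)"
  have C: "norm (fourier h \<xi>) \<le> C" for \<xi> unfolding C_def by (rule fourier_norm_le[OF h])
  have main: "(\<integral>\<^sup>+\<xi>. ennreal (gauss_weight \<delta> \<xi>) * (ennreal (norm (fourier h \<xi>)))\<^sup>2 \<partial>lborel)
      \<le> (\<integral>\<^sup>+x. (ennreal (norm (h x)))\<^sup>2 \<partial>lborel)" if \<delta>: "\<delta> > 0" for \<delta>
  proof -
    let ?g = "\<lambda>\<xi>::real^'n. complex_of_real (gauss_weight \<delta> \<xi>)"
    note gi = gauss_weight_integrable[OF \<delta>, where 'n='n]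
    have gfi: "integrable lborel (\<lambda>\<xi>. ?g \<xi> * fourier h \<xi>)"
    proof (rule Bochner_Integration.integrable_bound)
      show "integrable lborel (\<lambda>\<xi>. ?g \<xi> * of_real C)" by (rule integrable_mult_left[OF gi])
      have "C \<ge> 0" using C[of 0] norm_ge_zero order_trans by blast
      then show "AE \<xi> in lborel. norm (?g \<xi> * fourier h \<xi>) \<le> norm (?g \<xi> * of_real C)"
        using C by (intro AE_I2) (simp add: norm_mult gauss_weight_nonneg mult_left_mono)
    qed simp
    have gf2: "integrable lborel (\<lambda>\<xi>. gauss_weight \<delta> \<xi> * (norm (fourier h \<xi>))\<^sup>2)"
    proof (rule Bochner_Integration.integrable_bound)
      show "integrable lborel (\<lambda>\<xi>. ?g \<xi> * of_real (C\<^sup>2))" by (rule integrable_mult_left[OF gi])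
      show "AE \<xi> in lborel. norm (gauss_weight \<delta> \<xi> * (norm (fourier h \<xi>))\<^sup>2) \<le> norm (?g \<xi> * of_real (C\<^sup>2))"
        using C by (intro AE_I2) (simp add: norm_mult norm_power gauss_weight_nonneg mult_left_mono power_mono)
    qed simp
    have "complex_of_real (\<integral>\<xi>. gauss_weight \<delta> \<xi> * (norm (fourier h \<xi>))\<^sup>2 \<partial>lborel)
        = (\<integral>\<xi>. ?g \<xi> * fourier h \<xi> * cnj (fourier h \<xi>) \<partial>lborel)"
      unfolding integral_complex_of_real[symmetric] of_real_mult complex_norm_square mult.assoc ..
    also have "\<dots> = fourier_const TYPE('n) * (\<integral>\<xi>. \<integral>y. (?g \<xi> * fourier h \<xi>) * cnj (h y) * exp (\<i> * of_real (\<xi> \<bullet> y)) \<partial>lborel \<partial>lborel)"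
    proof -
      have cn: "cnj (fourier h \<xi>) = fourier_const TYPE('n) * (\<integral>y. cnj (h y) * exp (\<i> * of_real (\<xi> \<bullet> y)) \<partial>lborel)" for \<xi>
      proof -
        have "cnj (\<integral>y. h y * exp (- \<i> * of_real (\<xi> \<bullet> y)) \<partial>lborel) = (\<integral>y. cnj (h y * exp (- \<i> * of_real (\<xi> \<bullet> y))) \<partial>lborel)"
          by (rule Bochner_Integration.integral_cnj[symmetric])
        also have "\<dots> = (\<integral>y. cnj (h y) * exp (\<i> * of_real (\<xi> \<bullet> y)) \<partial>lborel)" by (simp add: exp_cnj)
        finally show ?thesis unfolding fourier_lborel[OF hm] by simp
      qed
      have "?g \<xi> * fourier h \<xi> * cnj (fourier h \<xi>)
          = fourier_const TYPE('n) * (\<integral>y. (?g \<xi> * fourier h \<xi>) * (cnj (h y) * exp (\<i> * of_real (\<xi> \<bullet> y))) \<partial>lborel)" for \<xi>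
        unfolding cn integral_mult_right_zero by (rule mult.left_commute)
      then show ?thesis by (simp only: integral_mult_right_zero mult.assoc)
    qed
    also have "\<dots> = fourier_const TYPE('n) * (\<integral>y. \<integral>\<xi>. (?g \<xi> * fourier h \<xi>) * cnj (h y) * exp (\<i> * of_real (\<xi> \<bullet> y)) \<partial>lborel \<partial>lborel)"
      using integrable_cnj[OF h] by (subst Fubini_bounded[OF gfi])
        (simp, unfold borel_prod case_prod_beta', intro borel_measurable_continuous_onI continuous_intros, simp, simp)
    also have "\<dots> = (\<integral>y. cnj (h y) * (fourier_const TYPE('n) * (\<integral>\<xi>. ?g \<xi> * fourier h \<xi> * exp (\<i> * of_real (\<xi> \<bullet> y)) \<partial>lborel)) \<partial>lborel)"
      by (simp only: integral_mult_right_zero[symmetric] mult_ac)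
    also have "\<dots> = (\<integral>y. cnj (h y) * (\<integral>x. h x * gauss_kernel \<delta> (y - x) \<partial>lborel) \<partial>lborel)"
      by (simp only: gauss_smoothing[OF \<delta> h])
    finally have eq: "complex_of_real (\<integral>\<xi>. gauss_weight \<delta> \<xi> * (norm (fourier h \<xi>))\<^sup>2 \<partial>lborel)
        = (\<integral>y. cnj (h y) * (\<integral>x. h x * gauss_kernel \<delta> (y - x) \<partial>lborel) \<partial>lborel)" .
    have "(\<integral>\<^sup>+\<xi>. ennreal (gauss_weight \<delta> \<xi>) * (ennreal (norm (fourier h \<xi>)))\<^sup>2 \<partial>lborel)
      = (\<integral>\<^sup>+\<xi>. ennreal (gauss_weight \<delta> \<xi> * (norm (fourier h \<xi>))\<^sup>2) \<partial>lborel)"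
      by (simp add: ennreal_mult gauss_weight_nonneg ennreal_power)
    also have "\<dots> = ennreal (\<integral>\<xi>. gauss_weight \<delta> \<xi> * (norm (fourier h \<xi>))\<^sup>2 \<partial>lborel)"
      by (rule nn_integral_eq_integral[OF gf2]) (simp add: gauss_weight_nonneg)
    also have "\<dots> \<le> ennreal (norm (\<integral>y. cnj (h y) * (\<integral>x. h x * gauss_kernel \<delta> (y - x) \<partial>lborel) \<partial>lborel))"
      unfolding eq[symmetric] norm_of_real by (rule ennreal_leI) simp
    also have "\<dots> \<le> (\<integral>\<^sup>+y. ennreal (norm (cnj (h y) * (\<integral>x. h x * gauss_kernel \<delta> (y - x) \<partial>lborel))) \<partial>lborel)"
      by (rule norm_integral_le_nn_integral) 
    also have "\<dots> \<le> (\<integral>\<^sup>+y. ennreal (norm (h y)) * (\<integral>\<^sup>+x. ennreal (norm (h x)) * ennreal (gauss_kernel \<delta> (y - x)) \<partial>lborel) \<partial>lborel)"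
    proof (rule nn_integral_mono)
      fix y
      have "ennreal (norm (\<integral>x. h x * gauss_kernel \<delta> (y - x) \<partial>lborel)) \<le> (\<integral>\<^sup>+x. ennreal (norm (h x * gauss_kernel \<delta> (y - x))) \<partial>lborel)"
        by (rule norm_integral_le_nn_integral)
      also have "\<dots> = (\<integral>\<^sup>+x. ennreal (norm (h x)) * ennreal (gauss_kernel \<delta> (y - x)) \<partial>lborel)"
        by (simp add: norm_mult ennreal_mult gauss_kernel_nonneg)
      finally show "ennreal (norm (cnj (h y) * (\<integral>x. h x * gauss_kernel \<delta> (y - x) \<partial>lborel)))
        \<le> ennreal (norm (h y)) * (\<integral>\<^sup>+x. ennreal (norm (h x)) * ennreal (gauss_kernel \<delta> (y - x)) \<partial>lborel)"
        by (simp add: norm_mult ennreal_mult mult_left_mono)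
    qed
    also have "\<dots> = (\<integral>\<^sup>+y. \<integral>\<^sup>+x. ennreal (norm (h y)) * ennreal (norm (h x)) * ennreal (gauss_kernel \<delta> (y - x)) \<partial>lborel \<partial>lborel)"
      by (subst nn_integral_cmult[symmetric]) (auto simp: mult.assoc)
    \<comment> \<open>From 2ab \<le> a^2 + b^2, shared out so that each square meets half of the
      kernel; the kernel has mass 1 in either variable, so the two halves add up to the squared L2
      norm.\<close>
    also have "\<dots> \<le> (\<integral>\<^sup>+y. \<integral>\<^sup>+x. (ennreal (norm (h y)))\<^sup>2 * ennreal (gauss_kernel \<delta> (y - x) / 2)
        + (ennreal (norm (h x)))\<^sup>2 * ennreal (gauss_kernel \<delta> (y - x) / 2) \<partial>lborel \<partial>lborel)"
    proof (intro nn_integral_mono)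
      fix x y
      have "norm (h y) * norm (h x) * gauss_kernel \<delta> (y - x) \<le> ((norm (h y))\<^sup>2 + (norm (h x))\<^sup>2) * (gauss_kernel \<delta> (y - x) / 2)"
        using mult_right_mono[OF sum_squares_bound[of "norm (h y)" "norm (h x)"], of "gauss_kernel \<delta> (y - x) / 2"] gauss_kernel_nonneg[of \<delta> "y - x"]
        by (simp add: field_simps)
      then show "ennreal (norm (h y)) * ennreal (norm (h x)) * ennreal (gauss_kernel \<delta> (y - x)) \<le>
        (ennreal (norm (h y)))\<^sup>2 * ennreal (gauss_kernel \<delta> (y - x) / 2) + (ennreal (norm (h x)))\<^sup>2 * ennreal (gauss_kernel \<delta> (y - x) / 2)"
        by (simp add: ennreal_mult[symmetric] ennreal_power ennreal_plus[symmetric] gauss_kernel_nonneg distrib_right ennreal_leI del: ennreal_plus)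
    qed
    also have "\<dots> = (\<integral>\<^sup>+y. \<integral>\<^sup>+x. (ennreal (norm (h y)))\<^sup>2 * ennreal (gauss_kernel \<delta> (y - x) / 2) \<partial>lborel \<partial>lborel)
        + (\<integral>\<^sup>+y. \<integral>\<^sup>+x. (ennreal (norm (h x)))\<^sup>2 * ennreal (gauss_kernel \<delta> (y - x) / 2) \<partial>lborel \<partial>lborel)"
      by (simp add: nn_integral_add)
    also have "(\<integral>\<^sup>+y. \<integral>\<^sup>+x. (ennreal (norm (h x)))\<^sup>2 * ennreal (gauss_kernel \<delta> (y - x) / 2) \<partial>lborel \<partial>lborel)
        = (\<integral>\<^sup>+x. \<integral>\<^sup>+y. (ennreal (norm (h x)))\<^sup>2 * ennreal (gauss_kernel \<delta> (y - x) / 2) \<partial>lborel \<partial>lborel)"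
      by (rule lborel_pair.Fubini') measurable
    also have "\<dots> = (\<integral>\<^sup>+x. (ennreal (norm (h x)))\<^sup>2 * ennreal (1 / 2) \<partial>lborel)"
    proof (rule nn_integral_cong)
      fix x :: "real^'n"
      have "(\<integral>\<^sup>+y. ennreal (gauss_kernel \<delta> (y - x) / 2) \<partial>lborel) = (\<integral>\<^sup>+y. ennreal (gauss_kernel \<delta> (y + (- x))) * ennreal (1 / 2) \<partial>lborel)"
        by (rule nn_integral_cong) (subst ennreal_mult[symmetric], auto simp: gauss_kernel_nonneg)
      also have "\<dots> = (\<integral>\<^sup>+y. ennreal (gauss_kernel \<delta> y) * ennreal (1 / 2) \<partial>(lborel :: (real^'n) measure))"
        by (rule nn_integral_translate[where f="\<lambda>y::real^'n. ennreal (gauss_kernel \<delta> y) * ennreal (1 / 2)"]) measurable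
      also have "\<dots> = ennreal (1 / 2)" by (simp add: nn_integral_multc nn_integral_gauss_kernel[OF \<delta>])
      finally show "(\<integral>\<^sup>+y. (ennreal (norm (h x)))\<^sup>2 * ennreal (gauss_kernel \<delta> (y - x) / 2) \<partial>lborel) = (ennreal (norm (h x)))\<^sup>2 * ennreal (1 / 2)"
        by (simp add: nn_integral_cmult)
    qed
    also have "(\<integral>\<^sup>+y. \<integral>\<^sup>+x. (ennreal (norm (h y)))\<^sup>2 * ennreal (gauss_kernel \<delta> (y - x) / 2) \<partial>lborel \<partial>lborel)
      = (\<integral>\<^sup>+y. (ennreal (norm (h y)))\<^sup>2 * ennreal (1 / 2) \<partial>lborel)"
    proof (rule nn_integral_cong)
      fix y :: "real^'n"
      have "(\<integral>\<^sup>+x. ennreal (gauss_kernel \<delta> (y - x) / 2) \<partial>lborel) = (\<integral>\<^sup>+x. ennreal (gauss_kernel \<delta> (y - x)) * ennreal (1 / 2) \<partial>lborel)"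
        by (rule nn_integral_cong) (subst ennreal_mult[symmetric], auto simp: gauss_kernel_nonneg)
      also have "\<dots> = (\<integral>\<^sup>+y. ennreal (gauss_kernel \<delta> y) * ennreal (1 / 2) \<partial>(lborel :: (real^'n) measure))"
        by (rule nn_integral_reflect[where f="\<lambda>y::real^'n. ennreal (gauss_kernel \<delta> y) * ennreal (1 / 2)"]) measurable
      also have "\<dots> = ennreal (1 / 2)" by (simp add: nn_integral_multc nn_integral_gauss_kernel[OF \<delta>])
      finally show "(\<integral>\<^sup>+x. (ennreal (norm (h y)))\<^sup>2 * ennreal (gauss_kernel \<delta> (y - x) / 2) \<partial>lborel) = (ennreal (norm (h y)))\<^sup>2 * ennreal (1 / 2)"
        by (simp add: nn_integral_cmult)
    qed
    also have "(\<integral>\<^sup>+y. (ennreal (norm (h y)))\<^sup>2 * ennreal (1 / 2) \<partial>lborel) + (\<integral>\<^sup>+x. (ennreal (norm (h x)))\<^sup>2 * ennreal (1 / 2) \<partial>lborel)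
      = (\<integral>\<^sup>+x. (ennreal (norm (h x)))\<^sup>2 \<partial>lborel)"
    proof -
      have "ennreal (1 / 2) + ennreal (1 / 2) = ennreal 1" by (subst ennreal_plus[symmetric]) simp_all
      then have "a * ennreal (1 / 2) + a * ennreal (1 / 2) = a" for a
        by (simp only: distrib_left[symmetric]) simp
      then show ?thesis by (subst nn_integral_add[symmetric]) simp_all
    qed
    finally show ?thesis .
  qed
  have "(\<integral>\<^sup>+\<xi>. (ennreal (norm (fourier h \<xi>)))\<^sup>2 \<partial>lborel)
    = (\<integral>\<^sup>+\<xi>. liminf (\<lambda>m. ennreal (gauss_weight (1 / real (Suc m)) \<xi>) * (ennreal (norm (fourier h \<xi>)))\<^sup>2) \<partial>lborel)"
  proof (rule nn_integral_cong)
    fix \<xi> :: "real^'n"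
    have "(\<lambda>m. ennreal (gauss_weight (1 / real (Suc m)) \<xi> * (norm (fourier h \<xi>))\<^sup>2)) \<longlonglongrightarrow> ennreal (1 * (norm (fourier h \<xi>))\<^sup>2)"
      by (intro tendsto_ennrealI tendsto_intros gauss_weight_tendsto)
    then have "(\<lambda>m. ennreal (gauss_weight (1 / real (Suc m)) \<xi>) * (ennreal (norm (fourier h \<xi>)))\<^sup>2) \<longlonglongrightarrow> (ennreal (norm (fourier h \<xi>)))\<^sup>2"
      by (simp add: ennreal_mult gauss_weight_nonneg ennreal_power)
    then show "(ennreal (norm (fourier h \<xi>)))\<^sup>2 = liminf (\<lambda>m. ennreal (gauss_weight (1 / real (Suc m)) \<xi>) * (ennreal (norm (fourier h \<xi>)))\<^sup>2)"
      by (simp add: lim_imp_Liminf)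
  qed
  also have "\<dots> \<le> liminf (\<lambda>m. \<integral>\<^sup>+\<xi>. ennreal (gauss_weight (1 / real (Suc m)) \<xi>) * (ennreal (norm (fourier h \<xi>)))\<^sup>2 \<partial>lborel)"
    by (rule nn_integral_liminf) measurable
  also have "\<dots> \<le> liminf (\<lambda>m::nat. \<integral>\<^sup>+x. (ennreal (norm (h x)))\<^sup>2 \<partial>lborel)"
    by (intro Liminf_mono always_eventually allI main) simp
  also have "\<dots> = (\<integral>\<^sup>+x. (ennreal (norm (h x)))\<^sup>2 \<partial>lborel)" by (simp add: Liminf_const)
  finally show ?thesis .
qed

section \<open>Injectivity of the Fourier transform\<close>

lemma flat_fun_1_pos: "t > 0 \<Longrightarrow> flat_fun 1 t > 0"
  by (simp add: flat_fun_1)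

lemma flat_fun_1_nonneg: "flat_fun 1 t \<ge> 0"
  by (simp add: flat_fun_1)

text \<open>On the cube of half side \<delta> the l1 norm is at most n \<delta> = 1 / m, so |x.y| <
  1 < pi / 2 and the cosine is positive. The real part of the transform is thus, up to a positive
  constant, the integral of a nonnegative function that is positive on an open box.\<close>

lemma fourier_bump_nonzero:
  fixes x :: "real^'n::finite"
  assumes m: "norm x < real m"
  defines "\<delta> \<equiv> 1 / (real m * real CARD('n))"
  shows "fourier (bump 1 (\<chi> i. - \<delta>) (\<chi> i. \<delta>)) x \<noteq> 0"
proof
  let ?a = "(\<chi> i. - \<delta>) :: real^'n" and ?b = "(\<chi> i. \<delta>) :: real^'n"
  let ?f = "bump 1 ?a ?b"
  define r where "r = (\<lambda>x::real^'n. \<Prod>i\<in>UNIV. flat_fun 1 (1 * (x $ i - ?a $ i)) * flat_fun 1 (1 * (?b $ i - x $ i)))"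
  have fr: "?f = (\<lambda>x. of_real (r x))" unfolding r_def by (rule ext, rule bump_of_real)
  have t: "?f \<in> test_functions" by (rule test_function_bump) simp
  have m0: "real m > 0" using m by (meson norm_ge_zero le_less_trans)
  have \<delta>: "\<delta> > 0" using m0 by (simp add: \<delta>_def)
  have r0: "r y \<ge> 0" for y unfolding r_def by (intro prod_nonneg) (simp add: flat_fun_1_nonneg)
  have rpos: "r y > 0" if "y \<in> box ?a ?b" for y
    unfolding r_def
  proof (rule prod_pos)
    fix i
    have "- \<delta> < y $ i" "y $ i < \<delta>" using that by (auto simp: mem_box_cart)
    then show "0 < flat_fun 1 (1 * (y $ i - ?a $ i)) * flat_fun 1 (1 * (?b $ i - y $ i))"
      by (intro mult_pos_pos flat_fun_1_pos) simp_all
  qed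
  have rout: "r y = 0" if "y \<notin> box ?a ?b" for y
    using bump_outside[of 1 y ?a ?b] that unfolding fr by simp
  have cpos: "cos (x \<bullet> y) > 0" if "y \<in> box ?a ?b" for y
  proof -
    have "\<bar>x \<bullet> y\<bar> \<le> norm x * norm y" by (rule Cauchy_Schwarz_ineq2)
    moreover have "norm y \<le> 1 / real m"
    proof -
      have "norm y \<le> (\<Sum>i\<in>UNIV. \<bar>y $ i\<bar>)" by (rule norm_le_l1_cart)
      also have "\<dots> \<le> (\<Sum>i\<in>(UNIV::'n set). \<delta>)"
      proof (rule sum_mono)
        fix i
        have "- \<delta> < y $ i" "y $ i < \<delta>" using that by (auto simp: mem_box_cart)
        then show "\<bar>y $ i\<bar> \<le> \<delta>" by linarith
      qed
      also have "\<dots> = 1 / real m" by (simp add: \<delta>_def)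
      finally show ?thesis .
    qed
    then have "norm x * norm y \<le> norm x * (1 / real m)" by (rule mult_left_mono) simp
    moreover have "norm x * (1 / real m) < 1" using m m0 by (simp add: divide_less_eq)
    moreover have "1 < pi / 2" using pi_gt3 by simp
    ultimately have "- (pi / 2) < x \<bullet> y" "x \<bullet> y < pi / 2" by linarith+
    then show ?thesis by (rule cos_gt_zero_pi)
  qed
  have int: "integrable lborel (\<lambda>y. ?f y * exp (- \<i> * of_real (x \<bullet> y)))"
    by (intro test_function_mult_integrable t continuous_intros)
  have Re: "(\<lambda>y. Re (?f y * exp (- \<i> * of_real (x \<bullet> y)))) = (\<lambda>y. r y * cos (x \<bullet> y))"
    unfolding fr by (simp add: Re_exp)
  assume "fourier ?f x = 0"
  then have "(\<integral>y. ?f y * exp (- \<i> * of_real (x \<bullet> y)) \<partial>lborel) = 0"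
    unfolding fourier_lborel[OF test_function_measurable[OF t]] by simp
  then have "(\<integral>y. r y * cos (x \<bullet> y) \<partial>lborel) = 0"
    using integral_Re[OF int] unfolding Re by simp
  moreover have "integrable lborel (\<lambda>y. r y * cos (x \<bullet> y))"
    using integrable_Re[OF int] unfolding Re .
  moreover have "r y * cos (x \<bullet> y) \<ge> 0" for y
    using r0[of y] cpos[of y] rout[of y] by (cases "y \<in> box ?a ?b") auto
  ultimately have "AE y in lborel. r y * cos (x \<bullet> y) = 0"
    using integral_nonneg_eq_0_iff_AE[of lborel "\<lambda>y. r y * cos (x \<bullet> y)"] by simp
  then have "AE y in lborel. y \<notin> box ?a ?b"
  proof eventually_elim
    case (elim y)
    then show ?case using rpos[of y] cpos[of y] by auto
  qed
  then have "box ?a ?b \<in> null_sets lborel" by (subst AE_iff_null_sets) auto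
  moreover have "0 \<in> box ?a ?b" using \<delta> by (simp add: mem_box_cart)
  ultimately show False
    using open_not_negligible[OF open_box, of ?a ?b] negligible_iff_null_sets null_sets_completionI by blast
qed

text \<open>Translating \<psi> multiplies its transform by a character, so the hypothesis says that
  the integrable function \<open>f x * fourier \<psi> x\<close> has zero Fourier transform. The
  factor \<open>fourier \<psi>\<close> is then divided out with bumps whose transforms have no zero
  in the open ball of radius m.\<close>

lemma AE_zero_of_fourier_test:
  fixes f :: "real^'n::finite \<Rightarrow> complex"
  assumes f: "f \<in> borel_measurable lebesgue"
    and int: "\<And>\<psi>. \<psi> \<in> test_functions \<Longrightarrow> integrable lebesgue (\<lambda>x. f x * fourier \<psi> x)"
    and 0: "\<And>\<psi>. \<psi> \<in> test_functions \<Longrightarrow> (\<integral>x. f x * fourier \<psi> x \<partial>lebesgue) = 0"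
  shows "AE x in lebesgue. f x = 0"
proof -
  obtain f' where f'[measurable]: "f' \<in> borel_measurable lborel" and eq: "AE x in lborel. f x = f' x"
    using completion_ex_borel_measurable_complex[OF f] by blast
  have eq': "AE x in lebesgue. f x = f' x" using eq by (rule AE_completion)
  have *: "integrable lborel (\<lambda>x. f' x * fourier \<psi> x) \<and> (\<integral>x. f' x * fourier \<psi> x \<partial>lborel) = 0"
    if \<psi>: "\<psi> \<in> test_functions" for \<psi>
  proof -
    have m: "(\<lambda>x. f' x * fourier \<psi> x) \<in> borel_measurable lborel"
      using fourier_measurable[OF \<psi>] f' by simp
    have ae: "AE x in lebesgue. f x * fourier \<psi> x = f' x * fourier \<psi> x"
      using eq' by eventually_elim simp
    have "integrable lebesgue (\<lambda>x. f' x * fourier \<psi> x)"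
      by (rule integrable_cong_AE_imp[OF int[OF \<psi>] measurable_completion[OF m]])
         (use ae in eventually_elim, simp)
    moreover have "(\<integral>x. f' x * fourier \<psi> x \<partial>lebesgue) = 0"
      using 0[OF \<psi>] integral_cong_AE[OF borel_measurable_integrable[OF int[OF \<psi>]] measurable_completion[OF m] ae] by simp
    ultimately show ?thesis using m by (simp add: integrable_completion integral_completion)
  qed
  have zero: "AE x in lborel. f' x * fourier \<psi> x = 0" if \<psi>: "\<psi> \<in> test_functions" for \<psi>
  proof (rule fourier_injective_L1)
    show "integrable lborel (\<lambda>x. f' x * fourier \<psi> x)" using * \<psi> by blast
    fix \<xi>
    have "0 = (\<integral>x. f' x * fourier (\<lambda>y. \<psi> (y + \<xi>)) x \<partial>lborel)" using *[OF test_function_translate[OF \<psi>, of \<xi>]] by simp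
    also have "\<dots> = (\<integral>x. f' x * fourier \<psi> x * exp (\<i> * of_real (\<xi> \<bullet> x)) \<partial>lborel)"
      by (simp add: fourier_translate[OF \<psi>] inner_commute mult_ac)
    finally show "(\<integral>x. f' x * fourier \<psi> x * exp (\<i> * of_real (\<xi> \<bullet> x)) \<partial>lborel) = 0" by simp
  qed
  define \<psi> where "\<psi> m = bump 1 (\<chi> i. - (1 / (real m * real CARD('n)))) (\<chi> i. 1 / (real m * real CARD('n)) :: real^'n)" for m
  have "AE x in lborel. \<forall>m. f' x * fourier (\<psi> m) x = 0"
    unfolding AE_all_countable by (intro allI zero) (simp add: \<psi>_def test_function_bump)
  then have "AE x in lborel. f' x = 0"
  proof eventually_elim
    case (elim x)
    obtain m where "norm x < real m" using reals_Archimedean2 by blast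
    from fourier_bump_nonzero[OF this] elim[rule_format, of m] show ?case by (simp add: \<psi>_def)
  qed
  then have "AE x in lebesgue. f' x = 0" by (rule AE_completion)
  with eq' show ?thesis by eventually_elim simp
qed

section \<open>Fourier transforms of products\<close>

text \<open>What the product formula asks of a transform: local integrability, and square
  integrability beyond frequency 1, so that the inverse transform is a bounded function plus a
  square integrable one. The pairing is stated on transforms of test functions, where both integrals
  converge absolutely.\<close>

definition fourier_pair :: "(real^'n::finite \<Rightarrow> complex) \<Rightarrow> (real^'n \<Rightarrow> complex) \<Rightarrow> bool" where
  "fourier_pair f b \<longleftrightarrow> b \<in> borel_measurable borel \<and>
     (\<forall>r. integrable lborel (\<lambda>\<xi>. indicator (cball 0 r) \<xi> *\<^sub>R b \<xi>)) \<and>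
     (\<integral>\<^sup>+\<xi>. indicator {\<xi>. 1 < norm \<xi>} \<xi> * (ennreal (norm (b \<xi>)))\<^sup>2 \<partial>lborel) < \<infinity> \<and>
     f \<in> borel_measurable lebesgue \<and>
     (\<forall>\<psi>\<in>test_functions. integrable lebesgue (\<lambda>x. f x * fourier \<psi> x) \<and>
        (\<integral>x. f x * fourier \<psi> x \<partial>lebesgue) = (\<integral>\<xi>. b \<xi> * \<psi> \<xi> \<partial>lborel))"

section \<open>Recovering a function from its frequency truncations\<close>

lemma inv_fourier_eq_fourier: "inv_fourier h x = fourier h (- x)"
  by (simp add: inv_fourier_def fourier_def)

lemma inv_fourier_measurable:
  fixes h :: "real^'n::finite \<Rightarrow> complex"
  assumes h: "h \<in> borel_measurable borel"
  shows "inv_fourier h \<in> borel_measurable borel"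
  unfolding inv_fourier_eq_fourier[abs_def] using fourier_measurable_L1[OF h] by measurable

lemma plancherel_le_inv:
  fixes h :: "real^'n::finite \<Rightarrow> complex"
  assumes h: "integrable lborel h"
  shows "(\<integral>\<^sup>+x. (ennreal (norm (inv_fourier h x)))\<^sup>2 \<partial>lborel) \<le> (\<integral>\<^sup>+\<xi>. (ennreal (norm (h \<xi>)))\<^sup>2 \<partial>lborel)"
proof -
  have [measurable]: "fourier h \<in> borel_measurable borel" using h by (intro fourier_measurable_L1) auto
  have "(\<integral>\<^sup>+x. (ennreal (norm (inv_fourier h x)))\<^sup>2 \<partial>lborel)
      = (\<integral>\<^sup>+x. (\<lambda>y. (ennreal (norm (fourier h y)))\<^sup>2) (0 - x) \<partial>lborel)"
    by (simp add: inv_fourier_eq_fourier)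
  also have "\<dots> = (\<integral>\<^sup>+x. (ennreal (norm (fourier h x)))\<^sup>2 \<partial>lborel)"
    by (rule nn_integral_reflect) measurable
  finally show ?thesis using plancherel_le[OF h] by simp
qed

text \<open>The Fourier exponential is symmetric in its two variables, so Fubini moves the inverse
  transform from one factor to the other.\<close>

lemma integral_inv_fourier_mult:
  fixes h k :: "real^'n::finite \<Rightarrow> complex"
  assumes h: "integrable lborel h" and k: "integrable lborel k"
  shows "(\<integral>x. inv_fourier h x * k x \<partial>lborel) = (\<integral>\<xi>. h \<xi> * inv_fourier k \<xi> \<partial>lborel)"
proof -
  have hm: "h \<in> borel_measurable borel" and km: "k \<in> borel_measurable borel" using h k by auto
  let ?c = "fourier_const TYPE('n)" and ?e = "\<lambda>x \<xi>::real^'n. exp (\<i> * of_real (x \<bullet> \<xi>))"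
  have "(\<integral>x. inv_fourier h x * k x \<partial>lborel) = (\<integral>x. ?c * (\<integral>\<xi>. k x * h \<xi> * ?e x \<xi> \<partial>lborel) \<partial>lborel)"
  proof (rule Bochner_Integration.integral_cong[OF refl])
    fix x :: "real^'n"
    have "(\<integral>\<xi>. k x * h \<xi> * ?e x \<xi> \<partial>lborel) = k x * (\<integral>\<xi>. h \<xi> * ?e x \<xi> \<partial>lborel)"
      by (simp only: mult.assoc integral_mult_right_zero)
    then show "inv_fourier h x * k x = ?c * (\<integral>\<xi>. k x * h \<xi> * ?e x \<xi> \<partial>lborel)"
      by (simp add: inv_fourier_lborel[OF hm])
  qed
  also have "\<dots> = ?c * (\<integral>x. \<integral>\<xi>. k x * h \<xi> * ?e x \<xi> \<partial>lborel \<partial>lborel)" by simp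
  also have "\<dots> = ?c * (\<integral>\<xi>. \<integral>x. k x * h \<xi> * ?e x \<xi> \<partial>lborel \<partial>lborel)"
    by (subst Fubini_bounded[OF k h])
       (unfold borel_prod case_prod_beta', intro borel_measurable_continuous_onI continuous_intros, simp, simp)
  also have "\<dots> = (\<integral>\<xi>. ?c * (\<integral>x. k x * h \<xi> * ?e x \<xi> \<partial>lborel) \<partial>lborel)" by simp
  also have "\<dots> = (\<integral>\<xi>. h \<xi> * inv_fourier k \<xi> \<partial>lborel)"
  proof (rule Bochner_Integration.integral_cong[OF refl])
    fix \<xi> :: "real^'n"
    have "(\<integral>x. k x * h \<xi> * ?e x \<xi> \<partial>lborel) = (\<integral>x. h \<xi> * (k x * ?e \<xi> x) \<partial>lborel)"
      by (rule Bochner_Integration.integral_cong) (auto simp: inner_commute mult_ac)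
    also have "\<dots> = h \<xi> * (\<integral>x. k x * ?e \<xi> x \<partial>lborel)" by simp
    finally show "?c * (\<integral>x. k x * h \<xi> * ?e x \<xi> \<partial>lborel) = h \<xi> * inv_fourier k \<xi>"
      by (simp add: inv_fourier_lborel[OF km])
  qed
  finally show ?thesis .
qed

definition freq_cut :: "real \<Rightarrow> (real^'n::finite \<Rightarrow> complex) \<Rightarrow> real^'n \<Rightarrow> complex" where
  "freq_cut M b = (\<lambda>\<xi>. indicator (cball 0 M) \<xi> *\<^sub>R b \<xi>)"

text \<open>Take Q^2 to be the sum of 4^k |d_k|^2. Its integral is at most the sum of C 4^k / 16^k,
  a convergent geometric series, and each single term of the sum gives |d_k| \<le> Q / 2^k. The sum
  may be infinite on a null set, where \<open>enn2real\<close> makes \<open>Q\<close> zero.\<close>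

lemma L2_series_bound:
  fixes d :: "nat \<Rightarrow> 'a \<Rightarrow> complex"
  assumes [measurable]: "\<And>k. d k \<in> borel_measurable M"
    and bound: "\<And>k. (\<integral>\<^sup>+x. (ennreal (norm (d k x)))\<^sup>2 \<partial>M) \<le> ennreal (C * (1 / 16) ^ k)" and C: "C \<ge> 0"
  obtains Q where "Q \<in> borel_measurable M" "\<And>x. Q x \<ge> (0::real)"
    "(\<integral>\<^sup>+x. (ennreal (Q x))\<^sup>2 \<partial>M) < \<infinity>"
    "AE x in M. \<forall>k. norm (d k x) \<le> Q x * (1 / 2) ^ k"
proof -
  define S where "S x = (\<Sum>k. ennreal (4 ^ k * (norm (d k x))\<^sup>2))" for x
  have [measurable]: "S \<in> borel_measurable M" unfolding S_def by measurable
  have "(\<integral>\<^sup>+x. S x \<partial>M) = (\<Sum>k. \<integral>\<^sup>+x. ennreal (4 ^ k * (norm (d k x))\<^sup>2) \<partial>M)"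
    unfolding S_def by (rule nn_integral_suminf) measurable
  also have "\<dots> \<le> (\<Sum>k. ennreal (C * (1 / 4) ^ k))"
  proof (rule suminf_le)
    fix k
    have "(\<integral>\<^sup>+x. ennreal (4 ^ k * (norm (d k x))\<^sup>2) \<partial>M) = ennreal (4 ^ k) * (\<integral>\<^sup>+x. (ennreal (norm (d k x)))\<^sup>2 \<partial>M)"
      by (subst nn_integral_cmult[symmetric]) (auto simp: ennreal_mult ennreal_power)
    also have "\<dots> \<le> ennreal (4 ^ k) * ennreal (C * (1 / 16) ^ k)" by (intro mult_left_mono bound) simp
    also have "\<dots> = ennreal (4 ^ k * (C * (1 / 16) ^ k))" using C by (simp add: ennreal_mult)
    also have "4 ^ k * (C * (1 / 16) ^ k) = C * (1 / 4) ^ k"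
      by (simp add: power_mult_distrib[symmetric] mult.left_commute[of "4 ^ k"])
    finally show "(\<integral>\<^sup>+x. ennreal (4 ^ k * (norm (d k x))\<^sup>2) \<partial>M) \<le> ennreal (C * (1 / 4) ^ k)" .
  qed auto
  also have "\<dots> = ennreal (\<Sum>k. C * (1 / 4) ^ k)"
    using C by (intro suminf_ennreal2 summable_mult) auto
  also have "\<dots> < \<infinity>" by simp
  finally have Sfin: "(\<integral>\<^sup>+x. S x \<partial>M) < \<infinity>" .
  show thesis
  proof (rule that)
    show "(\<lambda>x. sqrt (enn2real (S x))) \<in> borel_measurable M" by measurable
    show "sqrt (enn2real (S x)) \<ge> 0" for x by simp
    have "(\<integral>\<^sup>+x. (ennreal (sqrt (enn2real (S x))))\<^sup>2 \<partial>M) \<le> (\<integral>\<^sup>+x. S x \<partial>M)"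
    proof (rule nn_integral_mono)
      fix x
      have "(ennreal (sqrt (enn2real (S x))))\<^sup>2 = ennreal (enn2real (S x))" by (simp add: ennreal_power)
      also have "\<dots> \<le> S x" by (cases "S x") auto
      finally show "(ennreal (sqrt (enn2real (S x))))\<^sup>2 \<le> S x" .
    qed
    then show "(\<integral>\<^sup>+x. (ennreal (sqrt (enn2real (S x))))\<^sup>2 \<partial>M) < \<infinity>" using Sfin by simp
    have "AE x in M. S x \<noteq> \<infinity>" using Sfin by (intro nn_integral_noteq_infinite) auto
    then show "AE x in M. \<forall>k. norm (d k x) \<le> sqrt (enn2real (S x)) * (1 / 2) ^ k"
    proof eventually_elim
      case (elim x)
      show ?case
      proof
        fix k
        have "ennreal (4 ^ k * (norm (d k x))\<^sup>2) = (\<Sum>i\<in>{k}. ennreal (4 ^ i * (norm (d i x))\<^sup>2))" by simp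
        also have "\<dots> \<le> S x" unfolding S_def by (rule sum_le_suminf) auto
        finally have "4 ^ k * (norm (d k x))\<^sup>2 \<le> enn2real (S x)"
          using elim by (cases "S x") auto
        then have "sqrt (4 ^ k * (norm (d k x))\<^sup>2) \<le> sqrt (enn2real (S x))" by simp
        moreover have "sqrt (4 ^ k * (norm (d k x))\<^sup>2) = 2 ^ k * norm (d k x)"
        proof -
          have "(4::real) ^ k * (norm (d k x))\<^sup>2 = (2 ^ k * norm (d k x))\<^sup>2"
          proof -
            have "(4::real) ^ k = (2\<^sup>2) ^ k" by simp
            also have "\<dots> = (2 ^ k)\<^sup>2" by (simp only: power_mult[symmetric] mult.commute)
            finally show ?thesis by (simp add: power_mult_distrib)
          qed
          then show ?thesis by simp
        qed
        ultimately show "norm (d k x) \<le> sqrt (enn2real (S x)) * (1 / 2) ^ k"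
          by (simp add: power_divide field_simps)
      qed
    qed
  qed
qed

text \<open>Plancherel's inequality bounds differences of truncations by frequency tails. Radii so
  sparse that the tails are at most 16^(-k) turn convergence in mean into convergence almost
  everywhere, with one dominating function for all \<open>k\<close>.\<close>

lemma L2_realization:
  fixes b :: "real^'n::finite \<Rightarrow> complex"
  assumes b[measurable]: "b \<in> borel_measurable borel"
    and loc: "\<And>r. integrable lborel (freq_cut r b)"
    and tail: "(\<integral>\<^sup>+\<xi>. indicator {\<xi>. 1 < norm \<xi>} \<xi> * (ennreal (norm (b \<xi>)))\<^sup>2 \<partial>lborel) < \<infinity>"
  obtains M :: "nat \<Rightarrow> real" and F A Q where
    "\<And>k. M k \<ge> real k" "F \<in> borel_measurable borel"
    "AE x in lborel. (\<lambda>k. inv_fourier (freq_cut (M k) b) x) \<longlonglongrightarrow> F x"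
    "A \<ge> 0" "Q \<in> borel_measurable borel" "\<And>x. Q x \<ge> (0::real)" "(\<integral>\<^sup>+x. (ennreal (Q x))\<^sup>2 \<partial>lborel) < \<infinity>"
    "\<And>k. AE x in lborel. norm (inv_fourier (freq_cut (M k) b) x) \<le> A + Q x"
proof -
  define \<tau> where "\<tau> m = (\<integral>\<^sup>+\<xi>. indicator {\<xi>. m < norm \<xi>} \<xi> * (ennreal (norm (b \<xi>)))\<^sup>2 \<partial>lborel)" for m :: real
  have "(\<lambda>m. \<tau> (real (Suc m))) \<longlonglongrightarrow> (\<integral>\<^sup>+\<xi>. 0 \<partial>(lborel :: (real^'n) measure))"
    unfolding \<tau>_def
  proof (rule nn_integral_dominated_convergence[where w="\<lambda>\<xi>. indicator {\<xi>. 1 < norm \<xi>} \<xi> * (ennreal (norm (b \<xi>)))\<^sup>2"])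
    show "AE \<xi> in lborel. (\<lambda>m. indicator {\<xi>. real (Suc m) < norm \<xi>} \<xi> * (ennreal (norm (b \<xi>)))\<^sup>2) \<longlonglongrightarrow> 0"
    proof (rule AE_I2, rule tendsto_eventually)
      fix \<xi> :: "real^'n"
      obtain N where "norm \<xi> \<le> real N" using real_arch_simple by blast
      then show "\<forall>\<^sub>F m in sequentially. indicator {\<xi>. real (Suc m) < norm \<xi>} \<xi> * (ennreal (norm (b \<xi>)))\<^sup>2 = 0"
        by (intro eventually_sequentiallyI[of N]) (auto simp: indicator_def)
    qed
    show "AE \<xi> in lborel. indicator {\<xi>. real (Suc m) < norm \<xi>} \<xi> * (ennreal (norm (b \<xi>)))\<^sup>2
       \<le> indicator {\<xi>. 1 < norm \<xi>} \<xi> * (ennreal (norm (b \<xi>)))\<^sup>2" for m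
      by (intro AE_I2 mult_right_mono) (auto simp: indicator_def)
  qed (use tail in auto)
  then have lim: "(\<lambda>m. \<tau> (real (Suc m))) \<longlonglongrightarrow> 0" by simp
  have "\<exists>m. m \<ge> real k \<and> \<tau> m \<le> ennreal ((1 / 16) ^ k)" for k
  proof -
    have "\<forall>\<^sub>F m in sequentially. \<tau> (real (Suc m)) < ennreal ((1 / 16) ^ k)"
      by (rule order_tendstoD(2)[OF lim]) simp
    then obtain N where N: "\<And>m. m \<ge> N \<Longrightarrow> \<tau> (real (Suc m)) < ennreal ((1 / 16) ^ k)"
      by (auto simp: eventually_sequentially)
    show ?thesis by (rule exI[of _ "real (Suc (max N k))"]) (use N[of "max N k"] in auto)
  qed
  then obtain M where M: "\<And>k. M k \<ge> real k" "\<And>k. \<tau> (M k) \<le> ennreal ((1 / 16) ^ k)" by metis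
  have fm[measurable]: "freq_cut r b \<in> borel_measurable borel" for r
    using loc[of r] by auto
  define f where "f k = inv_fourier (freq_cut (M k) b)" for k
  have [measurable]: "f k \<in> borel_measurable borel" for k unfolding f_def by (rule inv_fourier_measurable) simp
  define d where "d k x = f (Suc k) x - f k x" for k x
  have [measurable]: "d k \<in> borel_measurable borel" for k unfolding d_def by measurable
  define e where "e k \<xi> = freq_cut (M (Suc k)) b \<xi> - freq_cut (M k) b \<xi>" for k \<xi>
  have ei: "integrable lborel (e k)" for k unfolding e_def by (intro Bochner_Integration.integrable_diff loc)
  have d_eq: "d k x = inv_fourier (e k) x" for k x
  proof -
    have "integrable lborel (\<lambda>\<xi>. freq_cut r b \<xi> * exp (\<i> * of_real (x \<bullet> \<xi>)))" for r
      by (rule Bochner_Integration.integrable_bound[OF loc[of r]]) (auto simp: norm_mult)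
    moreover have "e k \<in> borel_measurable borel" using ei by auto
    ultimately show ?thesis
      by (simp add: d_def f_def inv_fourier_lborel fm e_def left_diff_distrib right_diff_distrib)
  qed
  have d2: "(\<integral>\<^sup>+x. (ennreal (norm (d k x)))\<^sup>2 \<partial>lborel) \<le> ennreal (2 * (1 / 16) ^ k)" for k
  proof -
    have "(\<integral>\<^sup>+x. (ennreal (norm (d k x)))\<^sup>2 \<partial>lborel) \<le> (\<integral>\<^sup>+\<xi>. (ennreal (norm (e k \<xi>)))\<^sup>2 \<partial>lborel)"
      unfolding d_eq by (rule plancherel_le_inv[OF ei])
    \<comment> \<open>Nothing makes the radii \<open>M k\<close> monotone, so the difference of two
      truncations is charged to the tails of both.\<close>
    also have "\<dots> \<le> (\<integral>\<^sup>+\<xi>. indicator {\<xi>. M k < norm \<xi>} \<xi> * (ennreal (norm (b \<xi>)))\<^sup>2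
          + indicator {\<xi>. M (Suc k) < norm \<xi>} \<xi> * (ennreal (norm (b \<xi>)))\<^sup>2 \<partial>lborel)"
      by (rule nn_integral_mono) (auto simp: e_def freq_cut_def indicator_def)
    also have "\<dots> = \<tau> (M k) + \<tau> (M (Suc k))" unfolding \<tau>_def by (rule nn_integral_add) measurable
    also have "\<dots> \<le> ennreal ((1 / 16) ^ k) + ennreal ((1 / 16) ^ Suc k)" by (intro add_mono M)
    also have "\<dots> \<le> ennreal ((1 / 16) ^ k) + ennreal ((1 / 16) ^ k)" by (intro add_mono ennreal_leI) auto
    also have "\<dots> = ennreal (2 * (1 / 16) ^ k)" by (subst ennreal_plus[symmetric]) auto
    finally show ?thesis .
  qed
  obtain Q where Q: "Q \<in> borel_measurable lborel" "\<And>x. Q x \<ge> (0::real)"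
    "(\<integral>\<^sup>+x. (ennreal (Q x))\<^sup>2 \<partial>lborel) < \<infinity>" "AE x in lborel. \<forall>k. norm (d k x) \<le> Q x * (1 / 2) ^ k"
    by (rule L2_series_bound[of d lborel 2]) (use d2 in auto)
  \<comment> \<open>The first truncation is the inverse transform of an integrable function and
    supplies the bounded part; the later differences supply \<open>Q\<close>.\<close>
  obtain A where A: "A \<ge> 0" "\<And>x. norm (f 0 x) \<le> A"
  proof (rule that)
    let ?A = "norm (fourier_const TYPE('n)) * (\<integral>x. norm (freq_cut (M 0) b x) \<partial>lborel)"
    show "?A \<ge> 0" by simp
    show "norm (f 0 x) \<le> ?A" for x
      unfolding f_def inv_fourier_eq_fourier by (rule fourier_norm_le[OF loc])
  qed
  have f_sum: "f k x = f 0 x + (\<Sum>i<k. d i x)" for k x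
    by (induction k) (auto simp: d_def)
  have geo: "summable (\<lambda>k. q * (1 / 2) ^ k)" "(\<Sum>k. q * (1 / 2) ^ k) = 2 * q" for q :: real
    using suminf_geometric[of "1 / 2 :: real"] by (auto intro!: summable_mult simp: suminf_mult)
  show thesis
  proof (rule that[of M "\<lambda>x. lim (\<lambda>k. f k x)" A "\<lambda>x. 2 * Q x"])
    show "(\<lambda>x. lim (\<lambda>k. f k x)) \<in> borel_measurable borel" by (rule borel_measurable_lim_metric) simp
    show "AE x in lborel. (\<lambda>k. inv_fourier (freq_cut (M k) b) x) \<longlonglongrightarrow> lim (\<lambda>k. f k x)"
      using Q(4)
    proof eventually_elim
      case (elim x)
      have "summable (\<lambda>k. d k x)" by (rule summable_comparison_test'[OF geo(1)[of "Q x"]]) (use elim in auto)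
      then have "convergent (\<lambda>k. \<Sum>i<k. d i x)" by (simp add: summable_iff_convergent)
      then have "convergent (\<lambda>k. f 0 x + (\<Sum>i<k. d i x))" by (rule convergent_add[OF convergent_const])
      moreover have "(\<lambda>k. f k x) = (\<lambda>k. f 0 x + (\<Sum>i<k. d i x))" by (rule ext) (rule f_sum)
      ultimately have "convergent (\<lambda>k. f k x)" by (simp only:)
      then show ?case unfolding f_def[symmetric] by (simp add: convergent_LIMSEQ_iff)
    qed
    show "AE x in lborel. norm (inv_fourier (freq_cut (M k) b) x) \<le> A + 2 * Q x" for k
      using Q(4)
    proof eventually_elim
      case (elim x)
      have "norm (\<Sum>i<k. d i x) \<le> (\<Sum>i<k. Q x * (1 / 2) ^ i)" by (rule sum_norm_le) (use elim in auto)
      also have "\<dots> \<le> (\<Sum>i. Q x * (1 / 2) ^ i)" by (rule sum_le_suminf[OF geo(1)]) (auto simp: Q)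
      finally have "norm (f k x) \<le> A + 2 * Q x"
        unfolding f_sum[of k] geo(2) using A(2)[of x] norm_triangle_ineq[of "f 0 x" "\<Sum>i<k. d i x"] by linarith
      then show ?case unfolding f_def .
    qed
    have "(\<integral>\<^sup>+x. (ennreal (2 * Q x))\<^sup>2 \<partial>lborel) = 4 * (\<integral>\<^sup>+x. (ennreal (Q x))\<^sup>2 \<partial>lborel)"
      using Q(1) by (subst nn_integral_cmult[symmetric]) (auto simp: ennreal_mult Q power_mult_distrib)
    then show "(\<integral>\<^sup>+x. (ennreal (2 * Q x))\<^sup>2 \<partial>lborel) < \<infinity>" using Q(3) by (simp add: ennreal_mult_less_top)
  qed (use M A Q in auto)
qed

text \<open>A consequence of ab \<le> a^2 + b^2 for nonnegative a and b.\<close>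

lemma integrable_mult_L2:
  fixes k :: "'a \<Rightarrow> complex"
  assumes [measurable]: "Q \<in> borel_measurable M" "k \<in> borel_measurable M" and Q: "\<And>x. Q x \<ge> (0::real)"
    and Q2: "(\<integral>\<^sup>+x. (ennreal (Q x))\<^sup>2 \<partial>M) < \<infinity>" and k2: "(\<integral>\<^sup>+x. (ennreal (norm (k x)))\<^sup>2 \<partial>M) < \<infinity>"
  shows "integrable M (\<lambda>x. Q x * norm (k x))"
proof (rule integrableI_bounded)
  have "(\<integral>\<^sup>+x. ennreal (norm (Q x * norm (k x))) \<partial>M) \<le> (\<integral>\<^sup>+x. (ennreal (Q x))\<^sup>2 + (ennreal (norm (k x)))\<^sup>2 \<partial>M)"
  proof (rule nn_integral_mono)
    fix x
    have "Q x * norm (k x) \<le> (Q x)\<^sup>2 + (norm (k x))\<^sup>2"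
      using sum_squares_bound[of "Q x" "norm (k x)"] Q[of x] mult_nonneg_nonneg[OF Q[of x] norm_ge_zero[of "k x"]] by linarith
    then show "ennreal (norm (Q x * norm (k x))) \<le> (ennreal (Q x))\<^sup>2 + (ennreal (norm (k x)))\<^sup>2"
      using Q[of x] by (simp add: ennreal_power ennreal_plus[symmetric] ennreal_leI del: ennreal_plus)
  qed
  also have "\<dots> = (\<integral>\<^sup>+x. (ennreal (Q x))\<^sup>2 \<partial>M) + (\<integral>\<^sup>+x. (ennreal (norm (k x)))\<^sup>2 \<partial>M)"
    by (rule nn_integral_add) measurable
  also have "\<dots> < \<infinity>" using Q2 k2 by simp
  finally show "(\<integral>\<^sup>+x. ennreal (norm (Q x * norm (k x))) \<partial>M) < \<infinity>" .
qed measurable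

text \<open>The support of \<psi> lies in a ball of some radius r, so \<open>freq_cut r b\<close>
  times the bound of \<psi> dominates every truncation at once.\<close>

lemma freq_cut_mult_test:
  fixes b :: "real^'n::finite \<Rightarrow> complex"
  assumes b[measurable]: "b \<in> borel_measurable borel"
    and loc: "\<And>r. integrable lborel (freq_cut r b)" and \<psi>: "\<psi> \<in> test_functions"
  shows "integrable lborel (\<lambda>\<xi>. b \<xi> * \<psi> \<xi>)"
    and "(\<And>k. M k \<ge> real k) \<Longrightarrow> (\<lambda>k. \<integral>\<xi>. freq_cut (M k) b \<xi> * \<psi> \<xi> \<partial>lborel) \<longlonglongrightarrow> (\<integral>\<xi>. b \<xi> * \<psi> \<xi> \<partial>lborel)"
proof -
  obtain B where B: "B \<ge> 0" "\<And>x. norm (\<psi> x) \<le> B" using test_function_bounded \<psi> by blast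
  obtain K where K: "compact K" "\<And>x. x \<notin> K \<Longrightarrow> \<psi> x = 0" using test_function_support \<psi> by blast
  obtain r where r: "\<And>x. x \<in> K \<Longrightarrow> norm x \<le> r" using compact_imp_bounded[OF K(1)] bounded_iff by metis
  have [measurable]: "\<psi> \<in> borel_measurable borel" by (rule test_function_measurable[OF \<psi>])
  have bound: "norm (b \<xi> * \<psi> \<xi>) \<le> B * norm (freq_cut r b \<xi>)" for \<xi>
  proof (cases "\<xi> \<in> K")
    case True
    then have "freq_cut r b \<xi> = b \<xi>" using r by (simp add: freq_cut_def)
    then show ?thesis using B(2)[of \<xi>] by (simp add: norm_mult mult.commute[of B] mult_left_mono)
  qed (simp add: K B)
  have int: "integrable lborel (\<lambda>\<xi>. B * norm (freq_cut r b \<xi>))"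
    by (intro integrable_mult_right integrable_norm loc)
  show i: "integrable lborel (\<lambda>\<xi>. b \<xi> * \<psi> \<xi>)"
    by (rule Bochner_Integration.integrable_bound[OF int]) (measurable, rule AE_I2, use bound B in simp)
  assume M: "\<And>k. M k \<ge> real k"
  show "(\<lambda>k. \<integral>\<xi>. freq_cut (M k) b \<xi> * \<psi> \<xi> \<partial>lborel) \<longlonglongrightarrow> (\<integral>\<xi>. b \<xi> * \<psi> \<xi> \<partial>lborel)"
  proof (rule integral_dominated_convergence[OF _ _ int])
    show "(\<lambda>\<xi>. freq_cut (M k) b \<xi> * \<psi> \<xi>) \<in> borel_measurable lborel" for k
      unfolding freq_cut_def
      by (intro borel_measurable_times borel_measurable_scaleR borel_measurable_indicator) simp_all
    show "AE \<xi> in lborel. norm (freq_cut (M k) b \<xi> * \<psi> \<xi>) \<le> B * norm (freq_cut r b \<xi>)" for k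
    proof (rule AE_I2)
      fix \<xi>
      have "norm (freq_cut (M k) b \<xi> * \<psi> \<xi>) \<le> norm (b \<xi> * \<psi> \<xi>)" by (simp add: freq_cut_def indicator_def)
      then show "norm (freq_cut (M k) b \<xi> * \<psi> \<xi>) \<le> B * norm (freq_cut r b \<xi>)" using bound[of \<xi>] by linarith
    qed
    show "AE \<xi> in lborel. (\<lambda>k. freq_cut (M k) b \<xi> * \<psi> \<xi>) \<longlonglongrightarrow> b \<xi> * \<psi> \<xi>"
    proof (rule AE_I2, rule tendsto_eventually)
      fix \<xi> :: "real^'n"
      obtain N where N: "norm \<xi> \<le> real N" using real_arch_simple by blast
      have "freq_cut (M k) b \<xi> = b \<xi>" if "k \<ge> N" for k
      proof -
        have "real N \<le> real k" using that by simp
        then have "norm \<xi> \<le> M k" using N M[of k] by linarith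
        then show ?thesis by (simp add: freq_cut_def)
      qed
      then show "\<forall>\<^sub>F k in sequentially. freq_cut (M k) b \<xi> * \<psi> \<xi> = b \<xi> * \<psi> \<xi>"
        by (intro eventually_sequentiallyI[of N]) simp
    qed
  qed measurable
qed

text \<open>The limit \<open>F\<close> of the truncations pairs with transforms of test functions as
  \<open>f\<close> does, so it equals \<open>f\<close> almost everywhere. For \<open>g\<close> both
  integrable and square integrable, A |g| + Q |g| dominates, and the inverse transform is moved over
  to \<open>g\<close>.\<close>

lemma fourier_pair_limit:
  fixes f b :: "real^'n::finite \<Rightarrow> complex"
  assumes fb: "fourier_pair f b"
  obtains M where "\<And>k. M k \<ge> real k"
    "\<And>g. integrable lborel g \<Longrightarrow> (\<integral>\<^sup>+x. (ennreal (norm (g x)))\<^sup>2 \<partial>lborel) < \<infinity> \<Longrightarrow>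
      (\<lambda>k. \<integral>\<xi>. freq_cut (M k) b \<xi> * inv_fourier g \<xi> \<partial>lborel) \<longlonglongrightarrow> (\<integral>x. f x * g x \<partial>lebesgue)"
proof -
  have b[measurable]: "b \<in> borel_measurable borel"
    and loc: "\<And>r. integrable lborel (freq_cut r b)"
    and tail: "(\<integral>\<^sup>+\<xi>. indicator {\<xi>. 1 < norm \<xi>} \<xi> * (ennreal (norm (b \<xi>)))\<^sup>2 \<partial>lborel) < \<infinity>"
    and f: "f \<in> borel_measurable lebesgue"
    and pair: "\<And>\<psi>. \<psi> \<in> test_functions \<Longrightarrow> integrable lebesgue (\<lambda>x. f x * fourier \<psi> x)"
       "\<And>\<psi>. \<psi> \<in> test_functions \<Longrightarrow> (\<integral>x. f x * fourier \<psi> x \<partial>lebesgue) = (\<integral>\<xi>. b \<xi> * \<psi> \<xi> \<partial>lborel)"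
    using fb unfolding fourier_pair_def freq_cut_def by blast+
  obtain M F A Q where M: "\<And>k. M k \<ge> real k" and F[measurable]: "F \<in> borel_measurable borel"
    and lim: "AE x in lborel. (\<lambda>k. inv_fourier (freq_cut (M k) b) x) \<longlonglongrightarrow> F x"
    and A: "A \<ge> 0" and Q[measurable]: "Q \<in> borel_measurable borel" and Q0: "\<And>x. Q x \<ge> (0::real)"
    and Q2: "(\<integral>\<^sup>+x. (ennreal (Q x))\<^sup>2 \<partial>lborel) < \<infinity>"
    and dom: "\<And>k. AE x in lborel. norm (inv_fourier (freq_cut (M k) b) x) \<le> A + Q x"
    using L2_realization[OF b loc tail] by blast
  have [measurable]: "inv_fourier (freq_cut (M k) b) \<in> borel_measurable borel" for k
    using loc by (intro inv_fourier_measurable) auto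
  have Fdom: "AE x in lborel. norm (F x) \<le> A + Q x"
  proof -
    have "AE x in lborel. \<forall>k. norm (inv_fourier (freq_cut (M k) b) x) \<le> A + Q x"
      unfolding AE_all_countable using dom by blast
    then show ?thesis using lim
    proof eventually_elim
      case (elim x)
      then show ?case by (intro LIMSEQ_le_const2[OF tendsto_norm]) auto
    qed
  qed
  have step: "integrable lborel (\<lambda>x. F x * g x)"
      "(\<lambda>k. \<integral>\<xi>. freq_cut (M k) b \<xi> * inv_fourier g \<xi> \<partial>lborel) \<longlonglongrightarrow> (\<integral>x. F x * g x \<partial>lborel)"
    if g: "integrable lborel g" and g2: "(\<integral>\<^sup>+x. (ennreal (norm (g x)))\<^sup>2 \<partial>lborel) < \<infinity>" for g
  proof -
    have gm[measurable]: "g \<in> borel_measurable borel" using g by auto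
    have int: "integrable lborel (\<lambda>x. A * norm (g x) + Q x * norm (g x))"
      by (intro Bochner_Integration.integrable_add integrable_mult_right integrable_norm g integrable_mult_L2)
         (use Q0 Q2 g2 in auto)
    have bnd: "norm (y * g x) \<le> A * norm (g x) + Q x * norm (g x)" if "norm y \<le> A + Q x" for y :: complex and x
      using mult_right_mono[OF that, of "norm (g x)"] by (simp add: norm_mult distrib_right)
    show "integrable lborel (\<lambda>x. F x * g x)"
    proof (rule Bochner_Integration.integrable_bound[OF int])
      show "AE x in lborel. norm (F x * g x) \<le> norm (A * norm (g x) + Q x * norm (g x))"
        using Fdom by eventually_elim (use bnd A Q0 in simp)
    qed measurable
    have "(\<lambda>k. \<integral>x. inv_fourier (freq_cut (M k) b) x * g x \<partial>lborel) \<longlonglongrightarrow> (\<integral>x. F x * g x \<partial>lborel)"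
    proof (rule integral_dominated_convergence[OF _ _ int])
      show "AE x in lborel. (\<lambda>k. inv_fourier (freq_cut (M k) b) x * g x) \<longlonglongrightarrow> F x * g x"
        using lim by eventually_elim (intro tendsto_intros)
      show "AE x in lborel. norm (inv_fourier (freq_cut (M k) b) x * g x) \<le> A * norm (g x) + Q x * norm (g x)" for k
        using dom[of k] by eventually_elim (rule bnd)
    qed measurable
    then show "(\<lambda>k. \<integral>\<xi>. freq_cut (M k) b \<xi> * inv_fourier g \<xi> \<partial>lborel) \<longlonglongrightarrow> (\<integral>x. F x * g x \<partial>lborel)"
      by (simp only: integral_inv_fourier_mult[OF loc g])
  qed
  have FL: "F \<in> borel_measurable lebesgue" by (rule measurable_completion) simp
  have "AE x in lebesgue. f x - F x = 0"
  proof (rule AE_zero_of_fourier_test)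
    show "(\<lambda>x. f x - F x) \<in> borel_measurable lebesgue" using f FL by measurable
    fix \<psi> :: "real^'n \<Rightarrow> complex" assume \<psi>: "\<psi> \<in> test_functions"
    have \<psi>m[measurable]: "fourier \<psi> \<in> borel_measurable borel" by (rule fourier_measurable[OF \<psi>])
    have g: "integrable lborel (fourier \<psi>)" by (rule fourier_integrable[OF \<psi>])
    have g2: "(\<integral>\<^sup>+x. (ennreal (norm (fourier \<psi> x)))\<^sup>2 \<partial>lborel) < \<infinity>"
    proof -
      obtain B where B: "B \<ge> 0" "\<And>\<xi>. norm (fourier \<psi> \<xi>) \<le> B" using fourier_bounded \<psi> by blast
      have "(\<integral>\<^sup>+x. (ennreal (norm (fourier \<psi> x)))\<^sup>2 \<partial>lborel) \<le> (\<integral>\<^sup>+x. ennreal B * ennreal (norm (fourier \<psi> x)) \<partial>lborel)"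
        using B by (intro nn_integral_mono) (auto simp: power2_eq_square intro!: mult_right_mono ennreal_leI)
      also have "\<dots> = ennreal B * (\<integral>\<^sup>+x. ennreal (norm (fourier \<psi> x)) \<partial>lborel)" by (rule nn_integral_cmult) measurable
      also have "\<dots> < \<infinity>" using g by (simp add: integrable_iff_bounded ennreal_mult_less_top)
      finally show ?thesis .
    qed
    have "inv_fourier (fourier \<psi>) = \<psi>"
      using fourier_inversion_test[OF \<psi>] by (intro ext) (simp add: inv_fourier_lborel inner_commute)
    then have "(\<lambda>k. \<integral>\<xi>. freq_cut (M k) b \<xi> * \<psi> \<xi> \<partial>lborel) \<longlonglongrightarrow> (\<integral>x. F x * fourier \<psi> x \<partial>lborel)"
      using step(2)[OF g g2] by simp
    from LIMSEQ_unique[OF this freq_cut_mult_test(2)[OF b loc \<psi> M]]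
    have eq: "(\<integral>x. F x * fourier \<psi> x \<partial>lborel) = (\<integral>\<xi>. b \<xi> * \<psi> \<xi> \<partial>lborel)" by simp
    have iF: "integrable lebesgue (\<lambda>x. F x * fourier \<psi> x)"
      using step(1)[OF g g2] by (subst integrable_completion) auto
    have eqF: "(\<integral>x. F x * fourier \<psi> x \<partial>lebesgue) = (\<integral>\<xi>. b \<xi> * \<psi> \<xi> \<partial>lborel)"
      using eq by (subst integral_completion) auto
    show "integrable lebesgue (\<lambda>x. (f x - F x) * fourier \<psi> x)"
      using Bochner_Integration.integrable_diff[OF pair(1)[OF \<psi>] iF] by (simp add: left_diff_distrib)
    show "(\<integral>x. (f x - F x) * fourier \<psi> x \<partial>lebesgue) = 0"
      using pair(1)[OF \<psi>] iF by (simp add: left_diff_distrib eqF pair(2)[OF \<psi>])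
  qed
  then have fF: "AE x in lebesgue. f x = F x" by simp
  show thesis
  proof (rule that[OF M])
    fix g :: "real^'n \<Rightarrow> complex"
    assume g: "integrable lborel g" and g2: "(\<integral>\<^sup>+x. (ennreal (norm (g x)))\<^sup>2 \<partial>lborel) < \<infinity>"
    have [measurable]: "g \<in> borel_measurable borel" using g by auto
    have gL: "g \<in> borel_measurable lebesgue" by (rule measurable_completion) simp
    have "(\<integral>x. f x * g x \<partial>lebesgue) = (\<integral>x. F x * g x \<partial>lebesgue)"
    proof (rule integral_cong_AE)
      show "(\<lambda>x. f x * g x) \<in> borel_measurable lebesgue" using f gL by measurable
      show "(\<lambda>x. F x * g x) \<in> borel_measurable lebesgue" using FL gL by measurable
      show "AE x in lebesgue. f x * g x = F x * g x" using fF by eventually_elim simp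
    qed
    also have "\<dots> = (\<integral>x. F x * g x \<partial>lborel)" by (rule integral_completion) measurable
    finally show "(\<lambda>k. \<integral>\<xi>. freq_cut (M k) b \<xi> * inv_fourier g \<xi> \<partial>lborel) \<longlonglongrightarrow> (\<integral>x. f x * g x \<partial>lebesgue)"
      using step(2)[OF g g2] by simp
  qed
qed

text \<open>Multiplying \<open>g\<close> by \<open>fourier \<psi>\<close> smooths its transform to \<open>\<xi> \<mapsto> \<integral> bg \<eta> * \<psi> (\<xi> + \<eta>)\<close>, an honest integral
  by translation of \<open>\<psi>\<close>; hence only \<open>f\<close> has to be approximated.\<close>

theorem fourier_product:
  fixes f g bf bg :: "real^'n::finite \<Rightarrow> complex"
  assumes f: "fourier_pair f bf" and g: "fourier_pair g bg" and \<psi>: "\<psi> \<in> test_functions"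
    and g2: "integrable lebesgue (\<lambda>x. (norm (g x))\<^sup>2 * norm (fourier \<psi> x))"
    and fin: "(\<integral>\<^sup>+\<xi>. \<integral>\<^sup>+\<eta>. ennreal (norm (bf \<xi> * bg \<eta> * \<psi> (\<xi> + \<eta>))) \<partial>lborel \<partial>lborel) < \<infinity>"
  shows "(\<integral>x. f x * g x * fourier \<psi> x \<partial>lebesgue)
     = fourier_const TYPE('n) * (\<integral>\<xi>. \<integral>\<eta>. bf \<xi> * bg \<eta> * \<psi> (\<xi> + \<eta>) \<partial>lborel \<partial>lborel)"
proof -
  have [measurable]: "\<psi> \<in> borel_measurable borel" by (rule test_function_measurable[OF \<psi>])
  have [measurable]: "bf \<in> borel_measurable borel" "bg \<in> borel_measurable borel"
    and gL: "g \<in> borel_measurable lebesgue"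
    and fL: "f \<in> borel_measurable lebesgue"
    and gpair: "\<And>\<psi>. \<psi> \<in> test_functions \<Longrightarrow> integrable lebesgue (\<lambda>x. g x * fourier \<psi> x)"
       "\<And>\<psi>. \<psi> \<in> test_functions \<Longrightarrow> (\<integral>x. g x * fourier \<psi> x \<partial>lebesgue) = (\<integral>\<xi>. bg \<xi> * \<psi> \<xi> \<partial>lborel)"
    using f g unfolding fourier_pair_def by blast+
  have \<psi>m[measurable]: "fourier \<psi> \<in> borel_measurable borel" by (rule fourier_measurable[OF \<psi>])
  have \<psi>L: "fourier \<psi> \<in> borel_measurable lebesgue" by (rule measurable_completion) simp
  obtain g' where g'[measurable]: "g' \<in> borel_measurable lborel" and "AE x in lborel. g x = g' x"
    using completion_ex_borel_measurable_complex[OF gL] by blast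
  then have gg': "AE x in lebesgue. g x = g' x" by (intro AE_completion)
  have g'L: "g' \<in> borel_measurable lebesgue" by (rule measurable_completion) simp
  let ?k = "\<lambda>x. g' x * fourier \<psi> x"
  have km[measurable]: "?k \<in> borel_measurable lborel" by measurable
  have kL: "?k \<in> borel_measurable lebesgue" by (rule measurable_completion) measurable
  have eqk: "AE x in lebesgue. g x * fourier \<psi> x = ?k x" using gg' by eventually_elim simp
  have "integrable lebesgue ?k"
    by (rule integrable_cong_AE_imp[OF gpair(1)[OF \<psi>] kL]) (use eqk in eventually_elim, simp)
  then have ki: "integrable lborel ?k" by (simp add: integrable_completion)
  obtain B where B: "B \<ge> 0" "\<And>\<xi>. norm (fourier \<psi> \<xi>) \<le> B" using fourier_bounded \<psi> by blast
  \<comment> \<open>One factor \<open>fourier \<psi>\<close> of the square is bounded by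
    \<open>B\<close>; the other one belongs to the integrable function of \<open>g2\<close>.\<close>
  have k2: "(\<integral>\<^sup>+x. (ennreal (norm (?k x)))\<^sup>2 \<partial>lborel) < \<infinity>"
  proof -
    have "integrable lebesgue (\<lambda>x. (norm (g' x))\<^sup>2 * norm (fourier \<psi> x))"
    proof (rule integrable_cong_AE_imp[OF g2])
      show "(\<lambda>x. (norm (g' x))\<^sup>2 * norm (fourier \<psi> x)) \<in> borel_measurable lebesgue"
        using g'L \<psi>L by measurable
    qed (use gg' in eventually_elim, simp)
    then have i: "integrable lborel (\<lambda>x. (norm (g' x))\<^sup>2 * norm (fourier \<psi> x))"
      by (subst (asm) integrable_completion) auto
    have "(\<integral>\<^sup>+x. (ennreal (norm (?k x)))\<^sup>2 \<partial>lborel) \<le> (\<integral>\<^sup>+x. ennreal B * ennreal ((norm (g' x))\<^sup>2 * norm (fourier \<psi> x)) \<partial>lborel)"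
    proof (rule nn_integral_mono)
      fix x
      have "(norm (?k x))\<^sup>2 = norm (fourier \<psi> x) * ((norm (g' x))\<^sup>2 * norm (fourier \<psi> x))"
        by (simp add: norm_mult power2_eq_square)
      also have "\<dots> \<le> B * ((norm (g' x))\<^sup>2 * norm (fourier \<psi> x))" by (intro mult_right_mono B) simp
      finally show "(ennreal (norm (?k x)))\<^sup>2 \<le> ennreal B * ennreal ((norm (g' x))\<^sup>2 * norm (fourier \<psi> x))"
        using B(1) by (simp only: ennreal_power[OF norm_ge_zero] ennreal_mult[OF B(1) mult_nonneg_nonneg[OF zero_le_power2 norm_ge_zero], symmetric] ennreal_leI)
    qed
    also have "\<dots> = ennreal B * (\<integral>\<^sup>+x. ennreal ((norm (g' x))\<^sup>2 * norm (fourier \<psi> x)) \<partial>lborel)"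
      by (rule nn_integral_cmult) measurable
    also have "\<dots> < \<infinity>" using i by (simp add: integrable_iff_bounded ennreal_mult_less_top)
    finally show ?thesis .
  qed
  let ?c = "fourier_const TYPE('n)"
  have ifk: "inv_fourier ?k \<xi> = ?c * (\<integral>\<eta>. bg \<eta> * \<psi> (\<xi> + \<eta>) \<partial>lborel)" for \<xi>
  proof -
    have t: "(\<lambda>\<eta>. \<psi> (\<eta> + \<xi>)) \<in> test_functions" by (rule test_function_translate[OF \<psi>])
    have "(\<integral>x. ?k x * exp (\<i> * of_real (\<xi> \<bullet> x)) \<partial>lborel) = (\<integral>x. ?k x * exp (\<i> * of_real (\<xi> \<bullet> x)) \<partial>lebesgue)"
      by (rule integral_completion[symmetric]) measurable
    also have "\<dots> = (\<integral>x. g x * fourier (\<lambda>\<eta>. \<psi> (\<eta> + \<xi>)) x \<partial>lebesgue)"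
    proof (rule integral_cong_AE)
      show "(\<lambda>x. ?k x * exp (\<i> * of_real (\<xi> \<bullet> x))) \<in> borel_measurable lebesgue"
        by (rule measurable_completion) measurable
      show "(\<lambda>x. g x * fourier (\<lambda>\<eta>. \<psi> (\<eta> + \<xi>)) x) \<in> borel_measurable lebesgue"
        by (rule borel_measurable_integrable[OF gpair(1)[OF t]])
      show "AE x in lebesgue. ?k x * exp (\<i> * of_real (\<xi> \<bullet> x)) = g x * fourier (\<lambda>\<eta>. \<psi> (\<eta> + \<xi>)) x"
        using gg' by eventually_elim (simp add: fourier_translate[OF \<psi>] inner_commute mult_ac)
    qed
    also have "\<dots> = (\<integral>\<eta>. bg \<eta> * \<psi> (\<eta> + \<xi>) \<partial>lborel)" by (rule gpair(2)[OF t])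
    finally show ?thesis using km by (simp add: inv_fourier_lborel add.commute)
  qed
  obtain M where M: "\<And>k. M k \<ge> real k"
    and lims: "\<And>g. integrable lborel g \<Longrightarrow> (\<integral>\<^sup>+x. (ennreal (norm (g x)))\<^sup>2 \<partial>lborel) < \<infinity> \<Longrightarrow>
      (\<lambda>k. \<integral>\<xi>. freq_cut (M k) bf \<xi> * inv_fourier g \<xi> \<partial>lborel) \<longlonglongrightarrow> (\<integral>x. f x * g x \<partial>lebesgue)"
    using fourier_pair_limit[OF f] by blast
  have lim: "(\<lambda>k. \<integral>\<xi>. freq_cut (M k) bf \<xi> * inv_fourier ?k \<xi> \<partial>lborel) \<longlonglongrightarrow> (\<integral>x. f x * ?k x \<partial>lebesgue)"
    by (rule lims[OF ki k2])
  define P where "P \<xi> = (\<integral>\<eta>. bf \<xi> * bg \<eta> * \<psi> (\<xi> + \<eta>) \<partial>lborel)" for \<xi>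
  have P_eq: "bf \<xi> * inv_fourier ?k \<xi> = ?c * P \<xi>" for \<xi>
    unfolding ifk P_def by (simp add: mult.assoc)
  have Pm[measurable]: "P \<in> borel_measurable borel"
    unfolding P_def[abs_def] by (rule lborel.borel_measurable_lebesgue_integral) measurable
  have Pi: "integrable lborel P"
  proof (rule integrableI_bounded)
    have "(\<integral>\<^sup>+\<xi>. ennreal (norm (P \<xi>)) \<partial>lborel) \<le> (\<integral>\<^sup>+\<xi>. \<integral>\<^sup>+\<eta>. ennreal (norm (bf \<xi> * bg \<eta> * \<psi> (\<xi> + \<eta>))) \<partial>lborel \<partial>lborel)"
      unfolding P_def by (intro nn_integral_mono norm_integral_le_nn_integral)
    then show "(\<integral>\<^sup>+\<xi>. ennreal (norm (P \<xi>)) \<partial>lborel) < \<infinity>" using fin by simp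
  qed measurable
  \<comment> \<open>The double integral converges absolutely by \<open>fin\<close>, so on the
    frequency side the truncation of \<open>bf\<close> can be removed; comparison with
    \<open>lim\<close> gives the formula.\<close>
  have "(\<lambda>k. \<integral>\<xi>. freq_cut (M k) bf \<xi> * inv_fourier ?k \<xi> \<partial>lborel) \<longlonglongrightarrow> (\<integral>\<xi>. ?c * P \<xi> \<partial>lborel)"
  proof (rule integral_dominated_convergence[where w="\<lambda>\<xi>. norm (?c * P \<xi>)"])
    have cut: "freq_cut r bf \<xi> * inv_fourier ?k \<xi> = indicator (cball 0 r) \<xi> *\<^sub>R (?c * P \<xi>)" for r \<xi>
      unfolding P_eq[symmetric] freq_cut_def by simp
    show "(\<lambda>\<xi>. freq_cut (M k) bf \<xi> * inv_fourier ?k \<xi>) \<in> borel_measurable lborel" for k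
      unfolding cut by (intro borel_measurable_scaleR borel_measurable_indicator) (simp, measurable)
    show "integrable lborel (\<lambda>\<xi>. norm (?c * P \<xi>))" by (intro integrable_norm integrable_mult_right Pi)
    show "AE \<xi> in lborel. norm (freq_cut (M k) bf \<xi> * inv_fourier ?k \<xi>) \<le> norm (?c * P \<xi>)" for k
      unfolding cut by (intro AE_I2) (simp add: indicator_def)
    show "AE \<xi> in lborel. (\<lambda>k. freq_cut (M k) bf \<xi> * inv_fourier ?k \<xi>) \<longlonglongrightarrow> ?c * P \<xi>"
    proof (rule AE_I2, rule tendsto_eventually)
      fix \<xi> :: "real^'n"
      obtain N where N: "norm \<xi> \<le> real N" using real_arch_simple by blast
      have "norm \<xi> \<le> M k" if "k \<ge> N" for k
      proof -
        have "real N \<le> real k" using that by simp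
        then show "norm \<xi> \<le> M k" using N M[of k] by linarith
      qed
      then show "\<forall>\<^sub>F k in sequentially. freq_cut (M k) bf \<xi> * inv_fourier ?k \<xi> = ?c * P \<xi>"
        unfolding cut by (intro eventually_sequentiallyI[of N]) simp
    qed
  qed measurable
  from LIMSEQ_unique[OF lim this] have "(\<integral>x. f x * ?k x \<partial>lebesgue) = ?c * (\<integral>\<xi>. P \<xi> \<partial>lborel)" by simp
  moreover have "(\<integral>x. f x * g x * fourier \<psi> x \<partial>lebesgue) = (\<integral>x. f x * ?k x \<partial>lebesgue)"
  proof (rule integral_cong_AE)
    show "(\<lambda>x. f x * g x * fourier \<psi> x) \<in> borel_measurable lebesgue" using fL gL \<psi>L by measurable
    show "(\<lambda>x. f x * ?k x) \<in> borel_measurable lebesgue" using fL kL by measurable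
    show "AE x in lebesgue. f x * g x * fourier \<psi> x = f x * ?k x" using gg' by eventually_elim simp
  qed
  ultimately show ?thesis by (simp add: P_def)
qed

section \<open>Bilinear estimates on the Fourier side\<close>

lemma cball_pred [measurable]: "Measurable.pred borel (\<lambda>x::'a::euclidean_space. x \<in> cball a r)"
  unfolding mem_cball by measurable

lemma nn_integral_powr_interval:
  assumes "a < 1" "r \<ge> 0"
  shows "(\<integral>\<^sup>+t. indicator {- r..r} t * ennreal (\<bar>t\<bar> powr - a) \<partial>lborel) \<le> ennreal (2 * (r powr (1 - a) / (1 - a)))"
proof -
  have half: "(\<integral>\<^sup>+t. ennreal (indicator {0..r} t * t powr - a) \<partial>lborel) = ennreal (r powr (1 - a) / (1 - a))"
  proof -
    have "((\<lambda>t. t powr - a) has_integral (r powr (- a + 1) / (- a + 1))) {0..r}"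
      using assms by (intro has_integral_powr_from_0) auto
    then show ?thesis
      by (subst nn_integral_has_integral_lebesgue[rotated]) (auto simp: add.commute)
  qed
  have "(\<integral>\<^sup>+t. indicator {- r..r} t * ennreal (\<bar>t\<bar> powr - a) \<partial>lborel)
      \<le> (\<integral>\<^sup>+t. ennreal (indicator {0..r} t * t powr - a) + ennreal (indicator {0..r} (0 - t) * (0 - t) powr - a) \<partial>lborel)"
    by (rule nn_integral_mono) (auto simp: indicator_def abs_if)
  also have "\<dots> = (\<integral>\<^sup>+t. ennreal (indicator {0..r} t * t powr - a) \<partial>lborel)
      + (\<integral>\<^sup>+t. ennreal (indicator {0..r} (0 - t) * (0 - t) powr - a) \<partial>lborel)"
    by (rule nn_integral_add) measurable
  also have "(\<integral>\<^sup>+t. ennreal (indicator {0..r} (0 - t) * (0 - t) powr - a) \<partial>lborel)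
     = (\<integral>\<^sup>+t. ennreal (indicator {0..r} t * t powr - a) \<partial>lborel)"
    by (rule nn_integral_reflect[where f="\<lambda>t. ennreal (indicator {0..r} t * t powr - a)"]) measurable
  finally show ?thesis
    unfolding half using assms by (subst (asm) ennreal_plus[symmetric]) auto
qed

text \<open>Since \<open>norm x\<close> dominates every coordinate, the singularity is bounded by a product of
  one-dimensional integrable singularities.\<close>

lemma nn_integral_norm_singularity:
  assumes r: "r \<ge> 0"
  shows "(\<integral>\<^sup>+x. indicator (cball 0 r) x * ennreal (1 / norm x ^ (CARD('n) - 1)) \<partial>(lborel :: (real^'n::finite) measure))
    \<le> ennreal ((2 * real CARD('n)) ^ CARD('n) * r)"
proof -
  define N where "N = CARD('n)"
  have N: "N \<ge> 1" unfolding N_def by (simp add: Suc_leI)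
  \<comment> \<open>The exponent n - 1 is shared equally by the n coordinates; each then carries
    less than 1 and is integrable at 0.\<close>
  define a where "a = (real N - 1) / real N"
  have a: "a < 1" "1 - a = 1 / real N" "a \<ge> 0" using N by (simp_all add: a_def field_simps)
  have ne: "AE x in (lborel :: (real^'n) measure). \<forall>i. x $ i \<noteq> 0"
  proof -
    have "AE x in (lborel :: (real^'n) measure). x $ i \<noteq> 0" for i
    proof -
      have "{x::real^'n. x $ i = 0} \<in> null_sets lebesgue"
        using negligible_standard_hyperplane_cart by (simp add: negligible_iff_null_sets)
      then have "AE x in (lebesgue :: (real^'n) measure). x \<notin> {x. x $ i = 0}" by (rule AE_not_in)
      then show ?thesis by (simp add: AE_completion_iff)
    qed
    then show ?thesis by (simp add: AE_all_countable)
  qed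
  have "(\<integral>\<^sup>+x. indicator (cball 0 r) x * ennreal (1 / norm x ^ (CARD('n) - 1)) \<partial>(lborel :: (real^'n) measure))
    \<le> (\<integral>\<^sup>+x. (\<Prod>i\<in>UNIV. indicator {- r..r} (x $ i) * ennreal (\<bar>x $ i\<bar> powr - a)) \<partial>(lborel :: (real^'n) measure))"
    using ne
  proof (intro nn_integral_mono_AE, eventually_elim)
    case (elim x)
    show ?case
    proof (cases "norm x \<le> r")
      case True
      have i: "x $ i \<in> {- r..r}" for i using component_le_norm_cart[of x i] True by auto
      have pos: "norm x > 0" using elim by (metis zero_index zero_less_norm_iff)
      have "1 / norm x ^ (CARD('n) - 1) = norm x powr - (real N - 1)"
      proof -
        have "norm x powr (real N - 1) = norm x ^ (N - 1)"
          using powr_realpow[OF pos, of "N - 1"] N by (simp add: of_nat_diff)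
        then show ?thesis unfolding powr_minus_divide N_def by simp
      qed
      also have "\<dots> = (norm x powr - a) ^ N"
        using pos N by (simp add: powr_realpow[symmetric] powr_powr a_def)
      also have "\<dots> = (\<Prod>i\<in>(UNIV :: 'n set). norm x powr - a)" by (simp add: N_def)
      also have "\<dots> \<le> (\<Prod>i\<in>UNIV. \<bar>x $ i\<bar> powr - a)"
        by (intro prod_mono) (use elim a component_le_norm_cart[of x] in \<open>auto intro!: powr_mono2'\<close>)
      finally have "ennreal (1 / norm x ^ (CARD('n) - 1)) \<le> (\<Prod>i\<in>UNIV. ennreal (\<bar>x $ i\<bar> powr - a))"
        by (subst prod_ennreal) (auto intro: ennreal_leI)
      then show ?thesis using True i by simp
    qed simp
  qed
  also have "\<dots> = (\<Prod>i\<in>(UNIV::'n set). \<integral>\<^sup>+t. indicator {- r..r} t * ennreal (\<bar>t\<bar> powr - a) \<partial>lborel)"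
    by (rule nn_integral_prod_cart) measurable
  also have "\<dots> \<le> (\<Prod>i\<in>(UNIV::'n set). ennreal (2 * (r powr (1 - a) / (1 - a))))"
    by (intro prod_mono_ennreal nn_integral_powr_interval a r)
  also have "\<dots> = ennreal ((2 * (r powr (1 - a) / (1 - a))) ^ N)"
    using a by (subst prod_ennreal) (auto simp: N_def)
  also have "(2 * (r powr (1 - a) / (1 - a))) ^ N = (2 * real N) ^ N * r"
  proof (cases "r = 0")
    case False
    then have "(r powr (1 / real N)) ^ N = r" using r N by (simp add: powr_realpow[symmetric] powr_powr)
    then show ?thesis using a by (simp add: power_mult_distrib mult_ac)
  qed (use N in \<open>simp add: a\<close>)
  finally show ?thesis by (simp add: N_def)
qed

section \<open>Weighted convolution estimates\<close>

definition freq_weight :: "real^'n::finite \<Rightarrow> ennreal" where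
  "freq_weight \<xi> = ennreal (norm \<xi> ^ (CARD('n) - 2))"

text \<open>The squared weight of order n/2 - 2, while \<open>freq_weight\<close> is that of order
  n/2 - 1. It is written as a quotient because n - 4 as a natural number would be cut off to 0 for n
  = 3.\<close>

definition low_weight :: "real^'n::finite \<Rightarrow> ennreal" where
  "low_weight \<xi> = ennreal (norm \<xi> ^ (CARD('n) - 2) / (norm \<xi>)\<^sup>2)"

text \<open>The squared critical norm on the Fourier side, with values in \<open>ennreal\<close> so
  that it can be written down before it is known to be finite.\<close>

definition norm2 :: "(real^'n::finite \<Rightarrow> ennreal) \<Rightarrow> ennreal" where
  "norm2 f = (\<integral>\<^sup>+\<xi>. freq_weight \<xi> * (f \<xi>)\<^sup>2 \<partial>lborel)"

definition conv :: "(real^'n::finite \<Rightarrow> ennreal) \<Rightarrow> (real^'n \<Rightarrow> ennreal) \<Rightarrow> real^'n \<Rightarrow> ennreal" where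
  "conv f g \<xi> = (\<integral>\<^sup>+x. f x * g (\<xi> - x) \<partial>lborel)"

lemma freq_weight_measurable [measurable]: "freq_weight \<in> borel_measurable borel"
  unfolding freq_weight_def[abs_def] by measurable

lemma low_weight_measurable [measurable]: "low_weight \<in> borel_measurable borel"
  unfolding low_weight_def[abs_def] by measurable

lemma conv_measurable [measurable]:
  assumes [measurable]: "f \<in> borel_measurable borel" "g \<in> borel_measurable borel"
  shows "conv f g \<in> borel_measurable borel"
  unfolding conv_def[abs_def] by measurable

lemma conv_commute:
  assumes [measurable]: "f \<in> borel_measurable borel" "g \<in> borel_measurable borel"
  shows "conv f g = conv g f"
proof
  fix \<xi>
  have "conv f g \<xi> = (\<integral>\<^sup>+x. (\<lambda>y. f y * g (\<xi> - y)) (\<xi> - x) \<partial>lborel)"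
    unfolding conv_def by (rule nn_integral_reflect[symmetric]) measurable
  then show "conv f g \<xi> = conv g f \<xi>" by (simp add: conv_def mult.commute)
qed

lemma power2_add_le_ennreal: "(a + b)\<^sup>2 \<le> 2 * a\<^sup>2 + 2 * b\<^sup>2" for a b :: ennreal
proof (cases "a = \<top> \<or> b = \<top>")
  case False
  then obtain x y where xy: "a = ennreal x" "b = ennreal y" "x \<ge> 0" "y \<ge> 0"
    by (cases a; cases b) auto
  have "(x + y)\<^sup>2 \<le> 2 * x\<^sup>2 + 2 * y\<^sup>2" using sum_squares_bound[of x y] by (simp add: power2_sum)
  then have "ennreal ((x + y)\<^sup>2) \<le> ennreal (2 * x\<^sup>2 + 2 * y\<^sup>2)" by (rule ennreal_leI)
  also have "ennreal ((x + y)\<^sup>2) = (a + b)\<^sup>2"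
    using xy by (simp add: ennreal_plus[symmetric] ennreal_power del: ennreal_plus)
  also have "ennreal (2 * x\<^sup>2 + 2 * y\<^sup>2) = 2 * a\<^sup>2 + 2 * b\<^sup>2"
    using xy by (simp add: ennreal_power ennreal_mult)
  finally show ?thesis .
qed auto

text \<open>Cauchy-Schwarz after multiplying and dividing by the weight |x|^((n-2)/2), which goes
  with \<open>f\<close>; Fubini then leaves, at fixed \<eta> = \<xi> - x, exactly the kernel
  integral of the hypothesis. The set \<open>S\<close> selects the pairs of frequencies for which
  such a bound is available.\<close>

lemma weighted_Schur:
  fixes f g w :: "real^'n::finite \<Rightarrow> ennreal" and S :: "((real^'n) \<times> (real^'n)) set"
  assumes [measurable]: "f \<in> borel_measurable borel" "g \<in> borel_measurable borel" "w \<in> borel_measurable borel"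
    and S[measurable]: "S \<in> sets (borel \<Otimes>\<^sub>M borel)"
    and kernel: "\<And>\<eta>. (\<integral>\<^sup>+x. indicator S (x, \<eta>) * w (x + \<eta>) * ennreal (1 / norm x ^ (CARD('n) - 2)) \<partial>lborel)
        \<le> \<kappa> * freq_weight \<eta>"
  shows "(\<integral>\<^sup>+\<xi>. w \<xi> * (\<integral>\<^sup>+x. f x * g (\<xi> - x) * indicator S (x, \<xi> - x) \<partial>lborel)\<^sup>2 \<partial>lborel)
      \<le> \<kappa> * norm2 f * norm2 g"
proof -
  let ?v = "\<lambda>x::real^'n. ennreal (1 / norm x ^ (CARD('n) - 2))"
  let ?a = "\<lambda>x::real^'n. ennreal (sqrt (norm x ^ (CARD('n) - 2)))"
  let ?b = "\<lambda>x::real^'n. ennreal (1 / sqrt (norm x ^ (CARD('n) - 2)))"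
  have a2: "(?a x)\<^sup>2 = freq_weight x" and b2: "(?b x)\<^sup>2 = ?v x" for x
    by (simp_all add: freq_weight_def ennreal_power power_divide)
  \<comment> \<open>At the origin the reciprocal weight may be 1 / 0 = 0, so the product is 1 only
    off a null set.\<close>
  have ab: "AE x in lborel. ?a x * ?b x = 1"
  proof -
    have "AE x in (lborel :: (real^'n) measure). x \<noteq> 0" by (rule AE_lborel_singleton)
    then show ?thesis by eventually_elim (subst ennreal_mult[symmetric], auto)
  qed
  have point: "(\<integral>\<^sup>+x. f x * g (\<xi> - x) * indicator S (x, \<xi> - x) \<partial>lborel)\<^sup>2
      \<le> norm2 f * (\<integral>\<^sup>+x. (g (\<xi> - x))\<^sup>2 * indicator S (x, \<xi> - x) * ?v x \<partial>lborel)" for \<xi>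
  proof -
    have "(\<integral>\<^sup>+x. f x * g (\<xi> - x) * indicator S (x, \<xi> - x) \<partial>lborel)
       = (\<integral>\<^sup>+x. (?a x * f x) * (?b x * g (\<xi> - x) * indicator S (x, \<xi> - x)) \<partial>lborel)"
      using ab
    proof (intro nn_integral_cong_AE, eventually_elim)
      case (elim x)
      have "(?a x * f x) * (?b x * g (\<xi> - x) * indicator S (x, \<xi> - x))
        = (?a x * ?b x) * (f x * g (\<xi> - x) * indicator S (x, \<xi> - x))" by (simp only: mult_ac)
      then show ?case by (simp only: elim mult_1)
    qed
    also have "\<dots>\<^sup>2 \<le> (\<integral>\<^sup>+x. (?a x * f x)\<^sup>2 \<partial>lborel) * (\<integral>\<^sup>+x. (?b x * g (\<xi> - x) * indicator S (x, \<xi> - x))\<^sup>2 \<partial>lborel)"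
      by (rule Cauchy_Schwarz_nn_integral) measurable
    also have "(\<integral>\<^sup>+x. (?a x * f x)\<^sup>2 \<partial>lborel) = norm2 f"
      unfolding norm2_def by (simp only: power_mult_distrib a2)
    also have "(\<integral>\<^sup>+x. (?b x * g (\<xi> - x) * indicator S (x, \<xi> - x))\<^sup>2 \<partial>lborel)
       = (\<integral>\<^sup>+x. (g (\<xi> - x))\<^sup>2 * indicator S (x, \<xi> - x) * ?v x \<partial>lborel)"
      by (rule nn_integral_cong) (simp add: power_mult_distrib b2 indicator_def mult.commute)
    finally show ?thesis .
  qed
  have "(\<integral>\<^sup>+\<xi>. w \<xi> * (\<integral>\<^sup>+x. f x * g (\<xi> - x) * indicator S (x, \<xi> - x) \<partial>lborel)\<^sup>2 \<partial>lborel)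
     \<le> (\<integral>\<^sup>+\<xi>. w \<xi> * (norm2 f * (\<integral>\<^sup>+x. (g (\<xi> - x))\<^sup>2 * indicator S (x, \<xi> - x) * ?v x \<partial>lborel)) \<partial>lborel)"
    by (intro nn_integral_mono mult_left_mono point) simp
  also have "\<dots> = (\<integral>\<^sup>+\<xi>. \<integral>\<^sup>+x. norm2 f * (w \<xi> * (g (\<xi> - x))\<^sup>2 * indicator S (x, \<xi> - x) * ?v x) \<partial>lborel \<partial>lborel)"
    by (subst nn_integral_cmult[symmetric], measurable)+ (simp add: mult_ac)
  also have "\<dots> = (\<integral>\<^sup>+x. \<integral>\<^sup>+\<xi>. norm2 f * (w \<xi> * (g (\<xi> - x))\<^sup>2 * indicator S (x, \<xi> - x) * ?v x) \<partial>lborel \<partial>lborel)"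
    by (rule lborel_pair.Fubini') measurable
  also have "\<dots> = (\<integral>\<^sup>+x. \<integral>\<^sup>+\<eta>. norm2 f * (w (x + \<eta>) * (g \<eta>)\<^sup>2 * indicator S (x, \<eta>) * ?v x) \<partial>lborel \<partial>lborel)"
  proof (rule nn_integral_cong)
    fix x :: "real^'n"
    have "(\<integral>\<^sup>+\<xi>. norm2 f * (w \<xi> * (g (\<xi> - x))\<^sup>2 * indicator S (x, \<xi> - x) * ?v x) \<partial>lborel)
       = (\<integral>\<^sup>+\<xi>. (\<lambda>\<eta>. norm2 f * (w (x + \<eta>) * (g \<eta>)\<^sup>2 * indicator S (x, \<eta>) * ?v x)) (\<xi> + (- x)) \<partial>lborel)"
      by simp
    also have "\<dots> = (\<integral>\<^sup>+\<eta>. norm2 f * (w (x + \<eta>) * (g \<eta>)\<^sup>2 * indicator S (x, \<eta>) * ?v x) \<partial>lborel)"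
      by (rule nn_integral_translate) measurable
    finally show "(\<integral>\<^sup>+\<xi>. norm2 f * (w \<xi> * (g (\<xi> - x))\<^sup>2 * indicator S (x, \<xi> - x) * ?v x) \<partial>lborel)
      = (\<integral>\<^sup>+\<eta>. norm2 f * (w (x + \<eta>) * (g \<eta>)\<^sup>2 * indicator S (x, \<eta>) * ?v x) \<partial>lborel)" .
  qed
  also have "\<dots> = (\<integral>\<^sup>+\<eta>. \<integral>\<^sup>+x. norm2 f * (w (x + \<eta>) * (g \<eta>)\<^sup>2 * indicator S (x, \<eta>) * ?v x) \<partial>lborel \<partial>lborel)"
    by (rule lborel_pair.Fubini') measurable
  also have "\<dots> = (\<integral>\<^sup>+\<eta>. (norm2 f * (g \<eta>)\<^sup>2) * (\<integral>\<^sup>+x. indicator S (x, \<eta>) * w (x + \<eta>) * ?v x \<partial>lborel) \<partial>lborel)"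
    by (subst nn_integral_cmult[symmetric], measurable) (simp add: mult_ac)
  also have "\<dots> \<le> (\<integral>\<^sup>+\<eta>. (norm2 f * (g \<eta>)\<^sup>2) * (\<kappa> * freq_weight \<eta>) \<partial>lborel)"
    by (intro nn_integral_mono mult_left_mono kernel) simp
  also have "\<dots> = (\<integral>\<^sup>+\<eta>. (\<kappa> * norm2 f) * (freq_weight \<eta> * (g \<eta>)\<^sup>2) \<partial>lborel)" by (simp add: mult_ac)
  also have "\<dots> = (\<kappa> * norm2 f) * (\<integral>\<^sup>+\<eta>. freq_weight \<eta> * (g \<eta>)\<^sup>2 \<partial>lborel)" by (rule nn_integral_cmult) measurable
  also have "\<dots> = \<kappa> * norm2 f * norm2 g" by (simp add: norm2_def)
  finally show ?thesis .
qed

definition sing_const :: "'n::finite itself \<Rightarrow> real" where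
  "sing_const t = (2 * real CARD('n)) ^ CARD('n)"

lemma sing_const_nonneg: "sing_const t \<ge> 0"
  by (simp add: sing_const_def)

lemma singularity_translate:
  assumes r: "r \<ge> 0"
  shows "(\<integral>\<^sup>+x. indicator (cball 0 r) (x + \<eta>) * ennreal (1 / norm (x + \<eta>) ^ (CARD('n) - 1)) \<partial>(lborel :: (real^'n::finite) measure))
    \<le> ennreal (sing_const TYPE('n) * r)"
proof -
  have "(\<integral>\<^sup>+x. (\<lambda>y. indicator (cball 0 r) y * ennreal (1 / norm y ^ (CARD('n) - 1))) (x + \<eta>) \<partial>(lborel :: (real^'n::finite) measure))
     = (\<integral>\<^sup>+y. indicator (cball 0 r) y * ennreal (1 / norm y ^ (CARD('n) - 1)) \<partial>(lborel :: (real^'n::finite) measure))"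
    by (rule nn_integral_translate) measurable
  then show ?thesis using nn_integral_norm_singularity[OF r, where 'n='n] by (simp add: sing_const_def)
qed

text \<open>With p = |x| and q = |x + \<eta>| \<le> 2|\<eta>| the integrand is q^(n-3) / (q
  p^(n-2)). The first factor is at most (2|\<eta>|)^(n-3); the second is at most 1 / p^(n-1) or 1 /
  q^(n-1), according to which of p and q is smaller. The integrals of these singularities over balls
  of radii |\<eta>| and 2|\<eta>| add up to the factor 3.\<close>

lemma kernel_bound_near:
  fixes \<eta> :: "real^'n::finite"
  assumes n: "CARD('n) \<ge> 3"
  shows "(\<integral>\<^sup>+x. indicator {(x, \<eta>). norm x \<le> norm \<eta>} (x, \<eta>) * low_weight (x + \<eta>) * ennreal (1 / norm x ^ (CARD('n) - 2)) \<partial>lborel)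
     \<le> ennreal (3 * 2 ^ (CARD('n) - 3) * sing_const TYPE('n)) * freq_weight \<eta>"
proof -
  let ?N = "CARD('n)" and ?r = "norm \<eta>"
  let ?s = "\<lambda>r x::real^'n. indicator (cball 0 r) x * ennreal (1 / norm x ^ (?N - 1))"
  let ?c = "(2 * ?r) ^ (?N - 3)"
  have e: "?N - 2 = Suc (?N - 3)" "?N - 1 = Suc (Suc (?N - 3))" using n by simp_all
  have main: "AE x in lborel. indicator {(x, \<eta>). norm x \<le> norm \<eta>} (x, \<eta>) * low_weight (x + \<eta>) * ennreal (1 / norm x ^ (?N - 2))
     \<le> ennreal ?c * (?s ?r x + ?s (2 * ?r) (x + \<eta>))"
  proof -
    have "AE x in lborel. x \<noteq> (0::real^'n)" "AE x in lborel. x \<noteq> - \<eta>" by (rule AE_lborel_singleton)+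
    then show ?thesis
    proof eventually_elim
      case (elim x)
      show ?case
      proof (cases "norm x \<le> norm \<eta>")
        case True
        define p q where "p = norm x" and "q = norm (x + \<eta>)"
        have p: "p > 0" and q: "q > 0" using elim by (auto simp: p_def q_def eq_neg_iff_add_eq_0)
        have q2: "q \<le> 2 * ?r" using norm_triangle_ineq[of x \<eta>] True by (simp add: q_def)
        have "q ^ (?N - 2) / q\<^sup>2 * (1 / p ^ (?N - 2)) = q ^ (?N - 3) * (1 / (q * p ^ (?N - 2)))"
          using p q unfolding e by (simp add: power2_eq_square field_simps)
        also have "\<dots> \<le> ?c * (1 / p ^ (?N - 1) + 1 / q ^ (?N - 1))"
        proof (rule mult_mono)
          show "q ^ (?N - 3) \<le> ?c" using q2 q by (intro power_mono) auto
          show "1 / (q * p ^ (?N - 2)) \<le> 1 / p ^ (?N - 1) + 1 / q ^ (?N - 1)"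
          proof (cases "p \<le> q")
            case True
            have "p ^ (?N - 1) \<le> q * p ^ (?N - 2)" using True p unfolding e by (simp add: mult_right_mono)
            then have "1 / (q * p ^ (?N - 2)) \<le> 1 / p ^ (?N - 1)" using p q by (intro divide_left_mono) auto
            moreover have "0 \<le> 1 / q ^ (?N - 1)" using q by simp
            ultimately show ?thesis by linarith
          next
            case False
            have "q ^ (?N - 2) \<le> p ^ (?N - 2)" using False q by (intro power_mono) auto
            then have "q ^ (?N - 1) \<le> q * p ^ (?N - 2)" using q unfolding e by (simp add: mult_left_mono)
            then have "1 / (q * p ^ (?N - 2)) \<le> 1 / q ^ (?N - 1)" using p q by (intro divide_left_mono) auto
            moreover have "0 \<le> 1 / p ^ (?N - 1)" using p by simp
            ultimately show ?thesis by linarith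
          qed
        qed (use p q in auto)
        finally have "ennreal (q ^ (?N - 2) / q\<^sup>2 * (1 / p ^ (?N - 2))) \<le> ennreal (?c * (1 / p ^ (?N - 1) + 1 / q ^ (?N - 1)))"
          by (rule ennreal_leI)
        also have "\<dots> = ennreal ?c * (ennreal (1 / p ^ (?N - 1)) + ennreal (1 / q ^ (?N - 1)))"
          using p q by (simp add: ennreal_mult)
        also have "ennreal (q ^ (?N - 2) / q\<^sup>2 * (1 / p ^ (?N - 2))) = low_weight (x + \<eta>) * ennreal (1 / norm x ^ (?N - 2))"
          using p q by (subst ennreal_mult) (auto simp: low_weight_def p_def q_def)
        finally show ?thesis using True q2 by (simp add: p_def q_def)
      qed simp
    qed
  qed
  have "(\<integral>\<^sup>+x. indicator {(x, \<eta>). norm x \<le> norm \<eta>} (x, \<eta>) * low_weight (x + \<eta>) * ennreal (1 / norm x ^ (?N - 2)) \<partial>lborel)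
    \<le> (\<integral>\<^sup>+x. ennreal ?c * (?s ?r x + ?s (2 * ?r) (x + \<eta>)) \<partial>lborel)"
    by (rule nn_integral_mono_AE[OF main])
  also have "\<dots> = ennreal ?c * (\<integral>\<^sup>+x. ?s ?r x + ?s (2 * ?r) (x + \<eta>) \<partial>lborel)"
    by (rule nn_integral_cmult) measurable
  also have "(\<integral>\<^sup>+x. ?s ?r x + ?s (2 * ?r) (x + \<eta>) \<partial>lborel)
      = (\<integral>\<^sup>+x. ?s ?r x \<partial>lborel) + (\<integral>\<^sup>+x. ?s (2 * ?r) (x + \<eta>) \<partial>lborel)"
    by (rule nn_integral_add) measurable
  also have "ennreal ?c * ((\<integral>\<^sup>+x. ?s ?r x \<partial>lborel) + (\<integral>\<^sup>+x. ?s (2 * ?r) (x + \<eta>) \<partial>lborel))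
      \<le> ennreal ?c * (ennreal (sing_const TYPE('n) * ?r) + ennreal (sing_const TYPE('n) * (2 * ?r)))"
    using nn_integral_norm_singularity[of ?r, where 'n='n]
    by (intro mult_left_mono add_mono singularity_translate) (auto simp: sing_const_def)
  also have "\<dots> = ennreal (?c * (sing_const TYPE('n) * ?r + sing_const TYPE('n) * (2 * ?r)))"
  proof -
    have nn: "0 \<le> sing_const TYPE('n) * ?r" "0 \<le> sing_const TYPE('n) * (2 * ?r)" "0 \<le> ?c"
      by (simp_all add: sing_const_nonneg)
    show ?thesis
      unfolding ennreal_plus[OF nn(1,2), symmetric] by (rule ennreal_mult[symmetric]) (use nn in auto)
  qed
  also have "?c * (sing_const TYPE('n) * ?r + sing_const TYPE('n) * (2 * ?r))
     = 3 * 2 ^ (?N - 3) * sing_const TYPE('n) * ?r ^ (?N - 2)"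
    unfolding e by (simp add: power_mult_distrib algebra_simps)
  also have "ennreal \<dots> = ennreal (3 * 2 ^ (?N - 3) * sing_const TYPE('n)) * freq_weight \<eta>"
    by (simp add: freq_weight_def ennreal_mult sing_const_nonneg)
  finally show ?thesis .
qed

text \<open>An output frequency q \<ge> R \<ge> 2M with |x| \<le> M forces q \<le> 2|\<eta>|. The
  factor 1 / R^2 comes from dividing by q^2, and M^2 comes from 1 / |x|^(n-2) \<le> M / |x|^(n-1),
  integrated over the ball of radius M.\<close>

lemma kernel_bound_high:
  fixes \<eta> :: "real^'n::finite"
  assumes n: "CARD('n) \<ge> 3" and M: "M > 0" "2 * M \<le> R"
  shows "(\<integral>\<^sup>+x. indicator {(x, \<eta>). norm x \<le> M} (x, \<eta>) * (indicator {\<xi>. R \<le> norm \<xi>} (x + \<eta>) * low_weight (x + \<eta>))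
       * ennreal (1 / norm x ^ (CARD('n) - 2)) \<partial>lborel)
     \<le> ennreal (2 ^ (CARD('n) - 2) * sing_const TYPE('n) * (M / R)\<^sup>2) * freq_weight \<eta>"
proof -
  let ?N = "CARD('n)"
  have e: "?N - 1 = Suc (?N - 2)" using n by simp
  have R: "R > 0" using M by simp
  let ?s = "\<lambda>r x::real^'n. indicator (cball 0 r) x * ennreal (1 / norm x ^ (?N - 1))"
  let ?c = "(2 * norm \<eta>) ^ (?N - 2) / R\<^sup>2 * M"
  have main: "AE x in lborel. indicator {(x, \<eta>). norm x \<le> M} (x, \<eta>) * (indicator {\<xi>. R \<le> norm \<xi>} (x + \<eta>) * low_weight (x + \<eta>))
     * ennreal (1 / norm x ^ (?N - 2)) \<le> ennreal ?c * ?s M x"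
  proof -
    have "AE x in lborel. x \<noteq> (0::real^'n)" by (rule AE_lborel_singleton)
    then show ?thesis
    proof eventually_elim
      case (elim x)
      show ?case
      proof (cases "norm x \<le> M \<and> R \<le> norm (x + \<eta>)")
        case True
        define p q where "p = norm x" and "q = norm (x + \<eta>)"
        have p: "p > 0" "p \<le> M" and q: "R \<le> q" using elim True by (auto simp: p_def q_def)
        have q2: "q \<le> 2 * norm \<eta>" using norm_triangle_ineq[of x \<eta>] True M by (simp add: q_def)
        have "q ^ (?N - 2) / q\<^sup>2 * (1 / p ^ (?N - 2)) \<le> (2 * norm \<eta>) ^ (?N - 2) / R\<^sup>2 * (M * (1 / p ^ (?N - 1)))"
        proof (rule mult_mono)
          show "q ^ (?N - 2) / q\<^sup>2 \<le> (2 * norm \<eta>) ^ (?N - 2) / R\<^sup>2"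
            using q q2 R by (intro frac_le power_mono) auto
          have "p / (p * p ^ (?N - 2)) \<le> M / (p * p ^ (?N - 2))" using p by (intro divide_right_mono) auto
          then show "1 / p ^ (?N - 2) \<le> M * (1 / p ^ (?N - 1))" using p unfolding e by simp
        qed (use p q R in auto)
        then have "ennreal (q ^ (?N - 2) / q\<^sup>2 * (1 / p ^ (?N - 2))) \<le> ennreal (?c * (1 / p ^ (?N - 1)))"
          by (intro ennreal_leI) (simp add: mult.assoc)
        also have "\<dots> = ennreal ?c * ennreal (1 / p ^ (?N - 1))"
          using p M by (intro ennreal_mult) auto
        also have "ennreal (q ^ (?N - 2) / q\<^sup>2 * (1 / p ^ (?N - 2))) = low_weight (x + \<eta>) * ennreal (1 / norm x ^ (?N - 2))"
          using p q by (subst ennreal_mult) (auto simp: low_weight_def p_def q_def)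
        finally show ?thesis using True by (simp add: p_def q_def)
      qed (auto simp: indicator_def)
    qed
  qed
  have "(\<integral>\<^sup>+x. indicator {(x, \<eta>). norm x \<le> M} (x, \<eta>) * (indicator {\<xi>. R \<le> norm \<xi>} (x + \<eta>) * low_weight (x + \<eta>))
       * ennreal (1 / norm x ^ (?N - 2)) \<partial>lborel) \<le> (\<integral>\<^sup>+x. ennreal ?c * ?s M x \<partial>lborel)"
    by (rule nn_integral_mono_AE[OF main])
  also have "\<dots> = ennreal ?c * (\<integral>\<^sup>+x. ?s M x \<partial>lborel)" by (rule nn_integral_cmult) measurable
  also have "\<dots> \<le> ennreal ?c * ennreal (sing_const TYPE('n) * M)"
    using nn_integral_norm_singularity[of M, where 'n='n] M by (intro mult_left_mono) (auto simp: sing_const_def)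
  also have "\<dots> = ennreal (?c * (sing_const TYPE('n) * M))"
    using M by (subst ennreal_mult) (auto simp: sing_const_nonneg)
  also have "?c * (sing_const TYPE('n) * M) = 2 ^ (?N - 2) * sing_const TYPE('n) * (M / R)\<^sup>2 * norm \<eta> ^ (?N - 2)"
    by (simp add: power_mult_distrib power_divide power2_eq_square)
  also have "ennreal \<dots> = ennreal (2 ^ (?N - 2) * sing_const TYPE('n) * (M / R)\<^sup>2) * freq_weight \<eta>"
    by (simp add: freq_weight_def ennreal_mult sing_const_nonneg)
  finally show ?thesis .
qed

lemma sets_near: "{(x::real^'n::finite, \<eta>::real^'n). norm x \<le> norm \<eta>} \<in> sets (borel \<Otimes>\<^sub>M borel)"
proof -
  have "{(x::real^'n, \<eta>::real^'n). norm x \<le> norm \<eta>} = {p \<in> space (borel \<Otimes>\<^sub>M borel). norm (fst p) \<le> norm (snd p)}"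
    by (auto simp: space_pair_measure)
  then show ?thesis by (simp only:) measurable
qed

lemma sets_cut: "{(x::real^'n::finite, \<eta>::real^'n). norm x \<le> M} \<in> sets (borel \<Otimes>\<^sub>M borel)"
proof -
  have "{(x::real^'n, \<eta>::real^'n). norm x \<le> M} = {p \<in> space (borel \<Otimes>\<^sub>M borel). norm (fst p) \<le> M}"
    by (auto simp: space_pair_measure)
  then show ?thesis by (simp only:) measurable
qed

text \<open>The 12 is 3 from \<open>kernel_bound_near\<close>, times 2 for the square of a sum,
  times 2 for the two symmetric halves.\<close>

definition conv_const :: "'n::finite itself \<Rightarrow> real" where
  "conv_const t = 12 * 2 ^ (CARD('n) - 3) * sing_const t"

lemma conv_const_nonneg: "conv_const t \<ge> 0"
  by (simp add: conv_const_def sing_const_nonneg)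

text \<open>Of two frequencies one is the smaller, and \<open>kernel_bound_near\<close> wants it in
  the first place. The convolution is therefore split into two halves, exchanged by the reflection
  of x to \<xi> - x.\<close>

theorem conv_bound:
  fixes f g :: "real^'n::finite \<Rightarrow> ennreal"
  assumes n: "CARD('n) \<ge> 3" and f[measurable]: "f \<in> borel_measurable borel" and g[measurable]: "g \<in> borel_measurable borel"
  shows "(\<integral>\<^sup>+\<xi>. low_weight \<xi> * (conv f g \<xi>)\<^sup>2 \<partial>lborel) \<le> ennreal (conv_const TYPE('n)) * norm2 f * norm2 g"
proof -
  let ?S = "{(x::real^'n, \<eta>::real^'n). norm x \<le> norm \<eta>}"
  let ?\<kappa> = "ennreal (3 * 2 ^ (CARD('n) - 3) * sing_const TYPE('n))"
  note [measurable] = sets_near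
  define L where "L f g \<xi> = (\<integral>\<^sup>+x. f x * g (\<xi> - x) * indicator ?S (x, \<xi> - x) \<partial>lborel)" for f g :: "real^'n \<Rightarrow> ennreal" and \<xi>
  have Lm[measurable]: "L f g \<in> borel_measurable borel" if [measurable]: "f \<in> borel_measurable borel" "g \<in> borel_measurable borel" for f g
    unfolding L_def[abs_def] by measurable
  have L: "(\<integral>\<^sup>+\<xi>. low_weight \<xi> * (L f g \<xi>)\<^sup>2 \<partial>lborel) \<le> ?\<kappa> * norm2 f * norm2 g"
    if "f \<in> borel_measurable borel" "g \<in> borel_measurable borel" for f g
    unfolding L_def by (rule weighted_Schur[OF that low_weight_measurable sets_near kernel_bound_near[OF n]])
  have split: "conv f g \<xi> \<le> L f g \<xi> + L g f \<xi>" for \<xi>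
  proof -
    have "conv f g \<xi> \<le> (\<integral>\<^sup>+x. f x * g (\<xi> - x) * indicator ?S (x, \<xi> - x)
         + (\<lambda>y. g y * f (\<xi> - y) * indicator ?S (y, \<xi> - y)) (\<xi> - x) \<partial>lborel)"
      unfolding conv_def by (rule nn_integral_mono) (auto simp: indicator_def mult.commute)
    also have "\<dots> = L f g \<xi> + (\<integral>\<^sup>+x. (\<lambda>y. g y * f (\<xi> - y) * indicator ?S (y, \<xi> - y)) (\<xi> - x) \<partial>lborel)"
      unfolding L_def by (rule nn_integral_add) measurable
    also have "(\<integral>\<^sup>+x. (\<lambda>y. g y * f (\<xi> - y) * indicator ?S (y, \<xi> - y)) (\<xi> - x) \<partial>lborel) = L g f \<xi>"
      unfolding L_def by (rule nn_integral_reflect) measurable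
    finally show ?thesis .
  qed
  have "(\<integral>\<^sup>+\<xi>. low_weight \<xi> * (conv f g \<xi>)\<^sup>2 \<partial>lborel)
     \<le> (\<integral>\<^sup>+\<xi>. 2 * (low_weight \<xi> * (L f g \<xi>)\<^sup>2) + 2 * (low_weight \<xi> * (L g f \<xi>)\<^sup>2) \<partial>lborel)"
  proof (rule nn_integral_mono)
    fix \<xi> :: "real^'n"
    have "(conv f g \<xi>)\<^sup>2 \<le> (L f g \<xi> + L g f \<xi>)\<^sup>2" by (rule power_mono[OF split]) simp
    also have "\<dots> \<le> 2 * (L f g \<xi>)\<^sup>2 + 2 * (L g f \<xi>)\<^sup>2" by (rule power2_add_le_ennreal)
    finally have "low_weight \<xi> * (conv f g \<xi>)\<^sup>2 \<le> low_weight \<xi> * (2 * (L f g \<xi>)\<^sup>2 + 2 * (L g f \<xi>)\<^sup>2)"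
      by (rule mult_left_mono) simp
    then show "low_weight \<xi> * (conv f g \<xi>)\<^sup>2 \<le> 2 * (low_weight \<xi> * (L f g \<xi>)\<^sup>2) + 2 * (low_weight \<xi> * (L g f \<xi>)\<^sup>2)"
      by (simp add: distrib_left mult.left_commute)
  qed
  also have "\<dots> = 2 * (\<integral>\<^sup>+\<xi>. low_weight \<xi> * (L f g \<xi>)\<^sup>2 \<partial>lborel) + 2 * (\<integral>\<^sup>+\<xi>. low_weight \<xi> * (L g f \<xi>)\<^sup>2 \<partial>lborel)"
    by (simp add: nn_integral_add nn_integral_cmult)
  also have "\<dots> \<le> 2 * (?\<kappa> * norm2 f * norm2 g) + 2 * (?\<kappa> * norm2 g * norm2 f)"
    by (intro add_mono mult_left_mono L f g) simp_all
  also have "\<dots> = (2 * ?\<kappa> + 2 * ?\<kappa>) * norm2 f * norm2 g"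
    by (simp add: distrib_left distrib_right mult_ac)
  also have "2 * ?\<kappa> + 2 * ?\<kappa> = ennreal (conv_const TYPE('n))"
  proof -
    define k where "k = 3 * 2 ^ (CARD('n) - 3) * sing_const TYPE('n)"
    have k: "k \<ge> 0" by (simp add: k_def sing_const_nonneg)
    have "2 * ennreal k = ennreal (2 * k)" using k by (simp add: ennreal_mult)
    then have "2 * ennreal k + 2 * ennreal k = ennreal (2 * k + 2 * k)"
      using k by (simp only: ennreal_plus mult_nonneg_nonneg zero_le_numeral)
    moreover have "2 * k + 2 * k = conv_const TYPE('n)" by (simp add: conv_const_def k_def)
    ultimately show ?thesis by (simp only: k_def)
  qed
  finally show ?thesis .
qed

text \<open>Only \<open>f\<close> is split, at frequency M. Its low part reaches outputs above R
  only through high frequencies of \<open>g\<close>, at the price (M/R)^2; its high part is treated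
  by \<open>conv_bound\<close>. No smallness of \<open>g\<close> enters, so \<open>g\<close> can be
  the difference of two solutions.\<close>

theorem conv_bound_high:
  fixes f g :: "real^'n::finite \<Rightarrow> ennreal"
  assumes n: "CARD('n) \<ge> 3" and f[measurable]: "f \<in> borel_measurable borel" and g[measurable]: "g \<in> borel_measurable borel"
    and M: "M > 0" "2 * M \<le> R"
  shows "(\<integral>\<^sup>+\<xi>. indicator {\<xi>. R \<le> norm \<xi>} \<xi> * low_weight \<xi> * (conv f g \<xi>)\<^sup>2 \<partial>lborel)
     \<le> ennreal (2 * conv_const TYPE('n)) * (ennreal ((M / R)\<^sup>2) * norm2 f + norm2 (\<lambda>\<xi>. indicator {\<xi>. M < norm \<xi>} \<xi> * f \<xi>)) * norm2 g"
proof -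
  let ?S = "{(x::real^'n, \<eta>::real^'n). norm x \<le> M}"
  let ?h = "\<lambda>\<xi>. indicator {\<xi>. M < norm \<xi>} \<xi> * f \<xi>"
  let ?w = "\<lambda>\<xi>::real^'n. indicator {\<xi>. R \<le> norm \<xi>} \<xi> * low_weight \<xi>"
  let ?\<kappa> = "ennreal (2 ^ (CARD('n) - 2) * sing_const TYPE('n) * (M / R)\<^sup>2)"
  note [measurable] = sets_cut
  define L where "L \<xi> = (\<integral>\<^sup>+x. f x * g (\<xi> - x) * indicator ?S (x, \<xi> - x) \<partial>lborel)" for \<xi>
  have Lm[measurable]: "L \<in> borel_measurable borel" unfolding L_def[abs_def] by measurable
  have wm[measurable]: "?w \<in> borel_measurable borel" by measurable
  have hm[measurable]: "?h \<in> borel_measurable borel" by measurable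
  have L: "(\<integral>\<^sup>+\<xi>. ?w \<xi> * (L \<xi>)\<^sup>2 \<partial>lborel) \<le> ?\<kappa> * norm2 f * norm2 g"
    unfolding L_def by (rule weighted_Schur[OF f g wm sets_cut kernel_bound_high[OF n M]])
  have split: "conv f g \<xi> = L \<xi> + conv ?h g \<xi>" for \<xi>
  proof -
    have "conv f g \<xi> = (\<integral>\<^sup>+x. f x * g (\<xi> - x) * indicator ?S (x, \<xi> - x) + ?h x * g (\<xi> - x) \<partial>lborel)"
      unfolding conv_def by (rule nn_integral_cong) (auto simp: indicator_def)
    also have "\<dots> = L \<xi> + conv ?h g \<xi>" unfolding L_def conv_def by (rule nn_integral_add) measurable
    finally show ?thesis .
  qed
  have "(\<integral>\<^sup>+\<xi>. ?w \<xi> * (conv f g \<xi>)\<^sup>2 \<partial>lborel)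
     \<le> (\<integral>\<^sup>+\<xi>. 2 * (?w \<xi> * (L \<xi>)\<^sup>2) + 2 * (low_weight \<xi> * (conv ?h g \<xi>)\<^sup>2) \<partial>lborel)"
  proof (rule nn_integral_mono)
    fix \<xi> :: "real^'n"
    have "?w \<xi> * (conv f g \<xi>)\<^sup>2 \<le> ?w \<xi> * (2 * (L \<xi>)\<^sup>2 + 2 * (conv ?h g \<xi>)\<^sup>2)"
      unfolding split by (rule mult_left_mono[OF power2_add_le_ennreal]) simp
    also have "\<dots> = 2 * (?w \<xi> * (L \<xi>)\<^sup>2) + 2 * (?w \<xi> * (conv ?h g \<xi>)\<^sup>2)"
      by (simp add: distrib_left mult.left_commute)
    also have "\<dots> \<le> 2 * (?w \<xi> * (L \<xi>)\<^sup>2) + 2 * (low_weight \<xi> * (conv ?h g \<xi>)\<^sup>2)"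
      by (intro add_mono mult_left_mono mult_right_mono order_refl) (auto simp: indicator_def)
    finally show "?w \<xi> * (conv f g \<xi>)\<^sup>2 \<le> 2 * (?w \<xi> * (L \<xi>)\<^sup>2) + 2 * (low_weight \<xi> * (conv ?h g \<xi>)\<^sup>2)" .
  qed
  also have "\<dots> = 2 * (\<integral>\<^sup>+\<xi>. ?w \<xi> * (L \<xi>)\<^sup>2 \<partial>lborel) + 2 * (\<integral>\<^sup>+\<xi>. low_weight \<xi> * (conv ?h g \<xi>)\<^sup>2 \<partial>lborel)"
    by (subst nn_integral_add) (auto simp: nn_integral_cmult)
  also have "\<dots> \<le> 2 * (?\<kappa> * norm2 f * norm2 g) + 2 * (ennreal (conv_const TYPE('n)) * norm2 ?h * norm2 g)"
    by (intro add_mono mult_left_mono L conv_bound[OF n hm g]) simp_all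
  also have "\<dots> \<le> 2 * (ennreal (conv_const TYPE('n)) * ennreal ((M / R)\<^sup>2) * norm2 f * norm2 g)
      + 2 * (ennreal (conv_const TYPE('n)) * norm2 ?h * norm2 g)"
  proof (intro add_mono mult_left_mono mult_right_mono order_refl)
    have "CARD('n) - 2 = Suc (CARD('n) - 3)" using n by simp
    then have "2 ^ (CARD('n) - 2) = 2 * (2::real) ^ (CARD('n) - 3)" by simp
    then have "2 ^ (CARD('n) - 2) * sing_const TYPE('n) \<le> conv_const TYPE('n)"
      using sing_const_nonneg[of "TYPE('n)"] by (simp add: conv_const_def)
    then have "?\<kappa> \<le> ennreal (conv_const TYPE('n) * (M / R)\<^sup>2)" by (intro ennreal_leI mult_right_mono) auto
    then show "?\<kappa> \<le> ennreal (conv_const TYPE('n)) * ennreal ((M / R)\<^sup>2)"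
      by (simp add: ennreal_mult conv_const_nonneg)
  qed simp_all
  also have "\<dots> = ennreal (2 * conv_const TYPE('n)) * (ennreal ((M / R)\<^sup>2) * norm2 f + norm2 ?h) * norm2 g"
    by (simp add: ennreal_mult conv_const_nonneg distrib_left distrib_right mult_ac)
  finally show ?thesis .
qed

text \<open>The elementary inequality c \<le> a c^2 + 1/a, with \<open>low_weight\<close> for a,
  reduces the claim to \<open>conv_bound\<close>. The remainder 1/a = |\<xi>|^(4-n) is at most r^3 /
  |\<xi>|^(n-1) on the ball of radius r.\<close>

lemma conv_locally_integrable:
  fixes f g :: "real^'n::finite \<Rightarrow> ennreal"
  assumes n: "CARD('n) \<ge> 3" and [measurable]: "f \<in> borel_measurable borel" "g \<in> borel_measurable borel"
    and fin: "norm2 f < \<infinity>" "norm2 g < \<infinity>"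
  shows "(\<integral>\<^sup>+\<xi>. indicator (cball 0 r) \<xi> * conv f g \<xi> \<partial>lborel) < \<infinity>"
proof (cases "r \<ge> 0")
  case True
  let ?N = "CARD('n)"
  let ?s = "\<lambda>x::real^'n. indicator (cball 0 r) x * ennreal (1 / norm x ^ (?N - 1))"
  have e: "?N - 1 = Suc (?N - 2)" using n by simp
  have AM: "c \<le> ennreal a * c\<^sup>2 + ennreal (1 / a)" if a: "a > 0" for a :: real and c :: ennreal
  proof (cases "c = \<top>")
    case False
    then obtain x where x: "c = ennreal x" "x \<ge> 0" by (cases c) auto
    have "x \<le> a * x\<^sup>2 + 1 / a"
    proof -
      have "2 * (a * x) \<le> (a * x)\<^sup>2 + 1" using sum_squares_bound[of "a * x" 1] by simp
      moreover have "0 \<le> a * x" using a x by simp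
      ultimately have "a * x \<le> (a * x)\<^sup>2 + 1" by linarith
      then show ?thesis using a by (simp add: field_simps power2_eq_square)
    qed
    then have "ennreal x \<le> ennreal (a * x\<^sup>2 + 1 / a)" by (rule ennreal_leI)
    then show ?thesis using x a by (simp add: ennreal_mult ennreal_power)
  qed (use a in \<open>simp add: ennreal_mult_eq_top_iff\<close>)
  have "AE \<xi> in lborel. indicator (cball 0 r) \<xi> * conv f g \<xi> \<le> low_weight \<xi> * (conv f g \<xi>)\<^sup>2 + ennreal (r ^ 3) * ?s \<xi>"
  proof -
    have "AE x in lborel. x \<noteq> (0::real^'n)" by (rule AE_lborel_singleton)
    then show ?thesis
    proof eventually_elim
      case (elim \<xi>)
      show ?case
      proof (cases "norm \<xi> \<le> r")
        case True
        define p where "p = norm \<xi>"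
        have p: "p > 0" "p \<le> r" using elim True by (auto simp: p_def)
        have "1 / (p ^ (?N - 2) / p\<^sup>2) = p ^ 3 * (1 / p ^ (?N - 1))"
          using p unfolding e by (simp add: power2_eq_square power3_eq_cube)
        also have "\<dots> \<le> r ^ 3 * (1 / p ^ (?N - 1))" using p by (intro mult_right_mono power_mono) auto
        finally have le: "1 / (p ^ (?N - 2) / p\<^sup>2) \<le> r ^ 3 * (1 / p ^ (?N - 1))" .
        have "conv f g \<xi> \<le> ennreal (p ^ (?N - 2) / p\<^sup>2) * (conv f g \<xi>)\<^sup>2 + ennreal (1 / (p ^ (?N - 2) / p\<^sup>2))"
          by (rule AM) (use p in simp)
        also have "\<dots> \<le> ennreal (p ^ (?N - 2) / p\<^sup>2) * (conv f g \<xi>)\<^sup>2 + ennreal (r ^ 3 * (1 / p ^ (?N - 1)))"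
          by (intro add_left_mono ennreal_leI le)
        also have "ennreal (r ^ 3 * (1 / p ^ (?N - 1))) = ennreal (r ^ 3) * ennreal (1 / p ^ (?N - 1))"
          using p \<open>r \<ge> 0\<close> by (intro ennreal_mult) auto
        finally show ?thesis using True by (simp add: p_def low_weight_def)
      qed simp
    qed
  qed
  then have "(\<integral>\<^sup>+\<xi>. indicator (cball 0 r) \<xi> * conv f g \<xi> \<partial>lborel)
     \<le> (\<integral>\<^sup>+\<xi>. low_weight \<xi> * (conv f g \<xi>)\<^sup>2 + ennreal (r ^ 3) * ?s \<xi> \<partial>lborel)" by (rule nn_integral_mono_AE)
  also have "\<dots> = (\<integral>\<^sup>+\<xi>. low_weight \<xi> * (conv f g \<xi>)\<^sup>2 \<partial>lborel) + ennreal (r ^ 3) * (\<integral>\<^sup>+\<xi>. ?s \<xi> \<partial>lborel)"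
    by (simp add: nn_integral_add nn_integral_cmult)
  also have "\<dots> \<le> ennreal (conv_const TYPE('n)) * norm2 f * norm2 g + ennreal (r ^ 3) * ennreal ((2 * real CARD('n)) ^ CARD('n) * r)"
    by (intro add_mono mult_left_mono conv_bound[OF n] nn_integral_norm_singularity True) simp_all
  also have "\<dots> < \<infinity>" using fin by (simp add: ennreal_mult_less_top)
  finally show ?thesis .
qed (simp add: cball_empty)

section \<open>The Duhamel integral\<close>

text \<open>Two bounds for two regimes: 1/q does not depend on the length of the interval and serves
  high frequencies, the length itself serves low ones.\<close>

lemma nn_integral_exp_decay:
  assumes q: "q > 0" and ab: "a \<le> b"
  shows "(\<integral>\<^sup>+s. indicator {a..b} s * ennreal (exp (- (b - s) * q)) \<partial>lborel) \<le> ennreal (min (1 / q) (b - a))"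
proof -
  have "(\<integral>\<^sup>+s. ennreal (exp (- (b - s) * q)) * indicator {a..b} s \<partial>lborel)
     = ennreal (exp (- (b - b) * q) / q - exp (- (b - a) * q) / q)"
    by (rule nn_integral_FTC_Icc) (use q ab in \<open>auto intro!: derivative_eq_intros\<close>)
  also have "\<dots> \<le> ennreal (1 / q)" using q by (intro ennreal_leI) simp
  finally have 1: "(\<integral>\<^sup>+s. indicator {a..b} s * ennreal (exp (- (b - s) * q)) \<partial>lborel) \<le> ennreal (1 / q)"
    by (simp add: mult.commute)
  have "(\<integral>\<^sup>+s. indicator {a..b} s * ennreal (exp (- (b - s) * q)) \<partial>lborel) \<le> (\<integral>\<^sup>+s. indicator {a..b} s \<partial>lborel)"
  proof (rule nn_integral_mono)
    fix s
    show "indicator {a..b} s * ennreal (exp (- (b - s) * q)) \<le> indicator {a..b} s"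
    proof (cases "s \<in> {a..b}")
      case True
      then have "- (b - s) * q \<le> 0" using q by (intro mult_nonpos_nonneg) auto
      then have "exp (- (b - s) * q) \<le> 1" by (subst exp_le_one_iff)
      then have "ennreal (exp (- (b - s) * q)) \<le> ennreal 1" by (rule ennreal_leI)
      then show ?thesis using True by simp
    qed simp
  qed
  also have "\<dots> = ennreal (b - a)" using ab by simp
  finally show ?thesis using 1 by (simp add: min_def)
qed

lemma nn_integral_exp_decay':
  assumes q: "q > 0" and ab: "a \<le> b"
  shows "(\<integral>\<^sup>+t. indicator {a..b} t * ennreal (exp (- (t - a) * q)) \<partial>lborel) \<le> ennreal (min (1 / q) (b - a))"
proof -
  have "(\<integral>\<^sup>+t. indicator {a..b} t * ennreal (exp (- (t - a) * q)) \<partial>lborel)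
     = (\<integral>\<^sup>+t. (\<lambda>s. indicator {a..b} s * ennreal (exp (- (b - s) * q))) ((a + b) - t) \<partial>lborel)"
    by (rule nn_integral_cong) (auto simp: indicator_def)
  also have "\<dots> = (\<integral>\<^sup>+s. indicator {a..b} s * ennreal (exp (- (b - s) * q)) \<partial>lborel)"
    by (rule nn_integral_reflect) measurable
  finally show ?thesis using nn_integral_exp_decay[OF q ab] by simp
qed

text \<open>The squared weight of order n/2 - 3: two orders below the critical space, which the heat
  kernel of mass at most 1 / |\<xi>|^2 makes up.\<close>

definition heat_weight :: "real^'n::finite \<Rightarrow> ennreal" where
  "heat_weight \<xi> = ennreal (norm \<xi> ^ (CARD('n) - 2) / norm \<xi> ^ 4)"

lemma heat_weight_measurable [measurable]: "heat_weight \<in> borel_measurable borel"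
  unfolding heat_weight_def[abs_def] by measurable

text \<open>The Duhamel integral of a nonnegative majorant \<open>h\<close>. The starting time
  \<open>a\<close> is a parameter, so that the evolution can be restarted at a time up to which the
  majorant is known to vanish.\<close>

definition duhamel_bound :: "(real \<Rightarrow> real^'n::finite \<Rightarrow> ennreal) \<Rightarrow> real \<Rightarrow> real \<Rightarrow> real^'n \<Rightarrow> ennreal" where
  "duhamel_bound h a t \<xi> =
     (\<integral>\<^sup>+s. indicator {a..t} s * ennreal (exp (- (t - s) * (norm \<xi>)\<^sup>2)) * h s \<xi> \<partial>lborel)"

lemma duhamel_bound_measurable:
  fixes h :: "real \<Rightarrow> real^'n::finite \<Rightarrow> ennreal"
  assumes [measurable]: "(\<lambda>(s, \<xi>). h s \<xi>) \<in> borel_measurable (borel \<Otimes>\<^sub>M borel)"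
  shows "(\<lambda>(t, \<xi>). duhamel_bound h a t \<xi>) \<in> borel_measurable (borel \<Otimes>\<^sub>M borel)"
proof -
  \<comment> \<open>An indicator of an interval with a moving endpoint is seen to be jointly
    measurable once it is written as a condition on both variables.\<close>
  have 1: "(\<lambda>p::((real \<times> (real^'n)) \<times> real). indicator {a..fst (fst p)} (snd p) :: ennreal)
      = (\<lambda>p. if a \<le> snd p \<and> snd p \<le> fst (fst p) then 1 else 0)" by (auto simp: indicator_def)
  have 2: "(\<lambda>p. indicator {a..fst (fst p)} (snd p) :: ennreal) \<in> borel_measurable ((borel \<Otimes>\<^sub>M (borel :: (real^'n) measure)) \<Otimes>\<^sub>M borel)"
    unfolding 1 by measurable
  have 3: "(\<lambda>p. h (snd p) (snd (fst p))) \<in> borel_measurable ((borel \<Otimes>\<^sub>M borel :: (real \<times> (real^'n)) measure) \<Otimes>\<^sub>M borel)"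
    by measurable
  have "(\<lambda>p. \<integral>\<^sup>+s. indicator {a..fst p} s * ennreal (exp (- (fst p - s) * (norm (snd p))\<^sup>2)) * h s (snd p) \<partial>lborel)
      \<in> borel_measurable (borel \<Otimes>\<^sub>M (borel :: (real^'n) measure))"
    using 2 3 by (intro lborel.borel_measurable_nn_integral) (simp add: case_prod_beta', measurable)
  then show ?thesis unfolding duhamel_bound_def by (simp add: case_prod_beta')
qed

text \<open>Maximal regularity of the heat semigroup in \<open>L\<^sup>2\<close> in time, at fixed frequency: Young's
  inequality for a kernel of mass at most \<open>min (1 / q) \<tau>\<close>.\<close>

lemma duhamel_Young:
  fixes h :: "real \<Rightarrow> real^'n::finite \<Rightarrow> ennreal"
  assumes h: "(\<lambda>(s, \<xi>). h s \<xi>) \<in> borel_measurable (borel \<Otimes>\<^sub>M borel)" and \<tau>: "\<tau> \<ge> 0" and \<xi>: "\<xi> \<noteq> 0"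
  shows "(\<integral>\<^sup>+t. indicator {a..a + \<tau>} t * (duhamel_bound h a t \<xi>)\<^sup>2 \<partial>lborel)
     \<le> (ennreal (min (1 / (norm \<xi>)\<^sup>2) \<tau>))\<^sup>2 * (\<integral>\<^sup>+s. indicator {a..a + \<tau>} s * (h s \<xi>)\<^sup>2 \<partial>lborel)"
proof -
  define q where "q = (norm \<xi>)\<^sup>2"
  have q: "q > 0" using \<xi> by (simp add: q_def)
  define m where "m = min (1 / q) \<tau>"
  define k where "k = (\<lambda>s. h s \<xi>)"
  have km[measurable]: "k \<in> borel_measurable borel"
    unfolding k_def using measurable_compose[OF _ h, of "\<lambda>s. (s, \<xi>)" borel] by simp
  let ?e = "\<lambda>t s. ennreal (exp (- (t - s) * q))"
  let ?I = "\<lambda>t s. if a \<le> s \<and> s \<le> t \<and> t \<le> a + \<tau> then 1 else 0 :: ennreal"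
  have point: "indicator {a..a + \<tau>} t * (duhamel_bound h a t \<xi>)\<^sup>2
     \<le> ennreal m * (\<integral>\<^sup>+s. ?I t s * ?e t s * (k s)\<^sup>2 \<partial>lborel)" for t
  proof (cases "t \<in> {a..a + \<tau>}")
    case True
    \<comment> \<open>The square root of the kernel: one copy goes into each factor of
      Cauchy-Schwarz, so that the mass of the kernel splits off.\<close>
    let ?r = "\<lambda>s. ennreal (exp (- (t - s) * q / 2))"
    have r2: "(?r s)\<^sup>2 = ?e t s" for s
      by (simp add: ennreal_power exp_double[symmetric])
    have D: "duhamel_bound h a t \<xi> = (\<integral>\<^sup>+s. (indicator {a..t} s * ?r s) * (indicator {a..t} s * ?r s * k s) \<partial>lborel)"
    proof -
      have "indicator {a..t} s * ?e t s * k s = (indicator {a..t} s * ?r s) * (indicator {a..t} s * ?r s * k s)" for s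
        unfolding r2[of s, symmetric] power2_eq_square[of "?r s"]
        by (cases "s \<in> {a..t}") (simp_all only: indicator_simps mult_1 mult_zero_left mult.assoc not_False_eq_True)
      then show ?thesis unfolding duhamel_bound_def k_def q_def[symmetric] by (simp only:)
    qed
    have "(duhamel_bound h a t \<xi>)\<^sup>2 \<le> (\<integral>\<^sup>+s. (indicator {a..t} s * ?r s)\<^sup>2 \<partial>lborel) * (\<integral>\<^sup>+s. (indicator {a..t} s * ?r s * k s)\<^sup>2 \<partial>lborel)"
      unfolding D
      by (rule Cauchy_Schwarz_nn_integral) measurable
    also have "(\<integral>\<^sup>+s. (indicator {a..t} s * ?r s)\<^sup>2 \<partial>lborel) = (\<integral>\<^sup>+s. indicator {a..t} s * ?e t s \<partial>lborel)"
      by (rule nn_integral_cong) (simp only: power_mult_distrib r2, simp add: indicator_def)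
    also have "(\<integral>\<^sup>+s. (indicator {a..t} s * ?r s * k s)\<^sup>2 \<partial>lborel) = (\<integral>\<^sup>+s. ?I t s * ?e t s * (k s)\<^sup>2 \<partial>lborel)"
      using True by (intro nn_integral_cong) (simp only: power_mult_distrib r2, auto simp: indicator_def)
    also have "(\<integral>\<^sup>+s. indicator {a..t} s * ?e t s \<partial>lborel) * (\<integral>\<^sup>+s. ?I t s * ?e t s * (k s)\<^sup>2 \<partial>lborel)
        \<le> ennreal m * (\<integral>\<^sup>+s. ?I t s * ?e t s * (k s)\<^sup>2 \<partial>lborel)"
    proof (rule mult_right_mono)
      have "(\<integral>\<^sup>+s. indicator {a..t} s * ?e t s \<partial>lborel) \<le> ennreal (min (1 / q) (t - a))"
        using True by (intro nn_integral_exp_decay q) auto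
      also have "\<dots> \<le> ennreal m" unfolding m_def using True by (intro ennreal_leI) auto
      finally show "(\<integral>\<^sup>+s. indicator {a..t} s * ?e t s \<partial>lborel) \<le> ennreal m" .
    qed simp
    finally show ?thesis using True by simp
  qed simp
  have "(\<integral>\<^sup>+t. indicator {a..a + \<tau>} t * (duhamel_bound h a t \<xi>)\<^sup>2 \<partial>lborel)
     \<le> (\<integral>\<^sup>+t. ennreal m * (\<integral>\<^sup>+s. ?I t s * ?e t s * (k s)\<^sup>2 \<partial>lborel) \<partial>lborel)"
    by (rule nn_integral_mono[OF point])
  also have "\<dots> = ennreal m * (\<integral>\<^sup>+t. \<integral>\<^sup>+s. ?I t s * ?e t s * (k s)\<^sup>2 \<partial>lborel \<partial>lborel)"
    by (rule nn_integral_cmult) measurable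
  \<comment> \<open>After the exchange the kernel is integrated in \<open>t\<close> at fixed
    \<open>s\<close>, which yields the second factor \<open>m\<close>.\<close>
  also have "(\<integral>\<^sup>+t. \<integral>\<^sup>+s. ?I t s * ?e t s * (k s)\<^sup>2 \<partial>lborel \<partial>lborel) = (\<integral>\<^sup>+s. \<integral>\<^sup>+t. ?I t s * ?e t s * (k s)\<^sup>2 \<partial>lborel \<partial>lborel)"
    by (rule lborel_pair.Fubini') measurable
  also have "\<dots> \<le> (\<integral>\<^sup>+s. ennreal m * (indicator {a..a + \<tau>} s * (k s)\<^sup>2) \<partial>lborel)"
  proof (rule nn_integral_mono)
    fix s
    show "(\<integral>\<^sup>+t. ?I t s * ?e t s * (k s)\<^sup>2 \<partial>lborel) \<le> ennreal m * (indicator {a..a + \<tau>} s * (k s)\<^sup>2)"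
    proof (cases "s \<in> {a..a + \<tau>}")
      case True
      have "(\<integral>\<^sup>+t. ?I t s * ?e t s * (k s)\<^sup>2 \<partial>lborel) = (\<integral>\<^sup>+t. indicator {s..a + \<tau>} t * ?e t s \<partial>lborel) * (k s)\<^sup>2"
        using True by (subst nn_integral_multc[symmetric]) (auto intro!: nn_integral_cong simp: indicator_def)
      also have "\<dots> \<le> ennreal m * (k s)\<^sup>2"
      proof (rule mult_right_mono)
        have "(\<integral>\<^sup>+t. indicator {s..a + \<tau>} t * ?e t s \<partial>lborel) \<le> ennreal (min (1 / q) (a + \<tau> - s))"
          using True by (intro nn_integral_exp_decay' q) auto
        also have "\<dots> \<le> ennreal m" unfolding m_def using True by (intro ennreal_leI) auto
        finally show "(\<integral>\<^sup>+t. indicator {s..a + \<tau>} t * ?e t s \<partial>lborel) \<le> ennreal m" .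
      qed simp
      finally show ?thesis using True by simp
    next
      case False
      then have "?I t s = 0" for t by auto
      then show ?thesis by simp
    qed
  qed
  also have "\<dots> = ennreal m * (\<integral>\<^sup>+s. indicator {a..a + \<tau>} s * (k s)\<^sup>2 \<partial>lborel)"
    by (rule nn_integral_cmult) measurable
  finally have "(\<integral>\<^sup>+t. indicator {a..a + \<tau>} t * (duhamel_bound h a t \<xi>)\<^sup>2 \<partial>lborel)
     \<le> ennreal m * (ennreal m * (\<integral>\<^sup>+s. indicator {a..a + \<tau>} s * (k s)\<^sup>2 \<partial>lborel))"
    by (simp add: mult_left_mono)
  then show ?thesis by (simp add: m_def q_def k_def power2_eq_square mult.assoc)
qed

text \<open>The minimum of 1/|\<xi>|^2 and \<tau> from Young's inequality appears squared. Above R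
  the first bound turns \<open>freq_weight\<close> into \<open>heat_weight\<close>; below R one has
  \<tau>^2 \<le> \<tau>^2 R^4 / |\<xi>|^4, which gives the same weight with a constant that is small
  for small \<tau>.\<close>

lemma duhamel_energy:
  fixes h :: "real \<Rightarrow> real^'n::finite \<Rightarrow> ennreal"
  assumes h[measurable]: "(\<lambda>(s, \<xi>). h s \<xi>) \<in> borel_measurable (borel \<Otimes>\<^sub>M borel)" and \<tau>: "\<tau> \<ge> 0" and R: "R > 0"
  shows "(\<integral>\<^sup>+t. indicator {a..a + \<tau>} t * norm2 (duhamel_bound h a t) \<partial>lborel)
     \<le> (\<integral>\<^sup>+s. indicator {a..a + \<tau>} s * ((\<integral>\<^sup>+\<xi>. indicator {\<xi>. R \<le> norm \<xi>} \<xi> * heat_weight \<xi> * (h s \<xi>)\<^sup>2 \<partial>lborel)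
         + ennreal (\<tau>\<^sup>2 * R ^ 4) * (\<integral>\<^sup>+\<xi>. heat_weight \<xi> * (h s \<xi>)\<^sup>2 \<partial>lborel)) \<partial>lborel)"
proof -
  note [measurable] = duhamel_bound_measurable[OF h, of a]
  let ?I = "indicator {a..a + \<tau>} :: real \<Rightarrow> ennreal"
  let ?w = "\<lambda>\<xi>::real^'n. indicator {\<xi>. R \<le> norm \<xi>} \<xi> * heat_weight \<xi> + ennreal (\<tau>\<^sup>2 * R ^ 4) * heat_weight \<xi>"
  have weight: "freq_weight \<xi> * (ennreal (min (1 / (norm \<xi>)\<^sup>2) \<tau>))\<^sup>2 \<le> ?w \<xi>" if "\<xi> \<noteq> 0" for \<xi> :: "real^'n"
  proof -
    define p where "p = norm \<xi>"
    have p: "p > 0" using that by (simp add: p_def)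
    let ?N = "CARD('n) - 2"
    have eq: "freq_weight \<xi> * (ennreal (min (1 / (norm \<xi>)\<^sup>2) \<tau>))\<^sup>2 = ennreal (p ^ ?N * (min (1 / p\<^sup>2) \<tau>)\<^sup>2)"
      using \<tau> p by (simp add: freq_weight_def p_def ennreal_mult ennreal_power)
    show ?thesis
    proof (cases "R \<le> p")
      case True
      have "(min (1 / p\<^sup>2) \<tau>)\<^sup>2 \<le> (1 / p\<^sup>2)\<^sup>2" using \<tau> p by (intro power_mono) auto
      also have "\<dots> = 1 / p ^ 4" by (simp add: power_divide power_mult[symmetric])
      finally have "p ^ ?N * (min (1 / p\<^sup>2) \<tau>)\<^sup>2 \<le> p ^ ?N * (1 / p ^ 4)" using p by (intro mult_left_mono) auto
      then have "ennreal (p ^ ?N * (min (1 / p\<^sup>2) \<tau>)\<^sup>2) \<le> heat_weight \<xi>"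
        unfolding heat_weight_def p_def[symmetric] by (intro ennreal_leI) simp
      then show ?thesis unfolding eq using True by (simp add: p_def add_increasing2)
    next
      case False
      have "(min (1 / p\<^sup>2) \<tau>)\<^sup>2 \<le> \<tau>\<^sup>2" using \<tau> p by (intro power_mono) auto
      also have "\<dots> \<le> \<tau>\<^sup>2 * (R ^ 4 / p ^ 4)"
      proof -
        have "p ^ 4 \<le> R ^ 4" using False p by (intro power_mono) auto
        then have "1 \<le> R ^ 4 / p ^ 4" using p by simp
        then show ?thesis using mult_left_mono[of 1 "R ^ 4 / p ^ 4" "\<tau>\<^sup>2"] by simp
      qed
      finally have "p ^ ?N * (min (1 / p\<^sup>2) \<tau>)\<^sup>2 \<le> p ^ ?N * (\<tau>\<^sup>2 * (R ^ 4 / p ^ 4))" using p by (intro mult_left_mono) auto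
      then have "ennreal (p ^ ?N * (min (1 / p\<^sup>2) \<tau>)\<^sup>2) \<le> ennreal (\<tau>\<^sup>2 * R ^ 4 * (p ^ ?N / p ^ 4))"
        by (intro ennreal_leI) (simp add: mult_ac)
      also have "\<dots> = ennreal (\<tau>\<^sup>2 * R ^ 4) * heat_weight \<xi>"
        unfolding heat_weight_def p_def[symmetric] using p R by (intro ennreal_mult) auto
      finally show ?thesis unfolding eq by (simp add: add_increasing)
    qed
  qed
  have "(\<integral>\<^sup>+t. ?I t * norm2 (duhamel_bound h a t) \<partial>lborel)
     = (\<integral>\<^sup>+t. \<integral>\<^sup>+\<xi>. ?I t * (freq_weight \<xi> * (duhamel_bound h a t \<xi>)\<^sup>2) \<partial>lborel \<partial>lborel)"
    unfolding norm2_def by (subst nn_integral_cmult) auto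
  also have "\<dots> = (\<integral>\<^sup>+\<xi>. \<integral>\<^sup>+t. ?I t * (freq_weight \<xi> * (duhamel_bound h a t \<xi>)\<^sup>2) \<partial>lborel \<partial>lborel)"
    by (rule lborel_pair.Fubini') measurable
  also have "\<dots> \<le> (\<integral>\<^sup>+\<xi>. ?w \<xi> * (\<integral>\<^sup>+s. ?I s * (h s \<xi>)\<^sup>2 \<partial>lborel) \<partial>lborel)"
  proof (rule nn_integral_mono_AE)
    have "AE \<xi> in (lborel :: (real^'n) measure). \<xi> \<noteq> 0" by (rule AE_lborel_singleton)
    then show "AE \<xi> in lborel. (\<integral>\<^sup>+t. ?I t * (freq_weight \<xi> * (duhamel_bound h a t \<xi>)\<^sup>2) \<partial>lborel) \<le> ?w \<xi> * (\<integral>\<^sup>+s. ?I s * (h s \<xi>)\<^sup>2 \<partial>lborel)"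
    proof eventually_elim
      case (elim \<xi>)
      have "(\<integral>\<^sup>+t. ?I t * (freq_weight \<xi> * (duhamel_bound h a t \<xi>)\<^sup>2) \<partial>lborel)
        = (\<integral>\<^sup>+t. freq_weight \<xi> * (?I t * (duhamel_bound h a t \<xi>)\<^sup>2) \<partial>lborel)" by (simp only: mult.left_commute)
      also have "\<dots> = freq_weight \<xi> * (\<integral>\<^sup>+t. ?I t * (duhamel_bound h a t \<xi>)\<^sup>2 \<partial>lborel)"
        by (rule nn_integral_cmult) measurable
      also have "\<dots> \<le> freq_weight \<xi> * ((ennreal (min (1 / (norm \<xi>)\<^sup>2) \<tau>))\<^sup>2 * (\<integral>\<^sup>+s. ?I s * (h s \<xi>)\<^sup>2 \<partial>lborel))"
        by (intro mult_left_mono duhamel_Young[OF h \<tau> elim]) simp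
      also have "\<dots> \<le> ?w \<xi> * (\<integral>\<^sup>+s. ?I s * (h s \<xi>)\<^sup>2 \<partial>lborel)"
        unfolding mult.assoc[symmetric] by (intro mult_right_mono weight elim) simp
      finally show ?case .
    qed
  qed
  also have "\<dots> = (\<integral>\<^sup>+\<xi>. \<integral>\<^sup>+s. ?w \<xi> * (?I s * (h s \<xi>)\<^sup>2) \<partial>lborel \<partial>lborel)"
    by (subst nn_integral_cmult) auto
  also have "\<dots> = (\<integral>\<^sup>+s. \<integral>\<^sup>+\<xi>. ?w \<xi> * (?I s * (h s \<xi>)\<^sup>2) \<partial>lborel \<partial>lborel)"
    by (rule lborel_pair.Fubini') measurable
  also have "\<dots> = (\<integral>\<^sup>+s. ?I s * ((\<integral>\<^sup>+\<xi>. indicator {\<xi>. R \<le> norm \<xi>} \<xi> * heat_weight \<xi> * (h s \<xi>)\<^sup>2 \<partial>lborel)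
         + ennreal (\<tau>\<^sup>2 * R ^ 4) * (\<integral>\<^sup>+\<xi>. heat_weight \<xi> * (h s \<xi>)\<^sup>2 \<partial>lborel)) \<partial>lborel)"
  proof (rule nn_integral_cong)
    fix s
    have "(\<integral>\<^sup>+\<xi>. ?w \<xi> * (?I s * (h s \<xi>)\<^sup>2) \<partial>lborel)
      = (\<integral>\<^sup>+\<xi>. ?I s * (indicator {\<xi>. R \<le> norm \<xi>} \<xi> * heat_weight \<xi> * (h s \<xi>)\<^sup>2 + ennreal (\<tau>\<^sup>2 * R ^ 4) * (heat_weight \<xi> * (h s \<xi>)\<^sup>2)) \<partial>lborel)"
      by (rule nn_integral_cong) (simp add: distrib_left distrib_right mult_ac)
    also have "\<dots> = ?I s * (\<integral>\<^sup>+\<xi>. indicator {\<xi>. R \<le> norm \<xi>} \<xi> * heat_weight \<xi> * (h s \<xi>)\<^sup>2 + ennreal (\<tau>\<^sup>2 * R ^ 4) * (heat_weight \<xi> * (h s \<xi>)\<^sup>2) \<partial>lborel)"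
      by (rule nn_integral_cmult) measurable
    also have "(\<integral>\<^sup>+\<xi>. indicator {\<xi>. R \<le> norm \<xi>} \<xi> * heat_weight \<xi> * (h s \<xi>)\<^sup>2 + ennreal (\<tau>\<^sup>2 * R ^ 4) * (heat_weight \<xi> * (h s \<xi>)\<^sup>2) \<partial>lborel)
      = (\<integral>\<^sup>+\<xi>. indicator {\<xi>. R \<le> norm \<xi>} \<xi> * heat_weight \<xi> * (h s \<xi>)\<^sup>2 \<partial>lborel) + (\<integral>\<^sup>+\<xi>. ennreal (\<tau>\<^sup>2 * R ^ 4) * (heat_weight \<xi> * (h s \<xi>)\<^sup>2) \<partial>lborel)"
      by (rule nn_integral_add) measurable
    also have "(\<integral>\<^sup>+\<xi>. ennreal (\<tau>\<^sup>2 * R ^ 4) * (heat_weight \<xi> * (h s \<xi>)\<^sup>2) \<partial>lborel) = ennreal (\<tau>\<^sup>2 * R ^ 4) * (\<integral>\<^sup>+\<xi>. heat_weight \<xi> * (h s \<xi>)\<^sup>2 \<partial>lborel)"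
      by (rule nn_integral_cmult) measurable
    finally show "(\<integral>\<^sup>+\<xi>. ?w \<xi> * (?I s * (h s \<xi>)\<^sup>2) \<partial>lborel)
      = ?I s * ((\<integral>\<^sup>+\<xi>. indicator {\<xi>. R \<le> norm \<xi>} \<xi> * heat_weight \<xi> * (h s \<xi>)\<^sup>2 \<partial>lborel)
         + ennreal (\<tau>\<^sup>2 * R ^ 4) * (\<integral>\<^sup>+\<xi>. heat_weight \<xi> * (h s \<xi>)\<^sup>2 \<partial>lborel))" .
  qed
  finally show ?thesis .
qed

lemma heat_weight_null:
  fixes g :: "real^'n::finite \<Rightarrow> ennreal"
  assumes [measurable]: "g \<in> borel_measurable borel" and 0: "(\<integral>\<^sup>+\<xi>. heat_weight \<xi> * (g \<xi>)\<^sup>2 \<partial>lborel) = 0"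
  shows "AE \<xi> in lborel. g \<xi> = 0"
proof -
  have "AE \<xi> in lborel. heat_weight \<xi> * (g \<xi>)\<^sup>2 = 0"
    using 0 by (subst (asm) nn_integral_0_iff_AE) auto
  moreover have "AE \<xi> in (lborel :: (real^'n) measure). \<xi> \<noteq> 0" by (rule AE_lborel_singleton)
  ultimately show ?thesis
  proof eventually_elim
    case (elim \<xi>)
    then have "heat_weight \<xi> \<noteq> 0" by (simp add: heat_weight_def)
    then show ?case using elim(1) by simp
  qed
qed

text \<open>The vanishing of \<open>h\<close> is known at almost every time for almost every
  frequency; exchanging the two quantifiers, by measurability of the set in question, gives it at
  almost every frequency for almost every time. The integrals from 0 and from \<open>a\<close> then
  agree.\<close>

lemma duhamel_bound_shift:
  fixes h :: "real \<Rightarrow> real^'n::finite \<Rightarrow> ennreal"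
  assumes h[measurable]: "(\<lambda>(s, \<xi>). h s \<xi>) \<in> borel_measurable (borel \<Otimes>\<^sub>M borel)"
    and a: "0 \<le> a" "a \<le> t"
    and 0: "AE s in lborel. s \<in> {0..a} \<longrightarrow> (\<integral>\<^sup>+\<xi>. heat_weight \<xi> * (h s \<xi>)\<^sup>2 \<partial>lborel) = 0"
  shows "AE \<xi> in lborel. duhamel_bound h 0 t \<xi> = duhamel_bound h a t \<xi>"
proof -
  have "AE s in lborel. AE \<xi> in lborel. s \<in> {0..a} \<longrightarrow> h s \<xi> = 0"
    using 0
  proof eventually_elim
    case (elim s)
    show ?case
    proof (cases "s \<in> {0..a}")
      case True
      have "(\<lambda>\<xi>. h s \<xi>) \<in> borel_measurable borel" by measurable
      from heat_weight_null[OF this] True elim show ?thesis by simp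
    next
      case False
      then show ?thesis by (intro AE_I2) blast
    qed
  qed
  moreover have "{p \<in> space (lborel \<Otimes>\<^sub>M lborel). snd p \<in> {0..a} \<longrightarrow> h (snd p) (fst p) = 0} \<in> sets (lborel \<Otimes>\<^sub>M lborel)"
  proof -
    have [measurable]: "(\<lambda>p. h (snd p) (fst p)) \<in> borel_measurable (borel \<Otimes>\<^sub>M borel)"
      using measurable_compose[OF _ h, of "\<lambda>p. (snd p, fst p)"] by simp
    show ?thesis by measurable
  qed
  ultimately have "AE \<xi> in lborel. AE s in lborel. s \<in> {0..a} \<longrightarrow> h s \<xi> = 0"
    by (rule iffD2[OF lborel_pair.AE_commute[of "\<lambda>\<xi> s. s \<in> {0..a} \<longrightarrow> h s \<xi> = 0"], rotated])
  then show ?thesis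
  proof eventually_elim
    case (elim \<xi>)
    have "AE s in lborel. s \<noteq> a" by (rule AE_lborel_singleton)
    with elim show ?case unfolding duhamel_bound_def
      by (intro nn_integral_cong_AE, eventually_elim) (use a in \<open>auto simp: indicator_def\<close>)
  qed
qed

text \<open>\<open>N\<close> plays the energy of the difference, \<open>h\<close> a majorant of the
  difference of the nonlinear terms. Vanishing is propagated for \<open>h\<close>, in the form
  \<open>Z\<close>, because \<open>h\<close> is jointly measurable and fits
  \<open>duhamel_bound_shift\<close>; the vanishing of \<open>N\<close> at every single time is read
  off at the end.\<close>

theorem duhamel_uniqueness:
  fixes h :: "real \<Rightarrow> real^'n::finite \<Rightarrow> ennreal" and N :: "real \<Rightarrow> ennreal"
  assumes h[measurable]: "(\<lambda>(s, \<xi>). h s \<xi>) \<in> borel_measurable (borel \<Otimes>\<^sub>M borel)"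
    and N: "\<And>t. t \<in> time_interval T \<Longrightarrow> N t \<le> norm2 (duhamel_bound h 0 t)"
    and local: "\<And>a. a \<in> time_interval T \<Longrightarrow> \<exists>\<tau> R C. \<tau> > 0 \<and> R > 0 \<and> C \<ge> 0 \<and> a + \<tau> \<in> time_interval T \<and>
       (AE s in lborel. s \<in> {a..a + \<tau>} \<longrightarrow>
         (\<integral>\<^sup>+\<xi>. indicator {\<xi>. R \<le> norm \<xi>} \<xi> * heat_weight \<xi> * (h s \<xi>)\<^sup>2 \<partial>lborel) \<le> ennreal (1 / 4) * N s \<and>
         (\<integral>\<^sup>+\<xi>. heat_weight \<xi> * (h s \<xi>)\<^sup>2 \<partial>lborel) \<le> ennreal C * N s \<and> N s \<le> ennreal C)"
    and t: "t \<in> time_interval T"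
  shows "N t = 0"
proof -
  define K where "K s = (\<integral>\<^sup>+\<xi>. heat_weight \<xi> * (h s \<xi>)\<^sup>2 \<partial>lborel)" for s
  define Z where "Z b \<longleftrightarrow> (AE s in lborel. s \<in> {0..b} \<longrightarrow> K s = 0)" for b
  have sub: "b \<in> time_interval T" if "a \<in> time_interval T" "0 \<le> b" "b \<le> a" for a b
    using that by (auto simp: time_interval_def intro: le_less_trans[of "ereal b" "ereal a"])
  have Zmono: "Z b" if "Z a" "b \<le> a" for a b
    using that(1) unfolding Z_def by eventually_elim (use that(2) in auto)
  have Nle: "N s \<le> norm2 (duhamel_bound h a s)" if "Z a" "0 \<le> a" "a \<le> s" "s \<in> time_interval T" for a s
  proof -
    have "AE \<xi> in lborel. duhamel_bound h 0 s \<xi> = duhamel_bound h a s \<xi>"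
      by (rule duhamel_bound_shift[OF h that(2,3)]) (use that(1) in \<open>simp add: Z_def K_def\<close>)
    then have "norm2 (duhamel_bound h 0 s) = norm2 (duhamel_bound h a s)"
      unfolding norm2_def by (intro nn_integral_cong_AE, eventually_elim) simp
    then show ?thesis using N[OF that(4)] by simp
  qed
  have step: "\<exists>\<tau>>0. a + \<tau> \<in> time_interval T \<and> Z (a + \<tau>)" if a: "a \<in> time_interval T" "Z a" for a
  proof -
    have a0: "0 \<le> a" using a by (simp add: time_interval_def)
    obtain \<tau>\<^sub>0 R C where \<tau>0: "\<tau>\<^sub>0 > 0" and R: "R > 0" and C: "C \<ge> 0" and in0: "a + \<tau>\<^sub>0 \<in> time_interval T"
      and loc: "AE s in lborel. s \<in> {a..a + \<tau>\<^sub>0} \<longrightarrow>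
         (\<integral>\<^sup>+\<xi>. indicator {\<xi>. R \<le> norm \<xi>} \<xi> * heat_weight \<xi> * (h s \<xi>)\<^sup>2 \<partial>lborel) \<le> ennreal (1 / 4) * N s \<and>
         (\<integral>\<^sup>+\<xi>. heat_weight \<xi> * (h s \<xi>)\<^sup>2 \<partial>lborel) \<le> ennreal C * N s \<and> N s \<le> ennreal C"
      using local[OF a(1)] by blast
    \<comment> \<open>The entry 1 gives \<tau>^2 \<le> \<tau>; the last entry makes \<tau>^2 R^4 C
      at most 1/4, with C + 1 in place of C to avoid dividing by zero.\<close>
    define \<tau> where "\<tau> = min \<tau>\<^sub>0 (min 1 (1 / (4 * R ^ 4 * (C + 1))))"
    have \<tau>: "\<tau> > 0" "\<tau> \<le> \<tau>\<^sub>0" "\<tau> \<le> 1" using \<tau>0 R C by (auto simp: \<tau>_def)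
    have small: "\<tau>\<^sup>2 * R ^ 4 * C \<le> 1 / 4"
    proof -
      have "\<tau> * (4 * R ^ 4 * (C + 1)) \<le> 1"
        using R C by (subst pos_le_divide_eq[symmetric]) (auto simp: \<tau>_def)
      moreover have "\<tau>\<^sup>2 * (4 * R ^ 4 * C) \<le> \<tau> * (4 * R ^ 4 * (C + 1))"
        using \<tau> R C by (intro mult_mono) (auto simp: power2_eq_square mult_left_le)
      ultimately show ?thesis by simp
    qed
    have inT: "a + \<tau> \<in> time_interval T" using sub[OF in0] a0 \<tau> by simp
    let ?I = "indicator {a..a + \<tau>} :: real \<Rightarrow> ennreal"
    let ?G = "\<lambda>s. (\<integral>\<^sup>+\<xi>. indicator {\<xi>. R \<le> norm \<xi>} \<xi> * heat_weight \<xi> * (h s \<xi>)\<^sup>2 \<partial>lborel)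
         + ennreal (\<tau>\<^sup>2 * R ^ 4) * (\<integral>\<^sup>+\<xi>. heat_weight \<xi> * (h s \<xi>)\<^sup>2 \<partial>lborel)"
    define X where "X = (\<integral>\<^sup>+t. ?I t * norm2 (duhamel_bound h a t) \<partial>lborel)"
    note [measurable] = duhamel_bound_measurable[OF h, of a]
    have norm2m[measurable]: "(\<lambda>t. norm2 (duhamel_bound h a t)) \<in> borel_measurable borel"
      unfolding norm2_def by measurable
    have XG: "X \<le> (\<integral>\<^sup>+s. ?I s * ?G s \<partial>lborel)"
      unfolding X_def using \<tau> R by (intro duhamel_energy h) auto
    \<comment> \<open>High and low frequencies contribute 1/4 each; the sum 1/2 is below 1 and can
      be absorbed.\<close>
    have GN: "AE s in lborel. s \<in> {a..a + \<tau>} \<longrightarrow> ?G s \<le> ennreal (1 / 2) * N s \<and> K s \<le> ennreal C * N s \<and> N s \<le> ennreal C"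
      using loc
    proof eventually_elim
      case (elim s)
      show ?case
      proof
        assume s: "s \<in> {a..a + \<tau>}"
        then have e: "(\<integral>\<^sup>+\<xi>. indicator {\<xi>. R \<le> norm \<xi>} \<xi> * heat_weight \<xi> * (h s \<xi>)\<^sup>2 \<partial>lborel) \<le> ennreal (1 / 4) * N s"
          "(\<integral>\<^sup>+\<xi>. heat_weight \<xi> * (h s \<xi>)\<^sup>2 \<partial>lborel) \<le> ennreal C * N s" "N s \<le> ennreal C"
          using elim \<tau> by auto
        have "?G s \<le> ennreal (1 / 4) * N s + ennreal (\<tau>\<^sup>2 * R ^ 4) * (ennreal C * N s)"
          by (intro add_mono mult_left_mono e) simp
        also have "ennreal (\<tau>\<^sup>2 * R ^ 4) * (ennreal C * N s) = ennreal (\<tau>\<^sup>2 * R ^ 4 * C) * N s"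
          using C R by (simp add: ennreal_mult mult.assoc)
        also have "ennreal (1 / 4) * N s + ennreal (\<tau>\<^sup>2 * R ^ 4 * C) * N s \<le> ennreal (1 / 4) * N s + ennreal (1 / 4) * N s"
          by (intro add_mono mult_right_mono ennreal_leI small) auto
        also have "\<dots> = ennreal (1 / 2) * N s"
          unfolding distrib_right[symmetric] by (subst ennreal_plus[symmetric]) simp_all
        finally show "?G s \<le> ennreal (1 / 2) * N s \<and> K s \<le> ennreal C * N s \<and> N s \<le> ennreal C"
          using e by (simp add: K_def)
      qed
    qed
    \<comment> \<open>The local bound of \<open>N\<close> makes \<open>X\<close> finite; without
      finiteness X \<le> X/2 would say nothing.\<close>
    have "(\<integral>\<^sup>+s. ?I s * ?G s \<partial>lborel) \<le> (\<integral>\<^sup>+s. ennreal (1 / 2 * C) * ?I s \<partial>lborel)"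
    proof (rule nn_integral_mono_AE, use GN in eventually_elim)
      case (elim s)
      show ?case
      proof (cases "s \<in> {a..a + \<tau>}")
        case True
        have "?G s \<le> ennreal (1 / 2) * N s" using elim True by blast
        also have "\<dots> \<le> ennreal (1 / 2) * ennreal C" using elim True by (intro mult_left_mono) auto
        also have "\<dots> = ennreal (1 / 2 * C)" using C by (intro ennreal_mult[symmetric]) auto
        finally show ?thesis using True by simp
      qed simp
    qed
    also have "\<dots> = ennreal (1 / 2 * C) * ennreal \<tau>" using \<tau> by (subst nn_integral_cmult) auto
    also have "\<dots> < \<infinity>" by (simp add: ennreal_mult_less_top)
    finally have Xfin: "X < \<infinity>" using XG by (rule le_less_trans[rotated])
    have "(\<integral>\<^sup>+s. ?I s * ?G s \<partial>lborel) \<le> (\<integral>\<^sup>+s. ennreal (1 / 2) * (?I s * norm2 (duhamel_bound h a s)) \<partial>lborel)"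
    proof (rule nn_integral_mono_AE, use GN in eventually_elim)
      case (elim s)
      show ?case
      proof (cases "s \<in> {a..a + \<tau>}")
        case True
        have "?G s \<le> ennreal (1 / 2) * N s" using elim True by blast
        also have "\<dots> \<le> ennreal (1 / 2) * norm2 (duhamel_bound h a s)"
          using True a0 by (intro mult_left_mono Nle[OF a(2)] sub[OF inT]) auto
        finally show ?thesis using True by simp
      qed simp
    qed
    also have "\<dots> = ennreal (1 / 2) * X" unfolding X_def by (rule nn_integral_cmult) measurable
    finally have "X \<le> ennreal (1 / 2) * X" using XG by simp
    then have "X = 0"
    proof -
      obtain x where x: "X = ennreal x" "x \<ge> 0" using Xfin by (cases X) auto
      then have "ennreal x \<le> ennreal (1 / 2 * x)" using \<open>X \<le> ennreal (1 / 2) * X\<close> by (subst ennreal_mult) auto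
      then have "x \<le> 1 / 2 * x" using x by (subst (asm) ennreal_le_iff) auto
      then show ?thesis using x by simp
    qed
    then have "AE s in lborel. ?I s * norm2 (duhamel_bound h a s) = 0"
      unfolding X_def by (subst (asm) nn_integral_0_iff_AE) auto
    with GN a(2)[unfolded Z_def] have "AE s in lborel. s \<in> {0..a + \<tau>} \<longrightarrow> K s = 0"
    proof eventually_elim
      case (elim s)
      show ?case
      proof
        assume s: "s \<in> {0..a + \<tau>}"
        show "K s = 0"
        proof (cases "s \<le> a")
          case True then show ?thesis using elim s by auto
        next
          case False
          then have s': "s \<in> {a..a + \<tau>}" using s by auto
          then have "norm2 (duhamel_bound h a s) = 0" using elim by simp
          then have "N s = 0" using Nle[OF a(2) a0, of s] s' a0 sub[OF inT, of s] by auto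
          then show ?thesis using elim(1) s' by auto
        qed
      qed
    qed
    then show ?thesis using \<tau> inT unfolding Z_def by blast
  qed
  have all: "Z b" if b: "b \<in> time_interval T" for b
  proof (rule ccontr)
    assume nZ: "\<not> Z b"
    define S where "S = {c \<in> time_interval T. Z c}"
    have b0: "0 \<le> b" using b by (simp add: time_interval_def)
    have "AE s in lborel. s \<noteq> (0::real)" by (rule AE_lborel_singleton)
    then have "Z 0" unfolding Z_def by eventually_elim auto
    then have S0: "0 \<in> S" using sub[OF b order_refl b0] by (simp add: S_def)
    have Sb: "c \<le> b" if "c \<in> S" for c
      using Zmono[of c b] that nZ unfolding S_def by force
    then have bdd: "bdd_above S" by (auto simp: bdd_above_def)
    define c where "c = Sup S"
    have c0: "0 \<le> c" unfolding c_def by (rule cSup_upper[OF S0 bdd])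
    have cb: "c \<le> b" unfolding c_def using S0 Sb by (intro cSup_least) auto
    have cT: "c \<in> time_interval T" using sub[OF b c0 cb] .
    \<comment> \<open>The supremum is approached through countably many earlier times, so their null
      sets can be united.\<close>
    have "Z (c - 1 / real (Suc k))" for k
    proof -
      have "c - 1 / real (Suc k) < c" by simp
      then obtain d where "d \<in> S" "c - 1 / real (Suc k) < d" unfolding c_def using S0 bdd by (subst (asm) less_cSup_iff) auto
      then show ?thesis using Zmono[of d] by (auto simp: S_def)
    qed
    then have "AE s in lborel. \<forall>k. s \<in> {0..c - 1 / real (Suc k)} \<longrightarrow> K s = 0"
      unfolding Z_def AE_all_countable by blast
    moreover have "AE s in lborel. s \<noteq> c" by (rule AE_lborel_singleton)
    ultimately have "Z c" unfolding Z_def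
    proof eventually_elim
      case (elim s)
      show ?case
      proof
        assume "s \<in> {0..c}"
        with elim have s: "0 \<le> s" "s < c" by auto
        obtain k where "inverse (real (Suc k)) < c - s" using reals_Archimedean[of "c - s"] s by auto
        then have "s \<in> {0..c - 1 / real (Suc k)}" using s by (simp add: inverse_eq_divide)
        then show "K s = 0" using elim by blast
      qed
    qed
    then obtain \<tau> where "\<tau> > 0" "a + \<tau> \<in> time_interval T \<and> Z (a + \<tau>)" if "a = c" for a
      using step[OF cT] by auto
    then have "c + \<tau> \<in> S" "\<tau> > 0" by (auto simp: S_def)
    then show False using cSup_upper[OF _ bdd, of "c + \<tau>"] by (simp add: c_def)
  qed
  have t0: "0 \<le> t" using t by (simp add: time_interval_def)
  \<comment> \<open>Restarted at \<open>t\<close> itself, the integral runs over a single time; this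
    yields \<open>N t = 0\<close> at every time rather than at almost every time.\<close>
  have "AE \<xi> in lborel. duhamel_bound h 0 t \<xi> = duhamel_bound h t t \<xi>"
    by (rule duhamel_bound_shift[OF h t0]) (use all[OF t] in \<open>simp_all add: Z_def K_def\<close>)
  moreover have "duhamel_bound h t t \<xi> = 0" for \<xi>
  proof -
    have "AE s in lborel. s \<noteq> t" by (rule AE_lborel_singleton)
    then have "duhamel_bound h t t \<xi> = (\<integral>\<^sup>+s. 0 \<partial>(lborel :: real measure))"
      unfolding duhamel_bound_def by (intro nn_integral_cong_AE, eventually_elim) (auto simp: indicator_def)
    then show ?thesis by simp
  qed
  ultimately have "AE \<xi> in lborel. freq_weight \<xi> * (duhamel_bound h 0 t \<xi>)\<^sup>2 = 0"
    by (auto elim: eventually_mono)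
  then have "norm2 (duhamel_bound h 0 t) = (\<integral>\<^sup>+\<xi>. 0 \<partial>(lborel :: (real^'n) measure))"
    unfolding norm2_def by (rule nn_integral_cong_AE)
  then show ?thesis using N[OF t] by simp
qed

section \<open>Fourier representatives of Sobolev fields\<close>

lemma freq_cut_L1_loc:
  fixes b :: "real^'n::finite \<Rightarrow> complex"
  assumes b[measurable]: "b \<in> borel_measurable borel"
  shows "(\<forall>r. integrable lborel (\<lambda>\<xi>. indicator (cball 0 r) \<xi> *\<^sub>R b \<xi>)) \<longleftrightarrow> b \<in> L1_loc"
proof
  assume int: "\<forall>r. integrable lborel (\<lambda>\<xi>. indicator (cball 0 r) \<xi> *\<^sub>R b \<xi>)"
  show "b \<in> L1_loc" unfolding L1_loc_def
  proof (intro CollectI allI impI)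
    fix K :: "(real^'n) set" assume K: "compact K"
    obtain r where "\<forall>x\<in>K. norm x \<le> r" using compact_imp_bounded[OF K] unfolding bounded_iff by blast
    then have r: "K \<subseteq> cball 0 r" by auto
    have "(\<lambda>\<xi>. indicator (cball 0 r) \<xi> *\<^sub>R b \<xi>) \<in> borel_measurable lborel" using int by auto
    then have "set_integrable lebesgue (cball 0 r) b"
      unfolding set_integrable_def using int by (subst integrable_completion) auto
    then show "b absolutely_integrable_on K" by (rule set_integrable_subset) (use K r in \<open>auto simp: compact_imp_closed\<close>)
  qed
next
  assume L: "b \<in> L1_loc"
  show "\<forall>r. integrable lborel (\<lambda>\<xi>. indicator (cball 0 r) \<xi> *\<^sub>R b \<xi>)"
  proof
    fix r
    have "(\<lambda>\<xi>. indicator (cball 0 r) \<xi> *\<^sub>R b \<xi>) \<in> borel_measurable lborel" by measurable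
    moreover have "integrable lebesgue (\<lambda>\<xi>. indicator (cball 0 r) \<xi> *\<^sub>R b \<xi>)"
      using L compact_cball[of 0 r] unfolding L1_loc_def set_integrable_def by simp
    ultimately show "integrable lborel (\<lambda>\<xi>. indicator (cball 0 r) \<xi> *\<^sub>R b \<xi>)"
      by (rule integrable_completion[THEN iffD1])
  qed
qed

lemma L1_loc_nn_integral:
  fixes b :: "real^'n::finite \<Rightarrow> complex"
  assumes b[measurable]: "b \<in> borel_measurable borel"
    and fin: "\<And>r. (\<integral>\<^sup>+\<xi>. indicator (cball 0 r) \<xi> * ennreal (norm (b \<xi>)) \<partial>lborel) < \<infinity>"
  shows "b \<in> L1_loc"
proof (subst freq_cut_L1_loc[OF b, symmetric], rule allI, rule integrableI_bounded)
  fix r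
  have "(\<integral>\<^sup>+\<xi>. ennreal (norm (indicator (cball 0 r) \<xi> *\<^sub>R b \<xi>)) \<partial>lborel) = (\<integral>\<^sup>+\<xi>. indicator (cball 0 r) \<xi> * ennreal (norm (b \<xi>)) \<partial>lborel)"
    by (rule nn_integral_cong) (auto simp: indicator_def)
  then show "(\<integral>\<^sup>+\<xi>. ennreal (norm (indicator (cball 0 r) \<xi> *\<^sub>R b \<xi>)) \<partial>lborel) < \<infinity>" using fin by simp
qed measurable

lemma L1_loc_cong_AE:
  fixes g b :: "real^'n::finite \<Rightarrow> complex"
  assumes g: "g \<in> L1_loc" and b: "b \<in> borel_measurable borel" and ae: "AE x in lebesgue. g x = b x"
  shows "b \<in> L1_loc"
  unfolding L1_loc_def
proof (intro CollectI allI impI)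
  fix K :: "(real^'n) set" assume K: "compact K"
  have "integrable lebesgue (\<lambda>x. indicator K x *\<^sub>R g x)" using g K unfolding L1_loc_def set_integrable_def by blast
  moreover have "(\<lambda>x. indicator K x *\<^sub>R b x) \<in> borel_measurable lebesgue"
    using K b by (intro borel_measurable_scaleR borel_measurable_indicator measurable_completion) (auto simp: compact_imp_closed)
  moreover have "AE x in lebesgue. indicator K x *\<^sub>R g x = indicator K x *\<^sub>R b x" using ae by eventually_elim simp
  ultimately show "b absolutely_integrable_on K" unfolding set_integrable_def by (rule integrable_cong_AE_imp)
qed

lemma integral_test_cong_AE:
  fixes g b :: "real^'n::finite \<Rightarrow> complex"
  assumes g: "g \<in> L1_loc" and b: "b \<in> borel_measurable borel" and ae: "AE x in lebesgue. g x = b x"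
    and \<psi>: "\<psi> \<in> test_functions"
  shows "(\<integral>x. g x * \<psi> x \<partial>lebesgue) = (\<integral>x. b x * \<psi> x \<partial>lborel)"
proof -
  have m: "(\<lambda>x. b x * \<psi> x) \<in> borel_measurable lborel" using b test_function_measurable[OF \<psi>] by simp
  have "(\<integral>x. g x * \<psi> x \<partial>lebesgue) = (\<integral>x. b x * \<psi> x \<partial>lebesgue)"
    by (rule integral_cong_AE[OF borel_measurable_integrable[OF L1_loc_mult_test[OF g \<psi>]] measurable_completion[OF m]])
       (use ae in eventually_elim, simp)
  also have "\<dots> = (\<integral>x. b x * \<psi> x \<partial>lborel)" by (rule integral_completion[OF m])
  finally show ?thesis .
qed

text \<open>\<open>tempered_fun\<close> only speaks of products with Schwartz functions. Dividing by
  the transform of a bump that is nonzero on the open ball of radius m recovers \<open>f\<close>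
  there; at each point the quotients are eventually equal to \<open>f\<close>.\<close>

lemma tempered_fun_measurable:
  fixes f :: "real^'n::finite \<Rightarrow> complex"
  assumes f: "tempered_fun f"
  shows "f \<in> borel_measurable lebesgue"
proof (rule borel_measurable_LIMSEQ_metric)
  define \<psi> where "\<psi> m = bump 1 (\<chi> i. - (1 / (real m * real CARD('n)))) (\<chi> i. 1 / (real m * real CARD('n)) :: real^'n)" for m
  have t: "\<psi> m \<in> test_functions" for m by (simp add: \<psi>_def test_function_bump)
  show "(\<lambda>x. (f x * fourier (\<psi> m) x) / fourier (\<psi> m) x) \<in> borel_measurable lebesgue" for m
  proof (rule borel_measurable_divide)
    show "(\<lambda>x. f x * fourier (\<psi> m) x) \<in> borel_measurable lebesgue"
      using f fourier_in_schwartz[OF t] unfolding tempered_fun_def by (intro borel_measurable_integrable) blast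
    show "fourier (\<psi> m) \<in> borel_measurable lebesgue"
      by (rule measurable_completion) (use fourier_measurable[OF t] in simp)
  qed
  fix x :: "real^'n"
  obtain N where N: "norm x < real N" using reals_Archimedean2 by blast
  have "(f x * fourier (\<psi> m) x) / fourier (\<psi> m) x = f x" if "m \<ge> N" for m
  proof -
    have "norm x < real m" using N that by (meson le_less_trans less_le_trans of_nat_mono)
    then show ?thesis using fourier_bump_nonzero[of x m] by (simp add: \<psi>_def)
  qed
  then show "(\<lambda>m. (f x * fourier (\<psi> m) x) / fourier (\<psi> m) x) \<longlonglongrightarrow> f x"
    by (intro tendsto_eventually eventually_sequentiallyI[of N])
qed

lemma fourier_pair_represents:
  assumes "fourier_pair f b" shows "represents b (fourier_dist (regular_dist f))"
proof -
  have b: "b \<in> borel_measurable borel" using assms by (simp add: fourier_pair_def)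
  have L: "b \<in> L1_loc" using assms freq_cut_L1_loc[OF b] by (simp add: fourier_pair_def)
  have "fourier_dist (regular_dist f) \<psi> = regular_dist b \<psi>" if \<psi>: "\<psi> \<in> test_functions" for \<psi>
    using assms \<psi> integral_test_cong_AE[OF L b _ \<psi>] unfolding fourier_pair_def fourier_dist_def regular_dist_def by simp
  then show ?thesis using L by (simp add: represents_def)
qed

lemma norm2_add_le:
  fixes f g h :: "real^'n::finite \<Rightarrow> ennreal"
  assumes [measurable]: "g \<in> borel_measurable borel" "h \<in> borel_measurable borel"
    and le: "\<And>x. f x \<le> g x + h x"
  shows "norm2 f \<le> 2 * norm2 g + 2 * norm2 h"
proof -
  have "norm2 f \<le> (\<integral>\<^sup>+\<xi>. 2 * (freq_weight \<xi> * (g \<xi>)\<^sup>2) + 2 * (freq_weight \<xi> * (h \<xi>)\<^sup>2) \<partial>lborel)"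
    unfolding norm2_def
  proof (rule nn_integral_mono)
    fix \<xi> :: "real^'n"
    have "(f \<xi>)\<^sup>2 \<le> (g \<xi> + h \<xi>)\<^sup>2" by (rule power_mono[OF le]) simp
    also have "\<dots> \<le> 2 * (g \<xi>)\<^sup>2 + 2 * (h \<xi>)\<^sup>2" by (rule power2_add_le_ennreal)
    finally have "freq_weight \<xi> * (f \<xi>)\<^sup>2 \<le> freq_weight \<xi> * (2 * (g \<xi>)\<^sup>2 + 2 * (h \<xi>)\<^sup>2)" by (rule mult_left_mono) simp
    then show "freq_weight \<xi> * (f \<xi>)\<^sup>2 \<le> 2 * (freq_weight \<xi> * (g \<xi>)\<^sup>2) + 2 * (freq_weight \<xi> * (h \<xi>)\<^sup>2)"
      by (simp add: distrib_left mult.left_commute)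
  qed
  also have "\<dots> = 2 * norm2 g + 2 * norm2 h"
    unfolding norm2_def by (simp add: nn_integral_add nn_integral_cmult)
  finally show ?thesis .
qed

lemma norm2_mono: "(\<And>x. f x \<le> g x) \<Longrightarrow> norm2 f \<le> norm2 g"
  unfolding norm2_def by (intro nn_integral_mono mult_left_mono power_mono) auto

section \<open>Borel representatives with finite critical norm\<close>

abbreviation cabs :: "('a \<Rightarrow> complex) \<Rightarrow> 'a \<Rightarrow> ennreal" where
  "cabs f x \<equiv> ennreal (norm (f x))"

text \<open>The interface between the Sobolev definitions and the estimates: one Borel
  representative for the transform of every component, in place of the unspecified choice behind
  \<open>fourier_fun\<close>.\<close>

definition has_hat :: "(real^'n::finite \<Rightarrow> real^'n) \<Rightarrow> ('n \<Rightarrow> real^'n \<Rightarrow> complex) \<Rightarrow> bool" where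
  "has_hat w b \<longleftrightarrow> (\<forall>j. fourier_pair (component w j) (b j) \<and> norm2 (cabs (b j)) < \<infinity>)"

lemma has_hat_measurable: "has_hat w b \<Longrightarrow> b j \<in> borel_measurable borel"
  by (simp add: has_hat_def fourier_pair_def)

lemma sobolev_weight:
  fixes \<xi> :: "real^'n::finite"
  assumes n: "CARD('n) \<ge> 3"
  shows "(norm \<xi> powr (real CARD('n) / 2 - 1) * y)\<^sup>2 = norm \<xi> ^ (CARD('n) - 2) * y\<^sup>2"
proof -
  have "(norm \<xi> powr (real CARD('n) / 2 - 1))\<^sup>2 = norm \<xi> ^ (CARD('n) - 2)"
  proof (cases "\<xi> = 0")
    case False
    then have "norm \<xi> ^ (CARD('n) - 2) = norm \<xi> powr (real (CARD('n) - 2))" by (simp add: powr_realpow)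
    also have "\<dots> = norm \<xi> powr ((real CARD('n) / 2 - 1) + (real CARD('n) / 2 - 1))" using n by (simp add: of_nat_diff)
    also have "\<dots> = (norm \<xi> powr (real CARD('n) / 2 - 1))\<^sup>2" unfolding powr_add by (simp add: power2_eq_square)
    finally show ?thesis by simp
  qed (use n in simp)
  then show ?thesis by (simp add: power_mult_distrib)
qed

lemma norm2_eq_nn_integral:
  fixes b :: "real^'n::finite \<Rightarrow> complex"
  assumes n: "CARD('n) \<ge> 3"
  shows "norm2 (cabs b) = (\<integral>\<^sup>+\<xi>. ennreal ((norm \<xi> powr (real CARD('n) / 2 - 1) * norm (b \<xi>))\<^sup>2) \<partial>lborel)"
  unfolding norm2_def sobolev_weight[OF n] freq_weight_def
  by (rule nn_integral_cong) (simp add: ennreal_mult ennreal_power)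

lemma fourier_fun_eq:
  assumes b: "represents b (fourier_dist S)"
  shows "AE \<xi> in lebesgue. fourier_fun S \<xi> = b \<xi>" "represents (fourier_fun S) (fourier_dist S)"
proof -
  show "represents (fourier_fun S) (fourier_dist S)" unfolding fourier_fun_def by (rule someI[of _ b]) (rule b)
  then show "AE \<xi> in lebesgue. fourier_fun S \<xi> = b \<xi>" using b by (rule represents_unique)
qed

text \<open>\<open>fourier_fun\<close> is an arbitrary choice among functions that agree almost
  everywhere, so the norm may be computed with the Borel representative \<open>b\<close>.\<close>

lemma norm2_eq_hdot_norm:
  fixes b :: "real^'n::finite \<Rightarrow> complex"
  assumes n: "CARD('n) \<ge> 3" and b: "represents b (fourier_dist S)" and bm[measurable]: "b \<in> borel_measurable borel"
    and fin: "norm2 (cabs b) < \<infinity>"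
  shows "norm2 (cabs b) = ennreal ((hdot_norm (real CARD('n) / 2 - 1) S)\<^sup>2)"
proof -
  let ?s = "real CARD('n) / 2 - 1"
  let ?F = "\<lambda>b \<xi>. (norm \<xi> powr ?s * norm (b \<xi> :: complex))\<^sup>2"
  note ae = fourier_fun_eq(1)[OF b] and rep = fourier_fun_eq(2)[OF b]
  have gm: "fourier_fun S \<in> borel_measurable lebesgue" using rep L1_loc_measurable by (auto simp: represents_def)
  have i: "integrable lborel (?F b)"
    using fin unfolding norm2_eq_nn_integral[OF n] by (intro integrableI_bounded) auto
  have "(\<integral>\<xi>. ?F (fourier_fun S) \<xi> \<partial>lebesgue) = (\<integral>\<xi>. ?F b \<xi> \<partial>lebesgue)"
  proof (rule integral_cong_AE)
    have "(\<lambda>\<xi>::real^'n. norm \<xi> powr ?s) \<in> borel_measurable lebesgue" by (rule measurable_completion) measurable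
    then show "?F (fourier_fun S) \<in> borel_measurable lebesgue" using gm by measurable
    show "?F b \<in> borel_measurable lebesgue" by (rule measurable_completion) measurable
    show "AE \<xi> in lebesgue. ?F (fourier_fun S) \<xi> = ?F b \<xi>" using ae by eventually_elim simp
  qed
  also have "\<dots> = (\<integral>\<xi>. ?F b \<xi> \<partial>lborel)" by (rule integral_completion) measurable
  finally have "(hdot_norm ?s S)\<^sup>2 = (\<integral>\<xi>. ?F b \<xi> \<partial>lborel)"
    unfolding hdot_norm_def by (simp add: integral_nonneg_AE)
  then show ?thesis unfolding norm2_eq_nn_integral[OF n] by (subst nn_integral_eq_integral[OF i]) auto
qed

text \<open>The critical weight |\<xi>|^(n-2) is at least 1 beyond frequency 1, so finite energy
  implies the square integrable tail that \<open>fourier_pair\<close> demands; local integrability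
  is part of the Sobolev definition.\<close>

lemma hdot_field_has_hat:
  fixes w :: "real^'n::finite \<Rightarrow> real^'n"
  assumes n: "CARD('n) \<ge> 3" and w: "w \<in> hdot_field (real CARD('n) / 2 - 1)"
  shows "\<exists>b. has_hat w b"
proof -
  let ?s = "real CARD('n) / 2 - 1"
  have "\<exists>b. fourier_pair (component w j) b \<and> norm2 (cabs b) < \<infinity>" for j
  proof -
    let ?S = "component_dist w j"
    have tw: "tempered_fun (component w j)" and S: "?S \<in> hdot ?s"
      using w by (auto simp: hdot_field_def tempered_field_def)
    obtain g0 where "represents g0 (fourier_dist ?S)" using S by (auto simp: hdot_def)
    from fourier_fun_eq(2)[OF this] have rep: "represents (fourier_fun ?S) (fourier_dist ?S)" .
    then have L: "fourier_fun ?S \<in> L1_loc" by (simp add: represents_def)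
    obtain b where b[measurable]: "b \<in> borel_measurable lborel" and "AE \<xi> in lborel. fourier_fun ?S \<xi> = b \<xi>"
      using completion_ex_borel_measurable_complex[OF L1_loc_measurable[OF L]] by blast
    then have ae: "AE \<xi> in lebesgue. fourier_fun ?S \<xi> = b \<xi>" by (intro AE_completion)
    have bm[measurable]: "b \<in> borel_measurable borel" using b by simp
    have bL: "b \<in> L1_loc" by (rule L1_loc_cong_AE[OF L bm ae])
    have int: "integrable lebesgue (\<lambda>\<xi>. (norm \<xi> powr ?s * norm (fourier_fun ?S \<xi>))\<^sup>2)" using S by (simp add: hdot_def)
    have "integrable lebesgue (\<lambda>\<xi>. (norm \<xi> powr ?s * norm (b \<xi>))\<^sup>2)"
      by (rule integrable_cong_AE_imp[OF int measurable_completion])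
         (measurable, use ae in eventually_elim, simp)
    then have "integrable lborel (\<lambda>\<xi>. (norm \<xi> powr ?s * norm (b \<xi>))\<^sup>2)" by (subst (asm) integrable_completion) auto
    then have fin: "norm2 (cabs b) < \<infinity>"
      unfolding norm2_eq_nn_integral[OF n] by (simp add: integrable_iff_bounded)
    have "fourier_pair (component w j) b"
      unfolding fourier_pair_def
    proof (intro conjI ballI)
      show "\<forall>r. integrable lborel (\<lambda>\<xi>. indicator (cball 0 r) \<xi> *\<^sub>R b \<xi>)" using freq_cut_L1_loc[OF bm] bL by simp
      have "(\<integral>\<^sup>+\<xi>. indicator {\<xi>. 1 < norm \<xi>} \<xi> * (cabs b \<xi>)\<^sup>2 \<partial>lborel) \<le> norm2 (cabs b)"
        unfolding norm2_def
      proof (intro nn_integral_mono mult_right_mono)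
        fix \<xi> :: "real^'n"
        show "indicator {\<xi>. 1 < norm \<xi>} \<xi> \<le> freq_weight \<xi>"
        proof (cases "1 < norm \<xi>")
          case True
          then have "ennreal 1 \<le> freq_weight \<xi>" unfolding freq_weight_def by (intro ennreal_leI one_le_power) simp
          then show ?thesis using True by simp
        qed simp
      qed simp
      then show "(\<integral>\<^sup>+\<xi>. indicator {\<xi>. 1 < norm \<xi>} \<xi> * (cabs b \<xi>)\<^sup>2 \<partial>lborel) < \<infinity>" using fin by simp
      show "component w j \<in> borel_measurable lebesgue" by (rule tempered_fun_measurable[OF tw])
      fix \<psi> :: "real^'n \<Rightarrow> complex" assume \<psi>: "\<psi> \<in> test_functions"
      show "integrable lebesgue (\<lambda>x. component w j x * fourier \<psi> x)"
        using tw fourier_in_schwartz[OF \<psi>] unfolding tempered_fun_def by blast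
      have "(\<integral>x. component w j x * fourier \<psi> x \<partial>lebesgue) = (\<integral>\<xi>. fourier_fun ?S \<xi> * \<psi> \<xi> \<partial>lebesgue)"
        using rep \<psi> by (simp add: represents_def fourier_dist_def component_dist_def regular_dist_def)
      also have "\<dots> = (\<integral>\<xi>. b \<xi> * \<psi> \<xi> \<partial>lborel)" by (rule integral_test_cong_AE[OF L bm ae \<psi>])
      finally show "(\<integral>x. component w j x * fourier \<psi> x \<partial>lebesgue) = (\<integral>\<xi>. b \<xi> * \<psi> \<xi> \<partial>lborel)" .
    qed (rule bm)
    then show ?thesis using fin by blast
  qed
  then show ?thesis unfolding has_hat_def by metis
qed

lemma fourier_pair_test_integrable:
  assumes "fourier_pair f b" "\<psi> \<in> test_functions"
  shows "integrable lborel (\<lambda>\<xi>. b \<xi> * \<psi> \<xi>)"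
  using assms freq_cut_mult_test(1)[of b \<psi>] by (simp add: fourier_pair_def freq_cut_def)

lemma fourier_pair_diff:
  assumes f: "fourier_pair f a" and g: "fourier_pair g b"
  shows "fourier_pair (\<lambda>x. f x - g x) (\<lambda>\<xi>. a \<xi> - b \<xi>)"
proof -
  have [measurable]: "a \<in> borel_measurable borel" "b \<in> borel_measurable borel" using f g by (auto simp: fourier_pair_def)
  let ?J = "indicator {\<xi>. 1 < norm \<xi>} :: real^'a \<Rightarrow> ennreal"
  have "(\<integral>\<^sup>+\<xi>. ?J \<xi> * (ennreal (norm (a \<xi> - b \<xi>)))\<^sup>2 \<partial>lborel)
     \<le> (\<integral>\<^sup>+\<xi>. 2 * (?J \<xi> * (cabs a \<xi>)\<^sup>2) + 2 * (?J \<xi> * (cabs b \<xi>)\<^sup>2) \<partial>lborel)"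
  proof (rule nn_integral_mono)
    fix \<xi> :: "real^'a"
    have "ennreal (norm (a \<xi> - b \<xi>)) \<le> cabs a \<xi> + cabs b \<xi>"
      using ennreal_leI[OF norm_triangle_ineq4[of "a \<xi>" "b \<xi>"]] by simp
    then have "(ennreal (norm (a \<xi> - b \<xi>)))\<^sup>2 \<le> (cabs a \<xi> + cabs b \<xi>)\<^sup>2" by (rule power_mono) simp
    also have "\<dots> \<le> 2 * (cabs a \<xi>)\<^sup>2 + 2 * (cabs b \<xi>)\<^sup>2" by (rule power2_add_le_ennreal)
    finally show "?J \<xi> * (ennreal (norm (a \<xi> - b \<xi>)))\<^sup>2 \<le> 2 * (?J \<xi> * (cabs a \<xi>)\<^sup>2) + 2 * (?J \<xi> * (cabs b \<xi>)\<^sup>2)"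
      by (cases "1 < norm \<xi>") auto
  qed
  also have "\<dots> = 2 * (\<integral>\<^sup>+\<xi>. ?J \<xi> * (cabs a \<xi>)\<^sup>2 \<partial>lborel) + 2 * (\<integral>\<^sup>+\<xi>. ?J \<xi> * (cabs b \<xi>)\<^sup>2 \<partial>lborel)"
    by (simp add: nn_integral_add nn_integral_cmult)
  also have "\<dots> < \<infinity>" using f g by (simp add: fourier_pair_def ennreal_mult_less_top)
  finally have tail: "(\<integral>\<^sup>+\<xi>. ?J \<xi> * (ennreal (norm (a \<xi> - b \<xi>)))\<^sup>2 \<partial>lborel) < \<infinity>" .
  show ?thesis
    unfolding fourier_pair_def
  proof (intro conjI ballI allI)
    show "(\<lambda>\<xi>. a \<xi> - b \<xi>) \<in> borel_measurable borel" by measurable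
    show "integrable lborel (\<lambda>\<xi>. indicator (cball 0 r) \<xi> *\<^sub>R (a \<xi> - b \<xi>))" for r
      using f g unfolding fourier_pair_def scaleR_right_diff_distrib by (intro Bochner_Integration.integrable_diff) auto
    show "(\<integral>\<^sup>+\<xi>. ?J \<xi> * (ennreal (norm (a \<xi> - b \<xi>)))\<^sup>2 \<partial>lborel) < \<infinity>" by (rule tail)
    show "(\<lambda>x. f x - g x) \<in> borel_measurable lebesgue" using f g unfolding fourier_pair_def by (intro borel_measurable_diff) auto
    fix \<psi> :: "real^'a \<Rightarrow> complex" assume \<psi>: "\<psi> \<in> test_functions"
    have i: "integrable lebesgue (\<lambda>x. f x * fourier \<psi> x)" "integrable lebesgue (\<lambda>x. g x * fourier \<psi> x)"
      using f g \<psi> unfolding fourier_pair_def by blast+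
    show "integrable lebesgue (\<lambda>x. (f x - g x) * fourier \<psi> x)"
      using Bochner_Integration.integrable_diff[OF i] by (simp add: left_diff_distrib)
    show "(\<integral>x. (f x - g x) * fourier \<psi> x \<partial>lebesgue) = (\<integral>\<xi>. (a \<xi> - b \<xi>) * \<psi> \<xi> \<partial>lborel)"
      using i fourier_pair_test_integrable[OF f \<psi>] fourier_pair_test_integrable[OF g \<psi>] f g \<psi>
      by (simp add: left_diff_distrib fourier_pair_def)
  qed
qed

lemma cabs_diff_le: "ennreal (norm (a - b)) \<le> ennreal (norm a) + ennreal (norm (b :: complex))"
  using ennreal_leI[OF norm_triangle_ineq4[of a b]] by simp

lemma has_hat_diff:
  assumes u: "has_hat u a" and v: "has_hat v b"
  shows "has_hat (\<lambda>x. u x - v x) (\<lambda>j \<xi>. a j \<xi> - b j \<xi>)"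
  unfolding has_hat_def
proof (intro allI conjI)
  fix j
  note [measurable] = has_hat_measurable[OF u] has_hat_measurable[OF v]
  have "component (\<lambda>x. u x - v x) j = (\<lambda>x. component u j x - component v j x)" by (simp add: component_def fun_eq_iff)
  then show "fourier_pair (component (\<lambda>x. u x - v x) j) (\<lambda>\<xi>. a j \<xi> - b j \<xi>)"
    using u v by (simp add: has_hat_def fourier_pair_diff)
  have "norm2 (cabs (\<lambda>\<xi>. a j \<xi> - b j \<xi>)) \<le> 2 * norm2 (cabs (a j)) + 2 * norm2 (cabs (b j))"
    by (rule norm2_add_le) (auto intro: cabs_diff_le)
  also have "\<dots> < \<infinity>" using u v by (simp add: has_hat_def ennreal_mult_less_top)
  finally show "norm2 (cabs (\<lambda>\<xi>. a j \<xi> - b j \<xi>)) < \<infinity>" .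
qed

lemma has_hat_field_norm:
  fixes w :: "real^'n::finite \<Rightarrow> real^'n"
  assumes n: "CARD('n) \<ge> 3" and w: "has_hat w b"
  shows "(\<Sum>j\<in>UNIV. norm2 (cabs (b j))) = ennreal ((hdot_field_norm (real CARD('n) / 2 - 1) w)\<^sup>2)"
proof -
  have "norm2 (cabs (b j)) = ennreal ((hdot_norm (real CARD('n) / 2 - 1) (component_dist w j))\<^sup>2)" for j
    using w fourier_pair_represents[of "component w j" "b j"] has_hat_measurable[OF w, of j]
    by (intro norm2_eq_hdot_norm[OF n]) (auto simp: has_hat_def component_dist_def)
  then show ?thesis unfolding hdot_field_norm_def by (simp add: sum_nonneg)
qed

section \<open>The nonlinear term\<close>

definition cconv :: "(real^'n::finite \<Rightarrow> complex) \<Rightarrow> (real^'n \<Rightarrow> complex) \<Rightarrow> real^'n \<Rightarrow> complex" where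
  "cconv f g \<xi> = (\<integral>x. f x * g (\<xi> - x) \<partial>lborel)"

lemma cconv_measurable [measurable]:
  assumes [measurable]: "f \<in> borel_measurable borel" "g \<in> borel_measurable borel"
  shows "cconv f g \<in> borel_measurable borel"
  unfolding cconv_def[abs_def] by (rule lborel.borel_measurable_lebesgue_integral) measurable

lemma norm_cconv_le: "ennreal (norm (cconv f g \<xi>)) \<le> conv (cabs f) (cabs g) \<xi>"
proof -
  have "ennreal (norm (cconv f g \<xi>)) \<le> (\<integral>\<^sup>+x. ennreal (norm (f x * g (\<xi> - x))) \<partial>lborel)"
    unfolding cconv_def by (rule norm_integral_le_nn_integral)
  then show ?thesis by (simp add: conv_def norm_mult ennreal_mult)
qed

text \<open>The substitution \<zeta> = \<xi> + \<eta> and Fubini identify the double integral of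
  \<open>fourier_product\<close> with a convolution tested against \<psi>.\<close>

lemma conv_test:
  fixes f g \<psi> :: "real^'n::finite \<Rightarrow> complex"
  assumes [measurable]: "f \<in> borel_measurable borel" "g \<in> borel_measurable borel" "\<psi> \<in> borel_measurable borel"
  shows "(\<integral>\<^sup>+\<xi>. \<integral>\<^sup>+\<eta>. ennreal (norm (f \<xi> * g \<eta> * \<psi> (\<xi> + \<eta>))) \<partial>lborel \<partial>lborel)
     = (\<integral>\<^sup>+\<zeta>. conv (cabs f) (cabs g) \<zeta> * cabs \<psi> \<zeta> \<partial>lborel)"
    and "(\<integral>\<^sup>+\<zeta>. conv (cabs f) (cabs g) \<zeta> * cabs \<psi> \<zeta> \<partial>lborel) < \<infinity> \<Longrightarrow>
      (\<integral>\<xi>. \<integral>\<eta>. f \<xi> * g \<eta> * \<psi> (\<xi> + \<eta>) \<partial>lborel \<partial>lborel) = (\<integral>\<zeta>. cconv f g \<zeta> * \<psi> \<zeta> \<partial>lborel)"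
proof -
  have tr: "(\<integral>\<^sup>+\<eta>. ennreal (norm (f \<xi> * g \<eta> * \<psi> (\<xi> + \<eta>))) \<partial>lborel)
      = (\<integral>\<^sup>+\<zeta>. ennreal (norm (f \<xi> * g (\<zeta> - \<xi>) * \<psi> \<zeta>)) \<partial>lborel)" for \<xi>
    using nn_integral_translate[of "\<lambda>\<eta>. ennreal (norm (f \<xi> * g \<eta> * \<psi> (\<xi> + \<eta>)))" "- \<xi>"] by simp
  have "(\<integral>\<^sup>+\<xi>. \<integral>\<^sup>+\<eta>. ennreal (norm (f \<xi> * g \<eta> * \<psi> (\<xi> + \<eta>))) \<partial>lborel \<partial>lborel)
     = (\<integral>\<^sup>+\<zeta>. \<integral>\<^sup>+\<xi>. ennreal (norm (f \<xi> * g (\<zeta> - \<xi>) * \<psi> \<zeta>)) \<partial>lborel \<partial>lborel)"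
    unfolding tr by (rule lborel_pair.Fubini') measurable
  also have "\<dots> = (\<integral>\<^sup>+\<zeta>. conv (cabs f) (cabs g) \<zeta> * cabs \<psi> \<zeta> \<partial>lborel)"
  proof (rule nn_integral_cong)
    fix \<zeta>
    have "(\<integral>\<^sup>+\<xi>. ennreal (norm (f \<xi> * g (\<zeta> - \<xi>) * \<psi> \<zeta>)) \<partial>lborel) = (\<integral>\<^sup>+\<xi>. (cabs f \<xi> * cabs g (\<zeta> - \<xi>)) * cabs \<psi> \<zeta> \<partial>lborel)"
      by (simp add: norm_mult ennreal_mult)
    also have "\<dots> = conv (cabs f) (cabs g) \<zeta> * cabs \<psi> \<zeta>" unfolding conv_def by (rule nn_integral_multc) measurable
    finally show "(\<integral>\<^sup>+\<xi>. ennreal (norm (f \<xi> * g (\<zeta> - \<xi>) * \<psi> \<zeta>)) \<partial>lborel) = conv (cabs f) (cabs g) \<zeta> * cabs \<psi> \<zeta>" .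
  qed
  finally show eq: "(\<integral>\<^sup>+\<xi>. \<integral>\<^sup>+\<eta>. ennreal (norm (f \<xi> * g \<eta> * \<psi> (\<xi> + \<eta>))) \<partial>lborel \<partial>lborel)
     = (\<integral>\<^sup>+\<zeta>. conv (cabs f) (cabs g) \<zeta> * cabs \<psi> \<zeta> \<partial>lborel)" .
  assume fin: "(\<integral>\<^sup>+\<zeta>. conv (cabs f) (cabs g) \<zeta> * cabs \<psi> \<zeta> \<partial>lborel) < \<infinity>"
  have int: "integrable (lborel \<Otimes>\<^sub>M lborel) (\<lambda>(\<xi>, \<zeta>). f \<xi> * g (\<zeta> - \<xi>) * \<psi> \<zeta>)"
  proof (rule integrableI_bounded)
    show "(\<lambda>(\<xi>, \<zeta>). f \<xi> * g (\<zeta> - \<xi>) * \<psi> \<zeta>) \<in> borel_measurable (lborel \<Otimes>\<^sub>M lborel)" by measurable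
    have "(\<integral>\<^sup>+p. ennreal (norm (case p of (\<xi>, \<zeta>) \<Rightarrow> f \<xi> * g (\<zeta> - \<xi>) * \<psi> \<zeta>)) \<partial>(lborel \<Otimes>\<^sub>M lborel))
       = (\<integral>\<^sup>+\<xi>. \<integral>\<^sup>+\<zeta>. ennreal (norm (f \<xi> * g (\<zeta> - \<xi>) * \<psi> \<zeta>)) \<partial>lborel \<partial>lborel)"
      by (subst lborel.nn_integral_fst[symmetric]) auto
    also have "\<dots> < \<infinity>" using fin eq unfolding tr by simp
    finally show "(\<integral>\<^sup>+p. ennreal (norm (case p of (\<xi>, \<zeta>) \<Rightarrow> f \<xi> * g (\<zeta> - \<xi>) * \<psi> \<zeta>)) \<partial>(lborel \<Otimes>\<^sub>M lborel)) < \<infinity>" .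
  qed
  have tr2: "(\<integral>\<eta>. f \<xi> * g \<eta> * \<psi> (\<xi> + \<eta>) \<partial>lborel) = (\<integral>\<zeta>. f \<xi> * g (\<zeta> - \<xi>) * \<psi> \<zeta> \<partial>lborel)" for \<xi>
    using integral_translate[of "\<lambda>\<eta>. f \<xi> * g \<eta> * \<psi> (\<xi> + \<eta>)" "- \<xi>"] by simp
  have "(\<integral>\<xi>. \<integral>\<eta>. f \<xi> * g \<eta> * \<psi> (\<xi> + \<eta>) \<partial>lborel \<partial>lborel) = (\<integral>\<zeta>. \<integral>\<xi>. f \<xi> * g (\<zeta> - \<xi>) * \<psi> \<zeta> \<partial>lborel \<partial>lborel)"
    unfolding tr2 by (rule lborel_pair.Fubini_integral[OF int, symmetric])
  also have "\<dots> = (\<integral>\<zeta>. cconv f g \<zeta> * \<psi> \<zeta> \<partial>lborel)" by (simp add: cconv_def)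
  finally show "(\<integral>\<xi>. \<integral>\<eta>. f \<xi> * g \<eta> * \<psi> (\<xi> + \<eta>) \<partial>lborel \<partial>lborel) = (\<integral>\<zeta>. cconv f g \<zeta> * \<psi> \<zeta> \<partial>lborel)" .
qed

lemma conv_test_finite:
  fixes f g :: "real^'n::finite \<Rightarrow> complex"
  assumes n: "CARD('n) \<ge> 3" and [measurable]: "f \<in> borel_measurable borel" "g \<in> borel_measurable borel"
    and fin: "norm2 (cabs f) < \<infinity>" "norm2 (cabs g) < \<infinity>" and \<psi>: "\<psi> \<in> test_functions"
  shows "(\<integral>\<^sup>+\<zeta>. conv (cabs f) (cabs g) \<zeta> * cabs \<psi> \<zeta> \<partial>lborel) < \<infinity>"
proof -
  obtain B where B: "B \<ge> 0" "\<And>x. norm (\<psi> x) \<le> B" using test_function_bounded \<psi> by blast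
  obtain K where K: "compact K" "\<And>x. x \<notin> K \<Longrightarrow> \<psi> x = 0" using test_function_support \<psi> by blast
  obtain r where r: "\<And>x. x \<in> K \<Longrightarrow> norm x \<le> r" using compact_imp_bounded[OF K(1)] bounded_iff by metis
  have "(\<integral>\<^sup>+\<zeta>. conv (cabs f) (cabs g) \<zeta> * cabs \<psi> \<zeta> \<partial>lborel)
     \<le> (\<integral>\<^sup>+\<zeta>. ennreal B * (indicator (cball 0 r) \<zeta> * conv (cabs f) (cabs g) \<zeta>) \<partial>lborel)"
  proof (rule nn_integral_mono)
    fix \<zeta>
    show "conv (cabs f) (cabs g) \<zeta> * cabs \<psi> \<zeta> \<le> ennreal B * (indicator (cball 0 r) \<zeta> * conv (cabs f) (cabs g) \<zeta>)"
    proof (cases "\<zeta> \<in> K")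
      case True
      have "conv (cabs f) (cabs g) \<zeta> * cabs \<psi> \<zeta> \<le> conv (cabs f) (cabs g) \<zeta> * ennreal B"
        by (intro mult_left_mono ennreal_leI B) simp
      then show ?thesis using r[OF True] by (simp add: mult.commute)
    qed (simp add: K)
  qed
  also have "\<dots> = ennreal B * (\<integral>\<^sup>+\<zeta>. indicator (cball 0 r) \<zeta> * conv (cabs f) (cabs g) \<zeta> \<partial>lborel)"
    by (rule nn_integral_cmult) measurable
  also have "\<dots> < \<infinity>"
    using conv_locally_integrable[OF n, of "cabs f" "cabs g" r] fin by (simp add: ennreal_mult_less_top)
  finally show ?thesis .
qed

text \<open>\<open>fourier_product\<close> asks for the square of one factor to be integrable
  against \<open>fourier \<psi>\<close>. That square is the diagonal tensor entry of the same
  component, which is tempered by assumption.\<close>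

lemma tensor_entry_fourier:
  fixes w :: "real^'n::finite \<Rightarrow> real^'n"
  assumes n: "CARD('n) \<ge> 3" and w: "has_hat w b"
    and T: "\<And>j k. tempered_fun (tensor_entry w w j k)" and \<psi>: "\<psi> \<in> test_functions"
  shows "(\<integral>x. tensor_entry w w j k x * fourier \<psi> x \<partial>lebesgue)
      = fourier_const TYPE('n) * (\<integral>\<zeta>. cconv (b j) (b k) \<zeta> * \<psi> \<zeta> \<partial>lborel)"
proof -
  note bm[measurable] = has_hat_measurable[OF w]
  have \<psi>m[measurable]: "\<psi> \<in> borel_measurable borel" by (rule test_function_measurable[OF \<psi>])
  have fin: "(\<integral>\<^sup>+\<zeta>. conv (cabs (b j)) (cabs (b k)) \<zeta> * cabs \<psi> \<zeta> \<partial>lborel) < \<infinity>"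
    using w by (intro conv_test_finite[OF n bm bm _ _ \<psi>]) (auto simp: has_hat_def)
  have "integrable lebesgue (\<lambda>x. norm (tensor_entry w w k k x * fourier \<psi> x))"
    using T[of k k] fourier_in_schwartz[OF \<psi>] unfolding tempered_fun_def by (intro integrable_norm) blast
  then have sq: "integrable lebesgue (\<lambda>x. (norm (component w k x))\<^sup>2 * norm (fourier \<psi> x))"
    by (simp add: tensor_entry_def component_def norm_mult power2_eq_square)
  have "(\<integral>x. tensor_entry w w j k x * fourier \<psi> x \<partial>lebesgue) = (\<integral>x. component w j x * component w k x * fourier \<psi> x \<partial>lebesgue)"
    by (simp add: tensor_entry_def component_def)
  also have "\<dots> = fourier_const TYPE('n) * (\<integral>\<xi>. \<integral>\<eta>. b j \<xi> * b k \<eta> * \<psi> (\<xi> + \<eta>) \<partial>lborel \<partial>lborel)"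
    using w by (intro fourier_product \<psi> sq) (use fin in \<open>auto simp: has_hat_def conv_test\<close>)
  also have "\<dots> = fourier_const TYPE('n) * (\<integral>\<zeta>. cconv (b j) (b k) \<zeta> * \<psi> \<zeta> \<partial>lborel)"
    using conv_test(2)[OF bm bm \<psi>m fin] by simp
  finally show ?thesis .
qed

text \<open>The transform of the k-th component of the divergence: differentiation becomes
  multiplication by i \<zeta>_j, and the normalisation of the transform leaves one constant in front
  of each convolution.\<close>

definition div_hat :: "('n::finite \<Rightarrow> real^'n \<Rightarrow> complex) \<Rightarrow> 'n \<Rightarrow> real^'n \<Rightarrow> complex" where
  "div_hat b k \<zeta> = (\<Sum>j\<in>UNIV. fourier_const TYPE('n) * (\<i> * of_real (\<zeta> $ j)) * cconv (b j) (b k) \<zeta>)"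

lemma div_hat_measurable:
  assumes [measurable]: "\<And>j. b j \<in> borel_measurable borel"
  shows "div_hat b k \<in> borel_measurable borel"
  unfolding div_hat_def[abs_def] by measurable

lemma cconv_test_integrable:
  fixes f g :: "real^'n::finite \<Rightarrow> complex"
  assumes n: "CARD('n) \<ge> 3" and [measurable]: "f \<in> borel_measurable borel" "g \<in> borel_measurable borel"
    and fin: "norm2 (cabs f) < \<infinity>" "norm2 (cabs g) < \<infinity>" and \<psi>: "\<psi> \<in> test_functions"
  shows "integrable lborel (\<lambda>\<zeta>. cconv f g \<zeta> * \<psi> \<zeta>)"
proof (rule integrableI_bounded)
  have [measurable]: "\<psi> \<in> borel_measurable borel" by (rule test_function_measurable[OF \<psi>])
  show "(\<lambda>\<zeta>. cconv f g \<zeta> * \<psi> \<zeta>) \<in> borel_measurable lborel" by measurable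
  have "(\<integral>\<^sup>+\<zeta>. ennreal (norm (cconv f g \<zeta> * \<psi> \<zeta>)) \<partial>lborel) \<le> (\<integral>\<^sup>+\<zeta>. conv (cabs f) (cabs g) \<zeta> * cabs \<psi> \<zeta> \<partial>lborel)"
    by (rule nn_integral_mono) (simp add: norm_mult ennreal_mult mult_right_mono norm_cconv_le)
  also have "\<dots> < \<infinity>" by (rule conv_test_finite[OF n _ _ fin \<psi>]) measurable
  finally show "(\<integral>\<^sup>+\<zeta>. ennreal (norm (cconv f g \<zeta> * \<psi> \<zeta>)) \<partial>lborel) < \<infinity>" .
qed

text \<open>On a ball the factors \<zeta>_j are bounded by the radius, so local integrability is
  inherited from the convolutions.\<close>

lemma div_hat_L1_loc:
  fixes b :: "'n::finite \<Rightarrow> real^'n \<Rightarrow> complex"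
  assumes n: "CARD('n) \<ge> 3" and bm[measurable]: "\<And>j. b j \<in> borel_measurable borel"
    and fin: "\<And>j. norm2 (cabs (b j)) < \<infinity>"
  shows "div_hat b k \<in> L1_loc"
proof (rule L1_loc_nn_integral[OF div_hat_measurable[OF bm]])
  fix r
  let ?c = "norm (fourier_const TYPE('n))"
  have "(\<integral>\<^sup>+\<zeta>. indicator (cball 0 r) \<zeta> * ennreal (norm (div_hat b k \<zeta>)) \<partial>lborel)
     \<le> (\<integral>\<^sup>+\<zeta>. (\<Sum>j\<in>UNIV. ennreal (?c * r) * (indicator (cball 0 r) \<zeta> * conv (cabs (b j)) (cabs (b k)) \<zeta>)) \<partial>lborel)"
  proof (rule nn_integral_mono)
    fix \<zeta> :: "real^'n"
    show "indicator (cball 0 r) \<zeta> * ennreal (norm (div_hat b k \<zeta>))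
       \<le> (\<Sum>j\<in>UNIV. ennreal (?c * r) * (indicator (cball 0 r) \<zeta> * conv (cabs (b j)) (cabs (b k)) \<zeta>))"
    proof (cases "norm \<zeta> \<le> r")
      case True
      have "norm (div_hat b k \<zeta>) \<le> (\<Sum>j\<in>UNIV. norm (fourier_const TYPE('n) * (\<i> * of_real (\<zeta> $ j)) * cconv (b j) (b k) \<zeta>))"
        unfolding div_hat_def by (rule norm_sum)
      also have "\<dots> \<le> (\<Sum>j\<in>UNIV. (?c * r) * norm (cconv (b j) (b k) \<zeta>))"
      proof (rule sum_mono)
        fix j
        have "\<bar>\<zeta> $ j\<bar> \<le> r" using component_le_norm_cart[of \<zeta> j] True by simp
        then show "norm (fourier_const TYPE('n) * (\<i> * of_real (\<zeta> $ j)) * cconv (b j) (b k) \<zeta>) \<le> (?c * r) * norm (cconv (b j) (b k) \<zeta>)"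
          by (simp add: norm_mult mult_left_mono mult_right_mono)
      qed
      finally have "ennreal (norm (div_hat b k \<zeta>)) \<le> ennreal (\<Sum>j\<in>UNIV. (?c * r) * norm (cconv (b j) (b k) \<zeta>))" by (rule ennreal_leI)
      also have "\<dots> = (\<Sum>j\<in>UNIV. ennreal (?c * r) * ennreal (norm (cconv (b j) (b k) \<zeta>)))"
      proof -
        have "0 \<le> r" using True norm_ge_zero[of \<zeta>] by linarith
        then have "0 \<le> ?c * r" by simp
        then show ?thesis by (subst sum_ennreal[symmetric]) (auto simp: ennreal_mult intro!: sum.cong)
      qed
      also have "\<dots> \<le> (\<Sum>j\<in>UNIV. ennreal (?c * r) * conv (cabs (b j)) (cabs (b k)) \<zeta>)"
        by (intro sum_mono mult_left_mono norm_cconv_le) simp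
      finally show ?thesis using True by simp
    qed simp
  qed
  also have "\<dots> = (\<Sum>j\<in>UNIV. ennreal (?c * r) * (\<integral>\<^sup>+\<zeta>. indicator (cball 0 r) \<zeta> * conv (cabs (b j)) (cabs (b k)) \<zeta> \<partial>lborel))"
    by (simp add: nn_integral_sum nn_integral_cmult)
  also have "\<dots> < \<infinity>"
    using conv_locally_integrable[OF n, of "cabs (b _)" "cabs (b k)" r] fin by (simp add: ennreal_mult_less_top)
  finally show "(\<integral>\<^sup>+\<zeta>. indicator (cball 0 r) \<zeta> * ennreal (norm (div_hat b k \<zeta>)) \<partial>lborel) < \<infinity>" .
qed

text \<open>The minus sign of \<open>dist_partial\<close> meets the factor - i \<zeta>_j produced by
  differentiating a transform, which yields + i \<zeta>_j. Each coordinate multiple of \<psi> is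
  again a test function, so \<open>tensor_entry_fourier\<close> applies to it.\<close>

lemma div_tensor_represents:
  fixes w :: "real^'n::finite \<Rightarrow> real^'n"
  assumes n: "CARD('n) \<ge> 3" and w: "has_hat w b" and T: "\<And>j k. tempered_fun (tensor_entry w w j k)"
  shows "represents (div_hat b k) (fourier_dist (div_tensor w w k))"
proof -
  note bm[measurable] = has_hat_measurable[OF w]
  have fin: "norm2 (cabs (b j)) < \<infinity>" for j using w by (simp add: has_hat_def)
  note L = div_hat_L1_loc[OF n bm fin]
  have "fourier_dist (div_tensor w w k) \<psi> = regular_dist (div_hat b k) \<psi>" if \<psi>: "\<psi> \<in> test_functions" for \<psi>
  proof -
    note t = test_function_coord'[OF \<psi>, of "- \<i>"]
    have "fourier_dist (div_tensor w w k) \<psi> = (\<Sum>j\<in>UNIV. - (\<integral>x. tensor_entry w w j k x * fourier (\<lambda>\<xi>. - \<i> * of_real (\<xi> $ j) * \<psi> \<xi>) x \<partial>lebesgue))"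
      by (simp add: fourier_dist_def div_tensor_def dist_partial_def regular_dist_def partial_fourier[OF \<psi>])
    also have "\<dots> = (\<Sum>j\<in>UNIV. - (fourier_const TYPE('n) * (\<integral>\<zeta>. cconv (b j) (b k) \<zeta> * (- \<i> * of_real (\<zeta> $ j) * \<psi> \<zeta>) \<partial>lborel)))"
      by (simp only: tensor_entry_fourier[OF n w T t])
    also have "\<dots> = (\<Sum>j\<in>UNIV. \<integral>\<zeta>. - fourier_const TYPE('n) * (cconv (b j) (b k) \<zeta> * (- \<i> * of_real (\<zeta> $ j) * \<psi> \<zeta>)) \<partial>lborel)"
      by (simp only: integral_mult_right_zero minus_mult_left)
    also have "\<dots> = (\<integral>\<zeta>. (\<Sum>j\<in>UNIV. - fourier_const TYPE('n) * (cconv (b j) (b k) \<zeta> * (- \<i> * of_real (\<zeta> $ j) * \<psi> \<zeta>))) \<partial>lborel)"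
      by (rule Bochner_Integration.integral_sum[symmetric])
         (intro integrable_mult_right cconv_test_integrable[OF n bm bm fin fin t])
    also have "\<dots> = (\<integral>\<zeta>. div_hat b k \<zeta> * \<psi> \<zeta> \<partial>lborel)"
      unfolding div_hat_def sum_distrib_right
      by (rule Bochner_Integration.integral_cong[OF refl], rule sum.cong[OF refl]) (simp add: mult_ac)
    also have "\<dots> = regular_dist (div_hat b k) \<psi>"
      unfolding regular_dist_def
      by (rule integral_completion[symmetric])
         (use test_function_measurable[OF \<psi>] div_hat_measurable[of b k] bm in simp)
    finally show ?thesis .
  qed
  then show ?thesis using L by (simp add: represents_def)
qed

text \<open>\<open>leray_projection\<close> and \<open>duhamel_integral\<close> each provide some
  representative; by uniqueness they agree almost everywhere with the explicit one.\<close>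

lemma leray_hat:
  fixes w :: "real^'n::finite \<Rightarrow> real^'n"
  assumes n: "CARD('n) \<ge> 3" and w: "has_hat w b" and T: "\<And>j k. tempered_fun (tensor_entry w w j k)"
    and P: "leray_projection (div_tensor w w) P" and G: "represents G (fourier_dist (P j))"
  shows "AE \<xi> in lborel. G \<xi> = (\<Sum>k\<in>UNIV. of_real (leray_symbol j k \<xi>) * div_hat b k \<xi>)"
proof -
  obtain g where g: "\<And>k. represents (g k) (fourier_dist (div_tensor w w k))"
    and gj: "represents (\<lambda>\<xi>. \<Sum>k\<in>UNIV. of_real (leray_symbol j k \<xi>) * g k \<xi>) (fourier_dist (P j))"
    using P unfolding leray_projection_def by blast
  have "AE \<xi> in lebesgue. g k \<xi> = div_hat b k \<xi>" for k
    using represents_unique[OF g div_tensor_represents[OF n w T]] .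
  then have "AE \<xi> in lebesgue. \<forall>k. g k \<xi> = div_hat b k \<xi>" by (simp add: AE_all_countable)
  moreover have "AE \<xi> in lebesgue. G \<xi> = (\<Sum>k\<in>UNIV. of_real (leray_symbol j k \<xi>) * g k \<xi>)"
    by (rule represents_unique[OF G gj])
  ultimately have "AE \<xi> in lebesgue. G \<xi> = (\<Sum>k\<in>UNIV. of_real (leray_symbol j k \<xi>) * div_hat b k \<xi>)"
    by eventually_elim simp
  then show ?thesis by (simp only: AE_completion_iff)
qed

section \<open>Difference of the nonlinear terms of two solutions\<close>

lemma leray_symbol_bound: "\<bar>leray_symbol j k \<xi>\<bar> \<le> 2"
proof -
  have "\<bar>\<xi> $ j * \<xi> $ k / (norm \<xi>)\<^sup>2\<bar> \<le> 1"
  proof (cases "\<xi> = 0")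
    case False
    have "\<bar>\<xi> $ j\<bar> * \<bar>\<xi> $ k\<bar> \<le> norm \<xi> * norm \<xi>" by (intro mult_mono component_le_norm_cart) auto
    then show ?thesis using False by (simp add: abs_mult power2_eq_square divide_le_eq)
  qed simp
  moreover have "\<bar>(if j = k then 1 else 0) :: real\<bar> \<le> 1" by simp
  ultimately show ?thesis unfolding leray_symbol_def by linarith
qed

text \<open>Summing over all pairs of components gives one scalar majorant for every tensor entry,
  so that the estimates can be carried out for scalar functions.\<close>

definition conv_sum :: "('n::finite \<Rightarrow> real^'n \<Rightarrow> complex) \<Rightarrow> ('n \<Rightarrow> real^'n \<Rightarrow> complex) \<Rightarrow> real^'n \<Rightarrow> ennreal" where
  "conv_sum a w \<zeta> = (\<Sum>p\<in>UNIV. conv (cabs (a (fst p))) (cabs (w (snd p))) \<zeta>)"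

lemma conv_sum_ge: "conv (cabs (a k)) (cabs (w l)) \<zeta> \<le> conv_sum a w \<zeta>"
  unfolding conv_sum_def using member_le_sum[of "(k, l)" UNIV "\<lambda>p. conv (cabs (a (fst p))) (cabs (w (snd p))) \<zeta>"] by simp

text \<open>Bilinearity of \<open>cconv\<close> is available where the integrals converge. A locally
  integrable function is finite almost everywhere, and countably many balls cover the space.\<close>

lemma conv_finite_AE:
  fixes f g :: "real^'n::finite \<Rightarrow> complex"
  assumes n: "CARD('n) \<ge> 3" and [measurable]: "f \<in> borel_measurable borel" "g \<in> borel_measurable borel"
    and fin: "norm2 (cabs f) < \<infinity>" "norm2 (cabs g) < \<infinity>"
  shows "AE \<zeta> in lborel. integrable lborel (\<lambda>x. f x * g (\<zeta> - x))"
proof -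
  have "AE \<zeta> in lborel. indicator (cball 0 (real m)) \<zeta> * conv (cabs f) (cabs g) \<zeta> \<noteq> \<infinity>" for m :: nat
    using conv_locally_integrable[OF n, of "cabs f" "cabs g" "real m"] fin by (intro nn_integral_noteq_infinite) auto
  then have "AE \<zeta> in lborel. \<forall>m::nat. indicator (cball 0 (real m)) \<zeta> * conv (cabs f) (cabs g) \<zeta> \<noteq> \<infinity>"
    unfolding AE_all_countable by blast
  then show ?thesis
  proof eventually_elim
    case (elim \<zeta>)
    obtain m where "norm \<zeta> \<le> real m" using real_arch_simple by blast
    then have "conv (cabs f) (cabs g) \<zeta> < \<infinity>" using elim[rule_format, of m] by (simp add: less_top)
    then show ?case
      unfolding conv_def by (intro integrableI_bounded) (simp_all add: norm_mult ennreal_mult)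
  qed
qed

text \<open>The identity a_j * a_k - b_j * b_k = w_j * a_k + b_j * w_k for convolutions. Expanding
  it involves the mixed convolution b_j * a_k, whose convergence is therefore secured along with
  that of the other two.\<close>

lemma cconv_difference:
  fixes a b :: "'n::finite \<Rightarrow> real^'n \<Rightarrow> complex"
  assumes n: "CARD('n) \<ge> 3" and am: "\<And>j. a j \<in> borel_measurable borel" and bm: "\<And>j. b j \<in> borel_measurable borel"
    and fin: "\<And>j. norm2 (cabs (a j)) < \<infinity>" "\<And>j. norm2 (cabs (b j)) < \<infinity>"
  defines "w \<equiv> \<lambda>j \<xi>. a j \<xi> - b j \<xi>"
  shows "AE \<zeta> in lborel. \<forall>j k. ennreal (norm (cconv (a j) (a k) \<zeta> - cconv (b j) (b k) \<zeta>)) \<le> conv_sum a w \<zeta> + conv_sum b w \<zeta>"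
proof -
  note [measurable] = am bm
  have wm[measurable]: "w j \<in> borel_measurable borel" for j unfolding w_def by measurable
  have "AE \<zeta> in lborel. \<forall>j k. integrable lborel (\<lambda>x. a j x * a k (\<zeta> - x)) \<and> integrable lborel (\<lambda>x. b j x * b k (\<zeta> - x))
      \<and> integrable lborel (\<lambda>x. b j x * a k (\<zeta> - x))"
    unfolding AE_all_countable AE_conj_iff by (intro allI conjI conv_finite_AE n am bm fin)
  then show ?thesis
  proof eventually_elim
    case (elim \<zeta>)
    show ?case
    proof (intro allI)
      fix j k
      have i: "integrable lborel (\<lambda>x. a j x * a k (\<zeta> - x))" "integrable lborel (\<lambda>x. b j x * b k (\<zeta> - x))"
        "integrable lborel (\<lambda>x. b j x * a k (\<zeta> - x))" using elim by auto
      have "cconv (a j) (a k) \<zeta> - cconv (b j) (b k) \<zeta> = cconv (w j) (a k) \<zeta> + cconv (b j) (w k) \<zeta>"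
        using i by (simp add: cconv_def w_def left_diff_distrib right_diff_distrib)
      then have "ennreal (norm (cconv (a j) (a k) \<zeta> - cconv (b j) (b k) \<zeta>)) \<le> ennreal (norm (cconv (w j) (a k) \<zeta>) + norm (cconv (b j) (w k) \<zeta>))"
        by (intro ennreal_leI) (simp add: norm_triangle_ineq)
      also have "\<dots> = ennreal (norm (cconv (w j) (a k) \<zeta>)) + ennreal (norm (cconv (b j) (w k) \<zeta>))" by simp
      also have "\<dots> \<le> conv (cabs (w j)) (cabs (a k)) \<zeta> + conv (cabs (b j)) (cabs (w k)) \<zeta>"
        by (intro add_mono norm_cconv_le)
      also have "conv (cabs (w j)) (cabs (a k)) = conv (cabs (a k)) (cabs (w j))" by (rule conv_commute) measurable
      also have "conv (cabs (a k)) (cabs (w j)) \<zeta> + conv (cabs (b j)) (cabs (w k)) \<zeta> \<le> conv_sum a w \<zeta> + conv_sum b w \<zeta>"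
        by (intro add_mono conv_sum_ge)
      finally show "ennreal (norm (cconv (a j) (a k) \<zeta> - cconv (b j) (b k) \<zeta>)) \<le> conv_sum a w \<zeta> + conv_sum b w \<zeta>" .
    qed
  qed
qed

text \<open>The 2 bounds the Leray symbol; the three powers of n count the sums over the output
  component, over the component to which the symbol is applied, and over the direction of
  differentiation.\<close>

definition leray_const :: "'n::finite itself \<Rightarrow> real" where
  "leray_const t = 2 * norm (fourier_const t) * (real CARD('n)) ^ 3"

text \<open>Both terms carry the same Leray symbol and the same factors i \<zeta>_j, so the
  difference falls on the convolutions alone.\<close>

lemma leray_difference:
  fixes a b :: "'n::finite \<Rightarrow> real^'n \<Rightarrow> complex"
  assumes n: "CARD('n) \<ge> 3" and am: "\<And>j. a j \<in> borel_measurable borel" and bm: "\<And>j. b j \<in> borel_measurable borel"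
    and fin: "\<And>j. norm2 (cabs (a j)) < \<infinity>" "\<And>j. norm2 (cabs (b j)) < \<infinity>"
  defines "w \<equiv> \<lambda>j \<xi>. a j \<xi> - b j \<xi>"
  shows "AE \<zeta> in lborel. (\<Sum>j\<in>UNIV. ennreal (norm ((\<Sum>k\<in>UNIV. of_real (leray_symbol j k \<zeta>) * div_hat a k \<zeta>)
        - (\<Sum>k\<in>UNIV. of_real (leray_symbol j k \<zeta>) * div_hat b k \<zeta>))))
     \<le> ennreal (leray_const TYPE('n) * norm \<zeta>) * (conv_sum a w \<zeta> + conv_sum b w \<zeta>)"
proof -
  have "AE \<zeta> in lborel. \<forall>j k. ennreal (norm (cconv (a j) (a k) \<zeta> - cconv (b j) (b k) \<zeta>)) \<le> conv_sum a w \<zeta> + conv_sum b w \<zeta>"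
    unfolding w_def by (rule cconv_difference[OF n am bm fin])
  then show ?thesis
  proof eventually_elim
    case (elim \<zeta>)
    let ?c = "norm (fourier_const TYPE('n))"
    define X where "X = conv_sum a w \<zeta> + conv_sum b w \<zeta>"
    show ?case unfolding X_def[symmetric]
    proof (cases "X = \<top>")
      case True
      show "(\<Sum>j\<in>UNIV. ennreal (norm ((\<Sum>k\<in>UNIV. of_real (leray_symbol j k \<zeta>) * div_hat a k \<zeta>)
          - (\<Sum>k\<in>UNIV. of_real (leray_symbol j k \<zeta>) * div_hat b k \<zeta>)))) \<le> ennreal (leray_const TYPE('n) * norm \<zeta>) * X"
      \<comment> \<open>An infinite majorant makes the right-hand side infinite except at \<zeta> =
        0, where both divergences have the factor 0.\<close>
      proof (cases "\<zeta> = 0")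
        case False
        then have "leray_const TYPE('n) * norm \<zeta> > 0" by (simp add: leray_const_def)
        then have "ennreal (leray_const TYPE('n) * norm \<zeta>) * X = \<top>"
          unfolding True by (subst ennreal_mult_top) (simp only: ennreal_eq_0_iff not_le if_False split: if_split, simp)
        then show ?thesis by (simp only: top_greatest)
      qed (simp add: div_hat_def)
    next
      case False
      then obtain x where x: "X = ennreal x" "x \<ge> 0" by (cases X) auto
      have cc: "norm (cconv (a j) (a k) \<zeta> - cconv (b j) (b k) \<zeta>) \<le> x" for j k
        using elim[rule_format, of j k] x unfolding X_def[symmetric] by (simp add: ennreal_le_iff)
      have dd: "norm (div_hat a k \<zeta> - div_hat b k \<zeta>) \<le> real CARD('n) * (?c * norm \<zeta> * x)" for k
      proof -
        have "div_hat a k \<zeta> - div_hat b k \<zeta> = (\<Sum>j\<in>UNIV. fourier_const TYPE('n) * (\<i> * of_real (\<zeta> $ j)) * (cconv (a j) (a k) \<zeta> - cconv (b j) (b k) \<zeta>))"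
          by (simp add: div_hat_def sum_subtractf[symmetric] right_diff_distrib)
        also have "norm \<dots> \<le> (\<Sum>j\<in>(UNIV::'n set). ?c * norm \<zeta> * x)"
        proof (rule sum_norm_le)
          fix j
          show "norm (fourier_const TYPE('n) * (\<i> * of_real (\<zeta> $ j)) * (cconv (a j) (a k) \<zeta> - cconv (b j) (b k) \<zeta>)) \<le> ?c * norm \<zeta> * x"
            unfolding norm_mult by (intro mult_mono cc) (auto simp: component_le_norm_cart mult_left_mono)
        qed
        finally show ?thesis by simp
      qed
      have gg: "norm ((\<Sum>k\<in>UNIV. of_real (leray_symbol j k \<zeta>) * div_hat a k \<zeta>) - (\<Sum>k\<in>UNIV. of_real (leray_symbol j k \<zeta>) * div_hat b k \<zeta>))
          \<le> real CARD('n) * (2 * (real CARD('n) * (?c * norm \<zeta> * x)))" for j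
      proof -
        have "(\<Sum>k\<in>UNIV. of_real (leray_symbol j k \<zeta>) * div_hat a k \<zeta>) - (\<Sum>k\<in>UNIV. of_real (leray_symbol j k \<zeta>) * div_hat b k \<zeta>)
           = (\<Sum>k\<in>UNIV. of_real (leray_symbol j k \<zeta>) * (div_hat a k \<zeta> - div_hat b k \<zeta>))"
          by (simp add: sum_subtractf[symmetric] right_diff_distrib)
        also have "norm \<dots> \<le> (\<Sum>k\<in>(UNIV::'n set). 2 * (real CARD('n) * (?c * norm \<zeta> * x)))"
        proof (rule sum_norm_le)
          fix k
          have "norm (complex_of_real (leray_symbol j k \<zeta>)) \<le> 2" using leray_symbol_bound by simp
          then show "norm (of_real (leray_symbol j k \<zeta>) * (div_hat a k \<zeta> - div_hat b k \<zeta>))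
              \<le> 2 * (real CARD('n) * (?c * norm \<zeta> * x))"
            unfolding norm_mult[of "of_real (leray_symbol j k \<zeta>)"] by (rule mult_mono[OF _ dd]) simp_all
        qed
        finally show ?thesis by simp
      qed
      have "(\<Sum>j\<in>UNIV. ennreal (norm ((\<Sum>k\<in>UNIV. of_real (leray_symbol j k \<zeta>) * div_hat a k \<zeta>)
          - (\<Sum>k\<in>UNIV. of_real (leray_symbol j k \<zeta>) * div_hat b k \<zeta>)))) \<le> (\<Sum>j\<in>(UNIV::'n set). ennreal (real CARD('n) * (2 * (real CARD('n) * (?c * norm \<zeta> * x)))))"
        by (intro sum_mono ennreal_leI gg)
      also have "\<dots> = ennreal (\<Sum>j\<in>(UNIV::'n set). real CARD('n) * (2 * (real CARD('n) * (?c * norm \<zeta> * x))))"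
        using x by (intro sum_ennreal) auto
      also have "(\<Sum>j\<in>(UNIV::'n set). real CARD('n) * (2 * (real CARD('n) * (?c * norm \<zeta> * x)))) = leray_const TYPE('n) * norm \<zeta> * x"
        by (simp add: leray_const_def power3_eq_cube)
      also have "ennreal \<dots> = ennreal (leray_const TYPE('n) * norm \<zeta>) * X"
        using x by (simp add: leray_const_def ennreal_mult)
      finally show "(\<Sum>j\<in>UNIV. ennreal (norm ((\<Sum>k\<in>UNIV. of_real (leray_symbol j k \<zeta>) * div_hat a k \<zeta>)
          - (\<Sum>k\<in>UNIV. of_real (leray_symbol j k \<zeta>) * div_hat b k \<zeta>)))) \<le> ennreal (leray_const TYPE('n) * norm \<zeta>) * X" .
    qed
  qed
qed

section \<open>Energy estimates for the nonlinear difference\<close>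

lemma sum_power2_le_ennreal:
  fixes f :: "'a \<Rightarrow> ennreal"
  assumes "finite I"
  shows "(\<Sum>i\<in>I. f i)\<^sup>2 \<le> of_nat (card I) * (\<Sum>i\<in>I. (f i)\<^sup>2)"
  using Cauchy_Schwarz_nn_integral[of f "count_space I" "\<lambda>_. 1"] assms
  by (simp add: nn_integral_count_space_finite mult.commute)

definition hat_energy :: "('n::finite \<Rightarrow> real^'n \<Rightarrow> complex) \<Rightarrow> ennreal" where
  "hat_energy a = (\<Sum>k\<in>UNIV. norm2 (cabs (a k)))"

definition hat_tail :: "real \<Rightarrow> ('n::finite \<Rightarrow> real^'n \<Rightarrow> complex) \<Rightarrow> ennreal" where
  "hat_tail M a = (\<Sum>k\<in>UNIV. norm2 (\<lambda>\<xi>. indicator {\<xi>. M < norm \<xi>} \<xi> * cabs (a k) \<xi>))"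

lemma conv_sum_measurable:
  assumes [measurable]: "\<And>j. a j \<in> borel_measurable borel" "\<And>j. w j \<in> borel_measurable borel"
  shows "conv_sum a w \<in> borel_measurable borel"
  unfolding conv_sum_def[abs_def] by measurable

text \<open>The weight \<omega> and the constants \<open>A k\<close> are left open, so that the
  bound serves for all frequencies and for high ones alike. The square of a sum over the n^2 pairs
  costs the factor n^2.\<close>

lemma conv_sum_energy:
  fixes a w :: "'n::finite \<Rightarrow> real^'n \<Rightarrow> complex" and \<omega> :: "real^'n \<Rightarrow> ennreal"
  assumes am[measurable]: "\<And>j. a j \<in> borel_measurable borel" and wm[measurable]: "\<And>j. w j \<in> borel_measurable borel"
    and \<omega>[measurable]: "\<omega> \<in> borel_measurable borel"
    and bound: "\<And>k l. (\<integral>\<^sup>+\<zeta>. \<omega> \<zeta> * (conv (cabs (a k)) (cabs (w l)) \<zeta>)\<^sup>2 \<partial>lborel) \<le> A k * norm2 (cabs (w l))"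
  shows "(\<integral>\<^sup>+\<zeta>. \<omega> \<zeta> * (conv_sum a w \<zeta>)\<^sup>2 \<partial>lborel) \<le> of_nat (CARD('n) * CARD('n)) * ((\<Sum>k\<in>UNIV. A k) * hat_energy w)"
proof -
  let ?c = "of_nat (CARD('n) * CARD('n)) :: ennreal"
  let ?f = "\<lambda>p \<zeta>. conv (cabs (a (fst p))) (cabs (w (snd p))) \<zeta>"
  have "(\<integral>\<^sup>+\<zeta>. \<omega> \<zeta> * (conv_sum a w \<zeta>)\<^sup>2 \<partial>lborel) \<le> (\<integral>\<^sup>+\<zeta>. ?c * (\<Sum>p\<in>UNIV. \<omega> \<zeta> * (?f p \<zeta>)\<^sup>2) \<partial>lborel)"
  proof (rule nn_integral_mono)
    fix \<zeta>
    have "(conv_sum a w \<zeta>)\<^sup>2 \<le> ?c * (\<Sum>p\<in>UNIV. (?f p \<zeta>)\<^sup>2)"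
      unfolding conv_sum_def using sum_power2_le_ennreal[of UNIV "\<lambda>p. ?f p \<zeta>"] by (simp add: card_cartesian_product flip: UNIV_Times_UNIV)
    then have "\<omega> \<zeta> * (conv_sum a w \<zeta>)\<^sup>2 \<le> \<omega> \<zeta> * (?c * (\<Sum>p\<in>UNIV. (?f p \<zeta>)\<^sup>2))" by (rule mult_left_mono) simp
    then show "\<omega> \<zeta> * (conv_sum a w \<zeta>)\<^sup>2 \<le> ?c * (\<Sum>p\<in>UNIV. \<omega> \<zeta> * (?f p \<zeta>)\<^sup>2)"
      by (simp only: mult.left_commute sum_distrib_left)
  qed
  also have "\<dots> = ?c * (\<Sum>p\<in>UNIV. \<integral>\<^sup>+\<zeta>. \<omega> \<zeta> * (?f p \<zeta>)\<^sup>2 \<partial>lborel)"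
    by (subst nn_integral_cmult, measurable, subst nn_integral_sum, measurable)
  also have "\<dots> \<le> ?c * (\<Sum>p\<in>UNIV. A (fst p) * norm2 (cabs (w (snd p))))"
    by (intro mult_left_mono sum_mono bound) simp
  also have "(\<Sum>p\<in>UNIV. A (fst p) * norm2 (cabs (w (snd p)))) = (\<Sum>k\<in>UNIV. A k) * hat_energy w"
    unfolding hat_energy_def sum_product sum.cartesian_product by (simp add: case_prod_beta')
  finally show ?thesis .
qed

text \<open>The derivative in the divergence contributes |\<zeta>|^2 to the square and lifts the
  weight of order n/2 - 3 to that of order n/2 - 2, where the convolution estimates live.\<close>

lemma heat_weight_mult:
  assumes "K \<ge> 0"
  shows "heat_weight \<zeta> * (ennreal (K * norm \<zeta>) * X)\<^sup>2 = ennreal (K\<^sup>2) * (low_weight \<zeta> * X\<^sup>2)"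
proof -
  have "norm \<zeta> ^ (CARD('a) - 2) / norm \<zeta> ^ 4 * (K * norm \<zeta>)\<^sup>2 = K\<^sup>2 * (norm \<zeta> ^ (CARD('a) - 2) / (norm \<zeta>)\<^sup>2)"
  proof (cases "norm \<zeta> = 0")
    case False
    then show ?thesis by (simp add: field_simps power2_eq_square power4_eq_xxxx)
  qed simp
  then have "heat_weight \<zeta> * ennreal ((K * norm \<zeta>)\<^sup>2) = ennreal (K\<^sup>2) * low_weight \<zeta>"
    unfolding heat_weight_def low_weight_def by (subst (1 2) ennreal_mult[symmetric]) auto
  moreover have "(ennreal (K * norm \<zeta>) * X)\<^sup>2 = ennreal ((K * norm \<zeta>)\<^sup>2) * X\<^sup>2"
    using assms by (simp only: power_mult_distrib ennreal_power mult_nonneg_nonneg norm_ge_zero)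
  ultimately show ?thesis by (simp only: mult.assoc[symmetric])
qed

text \<open>The 4 is 2 for the square of a sum of two terms, times the 2 in front of
  \<open>conv_const\<close> in \<open>conv_bound_high\<close>; n^2 counts the pairs of
  components.\<close>

definition nonlin_const :: "'n::finite itself \<Rightarrow> real" where
  "nonlin_const t = 4 * (leray_const t)\<^sup>2 * (real CARD('n) * real CARD('n)) * conv_const t"

lemma leray_const_nonneg: "leray_const t \<ge> 0"
  by (simp add: leray_const_def)

text \<open>Taking \<omega> to be 1 or the indicator of high frequencies produces the two halves of
  \<open>nonlinear_estimate\<close> by one computation.\<close>

lemma nonlinear_weighted:
  fixes a b w :: "'n::finite \<Rightarrow> real^'n \<Rightarrow> complex" and h \<omega> :: "real^'n \<Rightarrow> ennreal"
  assumes am: "\<And>j. a j \<in> borel_measurable borel" and bm: "\<And>j. b j \<in> borel_measurable borel"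
    and wm: "\<And>j. w j \<in> borel_measurable borel" and \<omega>[measurable]: "\<omega> \<in> borel_measurable borel"
    and h: "AE \<zeta> in lborel. h \<zeta> \<le> ennreal (leray_const TYPE('n) * norm \<zeta>) * (conv_sum a w \<zeta> + conv_sum b w \<zeta>)"
    and A: "(\<integral>\<^sup>+\<zeta>. (\<omega> \<zeta> * low_weight \<zeta>) * (conv_sum a w \<zeta>)\<^sup>2 \<partial>lborel) \<le> of_nat (CARD('n) * CARD('n)) * (ennreal (2 * conv_const TYPE('n)) * A * E)"
    and B: "(\<integral>\<^sup>+\<zeta>. (\<omega> \<zeta> * low_weight \<zeta>) * (conv_sum b w \<zeta>)\<^sup>2 \<partial>lborel) \<le> of_nat (CARD('n) * CARD('n)) * (ennreal (2 * conv_const TYPE('n)) * B * E)"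
  shows "(\<integral>\<^sup>+\<zeta>. \<omega> \<zeta> * heat_weight \<zeta> * (h \<zeta>)\<^sup>2 \<partial>lborel) \<le> ennreal (nonlin_const TYPE('n)) * (A + B) * E"
proof -
  note [measurable] = conv_sum_measurable[OF am wm] conv_sum_measurable[OF bm wm]
  let ?K = "leray_const TYPE('n)" and ?X = "conv_sum a w" and ?Y = "conv_sum b w"
  let ?c = "of_nat (CARD('n) * CARD('n)) :: ennreal" and ?C = "ennreal (2 * conv_const TYPE('n))"
  have "(\<integral>\<^sup>+\<zeta>. \<omega> \<zeta> * heat_weight \<zeta> * (h \<zeta>)\<^sup>2 \<partial>lborel)
     \<le> (\<integral>\<^sup>+\<zeta>. ennreal (?K\<^sup>2) * (2 * ((\<omega> \<zeta> * low_weight \<zeta>) * (?X \<zeta>)\<^sup>2) + 2 * ((\<omega> \<zeta> * low_weight \<zeta>) * (?Y \<zeta>)\<^sup>2)) \<partial>lborel)"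
  proof (rule nn_integral_mono_AE, use h in eventually_elim)
    case (elim \<zeta>)
    have "heat_weight \<zeta> * (h \<zeta>)\<^sup>2 \<le> heat_weight \<zeta> * (ennreal (?K * norm \<zeta>) * (?X \<zeta> + ?Y \<zeta>))\<^sup>2"
      by (intro mult_left_mono power_mono elim) auto
    also have "\<dots> = ennreal (?K\<^sup>2) * (low_weight \<zeta> * (?X \<zeta> + ?Y \<zeta>)\<^sup>2)" by (rule heat_weight_mult[OF leray_const_nonneg])
    also have "\<dots> \<le> ennreal (?K\<^sup>2) * (low_weight \<zeta> * (2 * (?X \<zeta>)\<^sup>2 + 2 * (?Y \<zeta>)\<^sup>2))"
      by (intro mult_left_mono power2_add_le_ennreal) auto
    finally have "\<omega> \<zeta> * (heat_weight \<zeta> * (h \<zeta>)\<^sup>2) \<le> \<omega> \<zeta> * (ennreal (?K\<^sup>2) * (low_weight \<zeta> * (2 * (?X \<zeta>)\<^sup>2 + 2 * (?Y \<zeta>)\<^sup>2)))"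
      by (rule mult_left_mono) simp
    then show ?case by (simp only: mult.assoc distrib_left mult.left_commute)
  qed
  also have "\<dots> = ennreal (?K\<^sup>2) * (2 * (\<integral>\<^sup>+\<zeta>. (\<omega> \<zeta> * low_weight \<zeta>) * (?X \<zeta>)\<^sup>2 \<partial>lborel) + 2 * (\<integral>\<^sup>+\<zeta>. (\<omega> \<zeta> * low_weight \<zeta>) * (?Y \<zeta>)\<^sup>2 \<partial>lborel))"
    by (simp add: nn_integral_add nn_integral_cmult)
  also have "\<dots> \<le> ennreal (?K\<^sup>2) * (2 * (?c * (?C * A * E)) + 2 * (?c * (?C * B * E)))"
    by (intro mult_left_mono add_mono A B) auto
  also have "\<dots> = (ennreal (?K\<^sup>2) * (2 * (?c * ?C))) * (A + B) * E"
    by (simp only: distrib_left distrib_right mult.assoc mult.left_commute)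
  also have "ennreal (?K\<^sup>2) * (2 * (?c * ?C)) = ennreal (nonlin_const TYPE('n))"
  proof -
    have "?c = ennreal (real CARD('n) * real CARD('n))" by (simp add: ennreal_of_nat_eq_real_of_nat)
    moreover have "(2::ennreal) = ennreal 2" by simp
    ultimately have "ennreal (?K\<^sup>2) * (2 * (?c * ?C)) = ennreal (?K\<^sup>2 * (2 * ((real CARD('n) * real CARD('n)) * (2 * conv_const TYPE('n)))))"
      using conv_const_nonneg[of "TYPE('n)"] by (simp only: ennreal_mult[symmetric] mult_nonneg_nonneg zero_le_power2 of_nat_0_le_iff zero_le_numeral)
    then show ?thesis by (simp add: nonlin_const_def mult_ac)
  qed
  finally show ?thesis .
qed

text \<open>The difference \<open>w\<close> enters with its full energy in both bounds. In the
  second one the small factor is made up of the ratio M/R and of the tails of \<open>a\<close> and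
  \<open>b\<close> beyond M.\<close>

lemma nonlinear_estimate:
  fixes a b w :: "'n::finite \<Rightarrow> real^'n \<Rightarrow> complex" and h :: "real^'n \<Rightarrow> ennreal"
  assumes n: "CARD('n) \<ge> 3" and am: "\<And>j. a j \<in> borel_measurable borel" and bm: "\<And>j. b j \<in> borel_measurable borel"
    and wm: "\<And>j. w j \<in> borel_measurable borel"
    and h: "AE \<zeta> in lborel. h \<zeta> \<le> ennreal (leray_const TYPE('n) * norm \<zeta>) * (conv_sum a w \<zeta> + conv_sum b w \<zeta>)"
  shows "(\<integral>\<^sup>+\<zeta>. heat_weight \<zeta> * (h \<zeta>)\<^sup>2 \<partial>lborel)
      \<le> ennreal (nonlin_const TYPE('n)) * (hat_energy a + hat_energy b) * hat_energy w"
    and "M > 0 \<Longrightarrow> 2 * M \<le> R \<Longrightarrow> (\<integral>\<^sup>+\<zeta>. indicator {\<xi>. R \<le> norm \<xi>} \<zeta> * heat_weight \<zeta> * (h \<zeta>)\<^sup>2 \<partial>lborel)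
      \<le> ennreal (nonlin_const TYPE('n)) * ((ennreal ((M / R)\<^sup>2) * hat_energy a + hat_tail M a)
         + (ennreal ((M / R)\<^sup>2) * hat_energy b + hat_tail M b)) * hat_energy w"
proof -
  let ?C = "ennreal (2 * conv_const TYPE('n))"
  have C: "ennreal (conv_const TYPE('n)) \<le> ?C" using conv_const_nonneg[of "TYPE('n)"] by (intro ennreal_leI) simp
  have low: "(\<integral>\<^sup>+\<zeta>. (1 * low_weight \<zeta>) * (conv_sum f w \<zeta>)\<^sup>2 \<partial>lborel) \<le> of_nat (CARD('n) * CARD('n)) * (?C * hat_energy f * hat_energy w)"
    if [measurable]: "\<And>j. f j \<in> borel_measurable borel" for f :: "'n \<Rightarrow> real^'n \<Rightarrow> complex"
  proof -
    have "(\<integral>\<^sup>+\<zeta>. low_weight \<zeta> * (conv_sum f w \<zeta>)\<^sup>2 \<partial>lborel)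
       \<le> of_nat (CARD('n) * CARD('n)) * ((\<Sum>k\<in>UNIV. ?C * norm2 (cabs (f k))) * hat_energy w)"
    proof (rule conv_sum_energy)
      fix k l
      note [measurable] = wm
      have "(\<integral>\<^sup>+\<zeta>. low_weight \<zeta> * (conv (cabs (f k)) (cabs (w l)) \<zeta>)\<^sup>2 \<partial>lborel) \<le> ennreal (conv_const TYPE('n)) * norm2 (cabs (f k)) * norm2 (cabs (w l))"
        by (rule conv_bound[OF n]) measurable
      also have "\<dots> \<le> ?C * norm2 (cabs (f k)) * norm2 (cabs (w l))" by (intro mult_right_mono C) auto
      finally show "(\<integral>\<^sup>+\<zeta>. low_weight \<zeta> * (conv (cabs (f k)) (cabs (w l)) \<zeta>)\<^sup>2 \<partial>lborel) \<le> ?C * norm2 (cabs (f k)) * norm2 (cabs (w l))" .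
    qed (use wm that in auto)
    then show ?thesis by (simp add: hat_energy_def sum_distrib_left)
  qed
  have "(\<integral>\<^sup>+\<zeta>. (\<lambda>_. 1) \<zeta> * heat_weight \<zeta> * (h \<zeta>)\<^sup>2 \<partial>lborel) \<le> ennreal (nonlin_const TYPE('n)) * (hat_energy a + hat_energy b) * hat_energy w"
    by (rule nonlinear_weighted[OF am bm wm _ h low[OF am] low[OF bm]]) simp
  then show "(\<integral>\<^sup>+\<zeta>. heat_weight \<zeta> * (h \<zeta>)\<^sup>2 \<partial>lborel) \<le> ennreal (nonlin_const TYPE('n)) * (hat_energy a + hat_energy b) * hat_energy w" by simp
  assume M: "M > 0" "2 * M \<le> R"
  have high: "(\<integral>\<^sup>+\<zeta>. (indicator {\<xi>. R \<le> norm \<xi>} \<zeta> * low_weight \<zeta>) * (conv_sum f w \<zeta>)\<^sup>2 \<partial>lborel)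
      \<le> of_nat (CARD('n) * CARD('n)) * (?C * (ennreal ((M / R)\<^sup>2) * hat_energy f + hat_tail M f) * hat_energy w)"
    if [measurable]: "\<And>j. f j \<in> borel_measurable borel" for f :: "'n \<Rightarrow> real^'n \<Rightarrow> complex"
  proof -
    note [measurable] = wm
    have "(\<integral>\<^sup>+\<zeta>. (indicator {\<xi>. R \<le> norm \<xi>} \<zeta> * low_weight \<zeta>) * (conv_sum f w \<zeta>)\<^sup>2 \<partial>lborel)
       \<le> of_nat (CARD('n) * CARD('n)) * ((\<Sum>k\<in>UNIV. ?C * (ennreal ((M / R)\<^sup>2) * norm2 (cabs (f k)) + norm2 (\<lambda>\<xi>. indicator {\<xi>. M < norm \<xi>} \<xi> * cabs (f k) \<xi>))) * hat_energy w)"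
      by (rule conv_sum_energy[OF that wm _ conv_bound_high[OF n _ _ M]]) measurable
    then show ?thesis by (simp add: hat_energy_def hat_tail_def sum_distrib_left sum.distrib distrib_left)
  qed
  show "(\<integral>\<^sup>+\<zeta>. indicator {\<xi>. R \<le> norm \<xi>} \<zeta> * heat_weight \<zeta> * (h \<zeta>)\<^sup>2 \<partial>lborel)
      \<le> ennreal (nonlin_const TYPE('n)) * ((ennreal ((M / R)\<^sup>2) * hat_energy a + hat_tail M a)
         + (ennreal ((M / R)\<^sup>2) * hat_energy b + hat_tail M b)) * hat_energy w"
    by (rule nonlinear_weighted[OF am bm wm _ h high[OF am] high[OF bm]]) measurable
qed

text \<open>The first and third bounds carry information from one time to a nearby one: energy and
  tail are controlled by their values at the reference time plus the energy of the increment, which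
  continuity makes small.\<close>

lemma hat_energy_add:
  assumes [measurable]: "\<And>j. a j \<in> borel_measurable borel" "\<And>j. b j \<in> borel_measurable borel"
  shows "hat_energy a \<le> 2 * hat_energy b + 2 * hat_energy (\<lambda>j \<xi>. a j \<xi> - b j \<xi>)"
    and "hat_energy (\<lambda>j \<xi>. a j \<xi> - b j \<xi>) \<le> 2 * hat_energy a + 2 * hat_energy b"
    and "hat_tail M a \<le> 2 * hat_tail M b + 2 * hat_energy (\<lambda>j \<xi>. a j \<xi> - b j \<xi>)"
proof -
  have tri: "cabs (a k) \<xi> \<le> cabs (b k) \<xi> + ennreal (norm (a k \<xi> - b k \<xi>))" for k \<xi>
    using ennreal_leI[OF norm_triangle_ineq[of "b k \<xi>" "a k \<xi> - b k \<xi>"]] by simp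
  show "hat_energy a \<le> 2 * hat_energy b + 2 * hat_energy (\<lambda>j \<xi>. a j \<xi> - b j \<xi>)"
    unfolding hat_energy_def sum_distrib_left sum.distrib[symmetric]
    by (intro sum_mono norm2_add_le tri) measurable
  show "hat_energy (\<lambda>j \<xi>. a j \<xi> - b j \<xi>) \<le> 2 * hat_energy a + 2 * hat_energy b"
    unfolding hat_energy_def sum_distrib_left sum.distrib[symmetric]
    by (intro sum_mono norm2_add_le cabs_diff_le) measurable
  show "hat_tail M a \<le> 2 * hat_tail M b + 2 * hat_energy (\<lambda>j \<xi>. a j \<xi> - b j \<xi>)"
    unfolding hat_energy_def hat_tail_def sum_distrib_left sum.distrib[symmetric]
  proof (intro sum_mono norm2_add_le)
    fix k \<xi>
    show "indicator {\<xi>. M < norm \<xi>} \<xi> * cabs (a k) \<xi> \<le> indicator {\<xi>. M < norm \<xi>} \<xi> * cabs (b k) \<xi> + ennreal (norm (a k \<xi> - b k \<xi>))"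
      using tri[of k \<xi>] by (simp add: indicator_def)
  qed measurable
qed

text \<open>Dominated convergence gives the limit along integers, and the tail decreases in M, which
  settles all larger real M at once.\<close>

lemma hat_tail_small:
  fixes a :: "'n::finite \<Rightarrow> real^'n \<Rightarrow> complex"
  assumes [measurable]: "\<And>j. a j \<in> borel_measurable borel" and fin: "hat_energy a < \<infinity>" and e: "e > 0"
  shows "\<exists>m::nat. \<forall>M\<ge>real m. hat_tail M a < ennreal e"
proof -
  have fin': "norm2 (cabs (a k)) < \<infinity>" for k
    using fin unfolding hat_energy_def by (simp add: less_top)
  let ?t = "\<lambda>M k \<xi>. freq_weight \<xi> * (indicator {\<xi>. M < norm \<xi>} \<xi> * cabs (a k) \<xi>)\<^sup>2"
  have "(\<lambda>m. \<integral>\<^sup>+\<xi>. ?t (real m) k \<xi> \<partial>lborel) \<longlonglongrightarrow> (\<integral>\<^sup>+\<xi>. 0 \<partial>(lborel :: (real^'n) measure))" for k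
  proof (rule nn_integral_dominated_convergence[where w="\<lambda>\<xi>. freq_weight \<xi> * (cabs (a k) \<xi>)\<^sup>2"])
    show "AE \<xi> in lborel. (\<lambda>m. ?t (real m) k \<xi>) \<longlonglongrightarrow> 0"
    proof (rule AE_I2, rule tendsto_eventually)
      fix \<xi> :: "real^'n"
      obtain N where "norm \<xi> \<le> real N" using real_arch_simple by blast
      then show "\<forall>\<^sub>F m in sequentially. ?t (real m) k \<xi> = 0"
        by (intro eventually_sequentiallyI[of N]) (auto simp: indicator_def)
    qed
    show "AE \<xi> in lborel. ?t (real m) k \<xi> \<le> freq_weight \<xi> * (cabs (a k) \<xi>)\<^sup>2" for m
      by (intro AE_I2 mult_left_mono power_mono) (auto simp: indicator_def)
    show "(\<integral>\<^sup>+\<xi>. freq_weight \<xi> * (cabs (a k) \<xi>)\<^sup>2 \<partial>lborel) < \<infinity>" using fin'[of k] by (simp add: norm2_def)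
  qed measurable
  then have "(\<lambda>m. \<Sum>k\<in>UNIV. \<integral>\<^sup>+\<xi>. ?t (real m) k \<xi> \<partial>lborel) \<longlonglongrightarrow> (\<Sum>k\<in>(UNIV::'n set). \<integral>\<^sup>+\<xi>. 0 \<partial>(lborel :: (real^'n) measure))"
    by (intro tendsto_sum)
  then have "(\<lambda>m. hat_tail (real m) a) \<longlonglongrightarrow> 0" by (simp add: hat_tail_def norm2_def)
  from order_tendstoD(2)[OF this, of "ennreal e"] e obtain m where m: "hat_tail (real m) a < ennreal e"
    by (auto simp: eventually_sequentially)
  show ?thesis
  proof (rule exI[of _ m], intro allI impI)
    fix M assume "real m \<le> M"
    then have "hat_tail M a \<le> hat_tail (real m) a"
      unfolding hat_tail_def by (intro sum_mono norm2_mono) (auto simp: indicator_def)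
    then show "hat_tail M a < ennreal e" using m by simp
  qed
qed

section \<open>Uniqueness of mild solutions\<close>

text \<open>The exceptional set need not be measurable; enclosing it in a measurable null set makes
  the exchange of the two almost-everywhere quantifiers possible.\<close>

lemma AE_pair_both:
  fixes P :: "'a::euclidean_space \<times> 'b::euclidean_space \<Rightarrow> bool"
  assumes "AE p in lborel. P p"
  shows "AE x in lborel. AE y in lborel. P (x, y)" "AE y in lborel. AE x in lborel. P (x, y)"
proof -
  have "AE p in (lborel \<Otimes>\<^sub>M lborel). P p" by (subst lborel_prod) (rule assms)
  then obtain N where N: "{p \<in> space (lborel \<Otimes>\<^sub>M lborel). \<not> P p} \<subseteq> N" "N \<in> sets (lborel \<Otimes>\<^sub>M lborel)"
     "emeasure (lborel \<Otimes>\<^sub>M lborel) N = 0" by (rule AE_E)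
  have "AE p in (lborel \<Otimes>\<^sub>M lborel). p \<notin> N" using N by (intro AE_not_in) (auto simp: null_sets_def)
  then have 1: "AE x in lborel. AE y in lborel. (x, y) \<notin> N" by (rule lborel_pair.AE_pair)
  have "{p \<in> space (lborel \<Otimes>\<^sub>M lborel). (fst p, snd p) \<notin> N} = space (lborel \<Otimes>\<^sub>M lborel) - N" by auto
  then have "{p \<in> space (lborel \<Otimes>\<^sub>M lborel). (fst p, snd p) \<notin> N} \<in> sets (lborel \<Otimes>\<^sub>M lborel)"
    using N(2) by (simp only:) (rule sets.compl_sets)
  from lborel_pair.AE_commute[OF this] 1 have 2: "AE y in lborel. AE x in lborel. (x, y) \<notin> N" by blast
  have P: "(x, y) \<notin> N \<Longrightarrow> P (x, y)" for x y using N(1) by (auto simp: space_pair_measure)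
  show "AE x in lborel. AE y in lborel. P (x, y)" using 1 by (elim eventually_mono) (rule P)
  show "AE y in lborel. AE x in lborel. P (x, y)" using 2 by (elim eventually_mono) (rule P)
qed

lemma time_interval_sets: "time_interval T \<in> sets borel"
proof -
  have "time_interval T = {t \<in> space borel. 0 \<le> t \<and> ereal t < T}" by (auto simp: time_interval_def)
  also have "\<dots> \<in> sets borel" by measurable
  finally show ?thesis .
qed

lemma represents_diff:
  assumes "represents g S" "represents h R" shows "represents (\<lambda>\<xi>. g \<xi> - h \<xi>) (\<lambda>\<psi>. S \<psi> - R \<psi>)"
proof -
  have L: "g \<in> L1_loc" "h \<in> L1_loc" using assms by (auto simp: represents_def)
  have "regular_dist (\<lambda>\<xi>. g \<xi> - h \<xi>) \<psi> = regular_dist g \<psi> - regular_dist h \<psi>" if "\<psi> \<in> test_functions" for \<psi>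
    unfolding regular_dist_def left_diff_distrib
    by (rule Bochner_Integration.integral_diff) (intro L1_loc_mult_test L that)+
  then show ?thesis using assms L by (auto simp: represents_def L1_loc_diff)
qed

lemma represents_cong: "represents g S \<Longrightarrow> (\<And>\<psi>. \<psi> \<in> test_functions \<Longrightarrow> S \<psi> = R \<psi>) \<Longrightarrow> represents g R"
  by (simp add: represents_def)

text \<open>The heat flow of the common initial value cancels in the difference of two mild solutions.\<close>

lemma mild_difference:
  assumes u: "\<And>j. dist_eq (component_dist u j) (\<lambda>f. S j f - Iu j f)" and v: "\<And>j. dist_eq (component_dist v j) (\<lambda>f. S j f - Iv j f)"
    and a: "has_hat u a" and b: "has_hat v b"
    and gu: "represents gu (fourier_dist (Iu j))" and gv: "represents gv (fourier_dist (Iv j))"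
  shows "AE \<xi> in lborel. a j \<xi> - b j \<xi> = gv \<xi> - gu \<xi>"
proof -
  have "represents (a j) (fourier_dist (component_dist u j))" "represents (b j) (fourier_dist (component_dist v j))"
    using a b by (auto simp: has_hat_def component_dist_def intro: fourier_pair_represents)
  from represents_diff[OF this]
  have "represents (\<lambda>\<xi>. a j \<xi> - b j \<xi>) (\<lambda>\<psi>. fourier_dist (Iv j) \<psi> - fourier_dist (Iu j) \<psi>)"
  proof (rule represents_cong)
    fix \<psi> :: "real^'a \<Rightarrow> complex" assume "\<psi> \<in> test_functions"
    then have "fourier \<psi> \<in> schwartz" by (rule fourier_in_schwartz)
    then show "fourier_dist (component_dist u j) \<psi> - fourier_dist (component_dist v j) \<psi>
       = fourier_dist (Iv j) \<psi> - fourier_dist (Iu j) \<psi>"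
      using u[of j] v[of j] by (simp add: fourier_dist_def dist_eq_def)
  qed
  from represents_unique[OF this represents_diff[OF gv gu]] show ?thesis by (simp only: AE_completion_iff)
qed

lemma sum_power2_le: "finite I \<Longrightarrow> (\<Sum>i\<in>I. (f i)\<^sup>2) \<le> (\<Sum>i\<in>I. f i)\<^sup>2" for f :: "'a \<Rightarrow> ennreal"
proof (induction I rule: finite_induct)
  case (insert i I)
  have "(f i)\<^sup>2 + (\<Sum>i\<in>I. (f i)\<^sup>2) \<le> (f i)\<^sup>2 + (\<Sum>i\<in>I. f i)\<^sup>2" by (intro add_left_mono insert)
  also have "\<dots> \<le> (f i + (\<Sum>i\<in>I. f i))\<^sup>2" by (simp add: power2_sum)
  finally show ?case using insert by simp
qed simp

lemma hat_energy_zero: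
  assumes [measurable]: "\<And>j. w j \<in> borel_measurable borel" and 0: "hat_energy w = 0"
  shows "AE \<xi> in lborel. w j \<xi> = 0"
proof -
  have "norm2 (cabs (w j)) = 0" using 0 by (simp add: hat_energy_def)
  then have "AE \<xi> in lborel. freq_weight \<xi> * (cabs (w j) \<xi>)\<^sup>2 = 0"
    unfolding norm2_def by (subst (asm) nn_integral_0_iff_AE) auto
  moreover have "AE \<xi> in (lborel :: (real^'a) measure). \<xi> \<noteq> 0" by (rule AE_lborel_singleton)
  ultimately show ?thesis by eventually_elim (auto simp: freq_weight_def)
qed

text \<open>This is the way back from frequencies to the fields: a vanishing transform makes all
  pairings with transforms of test functions vanish.\<close>

lemma fourier_pair_zero:
  assumes f: "fourier_pair f b" and 0: "AE \<xi> in lborel. b \<xi> = 0"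
  shows "AE x in lebesgue. f x = 0"
proof (rule AE_zero_of_fourier_test)
  show "f \<in> borel_measurable lebesgue" using f by (simp add: fourier_pair_def)
  fix \<psi> :: "real^'a \<Rightarrow> complex" assume \<psi>: "\<psi> \<in> test_functions"
  show "integrable lebesgue (\<lambda>x. f x * fourier \<psi> x)" using f \<psi> by (simp add: fourier_pair_def)
  have "(\<integral>\<xi>. b \<xi> * \<psi> \<xi> \<partial>lborel) = 0"
    by (rule integral_eq_zero_AE) (use 0 in eventually_elim, simp)
  then show "(\<integral>x. f x * fourier \<psi> x \<partial>lebesgue) = 0" using f \<psi> by (simp add: fourier_pair_def)
qed

text \<open>By \<open>has_hat_field_norm\<close> the energy of the increment is the square of the
  field norm, which explains the threshold \<open>sqrt e\<close>. The limit says nothing at r = t,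
  where the increment is zero.\<close>

lemma continuous_hdot_hat:
  fixes u :: "real \<Rightarrow> real^'n::finite \<Rightarrow> real^'n"
  assumes n: "CARD('n) \<ge> 3" and c: "continuous_hdot T (real CARD('n) / 2 - 1) u"
    and a: "\<And>t. t \<in> time_interval T \<Longrightarrow> has_hat (u t) (a t)" and t: "t \<in> time_interval T" and e: "e > 0"
  shows "\<exists>d>0. \<forall>r\<in>time_interval T. \<bar>r - t\<bar> < d \<longrightarrow> hat_energy (\<lambda>j \<xi>. a r j \<xi> - a t j \<xi>) \<le> ennreal e"
proof -
  let ?s = "real CARD('n) / 2 - 1"
  have "((\<lambda>r. hdot_field_norm ?s (\<lambda>x. u r x - u t x)) \<longlongrightarrow> 0) (at t within time_interval T)"
    using c t unfolding continuous_hdot_def by blast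
  then have "\<forall>\<^sub>F r in at t within time_interval T. hdot_field_norm ?s (\<lambda>x. u r x - u t x) < sqrt e"
    using e by (intro order_tendstoD) auto
  then obtain d where d: "d > 0" "\<And>r. r \<in> time_interval T \<Longrightarrow> r \<noteq> t \<Longrightarrow> dist r t < d \<Longrightarrow> hdot_field_norm ?s (\<lambda>x. u r x - u t x) < sqrt e"
    unfolding eventually_at by blast
  show ?thesis
  proof (intro exI[of _ d] conjI d(1) ballI impI)
    fix r assume r: "r \<in> time_interval T" "\<bar>r - t\<bar> < d"
    show "hat_energy (\<lambda>j \<xi>. a r j \<xi> - a t j \<xi>) \<le> ennreal e"
    proof (cases "r = t")
      case True
      then show ?thesis by (simp add: hat_energy_def norm2_def)
    next
      case False
      have "0 \<le> hdot_field_norm ?s (\<lambda>x. u r x - u t x)"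
        unfolding hdot_field_norm_def by (intro real_sqrt_ge_zero sum_nonneg) simp
      moreover have "hdot_field_norm ?s (\<lambda>x. u r x - u t x) < sqrt e" using d(2)[OF r(1) False] r(2) by (simp add: dist_real_def)
      ultimately have "(hdot_field_norm ?s (\<lambda>x. u r x - u t x))\<^sup>2 \<le> (sqrt e)\<^sup>2" by (intro power_mono) auto
      then have "(hdot_field_norm ?s (\<lambda>x. u r x - u t x))\<^sup>2 \<le> e" using e by simp
      then show ?thesis
        using has_hat_field_norm[OF n has_hat_diff[OF a[OF r(1)] a[OF t]]] by (simp add: hat_energy_def ennreal_leI)
    qed
  qed
qed

text \<open>The distributions of its components determine a field up to null sets only; the
  conclusion is accordingly equality almost everywhere at each time.\<close>

theorem theorem3p9:
  fixes T :: ereal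
    and u\<^sub>0 :: "real^'n::finite \<Rightarrow> real^'n"
    and u v :: "real \<Rightarrow> real^'n \<Rightarrow> real^'n"
  assumes "CARD('n) \<ge> 3"
    and "0 < T"
    and "u\<^sub>0 \<in> hdot_field (real CARD('n) / 2 - 1)"
    and "mild_solution T u\<^sub>0 u"
    and "mild_solution T u\<^sub>0 v"
    and "continuous_hdot T (real CARD('n) / 2 - 1) u"
    and "continuous_hdot T (real CARD('n) / 2 - 1) v"
  shows "\<forall>t\<in>time_interval T. AE x in lebesgue. u t x = v t x"
proof -
  note n = assms(1)
  let ?TI = "time_interval T"
  have "\<forall>t\<in>?TI. \<exists>a. has_hat (u t) a" and "\<forall>t\<in>?TI. \<exists>b. has_hat (v t) b"
    using assms(6,7) hdot_field_has_hat[OF n] unfolding continuous_hdot_def by blast+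
  then obtain a b where a: "\<And>t. t \<in> ?TI \<Longrightarrow> has_hat (u t) (a t)" and b: "\<And>t. t \<in> ?TI \<Longrightarrow> has_hat (v t) (b t)"
    by metis
  define w where "w t j \<xi> = a t j \<xi> - b t j \<xi>" for t j \<xi>
  have am: "a t j \<in> borel_measurable borel" and bm: "b t j \<in> borel_measurable borel" if "t \<in> ?TI" for t j
    using has_hat_measurable a b that by blast+
  have wm: "w t j \<in> borel_measurable borel" if "t \<in> ?TI" for t j
    unfolding w_def[abs_def] using am[OF that, of j] bm[OF that, of j] by measurable
  have afin: "norm2 (cabs (a t j)) < \<infinity>" and bfin: "norm2 (cabs (b t j)) < \<infinity>" if "t \<in> ?TI" for t j
    using a[OF that] b[OF that] by (auto simp: has_hat_def)
  have Ea: "hat_energy (a t) < \<infinity>" and Eb: "hat_energy (b t) < \<infinity>" if "t \<in> ?TI" for t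
    using afin[OF that] bfin[OF that] by (simp_all add: hat_energy_def less_top)
  obtain Pu Iu where Pu: "\<And>s. s \<in> ?TI \<Longrightarrow> leray_projection (div_tensor (u s) (u s)) (Pu s)"
    and Du: "duhamel_integral T Pu Iu"
    and mu: "\<And>t j. t \<in> ?TI \<Longrightarrow> dist_eq (component_dist (u t) j) (\<lambda>f. heat t (component_dist u\<^sub>0 j) f - Iu t j f)"
    and Tu: "\<And>t j k. t \<in> ?TI \<Longrightarrow> tempered_fun (tensor_entry (u t) (u t) j k)"
    using assms(4) unfolding mild_solution_def by blast
  obtain Pv Iv where Pv: "\<And>s. s \<in> ?TI \<Longrightarrow> leray_projection (div_tensor (v s) (v s)) (Pv s)"
    and Dv: "duhamel_integral T Pv Iv"
    and mv: "\<And>t j. t \<in> ?TI \<Longrightarrow> dist_eq (component_dist (v t) j) (\<lambda>f. heat t (component_dist u\<^sub>0 j) f - Iv t j f)"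
    and Tv: "\<And>t j k. t \<in> ?TI \<Longrightarrow> tempered_fun (tensor_entry (v t) (v t) j k)"
    using assms(5) unfolding mild_solution_def by blast
  let ?e = "\<lambda>t \<xi> s. of_real (exp (- (t - s) * (norm \<xi>)\<^sup>2)) :: complex"
  obtain Gu where Gum: "\<And>j. (\<lambda>(s, \<xi>). Gu j s \<xi>) \<in> borel_measurable (lebesgue_on (?TI \<times> UNIV))"
    and Gur: "\<And>j s. s \<in> ?TI \<Longrightarrow> represents (Gu j s) (fourier_dist (Pu s j))"
    and Gui: "\<And>j t. t \<in> ?TI \<Longrightarrow> AE \<xi> in lebesgue. set_integrable lebesgue {0..t} (\<lambda>s. ?e t \<xi> s * Gu j s \<xi>)"
    and GuI: "\<And>j t. t \<in> ?TI \<Longrightarrow> represents (\<lambda>\<xi>. set_lebesgue_integral lebesgue {0..t} (\<lambda>s. ?e t \<xi> s * Gu j s \<xi>)) (fourier_dist (Iu t j))"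
    using Du unfolding duhamel_integral_def by blast
  obtain Gv where Gvm: "\<And>j. (\<lambda>(s, \<xi>). Gv j s \<xi>) \<in> borel_measurable (lebesgue_on (?TI \<times> UNIV))"
    and Gvr: "\<And>j s. s \<in> ?TI \<Longrightarrow> represents (Gv j s) (fourier_dist (Pv s j))"
    and Gvi: "\<And>j t. t \<in> ?TI \<Longrightarrow> AE \<xi> in lebesgue. set_integrable lebesgue {0..t} (\<lambda>s. ?e t \<xi> s * Gv j s \<xi>)"
    and GvI: "\<And>j t. t \<in> ?TI \<Longrightarrow> represents (\<lambda>\<xi>. set_lebesgue_integral lebesgue {0..t} (\<lambda>s. ?e t \<xi> s * Gv j s \<xi>)) (fourier_dist (Iv t j))"
    using Dv unfolding duhamel_integral_def by blast
  \<comment> \<open>The representatives in \<open>duhamel_integral\<close> are jointly measurable in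
    the sense of Lebesgue; a Borel function that equals their difference almost everywhere over the
    time interval allows Fubini in either order.\<close>
  have "\<exists>H. H \<in> borel_measurable borel \<and> (AE p in lborel. fst p \<in> ?TI \<longrightarrow> Gu j (fst p) (snd p) - Gv j (fst p) (snd p) = H p)" for j
  proof -
    have sets: "?TI \<times> UNIV \<in> sets (borel :: (real \<times> (real^'n)) measure)"
      unfolding borel_prod[symmetric] using time_interval_sets by simp
    then have "?TI \<times> UNIV \<in> sets (lebesgue :: (real \<times> (real^'n)) measure)" by simp
    moreover have "(\<lambda>p. Gu j (fst p) (snd p) - Gv j (fst p) (snd p)) \<in> borel_measurable (lebesgue_on (?TI \<times> UNIV))"
      using Gum[of j] Gvm[of j] unfolding case_prod_beta' by (rule borel_measurable_diff)
    ultimately have "(\<lambda>p. indicator (?TI \<times> UNIV) p *\<^sub>R (Gu j (fst p) (snd p) - Gv j (fst p) (snd p))) \<in> borel_measurable lebesgue"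
      by (subst (asm) borel_measurable_restrict_space_iff) auto
    then obtain H where Hm: "H \<in> borel_measurable lborel" and H:
       "AE p in lborel. indicator (?TI \<times> UNIV) p *\<^sub>R (Gu j (fst p) (snd p) - Gv j (fst p) (snd p)) = H p"
      by (rule completion_ex_borel_measurable_complex)
    from H have "AE p in lborel. fst p \<in> ?TI \<longrightarrow> Gu j (fst p) (snd p) - Gv j (fst p) (snd p) = H p"
    proof eventually_elim
      case (elim p)
      show ?case
      proof
        assume "fst p \<in> ?TI"
        then have "p \<in> ?TI \<times> UNIV" by (simp add: mem_Times_iff)
        then show "Gu j (fst p) (snd p) - Gv j (fst p) (snd p) = H p" using elim by simp
      qed
    qed
    with Hm show ?thesis by (intro exI[of _ H] conjI) (simp, assumption)
  qed
  then have "\<forall>j. \<exists>H. H \<in> borel_measurable borel \<and> (AE p in lborel. fst p \<in> ?TI \<longrightarrow> Gu j (fst p) (snd p) - Gv j (fst p) (snd p) = H p)"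
    by (rule allI)
  from choice[OF this] obtain H where HH: "\<forall>j. H j \<in> borel_measurable borel \<and>
      (AE p in lborel. fst p \<in> ?TI \<longrightarrow> Gu j (fst p) (snd p) - Gv j (fst p) (snd p) = H j p)"
    by (elim exE)
  have Hm: "H j \<in> borel_measurable borel"
    and H: "AE p in lborel. fst p \<in> ?TI \<longrightarrow> Gu j (fst p) (snd p) - Gv j (fst p) (snd p) = H j p" for j
    using HH by blast+
  have Hs: "AE s in lborel. AE \<xi> in lborel. s \<in> ?TI \<longrightarrow> Gu j s \<xi> - Gv j s \<xi> = H j (s, \<xi>)"
    and H\<xi>: "AE \<xi> in lborel. AE s in lborel. s \<in> ?TI \<longrightarrow> Gu j s \<xi> - Gv j s \<xi> = H j (s, \<xi>)" for j
    using AE_pair_both[OF H[of j]] by simp_all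
  define h where "h s \<xi> = (\<Sum>j\<in>UNIV. ennreal (norm (H j (s, \<xi>))))" for s \<xi>
  have hj: "(\<lambda>(s, \<xi>). ennreal (norm (H j (s, \<xi>)))) \<in> borel_measurable (borel \<Otimes>\<^sub>M borel)" for j
    using Hm[of j] unfolding borel_prod case_prod_beta' prod.collapse by measurable
  have h: "(\<lambda>(s, \<xi>). h s \<xi>) \<in> borel_measurable (borel \<Otimes>\<^sub>M borel)"
    unfolding h_def case_prod_beta' by (intro borel_measurable_sum) (use hj in \<open>simp add: case_prod_beta'\<close>)
  have sub: "r \<in> ?TI" if "t \<in> ?TI" "0 \<le> r" "r \<le> t" for r t
    using that by (auto simp: time_interval_def intro: le_less_trans[of "ereal r" "ereal t"])

  \<comment> \<open>The Duhamel term enters a mild solution with a minus sign, so \<open>w\<close>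
    is the term of \<open>v\<close> minus that of \<open>u\<close>; the norm of \<open>H\<close> is
    the same for either order.\<close>
  have upper: "hat_energy (w t) \<le> norm2 (duhamel_bound h 0 t)" if t: "t \<in> ?TI" for t
  proof -
    have point: "AE \<xi> in lborel. ennreal (norm (w t j \<xi>)) \<le> duhamel_bound (\<lambda>s \<xi>. ennreal (norm (H j (s, \<xi>)))) 0 t \<xi>" for j
    proof -
      have "AE \<xi> in lborel. set_integrable lebesgue {0..t} (\<lambda>s. ?e t \<xi> s * Gu j s \<xi>)"
        "AE \<xi> in lborel. set_integrable lebesgue {0..t} (\<lambda>s. ?e t \<xi> s * Gv j s \<xi>)"
        using Gui[OF t, of j] Gvi[OF t, of j] by (simp_all only: AE_completion_iff)
      moreover have "AE \<xi> in lborel. a t j \<xi> - b t j \<xi> = set_lebesgue_integral lebesgue {0..t} (\<lambda>s. ?e t \<xi> s * Gv j s \<xi>)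
          - set_lebesgue_integral lebesgue {0..t} (\<lambda>s. ?e t \<xi> s * Gu j s \<xi>)"
        by (rule mild_difference[OF mu[OF t] mv[OF t] a[OF t] b[OF t] GuI[OF t] GvI[OF t]])
      ultimately show ?thesis using H\<xi>[of j]
      proof eventually_elim
        case (elim \<xi>)
        have "w t j \<xi> = set_lebesgue_integral lebesgue {0..t} (\<lambda>s. ?e t \<xi> s * Gv j s \<xi> - ?e t \<xi> s * Gu j s \<xi>)"
          using elim by (simp add: w_def)
        then have "ennreal (norm (w t j \<xi>)) \<le> (\<integral>\<^sup>+s. ennreal (norm (indicator {0..t} s *\<^sub>R (?e t \<xi> s * Gv j s \<xi> - ?e t \<xi> s * Gu j s \<xi>))) \<partial>lebesgue)"
          unfolding set_lebesgue_integral_def by (simp only: norm_integral_le_nn_integral)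
        also have "\<dots> = (\<integral>\<^sup>+s. indicator {0..t} s * ennreal (exp (- (t - s) * (norm \<xi>)\<^sup>2)) * ennreal (norm (H j (s, \<xi>))) \<partial>lebesgue)"
        proof (rule nn_integral_cong_AE)
          have "AE s in lebesgue. s \<in> ?TI \<longrightarrow> Gu j s \<xi> - Gv j s \<xi> = H j (s, \<xi>)" using elim(4) by (rule AE_completion)
          then show "AE s in lebesgue. ennreal (norm (indicator {0..t} s *\<^sub>R (?e t \<xi> s * Gv j s \<xi> - ?e t \<xi> s * Gu j s \<xi>)))
             = indicator {0..t} s * ennreal (exp (- (t - s) * (norm \<xi>)\<^sup>2)) * ennreal (norm (H j (s, \<xi>)))"
          proof eventually_elim
            case (elim s)
            show ?case
            proof (cases "s \<in> {0..t}")
              case True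
              then have "H j (s, \<xi>) = Gu j s \<xi> - Gv j s \<xi>" using elim sub[OF t, of s] by auto
              then have "norm (?e t \<xi> s * Gv j s \<xi> - ?e t \<xi> s * Gu j s \<xi>) = exp (- (t - s) * (norm \<xi>)\<^sup>2) * norm (H j (s, \<xi>))"
                unfolding right_diff_distrib[symmetric] norm_mult norm_of_real by (simp add: norm_minus_commute)
              then show ?thesis using True by (simp add: ennreal_mult)
            qed simp
          qed
        qed
        also have "\<dots> = (\<integral>\<^sup>+s. indicator {0..t} s * ennreal (exp (- (t - s) * (norm \<xi>)\<^sup>2)) * ennreal (norm (H j (s, \<xi>))) \<partial>lborel)"
          by (rule nn_integral_completion)
        finally show ?case unfolding duhamel_bound_def .
      qed
    qed
    have sum: "(\<Sum>j\<in>UNIV. duhamel_bound (\<lambda>s \<xi>. ennreal (norm (H j (s, \<xi>)))) 0 t \<xi>) = duhamel_bound h 0 t \<xi>" for \<xi>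
    proof -
      have m: "(\<lambda>s. ennreal (norm (H j (s, \<xi>)))) \<in> borel_measurable borel" for j
        using measurable_compose[OF _ hj[of j], of "\<lambda>s. (s, \<xi>)" borel] by simp
      note [measurable] = m
      show ?thesis unfolding duhamel_bound_def h_def sum_distrib_left
        by (rule nn_integral_sum[symmetric]) measurable
    qed
    have "hat_energy (w t) = (\<integral>\<^sup>+\<xi>. freq_weight \<xi> * (\<Sum>j\<in>UNIV. (ennreal (norm (w t j \<xi>)))\<^sup>2) \<partial>lborel)"
      unfolding hat_energy_def norm2_def sum_distrib_left
      by (rule nn_integral_sum[symmetric]) (use wm[OF t] in measurable)
    also have "\<dots> \<le> norm2 (duhamel_bound h 0 t)"
      unfolding norm2_def
    proof (rule nn_integral_mono_AE)
      have "AE \<xi> in lborel. \<forall>j. ennreal (norm (w t j \<xi>)) \<le> duhamel_bound (\<lambda>s \<xi>. ennreal (norm (H j (s, \<xi>)))) 0 t \<xi>"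
        unfolding AE_all_countable using point by blast
      then show "AE \<xi> in lborel. freq_weight \<xi> * (\<Sum>j\<in>UNIV. (ennreal (norm (w t j \<xi>)))\<^sup>2) \<le> freq_weight \<xi> * (duhamel_bound h 0 t \<xi>)\<^sup>2"
      proof eventually_elim
        case (elim \<xi>)
        have "(\<Sum>j\<in>UNIV. (ennreal (norm (w t j \<xi>)))\<^sup>2) \<le> (\<Sum>j\<in>UNIV. ennreal (norm (w t j \<xi>)))\<^sup>2" by (rule sum_power2_le) simp
        also have "\<dots> \<le> (\<Sum>j\<in>UNIV. duhamel_bound (\<lambda>s \<xi>. ennreal (norm (H j (s, \<xi>)))) 0 t \<xi>)\<^sup>2"
          using elim by (intro power_mono sum_mono) auto
        also have "\<dots> = (duhamel_bound h 0 t \<xi>)\<^sup>2" by (simp only: sum)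
        finally show ?case by (rule mult_left_mono) simp
      qed
    qed
    finally show ?thesis .
  qed

  \<comment> \<open>Exceptional times come only from replacing the difference of \<open>Gu\<close>
    and \<open>Gv\<close> by \<open>H\<close>; the explicit form of the projected divergence holds
    at every time, for almost every frequency.\<close>
  have hbound: "AE s in lborel. s \<in> ?TI \<longrightarrow> (AE \<zeta> in lborel. h s \<zeta> \<le> ennreal (leray_const TYPE('n) * norm \<zeta>) * (conv_sum (a s) (w s) \<zeta> + conv_sum (b s) (w s) \<zeta>))"
  proof -
    have "AE s in lborel. \<forall>j. AE \<xi> in lborel. s \<in> ?TI \<longrightarrow> Gu j s \<xi> - Gv j s \<xi> = H j (s, \<xi>)"
      unfolding AE_all_countable using Hs by blast
    then show ?thesis
    proof eventually_elim
      case (elim s)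
      show ?case
      proof
        assume s: "s \<in> ?TI"
        have "AE \<zeta> in lborel. \<forall>j. Gu j s \<zeta> - Gv j s \<zeta> = H j (s, \<zeta>)"
          unfolding AE_all_countable using elim s by simp
        moreover have "AE \<zeta> in lborel. \<forall>j. Gu j s \<zeta> = (\<Sum>k\<in>UNIV. of_real (leray_symbol j k \<zeta>) * div_hat (a s) k \<zeta>)"
          unfolding AE_all_countable by (intro allI leray_hat[OF n a[OF s] Tu[OF s] Pu[OF s] Gur[OF s]])
        moreover have "AE \<zeta> in lborel. \<forall>j. Gv j s \<zeta> = (\<Sum>k\<in>UNIV. of_real (leray_symbol j k \<zeta>) * div_hat (b s) k \<zeta>)"
          unfolding AE_all_countable by (intro allI leray_hat[OF n b[OF s] Tv[OF s] Pv[OF s] Gvr[OF s]])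
        moreover have "AE \<zeta> in lborel. (\<Sum>j\<in>UNIV. ennreal (norm ((\<Sum>k\<in>UNIV. of_real (leray_symbol j k \<zeta>) * div_hat (a s) k \<zeta>)
            - (\<Sum>k\<in>UNIV. of_real (leray_symbol j k \<zeta>) * div_hat (b s) k \<zeta>))))
          \<le> ennreal (leray_const TYPE('n) * norm \<zeta>) * (conv_sum (a s) (w s) \<zeta> + conv_sum (b s) (w s) \<zeta>)"
          unfolding w_def[abs_def] by (rule leray_difference[OF n am[OF s] bm[OF s] afin[OF s] bfin[OF s]])
        ultimately show "AE \<zeta> in lborel. h s \<zeta> \<le> ennreal (leray_const TYPE('n) * norm \<zeta>) * (conv_sum (a s) (w s) \<zeta> + conv_sum (b s) (w s) \<zeta>)"
        proof eventually_elim
          case (elim \<zeta>)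
          have "h s \<zeta> = (\<Sum>j\<in>UNIV. ennreal (norm (Gu j s \<zeta> - Gv j s \<zeta>)))" using elim(1) by (simp add: h_def)
          then show ?case using elim(2-4) by simp
        qed
      qed
    qed
  qed

  have local: "\<exists>\<tau> R C. \<tau> > 0 \<and> R > 0 \<and> C \<ge> 0 \<and> t + \<tau> \<in> ?TI \<and>
       (AE s in lborel. s \<in> {t..t + \<tau>} \<longrightarrow>
         (\<integral>\<^sup>+\<xi>. indicator {\<xi>. R \<le> norm \<xi>} \<xi> * heat_weight \<xi> * (h s \<xi>)\<^sup>2 \<partial>lborel) \<le> ennreal (1 / 4) * hat_energy (w s) \<and>
         (\<integral>\<^sup>+\<xi>. heat_weight \<xi> * (h s \<xi>)\<^sup>2 \<partial>lborel) \<le> ennreal C * hat_energy (w s) \<and> hat_energy (w s) \<le> ennreal C)"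
    if t: "t \<in> ?TI" for t
  proof -
    \<comment> \<open>The added 1 keeps \<open>K\<close> positive, so that one may divide by it
      below.\<close>
    define K where "K = nonlin_const TYPE('n) + 1"
    have K: "K > 0" "nonlin_const TYPE('n) \<le> K"
      using conv_const_nonneg[of "TYPE('n)"] by (simp_all add: K_def nonlin_const_def add_nonneg_pos)
    \<comment> \<open>The tails of both solutions near \<open>t\<close> sum to at most 8e = 1/(16K);
      together with \<open>ratio\<close> this gives K times 1/(8K), which stays below the 1/4 asked
      by \<open>duhamel_uniqueness\<close>.\<close>
    define e where "e = 1 / (128 * K)"
    have e: "e > 0" using K by (simp add: e_def)
    obtain da where da: "da > 0" "\<And>r. r \<in> ?TI \<Longrightarrow> \<bar>r - t\<bar> < da \<Longrightarrow> hat_energy (\<lambda>j \<xi>. a r j \<xi> - a t j \<xi>) \<le> ennreal e"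
      using continuous_hdot_hat[OF n assms(6) a t e] by blast
    obtain db where db: "db > 0" "\<And>r. r \<in> ?TI \<Longrightarrow> \<bar>r - t\<bar> < db \<Longrightarrow> hat_energy (\<lambda>j \<xi>. b r j \<xi> - b t j \<xi>) \<le> ennreal e"
      using continuous_hdot_hat[OF n assms(7) b t e] by blast
    obtain ma where ma: "\<And>M. M \<ge> real ma \<Longrightarrow> hat_tail M (a t) < ennreal e"
      using hat_tail_small[OF am[OF t] Ea[OF t] e] by blast
    obtain mb where mb: "\<And>M. M \<ge> real mb \<Longrightarrow> hat_tail M (b t) < ennreal e"
      using hat_tail_small[OF bm[OF t] Eb[OF t] e] by blast
    obtain ea where ea: "hat_energy (a t) = ennreal ea" "ea \<ge> 0" using Ea[OF t] by (cases "hat_energy (a t)") auto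
    obtain eb where eb: "hat_energy (b t) = ennreal eb" "eb \<ge> 0" using Eb[OF t] by (cases "hat_energy (b t)") auto
    have e0: "0 \<le> e" using e by simp
    have two: "2 * ennreal x = ennreal (2 * x)" if "x \<ge> 0" for x using that by (simp add: ennreal_mult)
    \<comment> \<open>Bounds the sum of the two energies throughout the short interval: twice the
      values at \<open>t\<close> plus twice the bound \<open>e\<close> of each increment.\<close>
    define E where "E = 2 * ea + 2 * eb + 4 * e"
    have E: "E > 0" using ea eb e by (simp add: E_def add_nonneg_pos)
    define M where "M = real (Suc (max ma mb))"
    have M: "M > 0" "M \<ge> real ma" "M \<ge> real mb" by (auto simp: M_def)
    \<comment> \<open>The summand 2 ensures 2M \<le> R; the summand 16KE ensures (M/R)^2 E \<le>
      1/(16K), since the square of a number q \<ge> 1 is at least q.\<close>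
    define R where "R = M * (2 + 16 * K * E)"
    have R2: "2 * M \<le> R" using M K E by (simp add: R_def)
    have R: "R > 0" using R2 M by simp
    have ratio: "(M / R)\<^sup>2 * E \<le> 1 / (16 * K)"
    proof -
      define q where "q = 2 + 16 * K * E"
      have q: "q \<ge> 1" "q \<ge> 16 * K * E" using K E by (simp_all add: q_def)
      have "M / R = 1 / q" using M by (simp add: R_def q_def)
      then have "(M / R)\<^sup>2 * E = E / q\<^sup>2" by (simp add: power_divide)
      also have "\<dots> \<le> E / q" using q E by (intro divide_left_mono) (auto simp: power2_eq_square)
      also have "\<dots> \<le> E / (16 * K * E)" using q K E by (intro divide_left_mono) auto
      also have "\<dots> = 1 / (16 * K)" using E by simp
      finally show ?thesis .
    qed
    obtain \<tau>\<^sub>0 where \<tau>0: "\<tau>\<^sub>0 > 0" "t + \<tau>\<^sub>0 \<in> ?TI"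
    proof -
      have "ereal t < T" using t by (simp add: time_interval_def)
      then obtain r where r: "t < r" "ereal r < T" using ereal_dense2[of "ereal t" T] by auto
      then show thesis using that[of "r - t"] t by (simp add: time_interval_def)
    qed
    \<comment> \<open>The halves keep the closed interval inside the open neighbourhoods supplied by
      continuity.\<close>
    define \<tau> where "\<tau> = min \<tau>\<^sub>0 (min (da / 2) (db / 2))"
    have \<tau>: "\<tau> > 0" "\<tau> \<le> \<tau>\<^sub>0" "\<tau> < da" "\<tau> < db" using \<tau>0 da db by (auto simp: \<tau>_def min_less_iff_disj)
    have t0: "0 \<le> t" using t by (simp add: time_interval_def)
    have \<tau>T: "t + \<tau> \<in> ?TI" using sub[OF \<tau>0(2)] t0 \<tau> by simp
    \<comment> \<open>The constant 2(K + 1)E serves two purposes: it dominates KE in the estimate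
      over all frequencies and 2E as a bound of the energy of \<open>w\<close>.\<close>
    have estimates: "(\<integral>\<^sup>+\<xi>. indicator {\<xi>. R \<le> norm \<xi>} \<xi> * heat_weight \<xi> * (h s \<xi>)\<^sup>2 \<partial>lborel) \<le> ennreal (1 / 4) * hat_energy (w s) \<and>
         (\<integral>\<^sup>+\<xi>. heat_weight \<xi> * (h s \<xi>)\<^sup>2 \<partial>lborel) \<le> ennreal (2 * (K + 1) * E) * hat_energy (w s) \<and> hat_energy (w s) \<le> ennreal (2 * (K + 1) * E)"
      if s: "s \<in> {t..t + \<tau>}" and hs: "AE \<zeta> in lborel. h s \<zeta> \<le> ennreal (leray_const TYPE('n) * norm \<zeta>) * (conv_sum (a s) (w s) \<zeta> + conv_sum (b s) (w s) \<zeta>)" for s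
    proof -
      have sT: "s \<in> ?TI" using sub[OF \<tau>T, of s] s t0 by simp
      have near: "hat_energy (\<lambda>j \<xi>. a s j \<xi> - a t j \<xi>) \<le> ennreal e" "hat_energy (\<lambda>j \<xi>. b s j \<xi> - b t j \<xi>) \<le> ennreal e"
        using da(2)[OF sT] db(2)[OF sT] s \<tau> by auto
      have energies: "hat_energy (a s) + hat_energy (b s) \<le> ennreal E"
      proof -
        have "hat_energy (a s) + hat_energy (b s) \<le> (2 * hat_energy (a t) + 2 * hat_energy (\<lambda>j \<xi>. a s j \<xi> - a t j \<xi>))
            + (2 * hat_energy (b t) + 2 * hat_energy (\<lambda>j \<xi>. b s j \<xi> - b t j \<xi>))"
          by (intro add_mono hat_energy_add(1) am bm sT t)
        also have "\<dots> \<le> (2 * ennreal ea + 2 * ennreal e) + (2 * ennreal eb + 2 * ennreal e)"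
          unfolding ea eb by (intro add_mono mult_left_mono near order_refl) auto
        also have "\<dots> = ennreal ((2 * ea + 2 * e) + (2 * eb + 2 * e))"
          by (simp only: two ennreal_plus mult_nonneg_nonneg add_nonneg_nonneg zero_le_numeral ea(2) eb(2) e0)
        also have "(2 * ea + 2 * e) + (2 * eb + 2 * e) = E" by (simp add: E_def)
        finally show ?thesis .
      qed
      have tails: "hat_tail M (a s) + hat_tail M (b s) \<le> ennreal (8 * e)"
      proof -
        have "hat_tail M (a s) + hat_tail M (b s) \<le> (2 * hat_tail M (a t) + 2 * hat_energy (\<lambda>j \<xi>. a s j \<xi> - a t j \<xi>))
            + (2 * hat_tail M (b t) + 2 * hat_energy (\<lambda>j \<xi>. b s j \<xi> - b t j \<xi>))"
          by (intro add_mono hat_energy_add(3) am bm sT t)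
        also have "\<dots> \<le> (2 * ennreal e + 2 * ennreal e) + (2 * ennreal e + 2 * ennreal e)"
          by (intro add_mono mult_left_mono near less_imp_le[OF ma] less_imp_le[OF mb] M) auto
        also have "\<dots> = ennreal ((2 * e + 2 * e) + (2 * e + 2 * e))"
          by (simp only: two ennreal_plus mult_nonneg_nonneg add_nonneg_nonneg zero_le_numeral e0)
        also have "(2 * e + 2 * e) + (2 * e + 2 * e) = 8 * e" by simp
        finally show ?thesis .
      qed
      have KN: "ennreal (nonlin_const TYPE('n)) \<le> ennreal K" using K by (intro ennreal_leI) simp
      have "(\<integral>\<^sup>+\<xi>. heat_weight \<xi> * (h s \<xi>)\<^sup>2 \<partial>lborel) \<le> ennreal (nonlin_const TYPE('n)) * (hat_energy (a s) + hat_energy (b s)) * hat_energy (w s)"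
        by (rule nonlinear_estimate(1)[OF n am[OF sT] bm[OF sT] wm[OF sT] hs])
      also have "\<dots> \<le> ennreal K * ennreal E * hat_energy (w s)" by (intro mult_mono KN energies) auto
      also have "ennreal K * ennreal E = ennreal (K * E)" using K E by (simp add: ennreal_mult)
      also have "ennreal (K * E) * hat_energy (w s) \<le> ennreal (2 * (K + 1) * E) * hat_energy (w s)"
        using K E by (intro mult_right_mono ennreal_leI) auto
      finally have est1: "(\<integral>\<^sup>+\<xi>. heat_weight \<xi> * (h s \<xi>)\<^sup>2 \<partial>lborel) \<le> ennreal (2 * (K + 1) * E) * hat_energy (w s)" .
      have "(\<integral>\<^sup>+\<xi>. indicator {\<xi>. R \<le> norm \<xi>} \<xi> * heat_weight \<xi> * (h s \<xi>)\<^sup>2 \<partial>lborel)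
         \<le> ennreal (nonlin_const TYPE('n)) * ((ennreal ((M / R)\<^sup>2) * hat_energy (a s) + hat_tail M (a s))
           + (ennreal ((M / R)\<^sup>2) * hat_energy (b s) + hat_tail M (b s))) * hat_energy (w s)"
        by (rule nonlinear_estimate(2)[OF n am[OF sT] bm[OF sT] wm[OF sT] hs M(1) R2])
      also have "(ennreal ((M / R)\<^sup>2) * hat_energy (a s) + hat_tail M (a s)) + (ennreal ((M / R)\<^sup>2) * hat_energy (b s) + hat_tail M (b s))
          = ennreal ((M / R)\<^sup>2) * (hat_energy (a s) + hat_energy (b s)) + (hat_tail M (a s) + hat_tail M (b s))"
        by (simp add: distrib_left add_ac)
      also have "ennreal (nonlin_const TYPE('n)) * (ennreal ((M / R)\<^sup>2) * (hat_energy (a s) + hat_energy (b s)) + (hat_tail M (a s) + hat_tail M (b s))) * hat_energy (w s)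
         \<le> ennreal K * (ennreal ((M / R)\<^sup>2) * ennreal E + ennreal (8 * e)) * hat_energy (w s)"
        by (intro mult_right_mono mult_mono KN add_mono mult_left_mono energies tails) auto
      also have "ennreal K * (ennreal ((M / R)\<^sup>2) * ennreal E + ennreal (8 * e)) = ennreal (K * ((M / R)\<^sup>2 * E + 8 * e))"
        using K E e by (simp add: ennreal_mult)
      also have "ennreal (K * ((M / R)\<^sup>2 * E + 8 * e)) * hat_energy (w s) \<le> ennreal (1 / 4) * hat_energy (w s)"
      proof (intro mult_right_mono ennreal_leI)
        have "K * ((M / R)\<^sup>2 * E + 8 * e) \<le> K * (1 / (16 * K) + 8 * e)" using K ratio by (intro mult_left_mono) auto
        also have "\<dots> \<le> 1 / 4" using K by (simp add: e_def field_simps)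
        finally show "K * ((M / R)\<^sup>2 * E + 8 * e) \<le> 1 / 4" .
      qed simp
      finally have est2: "(\<integral>\<^sup>+\<xi>. indicator {\<xi>. R \<le> norm \<xi>} \<xi> * heat_weight \<xi> * (h s \<xi>)\<^sup>2 \<partial>lborel) \<le> ennreal (1 / 4) * hat_energy (w s)" .
      have "hat_energy (w s) \<le> 2 * hat_energy (a s) + 2 * hat_energy (b s)"
        using hat_energy_add(2)[OF am[OF sT] bm[OF sT]] by (simp add: w_def[abs_def])
      also have "\<dots> = 2 * (hat_energy (a s) + hat_energy (b s))" by (simp add: distrib_left)
      also have "\<dots> \<le> 2 * ennreal E" by (intro mult_left_mono energies) auto
      also have "\<dots> = ennreal (2 * E)" using E by (simp add: ennreal_mult)
      also have "\<dots> \<le> ennreal (2 * (K + 1) * E)" using K E by (intro ennreal_leI) auto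
      finally have "hat_energy (w s) \<le> ennreal (2 * (K + 1) * E)" .
      then show ?thesis using est1 est2 by simp
    qed
    have "AE s in lborel. s \<in> {t..t + \<tau>} \<longrightarrow>
         (\<integral>\<^sup>+\<xi>. indicator {\<xi>. R \<le> norm \<xi>} \<xi> * heat_weight \<xi> * (h s \<xi>)\<^sup>2 \<partial>lborel) \<le> ennreal (1 / 4) * hat_energy (w s) \<and>
         (\<integral>\<^sup>+\<xi>. heat_weight \<xi> * (h s \<xi>)\<^sup>2 \<partial>lborel) \<le> ennreal (2 * (K + 1) * E) * hat_energy (w s) \<and> hat_energy (w s) \<le> ennreal (2 * (K + 1) * E)"
      using hbound by eventually_elim (use estimates sub[OF \<tau>T] t0 in auto)
    then show ?thesis using \<tau> R \<tau>T K E by (intro exI[of _ \<tau>] exI[of _ R] exI[of _ "2 * (K + 1) * E"]) auto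
  qed

  show ?thesis
  proof
    fix t assume t: "t \<in> ?TI"
    have "hat_energy (w t) = 0"
      by (rule duhamel_uniqueness[OF h upper local t])
    then have w0: "AE \<xi> in lborel. a t j \<xi> - b t j \<xi> = 0" for j
      unfolding w_def[symmetric] by (rule hat_energy_zero[OF wm[OF t]])
    have "AE x in lebesgue. component (\<lambda>x. u t x - v t x) j x = 0" for j
      using has_hat_diff[OF a[OF t] b[OF t]] by (intro fourier_pair_zero[OF _ w0]) (auto simp: has_hat_def)
    then have "AE x in lebesgue. \<forall>j. component (\<lambda>x. u t x - v t x) j x = 0" unfolding AE_all_countable by blast
    then show "AE x in lebesgue. u t x = v t x" by eventually_elim (simp add: component_def vec_eq_iff)
  qed
qed

end
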